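(* Let $I \subset \mathbb{C}[z_1,\ldots,z_d]$ and $J \subset \mathbb{C}[z_1,\ldots,z_{d'}]$ be radical homogeneous ideals. Suppose that there are linear maps $A: \mathbb{C}^{d'} \to \mathbb{C}^d$ and $B: \mathbb{C}^d \to \mathbb{C}^{d'}$ which restrict to mutually inverse bijections $A: Z(J) \to Z(I)$ and $B: Z(I) \to Z(J)$. If $I$ and $J$ are admissible, then $C_{A^*}: \mathcal{F}_J \to \mathcal{F}_I$ and $C_{B^*}: \mathcal{F}_I \to \mathcal{F}_J$ are inverse to each other, and $$\Phi: \mathcal{A}_I \to \mathcal{A}_J, \quad T \mapsto (C_{A^*})^* \, T \, (C_{B^*})^*$$ is a completely bounded isomorphism. Regarding $\mathcal{A}_I$ and $\mathcal{A}_J$ as function algebras on $Z(I)$ and $Z(J)$, respectively, $\Phi$ is given by composition with $A$, that is, $\Phi(\varphi) = \varphi \circ A$ for all $\varphi \in \mathcal{A}_I$.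
   Context: $H^2_d$ is the Drury-Arveson space: the reproducing kernel Hilbert space on the open unit ball $\mathbb{B}_d \subset \mathbb{C}^d$ with kernel $K(z,w) = \frac{1}{1-\langle z,w\rangle}$; $M_{z_i}: f \mapsto z_i f$ are the (bounded) coordinate multiplication operators on it. For a homogeneous ideal $I \subset \mathbb{C}[z_1,\ldots,z_d]$, $\mathcal{F}_I = H^2_d \ominus I$ is the orthogonal complement of $I$ in $H^2_d$, and $\mathcal{D}_I = \mathcal{F}_I \cap \mathbb{C}[z_1,\ldots,z_d]$, a dense subspace of $\mathcal{F}_I$. For $I$ radical homogeneous, $\mathcal{A}_I \subset \mathcal{B}(\mathcal{F}_I)$ is the unital norm-closed (non-selfadjoint) algebra generated by the compressions of $M_{z_1},\ldots,M_{z_d}$ to $\mathcal{F}_I$. $V(I)$ is the vanishing locus of $I$ in $\mathbb{C}^d$ and $Z(I) = V(I) \cap \overline{\mathbb{B}_d}$. The algebra $\mathcal{A}_I$ is regarded as an algebra of continuous functions on $Z(I)$, in such a way that the compression of $M_p$ corresponds to $p|_{Z(I)}$ for every polynomial $p$. Admissible: let $J$ be a radical homogeneous ideal, $V(J) = W_1 \cup \ldots \cup W_r$ the decomposition into irreducible components, and $\widehat{J}_k$ the vanishing ideal of the linear span of $W_k$. $J$ is called admissible if the algebraic sum $\mathcal{F}_{\widehat{J}_1} + \ldots + \mathcal{F}_{\widehat{J}_r}$ is closed. Composition operators: in the situation of the claim, $f \mapsto f \circ A^*$ defines a bounded linear map $\mathcal{D}_J \to \mathcal{F}_I$ and $f \mapsto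 f\circ B^*$ defines a bounded linear map $\mathcal{D}_I \to \mathcal{F}_J$; $C_{A^*}: \mathcal{F}_J \to \mathcal{F}_I$ and $C_{B^*}: \mathcal{F}_I \to \mathcal{F}_J$ denote their continuous extensions. *)

theory Defs
  imports "HOL-Analysis.Analysis" "HOL-Library.Poly_Mapping"
    "HOL-Library.Function_Algebras" "HOL-Library.FuncSet"
begin

section \<open>Polynomials, ideals and varieties\<close>

text \<open>
  The ring of polynomials in the variables indexed by the finite type \<open>'n\<close> (so the
  number of variables is \<open>CARD('n)\<close>): finitely supported coefficient families over
  finitely supported exponents, with the convolution product of \<open>Poly_Mapping\<close>.
\<close>

type_synonym 'n mpoly = "('n \<Rightarrow>\<^sub>0 nat) \<Rightarrow>\<^sub>0 complex"

definition peval :: "'n::finite mpoly \<Rightarrow> complex ^ 'n \<Rightarrow> complex" where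
  "peval p z =
     (\<Sum>\<alpha>\<in>Poly_Mapping.keys p. Poly_Mapping.lookup p \<alpha> * (\<Prod>i\<in>UNIV. (z $ i) ^ Poly_Mapping.lookup \<alpha> i))"

definition coord :: "'n \<Rightarrow> 'n mpoly" where
  "coord i = Poly_Mapping.single (Poly_Mapping.single i 1) 1"

definition hom_comp :: "nat \<Rightarrow> 'n::finite mpoly \<Rightarrow> 'n mpoly" where
  "hom_comp k p =
     (\<Sum>\<alpha>\<in>{\<alpha> \<in> Poly_Mapping.keys p. (\<Sum>i\<in>UNIV. Poly_Mapping.lookup \<alpha> i) = k}.
        Poly_Mapping.single \<alpha> (Poly_Mapping.lookup p \<alpha>))"

definition poly_ideal :: "'n mpoly set \<Rightarrow> bool" where
  "poly_ideal I \<longleftrightarrow> 0 \<in> I \<and> (\<forall>p\<in>I. \<forall>q\<in>I. p + q \<in> I) \<and> (\<forall>p. \<forall>q\<in>I. p * q \<in> I)"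

definition radical_homogeneous_ideal :: "'n::finite mpoly set \<Rightarrow> bool" where
  "radical_homogeneous_ideal I \<longleftrightarrow> poly_ideal I
     \<and> (\<forall>p\<in>I. \<forall>k. hom_comp k p \<in> I)
     \<and> (\<forall>p k. p ^ k \<in> I \<longrightarrow> p \<in> I)"

definition vanishing_locus :: "'n::finite mpoly set \<Rightarrow> (complex ^ 'n) set" where
  "vanishing_locus S = {z. \<forall>p\<in>S. peval p z = 0}"

definition vanishing_ideal :: "(complex ^ 'n::finite) set \<Rightarrow> 'n mpoly set" where
  "vanishing_ideal W = {p. \<forall>z\<in>W. peval p z = 0}"

definition ball_locus :: "'n::finite mpoly set \<Rightarrow> (complex ^ 'n) set" where
  "ball_locus I = vanishing_locus I \<inter> cball 0 1"

definition algebraic_set :: "(complex ^ 'n::finite) set \<Rightarrow> bool" where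
  "algebraic_set W \<longleftrightarrow> (\<exists>S. W = vanishing_locus S)"

definition irreducible_variety :: "(complex ^ 'n::finite) set \<Rightarrow> bool" where
  "irreducible_variety W \<longleftrightarrow> algebraic_set W \<and> W \<noteq> {}
     \<and> (\<forall>W1 W2. algebraic_set W1 \<and> algebraic_set W2 \<and> W = W1 \<union> W2 \<longrightarrow> W = W1 \<or> W = W2)"

definition irreducible_decomposition ::
    "(complex ^ 'n::finite) set \<Rightarrow> (complex ^ 'n) set set \<Rightarrow> bool" where
  "irreducible_decomposition V \<W> \<longleftrightarrow> finite \<W> \<and> V = \<Union>\<W>
     \<and> (\<forall>W\<in>\<W>. irreducible_variety W)
     \<and> (\<forall>W\<in>\<W>. \<forall>W'\<in>\<W>. W \<subseteq> W' \<longrightarrow> W = W')"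


section \<open>Hilbert spaces of functions\<close>

text \<open>
  A Hilbert space of functions on a set \<open>X\<close> is given by its carrier and its inner product,
  which is linear in the first argument.  Functions on \<open>X\<close> are encoded as functions on the
  ambient type that are 0 off \<open>X\<close>; sums, differences and products of functions are
  pointwise (\<open>Function_Algebras\<close>).
\<close>

record 'x hfs =
  hcar :: "('x \<Rightarrow> complex) set"
  hip :: "('x \<Rightarrow> complex) \<Rightarrow> ('x \<Rightarrow> complex) \<Rightarrow> complex"

definition fscale :: "complex \<Rightarrow> ('x \<Rightarrow> complex) \<Rightarrow> 'x \<Rightarrow> complex" where
  "fscale c f = (\<lambda>x. c * f x)"

definition hnorm :: "'x hfs \<Rightarrow> ('x \<Rightarrow> complex) \<Rightarrow> real" where
  "hnorm H f = sqrt (Re (hip H f f))"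

definition hilbert_function_space :: "'x set \<Rightarrow> 'x hfs \<Rightarrow> bool" where
  "hilbert_function_space X H \<longleftrightarrow>
     (\<forall>f\<in>hcar H. \<forall>x. x \<notin> X \<longrightarrow> f x = 0)
   \<and> 0 \<in> hcar H
   \<and> (\<forall>f\<in>hcar H. \<forall>g\<in>hcar H. f + g \<in> hcar H)
   \<and> (\<forall>c. \<forall>f\<in>hcar H. fscale c f \<in> hcar H)
   \<and> (\<forall>f\<in>hcar H. \<forall>g\<in>hcar H. \<forall>h\<in>hcar H. hip H (f + g) h = hip H f h + hip H g h)
   \<and> (\<forall>c. \<forall>f\<in>hcar H. \<forall>g\<in>hcar H. hip H (fscale c f) g = c * hip H f g)
   \<and> (\<forall>f\<in>hcar H. \<forall>g\<in>hcar H. hip H g f = cnj (hip H f g))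
   \<and> (\<forall>f\<in>hcar H. f \<noteq> 0 \<longrightarrow> 0 < Re (hip H f f))
   \<and> (\<forall>s. (\<forall>n. s n \<in> hcar H)
          \<and> (\<forall>e>0. \<exists>N. \<forall>m\<ge>N. \<forall>n\<ge>N. hnorm H (s m - s n) < e)
        \<longrightarrow> (\<exists>f\<in>hcar H. (\<lambda>n::nat. hnorm H (s n - f)) \<longlonglongrightarrow> 0))"

definition is_rkhs :: "'x set \<Rightarrow> ('x \<Rightarrow> 'x \<Rightarrow> complex) \<Rightarrow> 'x hfs \<Rightarrow> bool" where
  "is_rkhs X K H \<longleftrightarrow> hilbert_function_space X H
   \<and> (\<forall>w\<in>X. (\<lambda>z. if z \<in> X then K z w else 0) \<in> hcar H
          \<and> (\<forall>f\<in>hcar H. hip H f (\<lambda>z. if z \<in> X then K z w else 0) = f w))"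

definition hclosed :: "'x hfs \<Rightarrow> ('x \<Rightarrow> complex) set \<Rightarrow> bool" where
  "hclosed H S \<longleftrightarrow> (\<forall>s f. (\<forall>n. s n \<in> S) \<and> f \<in> hcar H
     \<and> (\<lambda>n::nat. hnorm H (s n - f)) \<longlonglongrightarrow> 0 \<longrightarrow> f \<in> S)"

text \<open>Orthogonal projection from \<open>H\<close> onto a closed subspace \<open>F\<close> with the same inner product.\<close>

definition hproj :: "'x hfs \<Rightarrow> 'x hfs \<Rightarrow> ('x \<Rightarrow> complex) \<Rightarrow> 'x \<Rightarrow> complex" where
  "hproj H F f = (THE g. g \<in> hcar F \<and> (\<forall>h\<in>hcar F. hip H (f - g) h = 0))"


section \<open>Bounded operators and operator algebras\<close>

text \<open>
  Operators from \<open>H\<close> to \<open>K\<close> are extensional functions on the carrier of \<open>H\<close>, so that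
  operators which agree on \<open>H\<close> are equal.
\<close>

type_synonym ('x, 'y) hop = "('x \<Rightarrow> complex) \<Rightarrow> 'y \<Rightarrow> complex"

definition bounded_ops :: "'x hfs \<Rightarrow> 'y hfs \<Rightarrow> ('x, 'y) hop set" where
  "bounded_ops H K = {T \<in> hcar H \<rightarrow>\<^sub>E hcar K.
       (\<forall>f\<in>hcar H. \<forall>g\<in>hcar H. T (f + g) = T f + T g)
     \<and> (\<forall>c. \<forall>f\<in>hcar H. T (fscale c f) = fscale c (T f))
     \<and> (\<exists>b. \<forall>f\<in>hcar H. hnorm K (T f) \<le> b * hnorm H f)}"

definition op_norm :: "'x hfs \<Rightarrow> 'x hfs \<Rightarrow> ('x, 'x) hop \<Rightarrow> real" where
  "op_norm H K T = Inf {b. 0 \<le> b \<and> (\<forall>f\<in>hcar H. hnorm K (T f) \<le> b * hnorm H f)}"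

definition hadjoint :: "'x hfs \<Rightarrow> 'y hfs \<Rightarrow> ('x, 'y) hop \<Rightarrow> ('y, 'x) hop" where
  "hadjoint H K C =
     (\<lambda>g\<in>hcar K. THE f. f \<in> hcar H \<and> (\<forall>h\<in>hcar H. hip K (C h) g = hip H h f))"

definition op_id :: "'x hfs \<Rightarrow> ('x, 'x) hop" where
  "op_id H = (\<lambda>f\<in>hcar H. f)"

definition op_add :: "'x hfs \<Rightarrow> ('x, 'x) hop \<Rightarrow> ('x, 'x) hop \<Rightarrow> ('x, 'x) hop" where
  "op_add H S T = (\<lambda>f\<in>hcar H. S f + T f)"

definition op_diff :: "'x hfs \<Rightarrow> ('x, 'x) hop \<Rightarrow> ('x, 'x) hop \<Rightarrow> ('x, 'x) hop" where
  "op_diff H S T = (\<lambda>f\<in>hcar H. S f - T f)"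

definition op_scale :: "'x hfs \<Rightarrow> complex \<Rightarrow> ('x, 'x) hop \<Rightarrow> ('x, 'x) hop" where
  "op_scale H c T = (\<lambda>f\<in>hcar H. fscale c (T f))"

definition op_mult :: "'x hfs \<Rightarrow> ('x, 'x) hop \<Rightarrow> ('x, 'x) hop \<Rightarrow> ('x, 'x) hop" where
  "op_mult H S T = (\<lambda>f\<in>hcar H. S (T f))"

definition closed_unital_subalgebra :: "'x hfs \<Rightarrow> ('x, 'x) hop set \<Rightarrow> bool" where
  "closed_unital_subalgebra H \<A> \<longleftrightarrow> \<A> \<subseteq> bounded_ops H H
   \<and> op_id H \<in> \<A>
   \<and> (\<forall>S\<in>\<A>. \<forall>T\<in>\<A>. op_add H S T \<in> \<A>)
   \<and> (\<forall>c. \<forall>T\<in>\<A>. op_scale H c T \<in> \<A>)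
   \<and> (\<forall>S\<in>\<A>. \<forall>T\<in>\<A>. op_mult H S T \<in> \<A>)
   \<and> (\<forall>s T. (\<forall>n. s n \<in> \<A>) \<and> T \<in> bounded_ops H H
        \<and> (\<lambda>n::nat. op_norm H H (op_diff H (s n) T)) \<longlonglongrightarrow> 0 \<longrightarrow> T \<in> \<A>)"

text \<open>
  The norm of the \<open>n\<close> by \<open>n\<close> operator matrix \<open>(T i j)\<close>, acting on the \<open>n\<close>-fold Hilbert
  space direct sum of \<open>H\<close>.
\<close>

definition matrix_op_norm :: "nat \<Rightarrow> 'x hfs \<Rightarrow> (nat \<Rightarrow> nat \<Rightarrow> ('x, 'x) hop) \<Rightarrow> real" where
  "matrix_op_norm n H T = Inf {b. 0 \<le> b \<and>
     (\<forall>h. (\<forall>j<n. h j \<in> hcar H) \<longrightarrow>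
        sqrt (\<Sum>i<n. (hnorm H (\<Sum>j<n. T i j (h j)))\<^sup>2) \<le> b * sqrt (\<Sum>j<n. (hnorm H (h j))\<^sup>2))}"

definition completely_bounded ::
    "'x hfs \<Rightarrow> ('x, 'x) hop set \<Rightarrow> 'y hfs \<Rightarrow> (('x, 'x) hop \<Rightarrow> ('y, 'y) hop) \<Rightarrow> bool" where
  "completely_bounded H \<A> K \<Phi> \<longleftrightarrow>
     (\<exists>b. \<forall>n T. (\<forall>i<n. \<forall>j<n. T i j \<in> \<A>) \<longrightarrow>
        matrix_op_norm n K (\<lambda>i j. \<Phi> (T i j)) \<le> b * matrix_op_norm n H T)"

text \<open>An isomorphism of unital operator algebras: the inverse is completely bounded as well.\<close>

definition cb_isomorphism ::
    "'x hfs \<Rightarrow> ('x, 'x) hop set \<Rightarrow> 'y hfs \<Rightarrow> ('y, 'y) hop set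
      \<Rightarrow> (('x, 'x) hop \<Rightarrow> ('y, 'y) hop) \<Rightarrow> bool" where
  "cb_isomorphism H \<A> K \<B> \<Phi> \<longleftrightarrow> bij_betw \<Phi> \<A> \<B>
   \<and> \<Phi> (op_id H) = op_id K
   \<and> (\<forall>S\<in>\<A>. \<forall>T\<in>\<A>. \<Phi> (op_add H S T) = op_add K (\<Phi> S) (\<Phi> T))
   \<and> (\<forall>c. \<forall>T\<in>\<A>. \<Phi> (op_scale H c T) = op_scale K c (\<Phi> T))
   \<and> (\<forall>S\<in>\<A>. \<forall>T\<in>\<A>. \<Phi> (op_mult H S T) = op_mult K (\<Phi> S) (\<Phi> T))
   \<and> completely_bounded H \<A> K \<Phi>
   \<and> completely_bounded K \<B> H (inv_into \<A> \<Phi>)"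


section \<open>The Drury-Arveson space and its quotients\<close>

definition cinner :: "complex ^ 'n::finite \<Rightarrow> complex ^ 'n \<Rightarrow> complex" where
  "cinner z w = (\<Sum>i\<in>UNIV. z $ i * cnj (w $ i))"

definition cadjoint ::
    "(complex ^ 'm::finite \<Rightarrow> complex ^ 'n::finite) \<Rightarrow> complex ^ 'n \<Rightarrow> complex ^ 'm" where
  "cadjoint A = (THE A'. \<forall>z w. cinner (A z) w = cinner z (A' w))"

text \<open>
  By the Moore-Aronszajn theorem, a positive definite kernel determines its reproducing
  kernel Hilbert space; only the values of \<open>hip\<close> off the carrier are left open.
\<close>

definition drury_arveson :: "(complex ^ 'n::finite) hfs" where
  "drury_arveson = (SOME H. is_rkhs (ball 0 1) (\<lambda>z w. 1 / (1 - cinner z w)) H)"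

definition on_ball :: "(complex ^ 'n::finite \<Rightarrow> complex) \<Rightarrow> complex ^ 'n \<Rightarrow> complex" where
  "on_ball f = (\<lambda>z. if z \<in> ball 0 1 then f z else 0)"

definition Fsp :: "'n::finite mpoly set \<Rightarrow> (complex ^ 'n) hfs" where
  "Fsp I = drury_arveson
     \<lparr>hcar := {f \<in> hcar drury_arveson. \<forall>p\<in>I. hip drury_arveson f (on_ball (peval p)) = 0}\<rparr>"

definition compression :: "'n::finite mpoly set \<Rightarrow> 'n mpoly \<Rightarrow> (complex ^ 'n, complex ^ 'n) hop" where
  "compression I p = (\<lambda>f\<in>hcar (Fsp I). hproj drury_arveson (Fsp I) (on_ball (peval p) * f))"

definition Aalg :: "'n::finite mpoly set \<Rightarrow> (complex ^ 'n, complex ^ 'n) hop set" where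
  "Aalg I = \<Inter>{\<A>. closed_unital_subalgebra (Fsp I) \<A> \<and> (\<forall>i. compression I (coord i) \<in> \<A>)}"

text \<open>
  The decomposition into irreducible components exists and is unique, so it is immaterial
  that it is existentially quantified here.
\<close>

definition admissible :: "'n::finite mpoly set \<Rightarrow> bool" where
  "admissible J \<longleftrightarrow> (\<exists>\<W>. irreducible_decomposition (vanishing_locus J) \<W>
     \<and> hclosed drury_arveson
         {\<Sum>W\<in>\<W>. g W | g. \<forall>W\<in>\<W>. g W \<in> hcar (Fsp (vanishing_ideal (vec.span W)))})"

text \<open>
  A realisation of \<open>Aalg I\<close> as an algebra of continuous functions on \<open>ball_locus I\<close> in which
  the compression of multiplication by \<open>p\<close> corresponds to the restriction of \<open>p\<close>.  As the
  compressions of polynomials are dense in \<open>Aalg I\<close>, there is at most one; homomorphisms into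
  a supremum-normed algebra of continuous functions are automatically contractive.
\<close>

definition function_realisation ::
    "'n::finite mpoly set \<Rightarrow> ((complex ^ 'n, complex ^ 'n) hop \<Rightarrow> complex ^ 'n \<Rightarrow> complex) \<Rightarrow> bool" where
  "function_realisation I \<Gamma> \<longleftrightarrow>
     (\<forall>T\<in>Aalg I. continuous_on (ball_locus I) (\<Gamma> T))
   \<and> (\<forall>S\<in>Aalg I. \<forall>T\<in>Aalg I. \<forall>z\<in>ball_locus I. \<Gamma> (op_add (Fsp I) S T) z = \<Gamma> S z + \<Gamma> T z)
   \<and> (\<forall>c. \<forall>T\<in>Aalg I. \<forall>z\<in>ball_locus I. \<Gamma> (op_scale (Fsp I) c T) z = c * \<Gamma> T z)
   \<and> (\<forall>S\<in>Aalg I. \<forall>T\<in>Aalg I. \<forall>z\<in>ball_locus I. \<Gamma> (op_mult (Fsp I) S T) z = \<Gamma> S z * \<Gamma> T z)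
   \<and> (\<forall>T\<in>Aalg I. \<forall>z\<in>ball_locus I. cmod (\<Gamma> T z) \<le> op_norm (Fsp I) (Fsp I) T)
   \<and> (\<forall>S\<in>Aalg I. \<forall>T\<in>Aalg I. (\<forall>z\<in>ball_locus I. \<Gamma> S z = \<Gamma> T z) \<longrightarrow> S = T)
   \<and> (\<forall>p. \<forall>z\<in>ball_locus I. \<Gamma> (compression I p) z = peval p z)"

definition alg_fun ::
    "'n::finite mpoly set \<Rightarrow> (complex ^ 'n, complex ^ 'n) hop \<Rightarrow> complex ^ 'n \<Rightarrow> complex" where
  "alg_fun I = (SOME \<Gamma>. function_realisation I \<Gamma>)"


section \<open>Composition operators\<close>

text \<open>
  \<open>C\<close> is a bounded linear extension to \<open>Fsp J\<close> of the map sending a polynomial \<open>p\<close> in \<open>Fsp J\<close>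
  to \<open>p\<close> composed with \<open>L\<close>.  As \<open>L\<close> need not map the ball into the ball, the composition
  has to be formed with the polynomial and not with its restriction to the ball.
\<close>

definition comp_extension ::
    "'m::finite mpoly set \<Rightarrow> 'n::finite mpoly set \<Rightarrow> (complex ^ 'n \<Rightarrow> complex ^ 'm)
      \<Rightarrow> (complex ^ 'm, complex ^ 'n) hop \<Rightarrow> bool" where
  "comp_extension J I L C \<longleftrightarrow> C \<in> bounded_ops (Fsp J) (Fsp I)
   \<and> (\<forall>p. on_ball (peval p) \<in> hcar (Fsp J) \<longrightarrow>
        C (on_ball (peval p)) = on_ball (\<lambda>z. peval p (L z)))"

definition comp_op ::
    "'m::finite mpoly set \<Rightarrow> 'n::finite mpoly set \<Rightarrow> (complex ^ 'n \<Rightarrow> complex ^ 'm)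
      \<Rightarrow> (complex ^ 'm, complex ^ 'n) hop" where
  "comp_op J I L = (THE C. comp_extension J I L C)"

end

theory Submission
  imports Defs "HOL-Complex_Analysis.Conformal_Mappings"
    "HOL-Computational_Algebra.Fundamental_Theorem_Algebra"
begin

text \<open>
  The kernel functions at the points of \<open>vanishing_locus J\<close> in the ball span a dense subspace
  of \<open>Fsp J\<close>, and \<open>comp_op J I (cadjoint A)\<close> must send the kernel function at \<open>w\<close> to the one
  at \<open>A w\<close>; the difficulty is to bound this map.  By homogeneity \<open>A\<close> is isometric on the
  cone \<open>vanishing_locus J\<close>.  On an irreducible component \<open>W\<close>, an identity theorem in a
  local analytic parametrization polarizes this to \<open>cinner (A z) (A w) = cinner z w\<close>, so that \<open>A\<close> is
  isometric on the span of \<open>W\<close> and the map is isometric on \<open>Fsp (vanishing_ideal (vec.span W))\<close>.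
  Admissibility and the uniform boundedness principle split every element of the sum of these
  spaces into components of comparable norms.  The adjoints of the composition operators
  are composition with \<open>A\<close> and \<open>B\<close> on the variety, hence inverse to each other, and
  conjugation by them sends the compression of \<open>p\<close> to that of \<open>p\<close> composed with \<open>A\<close>; as \<open>Aalg I\<close> is the
  closure of such compressions, everything else follows by taking limits.
\<close>

section \<open>Hilbert spaces of functions\<close>

text \<open>The obstacle is that polarization fails across components: for \<open>z\<close> and
  \<open>w\<close> in different components, \<open>cinner (A z) (A w)\<close> may differ from
  \<open>cinner z w\<close>. So the map of kernel functions is in general not isometric, and its
  norm is controlled only by how well a sum over the components can be split. What makes the pieces
  fit together is that every map involved is composition with \<open>cadjoint A\<close> near the
  origin. As \<open>cadjoint A\<close> may move points of the ball out of it, formulas are compared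
  on a small ball only; that is enough to determine a function in \<open>drury_arveson\<close>. The
  norm equality for \<open>A\<close> on the cone holds because \<open>A\<close> and \<open>B\<close>
  are both contractive there and inverse to each other. The Nullstellensatz enters because totality
  of the kernel functions at the variety concerns the full vanishing ideal, while \<open>J\<close>
  is only given as radical. The algebra, in turn, is computed by values at points of the variety:
  they determine the elements of \<open>Fsp I\<close>, so that operator identities reduce to
  identities of functions.\<close>

locale hilbert_fs =
  fixes X :: "'x set" and H :: "'x hfs"
  assumes hfs: "hilbert_function_space X H"
begin

lemmas hfsD = hfs[unfolded hilbert_function_space_def]

lemma off_X: "f \<in> hcar H \<Longrightarrow> x \<notin> X \<Longrightarrow> f x = 0"
  using hfsD[THEN conjunct1] by blast

lemma zero_mem [simp, intro]: "0 \<in> hcar H"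
  using hfsD[THEN conjunct2, THEN conjunct1] by blast

lemma add_mem [simp, intro]: "f \<in> hcar H \<Longrightarrow> g \<in> hcar H \<Longrightarrow> f + g \<in> hcar H"
  using hfsD[THEN conjunct2, THEN conjunct2, THEN conjunct1] by blast

lemma scale_mem [simp, intro]: "f \<in> hcar H \<Longrightarrow> fscale c f \<in> hcar H"
  using hfsD[THEN conjunct2, THEN conjunct2, THEN conjunct2, THEN conjunct1] by blast

lemma hip_add_left: "f \<in> hcar H \<Longrightarrow> g \<in> hcar H \<Longrightarrow> h \<in> hcar H \<Longrightarrow>
     hip H (f + g) h = hip H f h + hip H g h"
  using hfsD[THEN conjunct2, THEN conjunct2, THEN conjunct2, THEN conjunct2, THEN conjunct1] by blast

lemma hip_scale_left: "f \<in> hcar H \<Longrightarrow> g \<in> hcar H \<Longrightarrow> hip H (fscale c f) g = c * hip H f g"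
  using hfsD[THEN conjunct2, THEN conjunct2, THEN conjunct2, THEN conjunct2, THEN conjunct2, THEN conjunct1] by blast

lemma hip_cnj: "f \<in> hcar H \<Longrightarrow> g \<in> hcar H \<Longrightarrow> hip H g f = cnj (hip H f g)"
  using hfsD[THEN conjunct2, THEN conjunct2, THEN conjunct2, THEN conjunct2, THEN conjunct2, THEN conjunct2, THEN conjunct1] by blast

lemma hip_pos: "f \<in> hcar H \<Longrightarrow> f \<noteq> 0 \<Longrightarrow> 0 < Re (hip H f f)"
  using hfsD[THEN conjunct2, THEN conjunct2, THEN conjunct2, THEN conjunct2, THEN conjunct2, THEN conjunct2, THEN conjunct2, THEN conjunct1] by blast

lemma complete:
  assumes "\<And>n. s n \<in> hcar H" "\<And>e. e > 0 \<Longrightarrow> \<exists>N. \<forall>m\<ge>N. \<forall>n\<ge>N. hnorm H (s m - s n) < e"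
  obtains f where "f \<in> hcar H" "(\<lambda>n::nat. hnorm H (s n - f)) \<longlonglongrightarrow> 0"
proof -
  note hfsD[THEN conjunct2, THEN conjunct2, THEN conjunct2, THEN conjunct2, THEN conjunct2, THEN conjunct2, THEN conjunct2, THEN conjunct2]
  from this[rule_format, of s] show ?thesis using assms that by auto
qed

lemma diff_eq: "f - g = f + fscale (- 1) g" for f g :: "'x \<Rightarrow> complex"
  by (auto simp: fscale_def fun_eq_iff)

lemma diff_mem [simp, intro]: "f \<in> hcar H \<Longrightarrow> g \<in> hcar H \<Longrightarrow> f - g \<in> hcar H"
  unfolding diff_eq by auto

lemma sum_mem [intro]: "(\<And>i. i \<in> A \<Longrightarrow> f i \<in> hcar H) \<Longrightarrow> sum f A \<in> hcar H"
  by (induction A rule: infinite_finite_induct) auto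

lemma hip_add_right:
  "f \<in> hcar H \<Longrightarrow> g \<in> hcar H \<Longrightarrow> h \<in> hcar H \<Longrightarrow> hip H h (f + g) = hip H h f + hip H h g"
  using hip_add_left[of f g h] hip_cnj by (metis add_mem complex_cnj_add)

lemma hip_scale_right:
  "f \<in> hcar H \<Longrightarrow> g \<in> hcar H \<Longrightarrow> hip H g (fscale c f) = cnj c * hip H g f"
  using hip_scale_left[of f g c] hip_cnj by (metis scale_mem complex_cnj_mult)

lemma hip_diff_left:
  "f \<in> hcar H \<Longrightarrow> g \<in> hcar H \<Longrightarrow> h \<in> hcar H \<Longrightarrow> hip H (f - g) h = hip H f h - hip H g h"
  unfolding diff_eq by (simp add: hip_add_left hip_scale_left)

lemma hip_diff_right:
  "f \<in> hcar H \<Longrightarrow> g \<in> hcar H \<Longrightarrow> h \<in> hcar H \<Longrightarrow> hip H h (f - g) = hip H h f - hip H h g"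
  unfolding diff_eq by (simp add: hip_add_right hip_scale_right)

lemma fscale_0 [simp]: "fscale 0 f = 0" "fscale c 0 = 0" "fscale 1 f = f"
  by (auto simp: fscale_def fun_eq_iff)

lemma hip_zero_left [simp]: "f \<in> hcar H \<Longrightarrow> hip H 0 f = 0"
  using hip_scale_left[of 0 f 0] by simp

lemma hip_zero_right [simp]: "f \<in> hcar H \<Longrightarrow> hip H f 0 = 0"
  using hip_scale_right[of 0 f 0] by simp

lemma hip_sum_left:
  "(\<And>i. i \<in> A \<Longrightarrow> f i \<in> hcar H) \<Longrightarrow> g \<in> hcar H \<Longrightarrow> hip H (sum f A) g = (\<Sum>i\<in>A. hip H (f i) g)"
  by (induction A rule: infinite_finite_induct) (auto simp: hip_add_left sum_mem)

lemma hip_self_nonneg: "f \<in> hcar H \<Longrightarrow> 0 \<le> Re (hip H f f)"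
  by (cases "f = 0") (auto dest: hip_pos)

lemma hnorm_sq: "f \<in> hcar H \<Longrightarrow> (hnorm H f)\<^sup>2 = Re (hip H f f)"
  by (simp add: hnorm_def hip_self_nonneg)

lemma hip_self: "f \<in> hcar H \<Longrightarrow> hip H f f = complex_of_real ((hnorm H f)\<^sup>2)"
  using hip_cnj[of f f] by (simp add: hnorm_sq complex_eq_iff)

lemma hnorm_nonneg [simp]: "f \<in> hcar H \<Longrightarrow> 0 \<le> hnorm H f"
  by (simp add: hnorm_def hip_self_nonneg)

lemma hnorm_zero [simp]: "hnorm H 0 = 0"
  by (simp add: hnorm_def)

lemma hnorm_eq_0: "f \<in> hcar H \<Longrightarrow> hnorm H f = 0 \<longleftrightarrow> f = 0"
  using hip_pos[of f] by (cases "f = 0") (auto simp: hnorm_def)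

lemma hnorm_scale: "f \<in> hcar H \<Longrightarrow> hnorm H (fscale c f) = cmod c * hnorm H f"
proof -
  assume f: "f \<in> hcar H"
  have "hip H (fscale c f) (fscale c f) = complex_of_real ((cmod c)\<^sup>2) * hip H f f"
    using f by (simp add: hip_scale_left hip_scale_right complex_norm_square mult_ac del: of_real_power)
  then show ?thesis
    by (simp add: hnorm_def real_sqrt_mult)
qed

lemma hnorm_uminus_diff: "f \<in> hcar H \<Longrightarrow> g \<in> hcar H \<Longrightarrow> hnorm H (f - g) = hnorm H (g - f)"
proof -
  assume "f \<in> hcar H" "g \<in> hcar H"
  moreover have "f - g = fscale (- 1) (g - f)"
    by (auto simp: fscale_def fun_eq_iff)
  ultimately show ?thesis by (simp add: hnorm_scale)
qed

lemma hnorm_add_sq: "f \<in> hcar H \<Longrightarrow> g \<in> hcar H \<Longrightarrow>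
   (hnorm H (f + g))\<^sup>2 = (hnorm H f)\<^sup>2 + (hnorm H g)\<^sup>2 + 2 * Re (hip H f g)"
  using hip_cnj[of f g] by (simp add: hnorm_sq hip_add_left hip_add_right)

lemma hnorm_diff_sq: "f \<in> hcar H \<Longrightarrow> g \<in> hcar H \<Longrightarrow>
   (hnorm H (f - g))\<^sup>2 = (hnorm H f)\<^sup>2 + (hnorm H g)\<^sup>2 - 2 * Re (hip H f g)"
  using hip_cnj[of f g] by (simp add: hnorm_sq hip_diff_left hip_diff_right)

lemma Cauchy_Schwarz:
  assumes f: "f \<in> hcar H" and g: "g \<in> hcar H"
  shows "cmod (hip H f g) \<le> hnorm H f * hnorm H g"
proof (cases "g = 0")
  case False
  define N where "N = (hnorm H g)\<^sup>2"
  have N: "N > 0" using hip_pos[OF g False] by (simp add: N_def hnorm_sq g)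
  define c where "c = hip H f g / N"
  have "0 \<le> (hnorm H (f + fscale (- c) g))\<^sup>2" by simp
  also have "\<dots> = (hnorm H f)\<^sup>2 + (cmod c)\<^sup>2 * N + 2 * Re (- (cnj c * hip H f g))"
    using f g by (subst hnorm_add_sq) (auto simp: hnorm_scale hip_scale_right N_def power_mult_distrib)
  also have "(cmod c)\<^sup>2 * N = (cmod (hip H f g))\<^sup>2 / N"
    using N by (simp add: c_def norm_divide power_divide field_simps power2_eq_square)
  also have "Re (- (cnj c * hip H f g)) = - (cmod (hip H f g))\<^sup>2 / N"
  proof -
    have "cnj c * hip H f g = complex_of_real ((cmod (hip H f g))\<^sup>2 / N)"
      by (simp add: c_def complex_norm_square mult_ac del: of_real_power)
    then show ?thesis by simp
  qed
  finally have "(cmod (hip H f g))\<^sup>2 / N \<le> (hnorm H f)\<^sup>2" by simp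
  then have "(cmod (hip H f g))\<^sup>2 \<le> (hnorm H f * hnorm H g)\<^sup>2"
    using N by (simp add: field_simps power_mult_distrib N_def)
  then show ?thesis
    by (rule power2_le_imp_le) (use f g in auto)
qed (use f in auto)

lemma hnorm_triangle:
  assumes f: "f \<in> hcar H" and g: "g \<in> hcar H"
  shows "hnorm H (f + g) \<le> hnorm H f + hnorm H g"
proof (rule power2_le_imp_le)
  have "Re (hip H f g) \<le> hnorm H f * hnorm H g"
    using Cauchy_Schwarz[OF f g] complex_Re_le_cmod order_trans by blast
  then show "(hnorm H (f + g))\<^sup>2 \<le> (hnorm H f + hnorm H g)\<^sup>2"
    using f g by (simp add: hnorm_add_sq power2_sum)
qed (use f g in auto)

lemma hnorm_triangle_diff:
  assumes "f \<in> hcar H" and "g \<in> hcar H" and "h \<in> hcar H"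
  shows "hnorm H (f - h) \<le> hnorm H (f - g) + hnorm H (g - h)"
  using hnorm_triangle[of "f - g" "g - h"] assms by simp

lemma hnorm_diff_ge:
  assumes "f \<in> hcar H" and "g \<in> hcar H"
  shows "\<bar>hnorm H f - hnorm H g\<bar> \<le> hnorm H (f - g)"
  using hnorm_triangle[of "f - g" g] hnorm_triangle[of "g - f" f] hnorm_uminus_diff[of f g] assms
  by (auto simp: abs_le_iff algebra_simps)

lemma hnorm_sum_le:
  assumes "\<And>i. i \<in> A \<Longrightarrow> f i \<in> hcar H"
  shows "hnorm H (sum f A) \<le> (\<Sum>i\<in>A. hnorm H (f i))"
  using assms
proof (induction A rule: infinite_finite_induct)
  case (insert x F)
  have "hnorm H (f x + sum f F) \<le> hnorm H (f x) + hnorm H (sum f F)"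
    by (intro hnorm_triangle sum_mem insert.prems) auto
  moreover have "hnorm H (sum f F) \<le> (\<Sum>i\<in>F. hnorm H (f i))"
    using insert.IH insert.prems by auto
  ultimately show ?case unfolding sum.insert[OF insert.hyps] by linarith
qed auto

lemma lim_hnorm:
  assumes "\<And>n. s n \<in> hcar H" "f \<in> hcar H" "(\<lambda>n::nat. hnorm H (s n - f)) \<longlonglongrightarrow> 0"
  shows "(\<lambda>n. hnorm H (s n)) \<longlonglongrightarrow> hnorm H f"
proof -
  have "(\<lambda>n. hnorm H (s n) - hnorm H f) \<longlonglongrightarrow> 0"
    by (rule Lim_null_comparison[OF _ assms(3)]) (use hnorm_diff_ge assms in auto)
  then show ?thesis by (simp add: LIM_zero_iff)
qed

lemma lim_hip:
  assumes "\<And>n. s n \<in> hcar H" "f \<in> hcar H" "(\<lambda>n::nat. hnorm H (s n - f)) \<longlonglongrightarrow> 0" "g \<in> hcar H"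
  shows "(\<lambda>n. hip H (s n) g) \<longlonglongrightarrow> hip H f g"
proof -
  have l: "(\<lambda>n. hnorm H (s n - f) * hnorm H g) \<longlonglongrightarrow> 0"
    using assms(3) by (rule tendsto_mult_left_zero)
  have "norm (hip H (s n) g - hip H f g) \<le> hnorm H (s n - f) * hnorm H g" for n
    using Cauchy_Schwarz[of "s n - f" g] assms by (simp add: hip_diff_left)
  then have "(\<lambda>n. hip H (s n) g - hip H f g) \<longlonglongrightarrow> 0"
    by (intro Lim_null_comparison[OF always_eventually[OF allI] l])
  then show ?thesis by (simp add: LIM_zero_iff)
qed

lemma lim_unique:
  assumes "\<And>n. s n \<in> hcar H" "f \<in> hcar H" "g \<in> hcar H"
    "(\<lambda>n::nat. hnorm H (s n - f)) \<longlonglongrightarrow> 0" "(\<lambda>n::nat. hnorm H (s n - g)) \<longlonglongrightarrow> 0"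
  shows "f = g"
proof -
  have "hnorm H (f - g) \<le> hnorm H (s n - f) + hnorm H (s n - g)" for n
    using hnorm_triangle_diff[of f "s n" g] hnorm_uminus_diff[of f "s n"] assms by auto
  moreover have "(\<lambda>n. hnorm H (s n - f) + hnorm H (s n - g)) \<longlonglongrightarrow> 0 + 0"
    by (intro tendsto_add assms)
  ultimately have "hnorm H (f - g) \<le> 0"
    using LIMSEQ_le_const[of "\<lambda>n. hnorm H (s n - f) + hnorm H (s n - g)" 0] by simp
  then have "hnorm H (f - g) = 0" using hnorm_nonneg[of "f - g"] assms by (simp add: order_antisym)
  then show ?thesis using hnorm_eq_0[of "f - g"] assms by auto
qed

lemma lim_Cauchy:
  assumes "\<And>n. s n \<in> hcar H" "f \<in> hcar H" "(\<lambda>n::nat. hnorm H (s n - f)) \<longlonglongrightarrow> 0" "e > 0"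
  shows "\<exists>N. \<forall>m\<ge>N. \<forall>n\<ge>N. hnorm H (s m - s n) < e"
proof -
  obtain N where N: "\<And>n. n \<ge> N \<Longrightarrow> hnorm H (s n - f) < e / 2"
    using LIMSEQ_D[OF assms(3), of "e/2"] assms by (auto simp: assms)
  have "hnorm H (s m - s n) < e" if "m \<ge> N" "n \<ge> N" for m n
    using hnorm_triangle_diff[of "s m" f "s n"] hnorm_uminus_diff[of f "s n"] N[OF that(1)] N[OF that(2)] assms
    by auto
  then show ?thesis by blast
qed

lemma hip_eq_zero_imp:
  assumes "f \<in> hcar H" "\<And>g. g \<in> hcar H \<Longrightarrow> hip H f g = 0" shows "f = 0"
  using hip_pos[of f] assms by force

definition hsub :: "('x \<Rightarrow> complex) set \<Rightarrow> bool" where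
  "hsub M \<longleftrightarrow> M \<subseteq> hcar H \<and> 0 \<in> M \<and> (\<forall>f\<in>M. \<forall>g\<in>M. f + g \<in> M) \<and> (\<forall>c. \<forall>f\<in>M. fscale c f \<in> M)"

lemma hsubD:
  assumes "hsub M"
  shows "M \<subseteq> hcar H" "0 \<in> M" "\<And>f g. f \<in> M \<Longrightarrow> g \<in> M \<Longrightarrow> f + g \<in> M"
    "\<And>c f. f \<in> M \<Longrightarrow> fscale c f \<in> M" "\<And>f g. f \<in> M \<Longrightarrow> g \<in> M \<Longrightarrow> f - g \<in> M"
    "\<And>A f. (\<And>i. i \<in> A \<Longrightarrow> f i \<in> M) \<Longrightarrow> sum f A \<in> M"
proof -
  show *: "M \<subseteq> hcar H" "0 \<in> M" "\<And>f g. f \<in> M \<Longrightarrow> g \<in> M \<Longrightarrow> f + g \<in> M"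
    "\<And>c f. f \<in> M \<Longrightarrow> fscale c f \<in> M"
    using assms by (auto simp: hsub_def)
  show "\<And>f g. f \<in> M \<Longrightarrow> g \<in> M \<Longrightarrow> f - g \<in> M"
    unfolding diff_eq using * by auto
  show "(\<And>i. i \<in> A \<Longrightarrow> f i \<in> M) \<Longrightarrow> sum f A \<in> M" for A f
    by (induction A rule: infinite_finite_induct) (auto simp: *)
qed

lemma restrict_hilbert:
  assumes "hsub M" "hclosed H M"
  shows "hilbert_function_space X (H\<lparr>hcar := M\<rparr>)"
proof -
  note M = hsubD[OF assms(1)]
  have n: "hnorm (H\<lparr>hcar := M\<rparr>) = hnorm H" by (simp add: hnorm_def fun_eq_iff)
  show ?thesis
    unfolding hilbert_function_space_def n
  proof (simp, intro conjI ballI allI impI)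
    fix s :: "nat \<Rightarrow> 'x \<Rightarrow> complex"
    assume s: "(\<forall>n. s n \<in> M) \<and> (\<forall>e>0. \<exists>N. \<forall>m\<ge>N. \<forall>n\<ge>N. hnorm H (s m - s n) < e)"
    then obtain f where "f \<in> hcar H" "(\<lambda>n::nat. hnorm H (s n - f)) \<longlonglongrightarrow> 0"
      using complete[of s] M(1) by blast
    then show "\<exists>f\<in>M. (\<lambda>n. hnorm H (s n - f)) \<longlonglongrightarrow> 0"
      using assms(2) s unfolding hclosed_def by blast
  next
    show "g \<in> M \<Longrightarrow> f \<in> M \<Longrightarrow> hip H f g = cnj (hip H g f)" for f g
      using M(1) by (intro hip_cnj) auto
  qed (use M(1) in \<open>auto intro: M off_X hip_add_left hip_scale_left hip_pos\<close>)
qed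

lemma parallelogram:
  assumes "f \<in> hcar H" "g \<in> hcar H"
  shows "(hnorm H (f - g))\<^sup>2 = 2 * (hnorm H f)\<^sup>2 + 2 * (hnorm H g)\<^sup>2 - (hnorm H (f + g))\<^sup>2"
  using assms by (simp add: hnorm_add_sq hnorm_diff_sq)

text \<open>The midpoint of two members of a minimizing sequence lies in \<open>M\<close> again and
  so has distance at least \<open>d\<close>; by the parallelogram law this makes the sequence
  Cauchy.\<close>

lemma closest_point:
  assumes M: "hsub M" "hclosed H M" and f: "f \<in> hcar H"
  obtains g where "g \<in> M" "\<And>h. h \<in> M \<Longrightarrow> hnorm H (f - g) \<le> hnorm H (f - h)"
proof -
  note MD = hsubD[OF M(1)]
  have MH: "h \<in> M \<Longrightarrow> h \<in> hcar H" for h using MD(1) by auto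
  define d where "d = Inf ((\<lambda>h. hnorm H (f - h)) ` M)"
  have bdd: "bdd_below ((\<lambda>h. hnorm H (f - h)) ` M)"
    by (rule bdd_belowI[of _ 0]) (use MH f in auto)
  have d_le: "d \<le> hnorm H (f - h)" if "h \<in> M" for h
    unfolding d_def using bdd that by (intro cInf_lower) auto
  have d0: "d \<ge> 0"
    unfolding d_def by (rule cInf_greatest) (use MD(2) MH f in auto)
  have "\<exists>h\<in>M. hnorm H (f - h) < d + inverse (of_nat (Suc n))" for n
  proof -
    have "Inf ((\<lambda>h. hnorm H (f - h)) ` M) < d + inverse (of_nat (Suc n))"
      unfolding d_def[symmetric] by simp
    then show ?thesis using cInf_lessD[of "(\<lambda>h. hnorm H (f - h)) ` M"] MD(2) by auto
  qed
  then obtain s where s: "\<And>n. s n \<in> M" "\<And>n. hnorm H (f - s n) < d + inverse (of_nat (Suc n))"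
    by metis
  have sH: "s n \<in> hcar H" for n using MH s by auto
  have lims: "(\<lambda>n. hnorm H (f - s n)) \<longlonglongrightarrow> d"
  proof (rule tendsto_sandwich[of "\<lambda>_. d" _ _ "\<lambda>n. d + inverse (of_nat (Suc n))"])
    show "(\<lambda>n. d + inverse (real (Suc n))) \<longlonglongrightarrow> d"
      using tendsto_add[OF tendsto_const LIMSEQ_inverse_real_of_nat] by fastforce
  qed (use d_le s in \<open>auto intro!: always_eventually less_imp_le simp del: of_nat_Suc\<close>)
  have key: "(hnorm H (s m - s n))\<^sup>2 \<le> 2 * (hnorm H (f - s m))\<^sup>2 + 2 * (hnorm H (f - s n))\<^sup>2 - 4 * d\<^sup>2" for m n
  proof -
    define h where "h = fscale (1/2) (s m + s n)"
    have h: "h \<in> M" using MD s by (auto simp: h_def)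
    have "(f - s n) + (f - s m) = fscale 2 (f - h)"
      by (auto simp: h_def fscale_def fun_eq_iff field_simps)
    then have e: "hnorm H ((f - s n) + (f - s m)) = 2 * hnorm H (f - h)"
      using MH[OF h] f by (simp add: hnorm_scale)
    have "d\<^sup>2 \<le> (hnorm H (f - h))\<^sup>2" using d_le[OF h] d0 by (rule power_mono)
    moreover have "(f - s n) - (f - s m) = s m - s n" by auto
    ultimately show ?thesis
      using parallelogram[of "f - s n" "f - s m"] e f sH by (simp add: power_mult_distrib)
  qed
  have "\<exists>N. \<forall>m\<ge>N. \<forall>n\<ge>N. hnorm H (s m - s n) < e" if "e > 0" for e
  proof -
    have "(\<lambda>n. (hnorm H (f - s n))\<^sup>2) \<longlonglongrightarrow> d\<^sup>2"
      by (intro tendsto_intros lims)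
    then obtain N where N: "\<And>n. n \<ge> N \<Longrightarrow> \<bar>(hnorm H (f - s n))\<^sup>2 - d\<^sup>2\<bar> < e\<^sup>2 / 4"
      using LIMSEQ_D[of "\<lambda>n. (hnorm H (f - s n))\<^sup>2" "d\<^sup>2" "e\<^sup>2/4"] \<open>e > 0\<close> by auto
    have "hnorm H (s m - s n) < e" if mn: "m \<ge> N" "n \<ge> N" for m n
    proof -
      have "(hnorm H (s m - s n))\<^sup>2 < e\<^sup>2"
        using key[of m n] N[OF mn(1)] N[OF mn(2)] by linarith
      then show ?thesis using \<open>e > 0\<close> by (simp add: power2_less_imp_less)
    qed
    then show ?thesis by blast
  qed
  then obtain g where g: "g \<in> hcar H" "(\<lambda>n::nat. hnorm H (s n - g)) \<longlonglongrightarrow> 0"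
    using complete[of s] sH by blast
  have gM: "g \<in> M" using M(2) s g unfolding hclosed_def by blast
  have "(\<lambda>n. hnorm H ((f - s n) - (f - g))) \<longlonglongrightarrow> 0"
  proof -
    have "(f - s n) - (f - g) = g - s n" for n by auto
    then show ?thesis using g hnorm_uminus_diff[OF g(1) sH] by simp
  qed
  then have "(\<lambda>n. hnorm H (f - s n)) \<longlonglongrightarrow> hnorm H (f - g)"
    using f g sH by (intro lim_hnorm) auto
  then have "hnorm H (f - g) = d" using lims LIMSEQ_unique by blast
  then show ?thesis using that gM d_le by blast
qed

text \<open>Replacing the closest point \<open>g\<close> by \<open>g + fscale c h\<close> cannot
  decrease the distance. For the best \<open>c\<close> the squared distance changes by
  \<open>- (cmod (hip H u h))\<^sup>2 / N\<close>, which must therefore be 0.\<close>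

theorem projection:
  assumes M: "hsub M" "hclosed H M" and f: "f \<in> hcar H"
  obtains g where "g \<in> M" "\<And>h. h \<in> M \<Longrightarrow> hip H (f - g) h = 0"
proof -
  note MD = hsubD[OF M(1)]
  have MH: "h \<in> M \<Longrightarrow> h \<in> hcar H" for h using MD(1) by auto
  obtain g where g: "g \<in> M" "\<And>h. h \<in> M \<Longrightarrow> hnorm H (f - g) \<le> hnorm H (f - h)"
    using closest_point[OF M f] by blast
  have "hip H (f - g) h = 0" if h: "h \<in> M" for h
  proof (cases "h = 0")
    case False
    define u where "u = f - g"
    have u: "u \<in> hcar H" using f MH g by (auto simp: u_def)
    define N where "N = (hnorm H h)\<^sup>2"
    have N: "N > 0" using hip_pos[OF MH[OF h] False] by (simp add: N_def hnorm_sq MH h)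
    define c where "c = hip H u h / N"
    have e: "f - (g + fscale c h) = u + fscale (- c) h"
      by (auto simp: u_def fscale_def fun_eq_iff)
    have "(hnorm H u)\<^sup>2 \<le> (hnorm H (u + fscale (- c) h))\<^sup>2"
      using g(2)[of "g + fscale c h"] MD(3)[OF g(1) MD(4)[OF h]] u
      unfolding e by (intro power_mono) (auto simp: u_def)
    also have "\<dots> = (hnorm H u)\<^sup>2 + (cmod c)\<^sup>2 * N + 2 * Re (- (cnj c * hip H u h))"
      using u MH[OF h] by (subst hnorm_add_sq) (auto simp: hnorm_scale hip_scale_right N_def power_mult_distrib)
    also have "(cmod c)\<^sup>2 * N = (cmod (hip H u h))\<^sup>2 / N"
      using N by (simp add: c_def norm_divide power_divide field_simps power2_eq_square)
    also have "cnj c * hip H u h = complex_of_real ((cmod (hip H u h))\<^sup>2 / N)"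
      by (simp add: c_def complex_norm_square mult_ac del: of_real_power)
    finally have "(cmod (hip H u h))\<^sup>2 / N \<le> 0" by simp
    then show ?thesis using N by (simp add: divide_le_0_iff u_def)
  qed (use f MH g in auto)
  then show ?thesis using that g by blast
qed

lemma bounded_functional_zero_closed:
  assumes "\<And>f. f \<in> hcar H \<Longrightarrow> cmod (\<phi> f) \<le> b * hnorm H f"
    and "\<And>f g. f \<in> hcar H \<Longrightarrow> g \<in> hcar H \<Longrightarrow> \<phi> (f - g) = \<phi> f - \<phi> g"
  shows "hclosed H {f \<in> hcar H. \<phi> f = 0}"
  unfolding hclosed_def
proof (intro allI impI, elim conjE)
  fix s :: "nat \<Rightarrow> 'x \<Rightarrow> complex" and f
  assume s: "\<forall>n. s n \<in> {f \<in> hcar H. \<phi> f = 0}" and f: "f \<in> hcar H"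
    and l: "(\<lambda>n. hnorm H (s n - f)) \<longlonglongrightarrow> 0"
  have "cmod (\<phi> f) \<le> b * hnorm H (s n - f)" for n
    using assms(1)[of "s n - f"] assms(2)[of "s n" f] s f by simp
  moreover have "(\<lambda>n. b * hnorm H (s n - f)) \<longlonglongrightarrow> 0"
    using l by (rule tendsto_mult_right_zero)
  ultimately have "cmod (\<phi> f) \<le> 0"
    using LIMSEQ_le_const[of "\<lambda>n. b * hnorm H (s n - f)" 0] by blast
  then show "f \<in> {f \<in> hcar H. \<phi> f = 0}" using f by auto
qed

text \<open>The kernel \<open>M\<close> of the functional is a closed subspace. Unless the
  functional is 0, some \<open>f\<close> has a nonzero part \<open>u\<close> orthogonal to
  \<open>M\<close>, and every \<open>h\<close> differs from a multiple of \<open>u\<close> by an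
  element of \<open>M\<close>; hence a multiple of \<open>u\<close> represents the
  functional.\<close>

theorem Riesz:
  assumes add: "\<And>f g. f \<in> hcar H \<Longrightarrow> g \<in> hcar H \<Longrightarrow> \<phi> (f + g) = \<phi> f + \<phi> g"
    and scale: "\<And>c f. f \<in> hcar H \<Longrightarrow> \<phi> (fscale c f) = c * \<phi> f"
    and bdd: "\<And>f. f \<in> hcar H \<Longrightarrow> cmod (\<phi> f) \<le> b * hnorm H f"
  obtains g where "g \<in> hcar H" "\<And>f. f \<in> hcar H \<Longrightarrow> \<phi> f = hip H f g"
proof -
  define M where "M = {f \<in> hcar H. \<phi> f = 0}"
  have diff: "\<phi> (f - g) = \<phi> f - \<phi> g" if "f \<in> hcar H" "g \<in> hcar H" for f g
    using that by (simp add: diff_eq add scale)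
  have cl: "hclosed H M" unfolding M_def
    by (rule bounded_functional_zero_closed[OF bdd diff])
  have sub: "hsub M"
    using scale[of 0 0] by (auto simp: hsub_def M_def add scale)
  show ?thesis
  proof (cases "\<forall>f\<in>hcar H. \<phi> f = 0")
    case True
    then show ?thesis using that[of 0] by auto
  next
    case False
    then obtain f where f: "f \<in> hcar H" "\<phi> f \<noteq> 0" by blast
    obtain p where p: "p \<in> M" "\<And>h. h \<in> M \<Longrightarrow> hip H (f - p) h = 0"
      using projection[OF sub cl f(1)] by blast
    define u where "u = f - p"
    have pH: "p \<in> hcar H" "\<phi> p = 0" using p by (auto simp: M_def)
    have u: "u \<in> hcar H" "\<phi> u \<noteq> 0" using pH f by (auto simp: u_def diff)
    have "u \<noteq> 0" using u scale[of 0 0] by auto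
    then have nu: "hip H u u \<noteq> 0" using hip_pos[of u] u by force
    \<comment> \<open>The coefficient is conjugated because the inner product is antilinear in its
      second argument.\<close>
    define g where "g = fscale (cnj (\<phi> u / hip H u u)) u"
    have rep: "\<phi> h = hip H h g" if h: "h \<in> hcar H" for h
    proof -
      define k where "k = h - fscale (\<phi> h / \<phi> u) u"
      have "k \<in> M" using h u by (auto simp: k_def M_def diff scale)
      then have "hip H u k = 0" using p by (auto simp: u_def)
      then have "hip H k u = 0" using hip_cnj[of u k] u h by (auto simp: k_def)
      then have "hip H h u = \<phi> h / \<phi> u * hip H u u"
        using h u by (simp add: k_def hip_diff_left hip_scale_left)
      then show ?thesis using u nu h by (simp add: g_def hip_scale_right)
    qed
    have "g \<in> hcar H" unfolding g_def using u(1) by (rule scale_mem)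
    then show ?thesis using rep by (rule that)
  qed
qed

end

text \<open>The closure \<open>M\<close> of \<open>S\<close> is a closed subspace, and the part of
  \<open>f\<close> orthogonal to \<open>M\<close> is orthogonal to \<open>S\<close>, hence 0. In
  this way totality of kernel functions becomes a supply of approximating sequences.\<close>

lemma (in hilbert_fs) dense_if_total:
  assumes S: "hsub S" and total: "\<And>f. f \<in> hcar H \<Longrightarrow> (\<And>s. s \<in> S \<Longrightarrow> hip H f s = 0) \<Longrightarrow> f = 0"
    and f: "f \<in> hcar H"
  obtains s where "\<And>n. s n \<in> S" "(\<lambda>n::nat. hnorm H (s n - f)) \<longlonglongrightarrow> 0"
proof -
  note SD = hsubD[OF S]
  have SH: "s \<in> S \<Longrightarrow> s \<in> hcar H" for s using SD(1) by auto
  define M where "M = {f \<in> hcar H. \<forall>e>0. \<exists>s\<in>S. hnorm H (s - f) < e}"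
  have M_sub: "hsub M"
    unfolding hsub_def
  proof (intro conjI ballI allI)
    show "M \<subseteq> hcar H" by (auto simp: M_def)
    show "0 \<in> M" using SD(2) by (force simp: M_def)
    show "f + g \<in> M" if "f \<in> M" "g \<in> M" for f g
    proof -
      have "\<exists>s\<in>S. hnorm H (s - (f + g)) < e" if e: "e > 0" for e
      proof -
        have e2: "e/2 > 0" using e by simp
        then obtain s where s: "s \<in> S" "hnorm H (s - f) < e/2"
          using \<open>f \<in> M\<close> unfolding M_def by blast
        obtain t where t: "t \<in> S" "hnorm H (t - g) < e/2"
          using \<open>g \<in> M\<close> e2 unfolding M_def by blast
        note st = s t
        have "hnorm H ((s - f) + (t - g)) \<le> hnorm H (s - f) + hnorm H (t - g)"
          using st \<open>f \<in> M\<close> \<open>g \<in> M\<close> SH by (intro hnorm_triangle diff_mem) (auto simp: M_def)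
        moreover have "(s - f) + (t - g) = (s + t) - (f + g)" by auto
        ultimately have "hnorm H ((s + t) - (f + g)) < e" using st(2,4) by simp
        then show ?thesis using SD(3)[OF st(1,3)] by blast
      qed
      then show ?thesis using that by (auto simp: M_def)
    qed
    show "fscale c f \<in> M" if "f \<in> M" for c f
    proof -
      have fH: "f \<in> hcar H" using that by (simp add: M_def)
      have "\<exists>s\<in>S. hnorm H (s - fscale c f) < e" if e: "e > 0" for e
      proof -
        have cp: "cmod c + 1 > 0" by (simp add: add_nonneg_pos)
        then have "e / (cmod c + 1) > 0" using e by simp
        then obtain s where s: "s \<in> S" "hnorm H (s - f) < e / (cmod c + 1)"
          using \<open>f \<in> M\<close> unfolding M_def by blast
        have eq: "fscale c (s - f) = fscale c s - fscale c f"
          by (auto simp: fscale_def fun_eq_iff algebra_simps)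
        have sf: "s - f \<in> hcar H" using s fH SH by auto
        have "cmod c * hnorm H (s - f) \<le> (cmod c + 1) * hnorm H (s - f)"
          using hnorm_nonneg[OF sf] by (intro mult_right_mono) auto
        also have "\<dots> < e" using s(2) cp by (simp only: pos_less_divide_eq mult.commute)
        finally have "hnorm H (fscale c s - fscale c f) < e"
          using sf unfolding eq[symmetric] by (simp add: hnorm_scale)
        then show ?thesis using SD(4)[OF s(1)] by blast
      qed
      then show ?thesis using fH by (auto simp: M_def)
    qed
  qed
  have M_cl: "hclosed H M"
    unfolding hclosed_def
  proof (intro allI impI, elim conjE)
    fix t :: "nat \<Rightarrow> 'x \<Rightarrow> complex" and g
    assume t: "\<forall>n. t n \<in> M" and g: "g \<in> hcar H" and l: "(\<lambda>n. hnorm H (t n - g)) \<longlonglongrightarrow> 0"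
    have tH: "t n \<in> hcar H" for n using t by (simp add: M_def)
    have "\<exists>s\<in>S. hnorm H (s - g) < e" if e: "e > 0" for e
    proof -
      have "e/2 > 0" using e by simp
      from LIMSEQ_D[OF l this] obtain n where "norm (hnorm H (t n - g) - 0) < e/2" by blast
      then have n: "hnorm H (t n - g) < e/2" using tH g by simp
      obtain s where s: "s \<in> S" "hnorm H (s - t n) < e/2"
        using t \<open>e/2 > 0\<close> unfolding M_def by blast
      have "hnorm H (s - g) < e"
        using hnorm_triangle_diff[OF SH[OF s(1)] tH[of n] g] s(2) n by linarith
      then show ?thesis using s by blast
    qed
    then show "g \<in> M" using g by (auto simp: M_def)
  qed
  have SM: "S \<subseteq> M" using SH by (force simp: M_def)
  obtain p where p: "p \<in> M" "\<And>h. h \<in> M \<Longrightarrow> hip H (f - p) h = 0"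
    using projection[OF M_sub M_cl f] by blast
  have "f - p = 0"
    using p SM f by (intro total) (auto simp: M_def)
  then have "f \<in> M" using p by simp
  then have "\<exists>s\<in>S. hnorm H (s - f) < inverse (of_nat (Suc n))" for n
    by (simp add: M_def)
  then obtain s where s: "\<And>n. s n \<in> S" "\<And>n. hnorm H (s n - f) < inverse (of_nat (Suc n))"
    by metis
  have "(\<lambda>n. hnorm H (s n - f)) \<longlonglongrightarrow> 0"
    using s SH f
    by (intro Lim_null_comparison[OF always_eventually[OF allI] LIMSEQ_inverse_real_of_nat])
       (auto intro: less_imp_le simp del: of_nat_Suc)
  then show ?thesis using that s by blast
qed

subsection \<open>Uniform boundedness\<close>

text \<open>A gliding hump argument in place of Baire category. Members \<open>h n\<close> of norm
  above \<open>4 ^ n\<close> are paired with a series whose \<open>n\<close>-th term has norm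
  \<open>(1/3) ^ n\<close> and a sign that keeps the pairing with \<open>h n\<close> large. The
  later terms can destroy at most half of it, so the pairing of the limit with \<open>h n\<close>
  has modulus at least \<open>(1/2) * (4/3) ^ n\<close>.\<close>

lemma (in hilbert_fs) uniform_boundedness:
  assumes Fam: "Fam \<subseteq> hcar H"
    and ptw: "\<And>g. g \<in> hcar H \<Longrightarrow> \<exists>M. \<forall>h\<in>Fam. cmod (hip H g h) \<le> M"
  shows "\<exists>M. \<forall>h\<in>Fam. hnorm H h \<le> M"
proof (rule ccontr)
  assume "\<not> ?thesis"
  then have "\<exists>h\<in>Fam. hnorm H h > 4 ^ n" for n :: nat by (meson not_le)
  then obtain h where h: "\<And>n. h n \<in> Fam" "\<And>n. hnorm H (h n) > 4 ^ n" by metis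
  have hH: "h n \<in> hcar H" for n using h Fam by auto
  have hpos: "hnorm H (h n) > 0" for n
    using h(2)[of n] zero_less_power[of "4::real" n] by linarith
  define v where "v n = fscale (of_real ((1/3)^n / hnorm H (h n))) (h n)" for n
  have vH: "v n \<in> hcar H" for n using hH by (simp add: v_def)
  have vn: "hnorm H (v n) = (1/3)^n" for n
    unfolding v_def hnorm_scale[OF hH] using hpos[of n] by (simp add: norm_divide norm_power)
  have vh: "cmod (hip H (v n) (h n)) = (1/3)^n * hnorm H (h n)" for n
    using hH hpos[of n]
    by (simp add: v_def hip_scale_left hip_self norm_mult norm_power power2_eq_square norm_divide)
  \<comment> \<open>of \<open>x \<plusminus> v n\<close>, one pairs with \<open>h n\<close> at least as strongly as \<open>v n\<close> does\<close>
  define step where "step n x = (if cmod (hip H (x + v n) (h n)) \<ge> cmod (hip H (v n) (h n))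
     then x + v n else x - v n)" for n x
  define s where "s = rec_nat 0 step"
  have s0: "s 0 = 0" and sS: "s (Suc n) = step n (s n)" for n by (simp_all add: s_def)
  have sH: "s n \<in> hcar H" for n
  proof (induction n)
    case (Suc n)
    then show ?case unfolding sS step_def using vH by auto
  qed (use s0 in \<open>metis zero_mem\<close>)
  have big: "cmod (hip H (s (Suc n)) (h n)) \<ge> (1/3)^n * hnorm H (h n)" for n
  proof (cases "cmod (hip H (s n + v n) (h n)) \<ge> cmod (hip H (v n) (h n))")
    case True
    then show ?thesis by (simp add: sS step_def vh)
  next
    case False
    let ?a = "hip H (s n) (h n)" and ?b = "hip H (v n) (h n)"
    have "2 * cmod ?b = cmod ((?a + ?b) - (?a - ?b))" by (simp add: norm_mult flip: mult_2)
    also have "\<dots> \<le> cmod (?a + ?b) + cmod (?a - ?b)" by (rule norm_triangle_ineq4)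
    finally have "cmod ?b \<le> cmod (?a - ?b)"
      using False by (simp add: hip_add_left sH vH hH)
    then show ?thesis using False by (simp add: sS step_def vh hip_diff_left sH vH hH)
  qed
  have stepn: "hnorm H (s (Suc n) - s n) = (1/3)^n" for n
  proof -
    have "s (Suc n) - s n = v n \<or> s (Suc n) - s n = 0 - v n"
      by (auto simp: sS step_def fun_eq_iff)
    moreover have "hnorm H (0 - v n) = hnorm H (v n)"
      using hnorm_uminus_diff[of 0 "v n"] vH by simp
    ultimately show ?thesis using vn[of n] by metis
  qed
  have tail: "hnorm H (s (n + k) - s n) \<le> (3/2) * (1/3)^n * (1 - (1/3)^k)" for n k
  proof (induction k)
    case (Suc k)
    have "hnorm H (s (n + Suc k) - s n) \<le> hnorm H (s (n + Suc k) - s (n + k)) + hnorm H (s (n + k) - s n)"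
      by (intro hnorm_triangle_diff sH)
    also have "\<dots> \<le> (1/3)^(n+k) + (3/2) * (1/3)^n * (1 - (1/3)^k)"
      using stepn[of "n+k"] Suc.IH unfolding add_Suc_right by linarith
    also have "\<dots> = (3/2) * (1/3)^n * (1 - (1/3)^Suc k)"
      by (simp add: power_add field_simps)
    finally show ?case .
  qed (simp flip: zero_fun_def)
  have tail': "hnorm H (s m - s n) \<le> (3/2) * (1/3)^n" if "m \<ge> n" for m n
  proof -
    have "(3/2) * (1/3)^n * (1 - (1/3)^(m-n)) \<le> (3/2) * (1/3::real)^n * 1"
      by (intro mult_left_mono) auto
    then show ?thesis
      using tail[of n "m - n"] unfolding le_add_diff_inverse[OF that] mult_1_right by linarith
  qed
  have "\<exists>N. \<forall>m\<ge>N. \<forall>n\<ge>N. hnorm H (s m - s n) < e" if e: "e > 0" for e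
  proof -
    obtain N where N: "(1/3::real)^N < e/3"
      using real_arch_pow_inv[of "e/3" "1/3"] e by auto
    have "hnorm H (s m - s n) < e" if "m \<ge> N" "n \<ge> N" for m n
    proof -
      have "hnorm H (s m - s n) \<le> hnorm H (s m - s N) + hnorm H (s n - s N)"
        using hnorm_triangle_diff[OF sH[of m] sH[of N] sH[of n]] hnorm_uminus_diff[OF sH[of N] sH[of n]] by simp
      also have "\<dots> \<le> 3 * (1/3)^N" using tail'[OF that(1)] tail'[OF that(2)] by simp
      finally show ?thesis using N by simp
    qed
    then show ?thesis by blast
  qed
  then obtain x where x: "x \<in> hcar H" "(\<lambda>n::nat. hnorm H (s n - x)) \<longlonglongrightarrow> 0"
    using complete[of s] sH by blast
  have dist: "hnorm H (s n - x) \<le> (3/2) * (1/3)^n" for n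
  proof -
    have "(\<lambda>m. (3/2) * (1/3)^n + hnorm H (s m - x)) \<longlonglongrightarrow> (3/2) * (1/3)^n + 0"
      by (intro tendsto_intros x)
    moreover have "hnorm H (s n - x) \<le> (3/2) * (1/3)^n + hnorm H (s m - x)" if "m \<ge> n" for m
      using hnorm_triangle_diff[OF sH[of n] sH[of m] x(1)] tail'[OF that] hnorm_uminus_diff[OF sH[of n] sH[of m]]
      by linarith
    ultimately show ?thesis
      using LIMSEQ_le_const[of _ "(3/2) * (1/3)^n + 0" "hnorm H (s n - x)"] by force
  qed
  obtain M where M: "\<And>n. cmod (hip H x (h n)) \<le> M"
    using ptw[OF x(1)] h(1) by blast
  \<comment> \<open>From index \<open>Suc n\<close> on, the series moves by at most
    \<open>(3/2) * (1/3) ^ Suc n = (1/2) * (1/3) ^ n\<close>, so half of the bound in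
    \<open>big\<close> survives in the limit.\<close>
  have le_M: "(1/2) * (4/3)^n \<le> M" for n
  proof -
    have "cmod (hip H (s (Suc n) - x) (h n)) \<le> (1/2) * (1/3)^n * hnorm H (h n)"
      using Cauchy_Schwarz[of "s (Suc n) - x" "h n"] mult_right_mono[OF dist[of "Suc n"], of "hnorm H (h n)"]
        sH x(1) hH by simp
    moreover have "cmod (hip H (s (Suc n)) (h n)) \<le> cmod (hip H (s (Suc n) - x) (h n)) + cmod (hip H x (h n))"
      using norm_triangle_ineq[of "hip H (s (Suc n) - x) (h n)" "hip H x (h n)"]
      by (simp add: hip_diff_left sH x(1) hH)
    ultimately have "(1/2) * (1/3)^n * hnorm H (h n) \<le> cmod (hip H x (h n))"
      using big[of n] by linarith
    moreover have "(1/2) * (1/3)^n * 4^n \<le> (1/2) * (1/3)^n * hnorm H (h n)"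
      using h(2)[of n] by (intro mult_left_mono) auto
    moreover have "(1/2) * (1/3)^n * 4^n = (1/2) * (4/3::real)^n"
      by (simp add: power_divide)
    ultimately show ?thesis using M[of n] by linarith
  qed
  obtain n where "(4/3::real)^n > 2 * M"
    using real_arch_pow[of "4/3" "2*M"] by auto
  then show False using le_M[of n] by linarith
qed

subsection \<open>Closed sums of closed subspaces\<close>

text \<open>With \<open>P w\<close> the projection onto \<open>F w\<close>, the sum \<open>Q\<close>
  of all \<open>P w\<close> is positive on \<open>S\<close>. If it is bounded below there, it is
  onto, and \<open>f = Q h\<close> yields the components \<open>P w h\<close>, which are bounded by
  the norm of \<open>h\<close> and thus by that of \<open>f\<close>.\<close>

theorem (in hilbert_fs) bounded_decomposition:
  fixes F :: "'w \<Rightarrow> ('x \<Rightarrow> complex) set"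
  assumes fin: "finite \<W>" and sub: "\<And>w. w \<in> \<W> \<Longrightarrow> hsub (F w)"
    and cl: "\<And>w. w \<in> \<W> \<Longrightarrow> hclosed H (F w)"
    and S_def: "S = {\<Sum>w\<in>\<W>. g w | g. \<forall>w\<in>\<W>. g w \<in> F w}" and S_cl: "hclosed H S"
  obtains C where "C \<ge> 0"
    "\<And>f. f \<in> S \<Longrightarrow> \<exists>g. (\<forall>w\<in>\<W>. g w \<in> F w \<and> hnorm H (g w) \<le> C * hnorm H f) \<and> f = (\<Sum>w\<in>\<W>. g w)"
proof -
  note FD = hsubD[OF sub]
  have FH: "f \<in> hcar H" if "w \<in> \<W>" "f \<in> F w" for w f using FD(1)[OF that(1)] that(2) by auto
  have S_sub: "hsub S"
    unfolding hsub_def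
  proof (intro conjI ballI allI)
    show "S \<subseteq> hcar H" using FH by (auto simp: S_def intro!: sum_mem)
    have "(\<Sum>w\<in>\<W>. 0) = (0 :: 'x \<Rightarrow> complex)" by (rule sum.neutral_const)
    then show "0 \<in> S" using FD(2) unfolding S_def by force
    show "f + g \<in> S" if "f \<in> S" "g \<in> S" for f g
    proof -
      obtain a b where ab: "\<forall>w\<in>\<W>. a w \<in> F w" "f = (\<Sum>w\<in>\<W>. a w)" "\<forall>w\<in>\<W>. b w \<in> F w" "g = (\<Sum>w\<in>\<W>. b w)"
        using \<open>f \<in> S\<close> \<open>g \<in> S\<close> unfolding S_def by blast
      then have "f + g = (\<Sum>w\<in>\<W>. a w + b w)" by (simp only: sum.distrib)
      then show ?thesis using ab FD(3) unfolding S_def by blast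
    qed
    show "fscale c f \<in> S" if "f \<in> S" for c f
    proof -
      obtain a where ab: "\<forall>w\<in>\<W>. a w \<in> F w" "f = (\<Sum>w\<in>\<W>. a w)"
        using \<open>f \<in> S\<close> unfolding S_def by blast
      have "fscale c (\<Sum>w\<in>A. a w) = (\<Sum>w\<in>A. fscale c (a w))" for A
        by (induction A rule: infinite_finite_induct) (auto simp: fscale_def fun_eq_iff algebra_simps)
      then show ?thesis using ab FD(4) unfolding S_def by blast
    qed
  qed
  note SD = hsubD[OF S_sub]
  have SH: "f \<in> hcar H" if "f \<in> S" for f using SD(1) that by auto
  \<comment> \<open>Closedness of \<open>S\<close> enters here: it makes \<open>S\<close> a Hilbert
    space, to which uniform boundedness, completeness and projection are applied below.\<close>
  interpret R: hilbert_fs X "H\<lparr>hcar := S\<rparr>"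
    by unfold_locales (rule restrict_hilbert[OF S_sub S_cl])
  have R_simps: "hcar (H\<lparr>hcar := S\<rparr>) = S" "hip (H\<lparr>hcar := S\<rparr>) = hip H" "hnorm (H\<lparr>hcar := S\<rparr>) = hnorm H"
    by (auto simp: hnorm_def fun_eq_iff)
  have "\<exists>g. g \<in> F w \<and> (\<forall>h\<in>F w. hip H (f - g) h = 0)" if "w \<in> \<W>" "f \<in> hcar H" for w f
    using projection[OF sub[OF that(1)] cl[OF that(1)] that(2)] by metis
  then obtain P where P: "\<And>w f. w \<in> \<W> \<Longrightarrow> f \<in> hcar H \<Longrightarrow> P w f \<in> F w"
    "\<And>w f h. w \<in> \<W> \<Longrightarrow> f \<in> hcar H \<Longrightarrow> h \<in> F w \<Longrightarrow> hip H (f - P w f) h = 0"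
    by metis
  have PH: "P w f \<in> hcar H" if "w \<in> \<W>" "f \<in> hcar H" for w f using FH P(1) that by blast
  have P_hip: "hip H f h = hip H (P w f) h" if "w \<in> \<W>" "f \<in> hcar H" "h \<in> F w" for w f h
    using P(2)[OF that] that PH FH by (simp add: hip_diff_left)
  have P_unique: "P w f = p" if w: "w \<in> \<W>" and f: "f \<in> hcar H" and p: "p \<in> F w" "\<And>h. h \<in> F w \<Longrightarrow> hip H f h = hip H p h" for w f p
  proof -
    have d: "P w f - p \<in> F w" using FD(5)[OF w P(1)[OF w f] p(1)] .
    have "hip H (P w f - p) (P w f - p) = 0"
      using p(2)[OF d] P_hip[OF w f d] FH[OF w d] PH[OF w f] FH[OF w p(1)] by (simp add: hip_diff_left)
    then have "P w f - p = 0" using hip_pos[OF FH[OF w d]] by force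
    then show ?thesis by simp
  qed
  have P_add: "P w (f + g) = P w f + P w g" if w: "w \<in> \<W>" and fg: "f \<in> hcar H" "g \<in> hcar H" for w f g
  proof (rule P_unique[OF w add_mem[OF fg] FD(3)[OF w P(1)[OF w fg(1)] P(1)[OF w fg(2)]]])
    show "hip H (f + g) h = hip H (P w f + P w g) h" if h: "h \<in> F w" for h
      using P_hip[OF w fg(1) h] P_hip[OF w fg(2) h] hip_add_left[OF fg FH[OF w h]]
        hip_add_left[OF PH[OF w fg(1)] PH[OF w fg(2)] FH[OF w h]] by (simp only:)
  qed
  have P_scale: "P w (fscale c f) = fscale c (P w f)" if w: "w \<in> \<W>" and f: "f \<in> hcar H" for w f c
  proof (rule P_unique[OF w scale_mem[OF f] FD(4)[OF w P(1)[OF w f]]])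
    show "hip H (fscale c f) h = hip H (fscale c (P w f)) h" if h: "h \<in> F w" for h
      using P_hip[OF w f h] hip_scale_left[OF f FH[OF w h]]
        hip_scale_left[OF PH[OF w f] FH[OF w h]] by (simp only:)
  qed
  have P_self: "hip H (P w f) f = complex_of_real ((hnorm H (P w f))\<^sup>2)" if "w \<in> \<W>" "f \<in> hcar H" for w f
  proof -
    have "hip H f (P w f) = hip H (P w f) (P w f)" by (intro P_hip P that)
    then have "hip H f (P w f) = complex_of_real ((hnorm H (P w f))\<^sup>2)"
      using hip_self[OF PH[OF that]] by (simp only:)
    then show ?thesis using hip_cnj[OF that(2) PH[OF that]] by (simp only: complex_cnj_complex_of_real)
  qed
  have P_norm: "hnorm H (P w f) \<le> hnorm H f" if "w \<in> \<W>" "f \<in> hcar H" for w f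
  proof (cases "hnorm H (P w f) = 0")
    case False
    have "(hnorm H (P w f))\<^sup>2 \<le> hnorm H (P w f) * hnorm H f"
      using Cauchy_Schwarz[OF PH[OF that] that(2)] unfolding P_self[OF that] norm_of_real by simp
    then show ?thesis using False hnorm_nonneg[OF PH[OF that]] by (simp add: power2_eq_square)
  qed (use that in simp)
  define N where "N f = (\<Sum>w\<in>\<W>. hnorm H (P w f))" for f
  have N_nonneg: "N f \<ge> 0" if "f \<in> hcar H" for f
    unfolding N_def using PH that by (intro sum_nonneg) auto
  \<comment> \<open>Splitting \<open>g\<close> into components \<open>a w\<close> turns the pairing
    with \<open>f\<close> into pairings of \<open>a w\<close> with \<open>P w f\<close>. The
    constant depends on the splitting of \<open>g\<close>, so the bound on the vectors
    \<open>f\<close> divided by \<open>N f\<close> is only pointwise so far.\<close>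
  have pair: "\<exists>M\<ge>0. \<forall>f\<in>hcar H. cmod (hip H g f) \<le> M * N f" if gS: "g \<in> S" for g
  proof -
    obtain a where a': "\<forall>w\<in>\<W>. a w \<in> F w" and a2: "g = (\<Sum>w\<in>\<W>. a w)"
      using gS unfolding S_def by blast
    have a: "\<And>w. w \<in> \<W> \<Longrightarrow> a w \<in> F w" "g = (\<Sum>w\<in>\<W>. a w)" using a' a2 by auto
    have aH: "a w \<in> hcar H" if "w \<in> \<W>" for w using FH a that by blast
    have "cmod (hip H g f) \<le> (\<Sum>w\<in>\<W>. hnorm H (a w)) * N f" if f: "f \<in> hcar H" for f
    proof -
      have "hip H g f = (\<Sum>w\<in>\<W>. hip H (a w) f)"
        unfolding a(2) by (rule hip_sum_left[OF aH f])
      also have "\<dots> = (\<Sum>w\<in>\<W>. hip H (a w) (P w f))"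
        using P_hip[OF _ f a(1)] hip_cnj[OF aH f] hip_cnj[OF aH PH[OF _ f]]
        by (intro sum.cong refl) (metis complex_cnj_cnj)
      also have "cmod \<dots> \<le> (\<Sum>w\<in>\<W>. hnorm H (a w) * hnorm H (P w f))"
        using Cauchy_Schwarz[OF aH PH[OF _ f]] by (intro sum_norm_le) auto
      also have "\<dots> \<le> (\<Sum>w\<in>\<W>. hnorm H (a w) * N f)"
        unfolding N_def using aH PH f fin by (intro sum_mono mult_left_mono member_le_sum) auto
      finally show ?thesis by (simp add: sum_distrib_right)
    qed
    then show ?thesis using aH by (intro exI[of _ "\<Sum>w\<in>\<W>. hnorm H (a w)"]) (auto intro: sum_nonneg)
  qed
  have N_zero: "f = 0" if "f \<in> S" "N f = 0" for f
  proof -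
    have "cmod (hip H f f) \<le> 0" using pair[OF that(1)] SH[OF that(1)] that(2) by force
    then show ?thesis using hip_pos[OF SH[OF that(1)]] by force
  qed
  \<comment> \<open>Uniform boundedness, applied to the vectors \<open>f\<close> divided by
    \<open>N f\<close>, makes the pointwise bounds uniform.\<close>
  obtain M where M: "M \<ge> 0" "\<And>f. f \<in> S \<Longrightarrow> hnorm H f \<le> M * N f"
  proof -
    define Fam where "Fam = (\<lambda>f. fscale (of_real (1 / N f)) f) ` (S - {0})"
    have Npos: "N f > 0" if "f \<in> S - {0}" for f
      using N_zero[of f] N_nonneg[OF SH] that by (metis DiffD1 DiffD2 insertI1 order_le_less)
    have "\<exists>M. \<forall>h\<in>Fam. hnorm H h \<le> M"
    proof (rule R.uniform_boundedness[unfolded R_simps])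
      show "Fam \<subseteq> S" using SD(4) by (auto simp: Fam_def)
      show "\<exists>M. \<forall>h\<in>Fam. cmod (hip H g h) \<le> M" if g: "g \<in> S" for g
      proof -
        obtain M where M: "M \<ge> 0" "\<And>f. f \<in> hcar H \<Longrightarrow> cmod (hip H g f) \<le> M * N f"
          using pair[OF g] by blast
        have "cmod (hip H g (fscale (of_real (1 / N f)) f)) \<le> M" if f: "f \<in> S - {0}" for f
        proof -
          have "cmod (hip H g (fscale (of_real (1 / N f)) f)) = cmod (hip H g f) / N f"
            using Npos[OF f] SH f g by (simp add: hip_scale_right norm_mult norm_divide)
          also have "\<dots> \<le> M" using M(2)[OF SH, of f] f Npos[OF f] by (simp add: pos_divide_le_eq)
          finally show ?thesis .
        qed
        then show ?thesis unfolding Fam_def by blast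
      qed
    qed
    then obtain M where M: "\<And>f. f \<in> S - {0} \<Longrightarrow> hnorm H (fscale (of_real (1 / N f)) f) \<le> M"
      unfolding Fam_def by blast
    have "hnorm H f \<le> max M 0 * N f" if f: "f \<in> S" for f
    proof (cases "f = 0")
      case False
      then have f': "f \<in> S - {0}" using f by blast
      have "hnorm H f / N f \<le> M"
        using M[OF f'] Npos[OF f'] SH[OF f] by (simp add: hnorm_scale norm_divide)
      then have "hnorm H f \<le> M * N f" using Npos[OF f'] by (simp add: pos_divide_le_eq)
      also have "\<dots> \<le> max M 0 * N f" using N_nonneg[OF SH[OF f]] by (intro mult_right_mono) auto
      finally show ?thesis .
    qed (use N_nonneg[OF zero_mem] in simp)
    then show ?thesis using that[of "max M 0"] by simp
  qed
  define r where "r = real (card \<W>)"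
  define Q where "Q f = (\<Sum>w\<in>\<W>. P w f)" for f
  have QS: "Q f \<in> S" if "f \<in> hcar H" for f
    using P(1)[OF _ that] unfolding Q_def S_def by blast
  have Q_add: "Q (f + g) = Q f + Q g" if "f \<in> hcar H" "g \<in> hcar H" for f g
  proof -
    have "Q (f + g) = (\<Sum>w\<in>\<W>. P w f + P w g)"
      unfolding Q_def by (intro sum.cong refl P_add that)
    then show ?thesis unfolding Q_def by (simp only: sum.distrib)
  qed
  have Q_scale: "Q (fscale c f) = fscale c (Q f)" if "f \<in> hcar H" for c f
  proof -
    have s: "fscale c (\<Sum>w\<in>A. P w f) = (\<Sum>w\<in>A. fscale c (P w f))" for A
      by (induction A rule: infinite_finite_induct) (auto simp: fscale_def fun_eq_iff algebra_simps)
    show ?thesis unfolding Q_def s by (intro sum.cong refl P_scale that)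
  qed
  have Q_diff: "Q (f - g) = Q f - Q g" if "f \<in> hcar H" "g \<in> hcar H" for f g
    unfolding diff_eq by (simp only: Q_add Q_scale that scale_mem)
  have Q_hip: "Re (hip H (Q f) f) = (\<Sum>w\<in>\<W>. (hnorm H (P w f))\<^sup>2)" if "f \<in> hcar H" for f
  proof -
    have "hip H (Q f) f = (\<Sum>w\<in>\<W>. hip H (P w f) f)"
      unfolding Q_def by (intro hip_sum_left PH that)
    also have "\<dots> = (\<Sum>w\<in>\<W>. complex_of_real ((hnorm H (P w f))\<^sup>2))"
      by (intro sum.cong refl P_self that)
    finally show ?thesis by (simp del: of_real_power)
  qed
  \<comment> \<open>The constant comes from \<open>hnorm H f \<le> M * N f\<close> and
    \<open>N f \<le> r * sqrt q\<close>, with \<open>q\<close> the product of the norms of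
    \<open>Q f\<close> and \<open>f\<close>: squaring and cancelling one factor
    \<open>hnorm H f\<close> leaves \<open>(M * r)\<^sup>2\<close>.\<close>
  define \<kappa> where "\<kappa> = (M * r)\<^sup>2"
  have lower: "hnorm H f \<le> \<kappa> * hnorm H (Q f)" if f: "f \<in> S" for f
  proof (cases "f = 0")
    case True
    then show ?thesis using SH[OF QS[OF SH[OF f]]] by (simp add: \<kappa>_def)
  next
    case False
    note fH = SH[OF f]
    have pos: "hnorm H f > 0"
      using hnorm_eq_0[OF fH] hnorm_nonneg[OF fH] False by linarith
    define q where "q = hnorm H (Q f) * hnorm H f"
    have q0: "q \<ge> 0" using QS[OF fH] SH fH by (simp add: q_def)
    have "hnorm H (P w f) \<le> sqrt q" if w: "w \<in> \<W>" for w
    proof -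
      have "(hnorm H (P w f))\<^sup>2 \<le> (\<Sum>w\<in>\<W>. (hnorm H (P w f))\<^sup>2)"
        using fin w by (intro member_le_sum) auto
      also have "\<dots> \<le> cmod (hip H (Q f) f)" using complex_Re_le_cmod Q_hip[OF fH] by metis
      also have "\<dots> \<le> q" unfolding q_def by (intro Cauchy_Schwarz SH QS fH)
      finally show ?thesis by (rule real_le_rsqrt)
    qed
    then have "N f \<le> r * sqrt q"
      unfolding N_def r_def using sum_bounded_above[of \<W> "\<lambda>w. hnorm H (P w f)" "sqrt q"] by simp
    then have "hnorm H f \<le> M * (r * sqrt q)"
      using M(2)[OF f] M(1) by (meson mult_left_mono order_trans)
    then have "(hnorm H f)\<^sup>2 \<le> (M * (r * sqrt q))\<^sup>2"
      using fH by (intro power_mono) auto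
    also have "\<dots> = \<kappa> * q" using q0 by (simp add: \<kappa>_def power_mult_distrib)
    finally have "hnorm H f * hnorm H f \<le> (\<kappa> * hnorm H (Q f)) * hnorm H f"
      by (simp add: q_def power2_eq_square mult_ac)
    then show ?thesis using pos by simp
  qed
  have Q_norm: "hnorm H (Q f) \<le> r * hnorm H f" if "f \<in> hcar H" for f
  proof -
    have "hnorm H (Q f) \<le> (\<Sum>w\<in>\<W>. hnorm H (P w f))"
      unfolding Q_def by (intro hnorm_sum_le PH that)
    also have "\<dots> \<le> r * hnorm H f"
      unfolding r_def using sum_bounded_above[of \<W> "\<lambda>w. hnorm H (P w f)"] P_norm that by simp
    finally show ?thesis .
  qed
  define RQ where "RQ = Q ` S"
  have RQ_sub: "R.hsub RQ"
    unfolding R.hsub_def R_simps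
  proof (intro conjI ballI allI)
    show "RQ \<subseteq> S" using QS SH by (auto simp: RQ_def)
    show "0 \<in> RQ" unfolding RQ_def using Q_scale[OF zero_mem, of 0] SD(2) by (simp add: image_iff) (metis fscale_0(1))
    show "f + g \<in> RQ" if "f \<in> RQ" "g \<in> RQ" for f g
      using that SD(3) Q_add SH unfolding RQ_def by (auto simp del: plus_fun_apply) (metis imageI)
    show "fscale c f \<in> RQ" if "f \<in> RQ" for c f
      using that SD(4) Q_scale SH unfolding RQ_def by auto (metis imageI)
  qed
  \<comment> \<open>An operator bounded below has closed range, as Cauchy images have Cauchy
    preimages.\<close>
  have RQ_cl: "hclosed (H\<lparr>hcar := S\<rparr>) RQ"
    unfolding hclosed_def R_simps
  proof (intro allI impI, elim conjE)
    fix t :: "nat \<Rightarrow> 'x \<Rightarrow> complex" and g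
    assume "\<forall>n. t n \<in> RQ" and g: "g \<in> S" and l: "(\<lambda>n. hnorm H (t n - g)) \<longlonglongrightarrow> 0"
    then have "\<forall>n. \<exists>s\<in>S. t n = Q s" by (auto simp: RQ_def)
    then obtain s where s: "\<And>n. s n \<in> S" "\<And>n. t n = Q (s n)" by metis
    have tH: "t n \<in> hcar H" for n using s QS SH by metis
    have "\<exists>N. \<forall>m\<ge>N. \<forall>n\<ge>N. hnorm H (s m - s n) < e" if e: "e > 0" for e
    proof -
      have k: "\<kappa> + 1 > 0" by (simp add: \<kappa>_def add_nonneg_pos)
      then have "e / (\<kappa> + 1) > 0" using e by simp
      from lim_Cauchy[OF tH SH[OF g] l this] obtain N
        where N: "\<And>m n. m \<ge> N \<Longrightarrow> n \<ge> N \<Longrightarrow> hnorm H (t m - t n) < e / (\<kappa> + 1)" by blast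
      have "hnorm H (s m - s n) < e" if "m \<ge> N" "n \<ge> N" for m n
      proof -
        have "hnorm H (s m - s n) \<le> \<kappa> * hnorm H (t m - t n)"
          using lower[OF SD(5)[OF s(1) s(1)]] unfolding Q_diff[OF SH[OF s(1)] SH[OF s(1)]] s(2) .
        also have "\<dots> \<le> (\<kappa> + 1) * hnorm H (t m - t n)"
          using tH by (intro mult_right_mono) auto
        also have "\<dots> < e" using N[OF that] k by (simp only: pos_less_divide_eq mult.commute)
        finally show ?thesis .
      qed
      then show ?thesis by blast
    qed
    then obtain f where f: "f \<in> S" "(\<lambda>n::nat. hnorm H (s n - f)) \<longlonglongrightarrow> 0"
      using R.complete[unfolded R_simps, of s] s(1) by blast
    have "norm (hnorm H (t n - Q f)) \<le> r * hnorm H (s n - f)" for n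
    proof -
      have "t n - Q f = Q (s n - f)" using Q_diff[OF SH[OF s(1)] SH[OF f(1)]] s(2) by simp
      moreover have "s n - f \<in> hcar H" using SD(5)[OF s(1) f(1)] SH by blast
      ultimately show ?thesis using Q_norm SH[OF QS] by simp
    qed
    then have "(\<lambda>n. hnorm H (t n - Q f)) \<longlonglongrightarrow> 0"
      by (intro Lim_null_comparison[OF always_eventually[OF allI] tendsto_mult_right_zero[OF f(2)]])
    then have "g = Q f"
      by (rule lim_unique[OF tH SH[OF g] SH[OF QS[OF SH[OF f(1)]]] l])
    then show "g \<in> RQ" using f(1) by (auto simp: RQ_def)
  qed
  \<comment> \<open>A vector \<open>u\<close> of \<open>S\<close> orthogonal to the range satisfies
    \<open>hip H u (Q u) = 0\<close>, so every \<open>P w u\<close> vanishes, and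
    \<open>u = 0\<close> by \<open>N_zero\<close>.\<close>
  have onto: "\<exists>h\<in>S. f = Q h" if f: "f \<in> S" for f
  proof -
    obtain g where g: "g \<in> RQ" "\<And>h. h \<in> RQ \<Longrightarrow> hip H (f - g) h = 0"
      using R.projection[OF RQ_sub RQ_cl, unfolded R_simps, OF f] by blast
    obtain h where h: "h \<in> S" "g = Q h" using g(1) by (auto simp: RQ_def)
    define u where "u = f - g"
    have u: "u \<in> S" using SD(5)[OF f QS[OF SH[OF h(1)]]] h(2) by (simp add: u_def)
    have "hip H u (Q u) = 0" using g(2)[of "Q u"] u by (simp add: u_def RQ_def)
    then have "hip H (Q u) u = 0" using hip_cnj[OF SH[OF u] SH[OF QS[OF SH[OF u]]]] by simp
    then have "(\<Sum>w\<in>\<W>. (hnorm H (P w u))\<^sup>2) = 0" using Q_hip[OF SH[OF u]] by simp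
    then have "N u = 0" using fin by (auto simp: N_def sum_nonneg_eq_0_iff)
    then have "u = 0" using N_zero u by blast
    then show ?thesis using h by (auto simp: u_def)
  qed
  show ?thesis
  proof (rule that[of \<kappa>])
    show "\<kappa> \<ge> 0" by (simp add: \<kappa>_def)
    show "\<exists>g. (\<forall>w\<in>\<W>. g w \<in> F w \<and> hnorm H (g w) \<le> \<kappa> * hnorm H f) \<and> f = (\<Sum>w\<in>\<W>. g w)" if f: "f \<in> S" for f
    proof -
      obtain h where h: "h \<in> S" "f = Q h" using onto[OF f] by blast
      have c: "P w h \<in> F w \<and> hnorm H (P w h) \<le> \<kappa> * hnorm H f" if "w \<in> \<W>" for w
        using P(1)[OF that SH[OF h(1)]] P_norm[OF that SH[OF h(1)]] lower[OF h(1)] h(2) by auto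
      show ?thesis
        using c h(2)[unfolded Q_def] by (intro exI[of _ "\<lambda>w. P w h"] conjI ballI) fast+
    qed
  qed
qed

subsection \<open>Bounded operators\<close>

locale hilbert_fs_pair = H: hilbert_fs X H + K: hilbert_fs Y K
  for X :: "'x set" and H and Y :: "'y set" and K
begin

lemma bounded_opsD:
  assumes "T \<in> bounded_ops H K"
  shows bops_mem: "\<And>f. f \<in> hcar H \<Longrightarrow> T f \<in> hcar K"
    and bops_add: "\<And>f g. f \<in> hcar H \<Longrightarrow> g \<in> hcar H \<Longrightarrow> T (f + g) = T f + T g"
    and bops_scale: "\<And>c f. f \<in> hcar H \<Longrightarrow> T (fscale c f) = fscale c (T f)"
    and bops_undef: "\<And>f. f \<notin> hcar H \<Longrightarrow> T f = undefined"
  using assms unfolding bounded_ops_def by (auto simp: PiE_def extensional_def)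

lemma bops_diff:
  assumes "T \<in> bounded_ops H K" "f \<in> hcar H" "g \<in> hcar H"
  shows "T (f - g) = T f - T g"
  using bops_add[OF assms(1,2), of "fscale (- 1) g"] bops_scale[OF assms(1,3), of "- 1"] assms(3)
  by (metis H.diff_eq H.scale_mem K.diff_eq)

lemma bops_zero:
  assumes "T \<in> bounded_ops H K" shows "T 0 = 0"
  using bops_scale[OF assms H.zero_mem, of 0] by simp

lemma bops_sum:
  assumes T: "T \<in> bounded_ops H K" and "\<And>i. i \<in> A \<Longrightarrow> f i \<in> hcar H"
  shows "T (sum f A) = (\<Sum>i\<in>A. T (f i))"
  using assms(2)
proof (induction A rule: infinite_finite_induct)
  case (insert x F)
  have "T (f x + sum f F) = T (f x) + T (sum f F)"
    by (intro bops_add[OF T] H.sum_mem insert.prems) auto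
  moreover have "T (sum f F) = (\<Sum>i\<in>F. T (f i))"
    by (rule insert.IH) (use insert.prems in auto)
  ultimately show ?case
    unfolding sum.insert[OF insert.hyps] by metis
qed (use bops_zero[OF T] in auto)

lemma bops_bound:
  assumes "T \<in> bounded_ops H K"
  obtains b where "b \<ge> 0" "\<And>f. f \<in> hcar H \<Longrightarrow> hnorm K (T f) \<le> b * hnorm H f"
proof -
  obtain b where b: "\<forall>f\<in>hcar H. hnorm K (T f) \<le> b * hnorm H f"
    using assms unfolding bounded_ops_def by blast
  show ?thesis
  proof (rule that[of "max b 0"])
    show "hnorm K (T f) \<le> max b 0 * hnorm H f" if f: "f \<in> hcar H" for f
    proof -
      have "b * hnorm H f \<le> max b 0 * hnorm H f"
        using f by (intro mult_right_mono) auto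
      then show ?thesis using b f by force
    qed
  qed auto
qed

lemma bops_eqI:
  assumes "S \<in> bounded_ops H K" "T \<in> bounded_ops H K" "\<And>f. f \<in> hcar H \<Longrightarrow> S f = T f"
  shows "S = T"
  using assms bops_undef by (metis ext)

lemma bopsI:
  assumes "\<And>f. f \<in> hcar H \<Longrightarrow> T f \<in> hcar K"
    and "\<And>f g. f \<in> hcar H \<Longrightarrow> g \<in> hcar H \<Longrightarrow> T (f + g) = T f + T g"
    and "\<And>c f. f \<in> hcar H \<Longrightarrow> T (fscale c f) = fscale c (T f)"
    and "\<And>f. f \<notin> hcar H \<Longrightarrow> T f = undefined"
    and "\<And>f. f \<in> hcar H \<Longrightarrow> hnorm K (T f) \<le> b * hnorm H f"
  shows "T \<in> bounded_ops H K"
proof -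
  have "\<exists>b. \<forall>f\<in>hcar H. hnorm K (T f) \<le> b * hnorm H f" using assms(5) by blast
  then show ?thesis
    using assms(1-4) unfolding bounded_ops_def by (auto simp: PiE_def extensional_def)
qed

lemma bops_lim:
  assumes T: "T \<in> bounded_ops H K" and s: "\<And>n. s n \<in> hcar H" and f: "f \<in> hcar H"
    and l: "(\<lambda>n::nat. hnorm H (s n - f)) \<longlonglongrightarrow> 0"
  shows "(\<lambda>n. hnorm K (T (s n) - T f)) \<longlonglongrightarrow> 0"
proof -
  obtain b where b: "\<And>f. f \<in> hcar H \<Longrightarrow> hnorm K (T f) \<le> b * hnorm H f"
    using bops_bound[OF T] by blast
  have "norm (hnorm K (T (s n) - T f)) \<le> b * hnorm H (s n - f)" for n
    using b[of "s n - f"] s f bops_mem[OF T] by (simp add: bops_diff[OF T])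
  then show ?thesis
    by (intro Lim_null_comparison[OF always_eventually[OF allI] tendsto_mult_right_zero[OF l]])
qed

text \<open>For fixed \<open>g\<close>, pairing \<open>T h\<close> with \<open>g\<close> is a
  bounded functional of \<open>h\<close>, so Riesz supplies the vector named by the definite
  description in \<open>hadjoint\<close>. Linearity follows from its uniqueness, the norm bound from
  pairing it with itself.\<close>

theorem adjoint:
  assumes T: "T \<in> bounded_ops H K"
  shows hadjoint_bops: "hadjoint H K T \<in> bounded_ops K H"
    and hadjoint_hip: "\<And>f g. f \<in> hcar H \<Longrightarrow> g \<in> hcar K \<Longrightarrow> hip K (T f) g = hip H f (hadjoint H K T g)"
proof -
  obtain b where b0: "b \<ge> 0" and b: "\<And>f. f \<in> hcar H \<Longrightarrow> hnorm K (T f) \<le> b * hnorm H f"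
    using bops_bound[OF T] by blast
  have ex: "\<exists>f. f \<in> hcar H \<and> (\<forall>h\<in>hcar H. hip K (T h) g = hip H h f)" if g: "g \<in> hcar K" for g
  proof (rule H.Riesz[of "\<lambda>h. hip K (T h) g" "b * hnorm K g"])
    show "cmod (hip K (T f) g) \<le> b * hnorm K g * hnorm H f" if f: "f \<in> hcar H" for f
    proof -
      have "cmod (hip K (T f) g) \<le> hnorm K (T f) * hnorm K g"
        using g bops_mem[OF T f] by (intro K.Cauchy_Schwarz)
      also have "\<dots> \<le> b * hnorm H f * hnorm K g"
        using b[OF f] g by (intro mult_right_mono) auto
      finally show ?thesis by (simp add: mult_ac)
    qed
    show "hip K (T (f + h)) g = hip K (T f) g + hip K (T h) g" if "f \<in> hcar H" "h \<in> hcar H" for f h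
      using that g bops_mem[OF T] by (subst bops_add[OF T]) (auto intro: K.hip_add_left)
    show "hip K (T (fscale c f)) g = c * hip K (T f) g" if "f \<in> hcar H" for c f
      using that g bops_mem[OF T] by (subst bops_scale[OF T]) (auto intro: K.hip_scale_left)
  qed blast
  have unique: "f = f'" if "f \<in> hcar H" "f' \<in> hcar H" "\<forall>h\<in>hcar H. hip H h f = hip H h f'" for f f'
  proof -
    have "hip H (f - f') (f - f') = 0"
      using that H.diff_mem[OF that(1,2)] by (subst H.hip_diff_right) auto
    then show ?thesis
      using H.hnorm_eq_0[of "f - f'"] that H.hnorm_sq[of "f - f'"] by simp
  qed
  have the: "hadjoint H K T g \<in> hcar H \<and> (\<forall>h\<in>hcar H. hip K (T h) g = hip H h (hadjoint H K T g))"
    if g: "g \<in> hcar K" for g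
  proof -
    have ex1: "\<exists>!f. f \<in> hcar H \<and> (\<forall>h\<in>hcar H. hip K (T h) g = hip H h f)"
      using ex[OF g] unique by (metis (no_types, lifting))
    have eq: "hadjoint H K T g = (THE f. f \<in> hcar H \<and> (\<forall>h\<in>hcar H. hip K (T h) g = hip H h f))"
      using g by (simp only: hadjoint_def restrict_apply')
    show ?thesis unfolding eq by (rule theI'[OF ex1])
  qed
  then show hip: "\<And>f g. f \<in> hcar H \<Longrightarrow> g \<in> hcar K \<Longrightarrow> hip K (T f) g = hip H f (hadjoint H K T g)"
    by blast
  have mem: "\<And>g. g \<in> hcar K \<Longrightarrow> hadjoint H K T g \<in> hcar H" using the by blast
  show "hadjoint H K T \<in> bounded_ops K H"
  proof -
    interpret KH: hilbert_fs_pair Y K X H by unfold_locales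
    show ?thesis
    proof (rule KH.bopsI)
      show "hadjoint H K T (f + g) = hadjoint H K T f + hadjoint H K T g"
        if "f \<in> hcar K" "g \<in> hcar K" for f g
      proof (rule unique)
        show "\<forall>h\<in>hcar H. hip H h (hadjoint H K T (f + g)) = hip H h (hadjoint H K T f + hadjoint H K T g)"
        proof
          fix h assume h: "h \<in> hcar H"
          show "hip H h (hadjoint H K T (f + g)) = hip H h (hadjoint H K T f + hadjoint H K T g)"
            using hip[OF h that(1)] hip[OF h that(2)] hip[OF h K.add_mem[OF that]]
              K.hip_add_right[OF that bops_mem[OF T h]] H.hip_add_right[OF mem[OF that(1)] mem[OF that(2)] h]
            by (simp only:)
        qed
      qed (use mem that in blast)+
      show "hadjoint H K T (fscale c f) = fscale c (hadjoint H K T f)" if "f \<in> hcar K" for c f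
      proof (rule unique)
        show "\<forall>h\<in>hcar H. hip H h (hadjoint H K T (fscale c f)) = hip H h (fscale c (hadjoint H K T f))"
        proof
          fix h assume h: "h \<in> hcar H"
          show "hip H h (hadjoint H K T (fscale c f)) = hip H h (fscale c (hadjoint H K T f))"
            using hip[OF h that] hip[OF h K.scale_mem[OF that]]
              K.hip_scale_right[OF that bops_mem[OF T h]] H.hip_scale_right[OF mem[OF that] h]
            by (simp only:)
        qed
      qed (use mem that in blast)+
      show "hnorm H (hadjoint H K T g) \<le> b * hnorm K g" if g: "g \<in> hcar K" for g
      proof (cases "hnorm H (hadjoint H K T g) = 0")
        case True
        then show ?thesis using b0 g by simp
      next
        case False
        define f where "f = hadjoint H K T g"
        have f: "f \<in> hcar H" using mem[OF g] by (simp add: f_def)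
        then have pos: "hnorm H f > 0"
          using False[folded f_def] H.hnorm_nonneg[OF f] by linarith
        have "hip H f f = hip K (T f) g" using hip[OF f g] by (simp add: f_def)
        then have "(hnorm H f)\<^sup>2 \<le> cmod (hip K (T f) g)"
          using H.hip_self[OF f] by (metis norm_of_real abs_ge_self)
        also have "\<dots> \<le> hnorm K (T f) * hnorm K g"
          using g bops_mem[OF T f] by (intro K.Cauchy_Schwarz)
        also have "\<dots> \<le> b * hnorm H f * hnorm K g"
          using b[OF f] g by (intro mult_right_mono) auto
        finally have "hnorm H f * hnorm H f \<le> (b * hnorm K g) * hnorm H f"
          by (simp add: power2_eq_square mult_ac)
        then show ?thesis using pos by (simp add: f_def)
      qed
    qed (use mem in \<open>auto simp: hadjoint_def\<close>)
  qed
qed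

end

text \<open>A relation and not a map, because the functions \<open>k i\<close> may be linearly
  dependent: whether sending \<open>k i\<close> to \<open>k' i\<close> extends linearly to the span
  is not known beforehand, and single-valuedness is a consequence of a norm bound on the
  pairs.\<close>

inductive_set linear_graph ::
  "'i set \<Rightarrow> ('i \<Rightarrow> 'x \<Rightarrow> complex) \<Rightarrow> ('i \<Rightarrow> 'y \<Rightarrow> complex) \<Rightarrow> (('x \<Rightarrow> complex) \<times> ('y \<Rightarrow> complex)) set"
  for L k k' where
  zero: "(0, 0) \<in> linear_graph L k k'"
| step: "(u, v) \<in> linear_graph L k k' \<Longrightarrow> i \<in> L \<Longrightarrow>
    (u + fscale c (k i), v + fscale c (k' i)) \<in> linear_graph L k k'"

lemma linear_graph_add:
  assumes "(u, v) \<in> linear_graph L k k'" "(u', v') \<in> linear_graph L k k'"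
  shows "(u + u', v + v') \<in> linear_graph L k k'"
  using assms(2,1)
proof induction
  case (step u' v' i c)
  then show ?case
    using linear_graph.step[of "u + u'" "v + v'" L k k' i c] by (simp only: add.assoc)
qed (simp only: add_0_right)

lemma linear_graph_scale:
  assumes "(u, v) \<in> linear_graph L k k'"
  shows "(fscale d u, fscale d v) \<in> linear_graph L k k'"
  using assms
proof induction
  case zero
  have z: "fscale d 0 = (0 :: 'z \<Rightarrow> complex)"
    by (auto simp: fscale_def fun_eq_iff)
  show ?case unfolding z by (rule linear_graph.zero)
next
  case (step u v i c)
  have "fscale d (u + fscale c (k i)) = fscale d u + fscale (d * c) (k i)"
    "fscale d (v + fscale c (k' i)) = fscale d v + fscale (d * c) (k' i)"
    by (auto simp: fscale_def fun_eq_iff algebra_simps)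
  then show ?case using linear_graph.step[OF step.IH step.hyps(2), of "d * c"] by metis
qed

lemma linear_graph_generator: "i \<in> L \<Longrightarrow> (k i, k' i) \<in> linear_graph L k k'"
proof -
  have "0 + fscale 1 f = f" for f :: "'z \<Rightarrow> complex"
    by (auto simp: fscale_def fun_eq_iff)
  then show "i \<in> L \<Longrightarrow> (k i, k' i) \<in> linear_graph L k k'"
    using linear_graph.step[OF linear_graph.zero, where c = 1] by metis
qed

context hilbert_fs_pair
begin

lemma linear_graph_mem:
  assumes k: "\<And>i. i \<in> L \<Longrightarrow> k i \<in> hcar H" "\<And>i. i \<in> L \<Longrightarrow> k' i \<in> hcar K"
    and "(u, v) \<in> linear_graph L k k'"
  shows "u \<in> hcar H" "v \<in> hcar K"
  using assms(3) by (induction) (auto simp: k)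

text \<open>The bound does double duty: it makes the second components converge when the first ones
  do, and, applied to differences of pairs, it makes the limit independent of the approximating
  sequence.\<close>

theorem extension_by_density:
  assumes k: "\<And>i. i \<in> L \<Longrightarrow> k i \<in> hcar H" and k': "\<And>i. i \<in> L \<Longrightarrow> k' i \<in> hcar K"
    and total: "\<And>f. f \<in> hcar H \<Longrightarrow> (\<And>i. i \<in> L \<Longrightarrow> hip H f (k i) = 0) \<Longrightarrow> f = 0"
    and bound: "\<And>u v. (u, v) \<in> linear_graph L k k' \<Longrightarrow> hnorm K v \<le> C * hnorm H u"
  obtains T where "T \<in> bounded_ops H K" "\<And>i. i \<in> L \<Longrightarrow> T (k i) = k' i"
    "\<And>f. f \<in> hcar H \<Longrightarrow> hnorm K (T f) \<le> C * hnorm H f"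
proof -
  let ?G = "linear_graph L k k'"
  note mem = linear_graph_mem[OF k k']
  have sub: "H.hsub (fst ` ?G)"
    unfolding H.hsub_def
  proof (intro conjI ballI allI)
    show "fst ` ?G \<subseteq> hcar H" using mem(1) by force
    show "0 \<in> fst ` ?G" using linear_graph.zero[of L k k'] by force
    show "f + g \<in> fst ` ?G" if fg: "f \<in> fst ` ?G" "g \<in> fst ` ?G" for f g
    proof -
      obtain f' g' where "(f, f') \<in> ?G" "(g, g') \<in> ?G" using fg by auto
      then have "(f + g, f' + g') \<in> ?G" by (rule linear_graph_add)
      then show ?thesis by (metis fst_conv image_eqI)
    qed
    show "fscale c f \<in> fst ` ?G" if "f \<in> fst ` ?G" for c f
      using that linear_graph_scale by (metis (no_types, lifting) fst_conv image_iff prod.collapse)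
  qed
  define lim where "lim f g \<longleftrightarrow> g \<in> hcar K \<and> (\<exists>s t. (\<forall>n::nat. (s n, t n) \<in> ?G)
      \<and> (\<lambda>n. hnorm H (s n - f)) \<longlonglongrightarrow> 0 \<and> (\<lambda>n. hnorm K (t n - g)) \<longlonglongrightarrow> 0)" for f g
  have Gdiff: "(u - u', v - v') \<in> ?G" if "(u, v) \<in> ?G" "(u', v') \<in> ?G" for u v u' v'
    using linear_graph_add[OF that(1) linear_graph_scale[OF that(2), of "- 1"]]
    by (simp only: H.diff_eq K.diff_eq)
  have lim_ex: "\<exists>g. lim f g" if f: "f \<in> hcar H" for f
  proof -
    obtain s where s: "\<And>n. s n \<in> fst ` ?G" "(\<lambda>n::nat. hnorm H (s n - f)) \<longlonglongrightarrow> 0"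
    proof (rule H.dense_if_total[OF sub _ f])
      show "h = 0" if "h \<in> hcar H" "\<And>s. s \<in> fst ` ?G \<Longrightarrow> hip H h s = 0" for h
      proof (rule total[OF that(1)])
        show "hip H h (k i) = 0" if "i \<in> L" for i
          using that linear_graph_generator[OF that, of k k'] by (intro \<open>\<And>s. s \<in> fst ` ?G \<Longrightarrow> hip H h s = 0\<close>) force
      qed
    qed blast
    then have "\<forall>n. \<exists>t. (s n, t) \<in> ?G" by fastforce
    then obtain t where st: "\<And>n. (s n, t n) \<in> ?G" by metis
    note m = mem(1)[OF _ _ st] mem(2)[OF _ _ st]
    have "\<exists>N. \<forall>m\<ge>N. \<forall>n\<ge>N. hnorm K (t m - t n) < e" if e: "e > 0" for e
    proof -
      have C: "\<bar>C\<bar> + 1 > 0" by simp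
      then have "e / (\<bar>C\<bar> + 1) > 0" using e by simp
      from H.lim_Cauchy[OF m(1) f s(2) this] obtain N
        where N: "\<And>m n. m \<ge> N \<Longrightarrow> n \<ge> N \<Longrightarrow> hnorm H (s m - s n) < e / (\<bar>C\<bar> + 1)" by blast
      have "hnorm K (t m - t n) < e" if "m \<ge> N" "n \<ge> N" for m n
      proof -
        have "hnorm K (t m - t n) \<le> C * hnorm H (s m - s n)"
          by (rule bound[OF Gdiff[OF st st]])
        also have "\<dots> \<le> (\<bar>C\<bar> + 1) * hnorm H (s m - s n)"
          using m(1) by (intro mult_right_mono) auto
        also have "\<dots> < e" using N[OF that] C by (simp only: pos_less_divide_eq mult.commute)
        finally show ?thesis .
      qed
      then show ?thesis by blast
    qed
    then obtain g where "g \<in> hcar K" "(\<lambda>n::nat. hnorm K (t n - g)) \<longlonglongrightarrow> 0"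
      using K.complete[of t] m(2) by blast
    then show ?thesis using s(2) st unfolding lim_def by blast
  qed
  have lim_bound: "hnorm K g \<le> C * hnorm H f" if f: "f \<in> hcar H" "lim f g" for f g
  proof -
    obtain s t where st: "\<And>n. (s n, t n) \<in> ?G" "(\<lambda>n. hnorm H (s n - f)) \<longlonglongrightarrow> 0"
      "(\<lambda>n. hnorm K (t n - g)) \<longlonglongrightarrow> 0" "g \<in> hcar K"
      using f(2) unfolding lim_def by blast
    note m = mem(1)[OF _ _ st(1)] mem(2)[OF _ _ st(1)]
    have "(\<lambda>n. hnorm K (t n)) \<longlonglongrightarrow> hnorm K g"
      by (rule K.lim_hnorm[OF m(2) st(4) st(3)])
    moreover have "(\<lambda>n. C * hnorm H (s n)) \<longlonglongrightarrow> C * hnorm H f"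
      by (intro tendsto_intros H.lim_hnorm[OF m(1) that(1) st(2)])
    ultimately show ?thesis
      by (rule LIMSEQ_le) (use bound st(1) in blast)
  qed
  have lim_add: "lim (f + f') (g + g')" if f: "f \<in> hcar H" "f' \<in> hcar H" "lim f g" "lim f' g'" for f f' g g'
  proof -
    obtain s t where st: "\<And>n. (s n, t n) \<in> ?G" "(\<lambda>n. hnorm H (s n - f)) \<longlonglongrightarrow> 0"
      "(\<lambda>n. hnorm K (t n - g)) \<longlonglongrightarrow> 0" "g \<in> hcar K"
      using f(3) unfolding lim_def by blast
    obtain s' t' where st': "\<And>n. (s' n, t' n) \<in> ?G" "(\<lambda>n. hnorm H (s' n - f')) \<longlonglongrightarrow> 0"
      "(\<lambda>n. hnorm K (t' n - g')) \<longlonglongrightarrow> 0" "g' \<in> hcar K"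
      using f(4) unfolding lim_def by blast
    note m = mem(1)[OF _ _ st(1)] mem(2)[OF _ _ st(1)] mem(1)[OF _ _ st'(1)] mem(2)[OF _ _ st'(1)]
    have "(\<lambda>n. hnorm H ((s n + s' n) - (f + f'))) \<longlonglongrightarrow> 0"
    proof (rule Lim_null_comparison[OF always_eventually[OF allI]])
      show "(\<lambda>n. hnorm H (s n - f) + hnorm H (s' n - f')) \<longlonglongrightarrow> 0"
        using tendsto_add[OF st(2) st'(2)] by simp
      have "hnorm H ((s n - f) + (s' n - f')) \<le> hnorm H (s n - f) + hnorm H (s' n - f')" for n
        using m that by (intro H.hnorm_triangle) auto
      moreover have "(s n - f) + (s' n - f') = (s n + s' n) - (f + f')" for n by auto
      ultimately show "norm (hnorm H ((s n + s' n) - (f + f'))) \<le> hnorm H (s n - f) + hnorm H (s' n - f')" for n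
        using m that by (metis H.add_mem H.diff_mem H.hnorm_nonneg abs_of_nonneg real_norm_def)
    qed
    moreover have "(\<lambda>n. hnorm K ((t n + t' n) - (g + g'))) \<longlonglongrightarrow> 0"
    proof (rule Lim_null_comparison[OF always_eventually[OF allI]])
      show "(\<lambda>n. hnorm K (t n - g) + hnorm K (t' n - g')) \<longlonglongrightarrow> 0"
        using tendsto_add[OF st(3) st'(3)] by simp
      have "hnorm K ((t n - g) + (t' n - g')) \<le> hnorm K (t n - g) + hnorm K (t' n - g')" for n
        using m st(4) st'(4) by (intro K.hnorm_triangle) auto
      moreover have "(t n - g) + (t' n - g') = (t n + t' n) - (g + g')" for n by auto
      ultimately show "norm (hnorm K ((t n + t' n) - (g + g'))) \<le> hnorm K (t n - g) + hnorm K (t' n - g')" for n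
        using m st(4) st'(4) by (metis K.add_mem K.diff_mem K.hnorm_nonneg abs_of_nonneg real_norm_def)
    qed
    moreover have "(s n + s' n, t n + t' n) \<in> ?G" for n
      by (rule linear_graph_add[OF st(1) st'(1)])
    ultimately show ?thesis
      unfolding lim_def using st(4) st'(4)
      by (intro conjI exI[of _ "\<lambda>n. s n + s' n"] exI[of _ "\<lambda>n. t n + t' n"]) auto
  qed
  have lim_scale: "lim (fscale c f) (fscale c g)" if f: "f \<in> hcar H" "lim f g" for f g c
  proof -
    obtain s t where st: "\<And>n. (s n, t n) \<in> ?G" "(\<lambda>n. hnorm H (s n - f)) \<longlonglongrightarrow> 0"
      "(\<lambda>n. hnorm K (t n - g)) \<longlonglongrightarrow> 0" "g \<in> hcar K"
      using f(2) unfolding lim_def by blast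
    note m = mem(1)[OF _ _ st(1)] mem(2)[OF _ _ st(1)]
    have e: "fscale c a - fscale c b = fscale c (a - b)" for a b :: "'z \<Rightarrow> complex"
      by (auto simp: fscale_def fun_eq_iff algebra_simps)
    have "(\<lambda>n. hnorm H (fscale c (s n) - fscale c f)) \<longlonglongrightarrow> 0"
      using tendsto_mult_right_zero[OF st(2), of "cmod c"] m that(1)
      unfolding e by (simp add: H.hnorm_scale)
    moreover have "(\<lambda>n. hnorm K (fscale c (t n) - fscale c g)) \<longlonglongrightarrow> 0"
      using tendsto_mult_right_zero[OF st(3), of "cmod c"] m st(4)
      unfolding e by (simp add: K.hnorm_scale)
    ultimately show ?thesis
      unfolding lim_def using st(4) linear_graph_scale[OF st(1)]
      by (intro conjI exI[of _ "\<lambda>n. fscale c (s n)"] exI[of _ "\<lambda>n. fscale c (t n)"]) auto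
  qed
  have lim_unique: "g = g'" if f: "f \<in> hcar H" and "lim f g" "lim f g'" for f g g'
  proof -
    have "lim (f + fscale (- 1) f) (g + fscale (- 1) g')"
      by (intro lim_add lim_scale that H.scale_mem)
    then have l: "lim (f - f) (g - g')" by (simp only: H.diff_eq K.diff_eq)
    have "f - f \<in> hcar H" using f by blast
    from lim_bound[OF this l] have "hnorm K (g - g') \<le> 0" by simp
    moreover have "g - g' \<in> hcar K" using l unfolding lim_def by blast
    ultimately have "hnorm K (g - g') = 0" using K.hnorm_nonneg by (metis order_antisym)
    then show ?thesis using K.hnorm_eq_0[OF \<open>g - g' \<in> hcar K\<close>] by simp
  qed
  define T where "T f = (if f \<in> hcar H then THE g. lim f g else undefined)" for f
  have T: "lim f (T f)" if "f \<in> hcar H" for f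
    using theI'[of "lim f"] lim_ex[OF that] lim_unique[OF that] that unfolding T_def by auto
  have Teq: "T f = g" if "f \<in> hcar H" "lim f g" for f g
    using lim_unique[OF that(1) T[OF that(1)] that(2)] .
  have mem': "T f \<in> hcar K" if "f \<in> hcar H" for f using T[OF that] unfolding lim_def by blast
  show ?thesis
  proof (rule that)
    show "T \<in> bounded_ops H K"
    proof (rule bopsI[of _ C])
      show "T (f + g) = T f + T g" if "f \<in> hcar H" "g \<in> hcar H" for f g
        by (rule Teq[OF H.add_mem[OF that] lim_add[OF that T[OF that(1)] T[OF that(2)]]])
      show "T (fscale c f) = fscale c (T f)" if "f \<in> hcar H" for c f
        by (rule Teq[OF H.scale_mem[OF that] lim_scale[OF that T[OF that]]])
      show "hnorm K (T f) \<le> C * hnorm H f" if "f \<in> hcar H" for f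
        by (rule lim_bound[OF that T[OF that]])
    qed (simp_all add: mem', simp add: T_def)
    show "T (k i) = k' i" if "i \<in> L" for i
    proof (rule Teq[OF k[OF that]])
      show "lim (k i) (k' i)"
        unfolding lim_def using k'[OF that] linear_graph_generator[OF that, of k k']
        by (intro conjI exI[of _ "\<lambda>_. k i"] exI[of _ "\<lambda>_. k' i"]) auto
    qed
    show "hnorm K (T f) \<le> C * hnorm H f" if "f \<in> hcar H" for f
      by (rule lim_bound[OF that T[OF that]])
  qed
qed

end

section \<open>Polynomials\<close>

definition monom_fun :: "('n::finite \<Rightarrow>\<^sub>0 nat) \<Rightarrow> complex ^ 'n \<Rightarrow> complex" where
  "monom_fun \<alpha> z = (\<Prod>i\<in>UNIV. (z $ i) ^ Poly_Mapping.lookup \<alpha> i)"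

definition tdeg :: "('n::finite \<Rightarrow>\<^sub>0 nat) \<Rightarrow> nat" where
  "tdeg \<alpha> = (\<Sum>i\<in>UNIV. Poly_Mapping.lookup \<alpha> i)"

abbreviation const :: "complex \<Rightarrow> 'n mpoly" where
  "const c \<equiv> Poly_Mapping.single 0 c"

lemma monom_fun_0 [simp]: "monom_fun 0 z = 1"
  by (simp add: monom_fun_def)

lemma monom_fun_add: "monom_fun (\<alpha> + \<beta>) z = monom_fun \<alpha> z * monom_fun \<beta> z"
  by (simp add: monom_fun_def lookup_add power_add prod.distrib)

lemma monom_fun_single [simp]: "monom_fun (Poly_Mapping.single i 1) z = z $ i"
proof -
  have "monom_fun (Poly_Mapping.single i 1) z = (\<Prod>j\<in>UNIV. if j = i then z $ i else 1)"
    unfolding monom_fun_def by (intro prod.cong) (auto simp: lookup_single when_def)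
  then show ?thesis by simp
qed

lemma monom_fun_times: "monom_fun \<alpha> (\<chi> i. z $ i * w $ i) = monom_fun \<alpha> z * monom_fun \<alpha> w"
  by (simp add: monom_fun_def power_mult_distrib prod.distrib)

lemma monom_fun_scale: "monom_fun \<alpha> (c *s z) = c ^ tdeg \<alpha> * monom_fun \<alpha> z"
  by (simp add: monom_fun_def tdeg_def power_mult_distrib prod.distrib power_sum)

lemma tdeg_add: "tdeg (\<alpha> + \<beta>) = tdeg \<alpha> + tdeg \<beta>"
  by (simp add: tdeg_def lookup_add sum.distrib)

lemma tdeg_0 [simp]: "tdeg 0 = 0"
  by (simp add: tdeg_def)

lemma tdeg_single [simp]: "tdeg (Poly_Mapping.single i n) = n"
proof -
  have "tdeg (Poly_Mapping.single i n) = (\<Sum>j\<in>UNIV. if j = i then n else 0)"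
    unfolding tdeg_def by (intro sum.cong) (auto simp: lookup_single when_def)
  then show ?thesis by simp
qed

lemma lookup_le_tdeg: "Poly_Mapping.lookup \<alpha> i \<le> tdeg \<alpha>"
  unfolding tdeg_def by (rule member_le_sum) auto

lemma tdeg_eq_0: "tdeg \<alpha> = 0 \<Longrightarrow> \<alpha> = 0"
  using lookup_le_tdeg[of \<alpha>] by (intro poly_mapping_eqI) simp

lemma exponent_cases:
  assumes "\<alpha> \<noteq> (0 :: 'n::finite \<Rightarrow>\<^sub>0 nat)"
  obtains i \<beta> where "\<alpha> = Poly_Mapping.single i 1 + \<beta>"
proof -
  obtain i where i: "Poly_Mapping.lookup \<alpha> i \<noteq> 0"
    using assms poly_mapping_eqI[of \<alpha> 0] by auto
  define \<beta> where "\<beta> = Abs_poly_mapping (\<lambda>j. Poly_Mapping.lookup \<alpha> j - (if j = i then 1 else 0))"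
  have l: "Poly_Mapping.lookup \<beta> j = Poly_Mapping.lookup \<alpha> j - (if j = i then 1 else 0)" for j
    unfolding \<beta>_def by (subst lookup_Abs_poly_mapping) auto
  have "\<alpha> = Poly_Mapping.single i 1 + \<beta>"
    by (rule poly_mapping_eqI) (use i in \<open>auto simp: lookup_add l lookup_single when_def\<close>)
  then show ?thesis by (rule that)
qed

lemma finite_exponents_bounded: "finite {\<alpha> :: 'n::finite \<Rightarrow>\<^sub>0 nat. tdeg \<alpha> \<le> D}"
proof -
  have "finite (Pi\<^sub>E (UNIV :: 'n set) (\<lambda>_. {..D}))" by (intro finite_PiE) auto
  moreover have "Poly_Mapping.lookup ` {\<alpha> :: 'n \<Rightarrow>\<^sub>0 nat. tdeg \<alpha> \<le> D} \<subseteq> Pi\<^sub>E UNIV (\<lambda>_. {..D})"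
    by (auto simp: PiE_UNIV_domain intro: order_trans[OF lookup_le_tdeg])
  ultimately have "finite (Poly_Mapping.lookup ` {\<alpha> :: 'n \<Rightarrow>\<^sub>0 nat. tdeg \<alpha> \<le> D})"
    by (rule rev_finite_subset)
  then show ?thesis
    by (rule finite_imageD) (auto intro: inj_onI poly_mapping_eqI)
qed

lemma peval_superset:
  assumes "finite A" "Poly_Mapping.keys p \<subseteq> A"
  shows "peval p z = (\<Sum>\<alpha>\<in>A. Poly_Mapping.lookup p \<alpha> * monom_fun \<alpha> z)"
  unfolding peval_def monom_fun_def[symmetric]
  by (rule sum.mono_neutral_left) (use assms in \<open>auto simp: in_keys_iff\<close>)

lemma peval_0 [simp]: "peval 0 z = 0"
  by (simp add: peval_def)

lemma peval_single [simp]: "peval (Poly_Mapping.single \<alpha> c) z = c * monom_fun \<alpha> z"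
  by (subst peval_superset[of "{\<alpha>}"]) auto

lemma peval_add [simp]: "peval (p + q) z = peval p z + peval q z"
proof -
  have A: "finite (Poly_Mapping.keys p \<union> Poly_Mapping.keys q)" by simp
  show ?thesis
    by (simp add: peval_superset[OF A] Poly_Mapping.keys_add lookup_add sum.distrib algebra_simps)
qed

lemma peval_sum: "peval (sum f A) z = (\<Sum>x\<in>A. peval (f x) z)"
  by (induction A rule: infinite_finite_induct) auto

lemma mpoly_sum_monomials: "p = (\<Sum>\<alpha>\<in>Poly_Mapping.keys p. Poly_Mapping.single \<alpha> (Poly_Mapping.lookup p \<alpha>))"
proof (rule poly_mapping_eqI)
  fix \<beta>
  have "(\<Sum>\<alpha>\<in>Poly_Mapping.keys p. Poly_Mapping.lookup (Poly_Mapping.single \<alpha> (Poly_Mapping.lookup p \<alpha>)) \<beta>)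
      = (\<Sum>\<alpha>\<in>Poly_Mapping.keys p. if \<alpha> = \<beta> then Poly_Mapping.lookup p \<beta> else 0)"
    by (intro sum.cong) (auto simp: lookup_single when_def)
  then show "Poly_Mapping.lookup p \<beta> = Poly_Mapping.lookup
      (\<Sum>\<alpha>\<in>Poly_Mapping.keys p. Poly_Mapping.single \<alpha> (Poly_Mapping.lookup p \<alpha>)) \<beta>"
    by (auto simp: lookup_sum in_keys_iff)
qed

lemma peval_mult [simp]: "peval (p * q) z = peval p z * peval q z"
proof -
  have "p * q = (\<Sum>\<alpha>\<in>Poly_Mapping.keys p. \<Sum>\<beta>\<in>Poly_Mapping.keys q.
      Poly_Mapping.single (\<alpha> + \<beta>) (Poly_Mapping.lookup p \<alpha> * Poly_Mapping.lookup q \<beta>))"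
    by (subst mpoly_sum_monomials[of p], subst mpoly_sum_monomials[of q]) (simp add: sum_product mult_single)
  then have "peval (p * q) z = (\<Sum>\<alpha>\<in>Poly_Mapping.keys p. \<Sum>\<beta>\<in>Poly_Mapping.keys q.
      (Poly_Mapping.lookup p \<alpha> * monom_fun \<alpha> z) * (Poly_Mapping.lookup q \<beta> * monom_fun \<beta> z))"
    by (simp add: peval_sum monom_fun_add mult_ac)
  also have "\<dots> = peval p z * peval q z"
    unfolding peval_superset[OF finite_keys subset_refl] by (rule sum_product[symmetric])
  finally show ?thesis .
qed

lemma peval_1 [simp]: "peval 1 z = 1"
  using peval_single[of 0 1 z] by simp

lemma peval_coord [simp]: "peval (coord i) z = z $ i"
  unfolding coord_def peval_single monom_fun_single by simp

lemma peval_uminus [simp]: "peval (- p) z = - peval p z"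
  using peval_add[of p "- p" z] by (simp add: eq_neg_iff_add_eq_0 add.commute)

lemma peval_diff [simp]: "peval (p - q) z = peval p z - peval q z"
  using peval_add[of p "- q" z] by simp

lemma peval_power [simp]: "peval (p ^ k) z = peval p z ^ k"
  by (induction k) auto

text \<open>Substitution of linear maps, boundedness of multipliers and membership in operator
  algebras are all compatible with sums and products, so they need checking on constants and
  coordinates only.\<close>

lemma mpoly_induct [case_names const coord add mult]:
  assumes "\<And>c. P (const c)" "\<And>i. P (coord i)"
    "\<And>p q. P p \<Longrightarrow> P q \<Longrightarrow> P (p + q)" "\<And>p q. P p \<Longrightarrow> P q \<Longrightarrow> P (p * q)"
  shows "P (p :: 'n::finite mpoly)"
proof -
  have mon: "P (Poly_Mapping.single \<alpha> 1)" for \<alpha> :: "'n \<Rightarrow>\<^sub>0 nat"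
  proof (induction "tdeg \<alpha>" arbitrary: \<alpha>)
    case 0
    then have "\<alpha> = 0" using tdeg_eq_0[of \<alpha>] by simp
    then show ?case using assms(1)[of 1] by simp
  next
    case (Suc n)
    then have "\<alpha> \<noteq> 0" by auto
    then obtain i \<beta> where e: "\<alpha> = Poly_Mapping.single i 1 + \<beta>" by (rule exponent_cases)
    then have "P (Poly_Mapping.single \<beta> 1)" using Suc by (intro Suc) (simp add: tdeg_add)
    then have "P (coord i * Poly_Mapping.single \<beta> 1)" by (intro assms(4) assms(2))
    then show ?case by (simp add: coord_def mult_single e)
  qed
  have single: "P (Poly_Mapping.single \<alpha> c)" for \<alpha> :: "'n \<Rightarrow>\<^sub>0 nat" and c
    using assms(4)[OF assms(1)[of c] mon[of \<alpha>]] by (simp add: mult_single)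
  have sum: "P (sum f A)" if "\<And>x. x \<in> A \<Longrightarrow> P (f x)" for f :: "('n \<Rightarrow>\<^sub>0 nat) \<Rightarrow> 'n mpoly" and A
    using that
    by (induction A rule: infinite_finite_induct) (use assms(1)[of 0] assms(3) in auto)
  show ?thesis
    by (rule ssubst[OF mpoly_sum_monomials[of p]]) (intro sum single)
qed

text \<open>Dedekind's argument: distinct monomials are distinct characters of the multiplicative
  monoid of all vectors.\<close>

lemma monom_fun_independent:
  assumes "finite A" "\<And>z. (\<Sum>\<alpha>\<in>A. c \<alpha> * monom_fun \<alpha> z) = 0" "\<alpha> \<in> A"
  shows "c \<alpha> = (0 :: complex)"
  using assms
proof (induction A arbitrary: c \<alpha> rule: finite_induct)
  case (insert \<beta> A)
  have others: "c \<gamma> = 0" if \<gamma>: "\<gamma> \<in> A" for \<gamma>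
  proof -
    have "\<gamma> \<noteq> \<beta>" using \<gamma> insert.hyps by auto
    then obtain i where i: "Poly_Mapping.lookup \<gamma> i \<noteq> Poly_Mapping.lookup \<beta> i"
      using poly_mapping_eqI[of \<gamma> \<beta>] by blast
    \<comment> \<open>\<open>w\<close> is 2 in a coordinate where the two exponents differ, so it
      separates the two monomials. Replacing \<open>z\<close> by its product with \<open>w\<close>
      and subtracting \<open>monom_fun \<beta> w\<close> times the relation removes the term of
      \<open>\<beta>\<close>.\<close>
    define w :: "complex ^ 'a" where "w = (\<chi> j. if j = i then 2 else 1)"
    have w: "monom_fun \<delta> w = 2 ^ Poly_Mapping.lookup \<delta> i" for \<delta>
    proof -
      have "monom_fun \<delta> w = (\<Prod>j\<in>UNIV. if j = i then 2 ^ Poly_Mapping.lookup \<delta> i else 1)"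
        unfolding monom_fun_def by (intro prod.cong) (auto simp: w_def)
      then show ?thesis by simp
    qed
    have "(\<Sum>\<alpha>\<in>A. c \<alpha> * (monom_fun \<alpha> w - monom_fun \<beta> w) * monom_fun \<alpha> z) = 0" for z
    proof -
      have "(\<Sum>\<alpha>\<in>insert \<beta> A. c \<alpha> * monom_fun \<alpha> (\<chi> i. w $ i * z $ i))
          - monom_fun \<beta> w * (\<Sum>\<alpha>\<in>insert \<beta> A. c \<alpha> * monom_fun \<alpha> z) = 0"
        unfolding insert.prems(1) by simp
      then show ?thesis
        using insert.hyps
        by (simp add: monom_fun_times sum_distrib_left sum_subtractf[symmetric] algebra_simps)
    qed
    from insert.IH[OF this \<gamma>] have "c \<gamma> * (monom_fun \<gamma> w - monom_fun \<beta> w) = 0" .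
    moreover have "(2 :: complex) ^ a \<noteq> 2 ^ b" if "a \<noteq> b" for a b :: nat
    proof
      assume "(2 :: complex) ^ a = 2 ^ b"
      then have "cmod (2 ^ a) = cmod (2 ^ b)" by simp
      then show False using that by (simp add: norm_power)
    qed
    ultimately show ?thesis using i by (simp add: w)
  qed
  have "c \<beta> = 0"
    using insert.prems(1)[of "\<chi> i. 1"] insert.hyps others by (simp add: monom_fun_def)
  then show ?case using others insert.prems(2) by auto
qed simp

subsection \<open>Homogeneous components and cones\<close>

lemma lookup_hom_comp: "Poly_Mapping.lookup (hom_comp k p) \<alpha> = (if tdeg \<alpha> = k then Poly_Mapping.lookup p \<alpha> else 0)"
proof -
  let ?B = "{\<alpha> \<in> Poly_Mapping.keys p. tdeg \<alpha> = k}"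
  have "Poly_Mapping.lookup (hom_comp k p) \<alpha>
      = (\<Sum>\<beta>\<in>?B. Poly_Mapping.lookup (Poly_Mapping.single \<beta> (Poly_Mapping.lookup p \<beta>)) \<alpha>)"
    by (simp add: hom_comp_def tdeg_def lookup_sum)
  also have "\<dots> = (\<Sum>\<beta>\<in>?B. if \<beta> = \<alpha> then Poly_Mapping.lookup p \<alpha> else 0)"
    by (intro sum.cong) (auto simp: lookup_single when_def)
  finally show ?thesis by (auto simp: in_keys_iff)
qed

lemma peval_hom_comp_scale: "peval (hom_comp k p) (c *s z) = c ^ k * peval (hom_comp k p) z"
proof -
  have "peval (hom_comp k p) (c *s z) = (\<Sum>\<alpha>\<in>Poly_Mapping.keys (hom_comp k p).
      Poly_Mapping.lookup (hom_comp k p) \<alpha> * monom_fun \<alpha> (c *s z))"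
    by (rule peval_superset) auto
  also have "\<dots> = (\<Sum>\<alpha>\<in>Poly_Mapping.keys (hom_comp k p).
      c ^ k * (Poly_Mapping.lookup (hom_comp k p) \<alpha> * monom_fun \<alpha> z))"
    by (intro sum.cong) (auto simp: monom_fun_scale lookup_hom_comp)
  also have "\<dots> = c ^ k * peval (hom_comp k p) z"
    by (subst peval_superset[OF finite_keys subset_refl]) (simp add: sum_distrib_left)
  finally show ?thesis .
qed

lemma sum_hom_comp:
  obtains N where "p = (\<Sum>k\<le>N. hom_comp k p)"
proof
  define N where "N = Max (insert 0 (tdeg ` Poly_Mapping.keys p))"
  have N: "tdeg \<alpha> \<le> N" if "\<alpha> \<in> Poly_Mapping.keys p" for \<alpha>
    unfolding N_def using that by (intro Max_ge) auto
  show "p = (\<Sum>k\<le>N. hom_comp k p)"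
  proof (rule poly_mapping_eqI)
    fix \<alpha>
    show "Poly_Mapping.lookup p \<alpha> = Poly_Mapping.lookup (\<Sum>k\<le>N. hom_comp k p) \<alpha>"
      using N[of \<alpha>] by (cases "\<alpha> \<in> Poly_Mapping.keys p") (auto simp: lookup_sum lookup_hom_comp in_keys_iff)
  qed
qed

definition cone :: "(complex ^ 'n) set \<Rightarrow> bool" where
  "cone Z \<longleftrightarrow> (\<forall>z\<in>Z. \<forall>c. c *s z \<in> Z)"

text \<open>Each homogeneous component of a member of the ideal is in the ideal, and scaling the
  argument by \<open>c\<close> multiplies it by a power of \<open>c\<close>.\<close>

lemma cone_vanishing_locus:
  assumes "radical_homogeneous_ideal I"
  shows "cone (vanishing_locus I)"
  unfolding cone_def
proof (intro ballI allI)
  fix z c assume z: "z \<in> vanishing_locus I"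
  have "peval p (c *s z) = 0" if p: "p \<in> I" for p
  proof -
    obtain N where N: "p = (\<Sum>k\<le>N. hom_comp k p)" by (rule sum_hom_comp)
    have "peval (hom_comp k p) z = 0" for k
      using assms p z unfolding radical_homogeneous_ideal_def vanishing_locus_def by blast
    then show ?thesis by (subst N) (simp add: peval_sum peval_hom_comp_scale)
  qed
  then show "c *s z \<in> vanishing_locus I" by (simp add: vanishing_locus_def)
qed

lemma mpoly_compose_linear:
  assumes "Vector_Spaces.linear (*s) (*s) (A :: complex ^ 'm::finite \<Rightarrow> complex ^ 'n::finite)"
  shows "\<exists>q. \<forall>z. peval q z = peval p (A z)"
proof (induction p rule: mpoly_induct)
  case (const c)
  show ?case by (intro exI[of _ "Poly_Mapping.single 0 c"]) simp
next
  case (coord i)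
  have e: "A z $ i = (\<Sum>j\<in>UNIV. z $ j * A (axis j 1) $ i)" for z
  proof -
    interpret A: Vector_Spaces.linear "(*s)" "(*s)" A by fact
    have "z = (\<Sum>j\<in>UNIV. (z $ j) *s axis j 1)" by (rule basis_expansion[symmetric])
    then have "A z = (\<Sum>j\<in>UNIV. (z $ j) *s A (axis j 1))"
      using A.sum[of "\<lambda>j. (z $ j) *s axis j 1" UNIV] A.scale by (metis (mono_tags, lifting) sum.cong)
    then show ?thesis by simp
  qed
  have "peval (\<Sum>j\<in>UNIV. coord j * const (A (axis j 1) $ i)) z = peval (coord i) (A z)" for z
    unfolding peval_coord e[of z] by (simp add: peval_sum)
  then show ?case by blast
next
  case (add p q)
  then obtain p' q' where "\<forall>z. peval p' z = peval p (A z)" "\<forall>z. peval q' z = peval q (A z)" by blast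
  then show ?case by (intro exI[of _ "p' + q'"]) simp
next
  case (mult p q)
  then obtain p' q' where "\<forall>z. peval p' z = peval p (A z)" "\<forall>z. peval q' z = peval q (A z)" by blast
  then show ?case by (intro exI[of _ "p' * q'"]) simp
qed

subsection \<open>The Nullstellensatz\<close>

text \<open>Gaussian elimination: solving one equation for a pivot unknown \<open>a0\<close> leaves
  one equation and one unknown fewer.\<close>

lemma homogeneous_system_nontrivial:
  fixes q :: "'a \<Rightarrow> 'k \<Rightarrow> complex"
  assumes "finite A" "finite T" "card A < card T"
  shows "\<exists>c. (\<exists>a\<in>T. c a \<noteq> 0) \<and> (\<forall>\<alpha>\<in>A. (\<Sum>a\<in>T. c a * q a \<alpha>) = 0)"
  using assms
proof (induction A arbitrary: T q rule: finite_induct)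
  case empty
  then have "T \<noteq> {}" by auto
  then show ?case by (intro exI[of _ "\<lambda>_. 1"]) auto
next
  case (insert \<beta> A)
  show ?case
  proof (cases "\<forall>a\<in>T. q a \<beta> = 0")
    case True
    have "card A < card T" using insert by simp
    from insert.IH[OF insert.prems(1) this, of q] obtain c
      where "\<exists>a\<in>T. c a \<noteq> 0" "\<forall>\<alpha>\<in>A. (\<Sum>a\<in>T. c a * q a \<alpha>) = 0" by blast
    then show ?thesis using True by (intro exI[of _ c]) auto
  next
    case False
    then obtain a0 where a0: "a0 \<in> T" "q a0 \<beta> \<noteq> 0" by blast
    define T' where "T' = T - {a0}"
    have T': "T = insert a0 T'" "a0 \<notin> T'" "finite T'" using a0 insert.prems by (auto simp: T'_def)
    have "card A < card T'" using insert T' by simp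
    from insert.IH[OF T'(3) this, of "\<lambda>a \<alpha>. q a \<alpha> - q a \<beta> / q a0 \<beta> * q a0 \<alpha>"]
    obtain c where c: "\<exists>a\<in>T'. c a \<noteq> 0"
      "\<And>\<alpha>. \<alpha> \<in> A \<Longrightarrow> (\<Sum>a\<in>T'. c a * (q a \<alpha> - q a \<beta> / q a0 \<beta> * q a0 \<alpha>)) = 0" by blast
    define d where "d = - (\<Sum>a\<in>T'. c a * q a \<beta>) / q a0 \<beta>"
    define c' where "c' = c(a0 := d)"
    have sum: "(\<Sum>a\<in>T. c' a * q a \<alpha>) = d * q a0 \<alpha> + (\<Sum>a\<in>T'. c a * q a \<alpha>)" for \<alpha>
    proof -
      have "(\<Sum>a\<in>T'. c' a * q a \<alpha>) = (\<Sum>a\<in>T'. c a * q a \<alpha>)"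
        using T'(2) by (intro sum.cong) (auto simp: c'_def)
      then show ?thesis using T' by (simp add: c'_def)
    qed
    have "(\<Sum>a\<in>T. c' a * q a \<alpha>) = 0" if "\<alpha> \<in> insert \<beta> A" for \<alpha>
    proof (cases "\<alpha> = \<beta>")
      case True
      then show ?thesis unfolding sum using a0 by (simp add: d_def)
    next
      case False
      then have "\<alpha> \<in> A" using that by simp
      have "(\<Sum>a\<in>T'. c a * (q a \<beta> / q a0 \<beta> * q a0 \<alpha>)) = - d * q a0 \<alpha>"
        by (simp add: d_def sum_distrib_right sum_distrib_left sum_divide_distrib mult_ac)
      then show ?thesis
        using c(2)[OF \<open>\<alpha> \<in> A\<close>] unfolding sum by (simp add: right_diff_distrib sum_subtractf add.commute)
    qed
    moreover have "\<exists>a\<in>T. c' a \<noteq> 0" using c(1) T' by (auto simp: c'_def)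
    ultimately show ?thesis by blast
  qed
qed

text \<open>An ideal \<open>P\<close> maximal among those avoiding the powers of \<open>f\<close> is prime.  As \<open>\<complex>\<close> is
  uncountable but the polynomial ring has countable dimension, the relations
  \<open>f\<^sup>k - q\<^sub>a * (x - a) \<in> P\<close> cannot hold for all complex \<open>a\<close>, so \<open>P\<close> is the ideal of a point.\<close>

theorem Nullstellensatz:
  fixes I :: "'n::finite mpoly set"
  assumes I: "poly_ideal I" and rad: "\<And>p k. p ^ k \<in> I \<Longrightarrow> p \<in> I" and f: "f \<notin> I"
  shows "\<exists>z\<in>vanishing_locus I. peval f z \<noteq> 0"
proof -
  define \<J> where "\<J> = {K. poly_ideal K \<and> I \<subseteq> K \<and> (\<forall>k. f ^ k \<notin> K)}"
  have "\<exists>M\<in>\<J>. \<forall>K\<in>\<J>. M \<subseteq> K \<longrightarrow> K = M"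
  proof (rule subset_Zorn_nonempty)
    show "\<J> \<noteq> {}" using I rad f by (auto simp: \<J>_def)
    fix \<C> assume C: "\<C> \<noteq> {}" "subset.chain \<J> \<C>"
    then have sub: "\<C> \<subseteq> \<J>" and tot: "\<And>K L. K \<in> \<C> \<Longrightarrow> L \<in> \<C> \<Longrightarrow> K \<subseteq> L \<or> L \<subseteq> K"
      by (auto simp: subset_chain_def)
    have ideal: "0 \<in> M" "p \<in> M \<Longrightarrow> q \<in> M \<Longrightarrow> p + q \<in> M" "q \<in> M \<Longrightarrow> p * q \<in> M" if "M \<in> \<C>" for M p q
      using that sub unfolding \<J>_def poly_ideal_def by blast+
    have "poly_ideal (\<Union>\<C>)"
      unfolding poly_ideal_def
    proof (intro conjI ballI allI)
      show "0 \<in> \<Union>\<C>" using C(1) ideal(1) by blast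
      show "p + q \<in> \<Union>\<C>" if pq: "p \<in> \<Union>\<C>" "q \<in> \<Union>\<C>" for p q
      proof -
        obtain K L where KL: "K \<in> \<C>" "p \<in> K" "L \<in> \<C>" "q \<in> L" using pq by blast
        then obtain M where "M \<in> \<C>" "p \<in> M" "q \<in> M" using tot[OF KL(1,3)] by blast
        then show ?thesis using ideal(2) by blast
      qed
      show "p * q \<in> \<Union>\<C>" if "q \<in> \<Union>\<C>" for p q
        using that ideal(3) by blast
    qed
    moreover have "I \<subseteq> \<Union>\<C>" using C(1) sub by (auto simp: \<J>_def)
    moreover have "\<forall>k. f ^ k \<notin> \<Union>\<C>" using sub by (auto simp: \<J>_def)
    ultimately show "\<Union>\<C> \<in> \<J>" by (simp add: \<J>_def)
  qed
  then obtain P where P: "P \<in> \<J>" and Pmax: "\<And>K. K \<in> \<J> \<Longrightarrow> P \<subseteq> K \<Longrightarrow> K = P" by blast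
  have P0: "0 \<in> P" and P_add: "\<And>p q. p \<in> P \<Longrightarrow> q \<in> P \<Longrightarrow> p + q \<in> P"
    and P_mult: "\<And>p q. q \<in> P \<Longrightarrow> p * q \<in> P" and IP: "I \<subseteq> P" and fP: "\<And>k. f ^ k \<notin> P"
    using P by (auto simp: \<J>_def poly_ideal_def)
  have P_diff: "p - q \<in> P" if "p \<in> P" "q \<in> P" for p q
    using P_add[OF that(1) P_mult[OF that(2), of "- 1"]] by simp
  have P_sum: "sum g A \<in> P" if "\<And>x. x \<in> A \<Longrightarrow> g x \<in> P" for g :: "complex \<Rightarrow> 'n mpoly" and A
    using that by (induction A rule: infinite_finite_induct) (auto intro: P0 P_add)
  \<comment> \<open>By maximality, the ideal generated by \<open>P\<close> and a further element
    \<open>a\<close> contains a power of \<open>f\<close>.\<close>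
  have key: "\<exists>k r. f ^ k - r * a \<in> P" if a: "a \<notin> P" for a
  proof (rule ccontr)
    assume neg: "\<nexists>k r. f ^ k - r * a \<in> P"
    define K where "K = {p. \<exists>r. p - r * a \<in> P}"
    have "poly_ideal K"
      unfolding poly_ideal_def
    proof (intro conjI ballI allI)
      show "0 \<in> K" using P0 by (auto simp: K_def intro: exI[of _ 0])
      show "p + q \<in> K" if pq: "p \<in> K" "q \<in> K" for p q
      proof -
        obtain r s where "p - r * a \<in> P" "q - s * a \<in> P" using pq by (auto simp: K_def)
        from P_add[OF this] have "(p + q) - (r + s) * a \<in> P" by (simp add: algebra_simps)
        then show ?thesis by (auto simp: K_def)
      qed
      show "p * q \<in> K" if q: "q \<in> K" for p q
      proof -
        obtain r where "q - r * a \<in> P" using q by (auto simp: K_def)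
        from P_mult[OF this, of p] have "p * q - (p * r) * a \<in> P" by (simp add: algebra_simps)
        then show ?thesis by (auto simp: K_def)
      qed
    qed
    moreover have PK: "P \<subseteq> K" by (auto simp: K_def intro: exI[of _ 0])
    ultimately have "K \<in> \<J>" using IP neg by (auto simp: \<J>_def K_def)
    from Pmax[OF this PK] have "K = P" .
    moreover have "a \<in> K" using P0 by (auto simp: K_def intro: exI[of _ 1])
    ultimately show False using a by blast
  qed
  have prime: "a \<in> P \<or> b \<in> P" if ab: "a * b \<in> P" for a b
  proof (rule ccontr)
    assume "\<not> ?thesis"
    then obtain k r l s where kr: "f ^ k - r * a \<in> P" and ls: "f ^ l - s * b \<in> P"
      using key by metis
    have "f ^ l * (f ^ k - r * a) + ((r * a) * (f ^ l - s * b) + (r * s) * (a * b)) \<in> P"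
      by (intro P_add P_mult kr ls ab)
    also have "f ^ l * (f ^ k - r * a) + ((r * a) * (f ^ l - s * b) + (r * s) * (a * b)) = f ^ (l + k)"
      by (simp add: algebra_simps power_add)
    finally show False using fP by blast
  qed
  have const_P: "c = 0" if "const c \<in> P" for c
  proof (rule ccontr)
    assume "c \<noteq> 0"
    have "const (1 / c) * const c \<in> P" using that by (rule P_mult)
    then show False using \<open>c \<noteq> 0\<close> fP[of 0] by (simp add: mult_single)
  qed
  have point: "\<exists>a. coord i - const a \<in> P" for i :: 'n
  proof (rule ccontr)
    let ?x = "coord i :: 'n mpoly"
    assume neg: "\<nexists>a. ?x - const a \<in> P"
    then have "\<forall>a. \<exists>k r. f ^ k - r * (?x - const a) \<in> P" using key by blast
    then obtain k q where kq: "\<And>a. f ^ k a - q a * (?x - const a) \<in> P" by metis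
    define D where "D a = Max (insert 0 (tdeg ` Poly_Mapping.keys (q a)))" for a
    have D: "tdeg \<alpha> \<le> D a" if "\<alpha> \<in> Poly_Mapping.keys (q a)" for \<alpha> a
      unfolding D_def using that by (intro Max_ge) auto
    \<comment> \<open>There are uncountably many points \<open>a\<close>, but only countably many
      pairs of an exponent \<open>k a\<close> and a degree bound \<open>D a\<close>, so one pair
      occurs infinitely often.\<close>
    have "\<exists>n d. infinite {a. k a = n \<and> D a = d}"
    proof (rule ccontr)
      assume "\<not> ?thesis"
      then have "countable (\<Union>(n, d)\<in>UNIV. {a. k a = n \<and> D a = d})"
        by (intro countable_UN) (auto intro: countable_finite)
      moreover have "(\<Union>(n, d)\<in>UNIV. {a. k a = n \<and> D a = d}) = (UNIV :: complex set)" by auto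
      ultimately show False using uncountable_UNIV_complex by simp
    qed
    then obtain n d where inf: "infinite {a. k a = n \<and> D a = d}" by blast
    define A where "A = {\<alpha> :: 'n \<Rightarrow>\<^sub>0 nat. tdeg \<alpha> \<le> d}"
    have A: "finite A" unfolding A_def by (rule finite_exponents_bounded)
    \<comment> \<open>One point more than there are monomials of degree at most \<open>d\<close>,
      which makes the polynomials \<open>q a\<close> for \<open>a \<in> T\<close> linearly
      dependent.\<close>
    obtain T where T: "finite T" "card T = Suc (card A)" "T \<subseteq> {a. k a = n \<and> D a = d}"
      using infinite_arbitrarily_large[OF inf] by blast
    obtain c where c: "\<exists>a\<in>T. c a \<noteq> 0" "\<And>\<alpha>. \<alpha> \<in> A \<Longrightarrow> (\<Sum>a\<in>T. c a * Poly_Mapping.lookup (q a) \<alpha>) = 0"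
      using homogeneous_system_nontrivial[OF A T(1), of "\<lambda>a. Poly_Mapping.lookup (q a)"] T(2) by auto
    obtain a0 where a0: "a0 \<in> T" "c a0 \<noteq> 0" using c(1) by blast
    have lookup_const: "Poly_Mapping.lookup (const b * p) \<alpha> = b * Poly_Mapping.lookup p \<alpha>" for b and p :: "'n mpoly" and \<alpha>
      by (simp flip: mult_map_scale_conv_mult add: Poly_Mapping.map.rep_eq when_def)
    have dep: "(\<Sum>a\<in>T. const (c a) * q a) = 0"
    proof (rule poly_mapping_eqI)
      fix \<alpha>
      show "Poly_Mapping.lookup (\<Sum>a\<in>T. const (c a) * q a) \<alpha> = Poly_Mapping.lookup 0 \<alpha>"
      proof (cases "\<alpha> \<in> A")
        case True
        then show ?thesis using c(2) by (simp add: lookup_sum lookup_const)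
      next
        case False
        then have "Poly_Mapping.lookup (q a) \<alpha> = 0" if "a \<in> T" for a
          using D[of \<alpha> a] T(3) that by (auto simp: A_def in_keys_iff)
        then show ?thesis by (simp add: lookup_sum lookup_const)
      qed
    qed
    \<comment> \<open>Multiplying the relation of \<open>a\<close> by the factors of the other
      points gives all relations the common product over \<open>T\<close>. In the sum weighted by
      \<open>c\<close> the terms with \<open>q a\<close> then cancel, leaving
      \<open>f ^ n * G \<in> P\<close>.\<close>
    define w where "w a = (\<Prod>b\<in>T-{a}. ?x - const b)" for a
    have w: "(?x - const a) * w a = (\<Prod>b\<in>T. ?x - const b)" if "a \<in> T" for a
      unfolding w_def using prod.remove[OF T(1) that, of "\<lambda>b. ?x - const b"] by simp
    define G where "G = (\<Sum>a\<in>T. const (c a) * w a)"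
    have "(\<Sum>a\<in>T. (const (c a) * w a) * (f ^ n - q a * (?x - const a))) \<in> P"
      using kq T(3) by (intro P_sum P_mult) force
    also have "(\<Sum>a\<in>T. (const (c a) * w a) * (f ^ n - q a * (?x - const a)))
        = f ^ n * G - (\<Sum>a\<in>T. (const (c a) * q a) * ((?x - const a) * w a))"
      by (simp add: G_def sum_distrib_left sum_subtractf[symmetric] algebra_simps)
    also have "(\<Sum>a\<in>T. (const (c a) * q a) * ((?x - const a) * w a)) = (\<Sum>a\<in>T. const (c a) * q a) * (\<Prod>b\<in>T. ?x - const b)"
      unfolding sum_distrib_right by (intro sum.cong) (auto simp: w)
    finally have "G \<in> P" using prime[of "f ^ n" G] fP by (simp add: dep)
    \<comment> \<open>\<open>G\<close> is a polynomial in \<open>coord i\<close> alone. The map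
      \<open>h\<close> substitutes \<open>coord i\<close> into univariate polynomials, whose
      factorization into linear factors becomes available for \<open>G\<close>.\<close>
    define h where "h g = poly (map_poly const g) ?x" for g :: "complex poly"
    have h_add: "h (p + r) = h p + h r" for p r
    proof -
      have "map_poly const (p + r) = map_poly const p + (map_poly const r :: 'n mpoly poly)"
        by (rule poly_eqI) (simp add: coeff_map_poly single_add)
      then show ?thesis by (simp add: h_def)
    qed
    have h_pCons: "h (pCons a p) = const a + ?x * h p" for a p
      by (simp add: h_def map_poly_pCons)
    have h_smult: "h (smult a p) = const a * h p" for a p
      by (induction p) (simp_all add: h_pCons mult_single algebra_simps, simp add: h_def)
    have h_mult: "h (p * r) = h p * h r" for p r
    proof (induction p)
      case 0
      show ?case by (simp add: h_def)
    next
      case (pCons a p)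
      have "h (pCons a p * r) = h (smult a r) + h (pCons 0 (p * r))"
        by (simp add: h_add)
      also have "\<dots> = h (pCons a p) * h r"
        by (simp add: h_smult h_pCons pCons.IH algebra_simps)
      finally show ?case .
    qed
    have h_0: "h 0 = 0" and h_1: "h 1 = 1" by (simp_all add: h_def)
    have h_lin: "h [:- b, 1:] = ?x - const b" for b
      by (simp add: h_pCons h_0 single_uminus)
    have h_prod: "h (prod g B) = (\<Prod>b\<in>B. h (g b))" for g and B :: "complex set"
      by (induction B rule: infinite_finite_induct) (auto simp: h_1 h_mult)
    have h_sum: "h (sum g B) = (\<Sum>b\<in>B. h (g b))" for g and B :: "complex set"
      by (induction B rule: infinite_finite_induct) (auto simp: h_0 h_add)
    define g where "g = (\<Sum>a\<in>T. smult (c a) (\<Prod>b\<in>T-{a}. [:- b, 1:]))"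
    have hg: "h g = G" by (simp add: g_def G_def w_def h_sum h_smult h_prod h_lin)
    \<comment> \<open>Every product except the one belonging to \<open>a0\<close> contains a factor
      that vanishes at \<open>a0\<close>, so \<open>g\<close> is not the zero polynomial.\<close>
    have "poly g a0 = (\<Sum>a\<in>T. if a = a0 then c a0 * (\<Prod>b\<in>T-{a0}. a0 - b) else 0)"
      unfolding g_def poly_sum using T(1) a0 by (intro sum.cong) (auto simp: poly_prod)
    then have "poly g a0 \<noteq> 0" using a0 T(1) by simp
    then have "g \<noteq> 0" by auto
    \<comment> \<open>As \<open>P\<close> is prime and contains no nonzero constant, splitting off
      one root after the other must meet a linear factor in \<open>P\<close>.\<close>
    have "\<exists>a. ?x - const a \<in> P" if "h p \<in> P" "p \<noteq> 0" for p
      using that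
    proof (induction "degree p" arbitrary: p)
      case 0
      then obtain a where "p = [:a:]" "a \<noteq> 0" by (metis degree_eq_zeroE pCons_0_0)
      then show ?case using 0 const_P[of a] by (simp add: h_pCons h_0)
    next
      case (Suc m)
      then obtain a where "poly p a = 0"
        using alg_closed_imp_poly_has_root[of p] by (metis zero_less_Suc)
      then obtain p' where p': "p = [:- a, 1:] * p'" by (meson dvdE poly_eq_0_iff_dvd)
      have "p' \<noteq> 0" using p' Suc by auto
      then have "degree ([:- a, 1:] * p') = degree [:- a, 1:] + degree p'"
        by (intro degree_mult_eq) auto
      then have "degree p' = m" using Suc(2) unfolding p' by simp
      have "(?x - const a) * h p' \<in> P" using Suc.prems(1) by (simp only: p' h_mult h_lin)
      then show ?case using prime Suc.hyps(1)[of p'] \<open>degree p' = m\<close> \<open>p' \<noteq> 0\<close> by blast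
    qed
    then show False using neg \<open>G \<in> P\<close> \<open>g \<noteq> 0\<close> hg by blast
  qed
  then obtain a where a: "\<And>i. coord i - const (a i) \<in> P" by metis
  define z where "z = (\<chi> i. a i)"
  \<comment> \<open>Modulo \<open>P\<close> every polynomial is congruent to its value at
    \<open>z\<close>. So members of \<open>P\<close> vanish at \<open>z\<close>, and
    \<open>f\<close> does not.\<close>
  have ev: "p - const (peval p z) \<in> P" for p
  proof (induction p rule: mpoly_induct)
    case (const c)
    show ?case using P0 by simp
  next
    case (coord i)
    show ?case using a by (simp add: z_def)
  next
    case (add p q)
    from P_add[OF add.IH] show ?case by (simp add: single_add algebra_simps)
  next
    case (mult p q)
    have "q * (p - const (peval p z)) + const (peval p z) * (q - const (peval q z)) \<in> P"
      by (intro P_add P_mult mult)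
    then show ?case by (simp add: mult_single algebra_simps)
  qed
  have "peval p z = 0" if "p \<in> P" for p
    using const_P P_diff[OF that ev[of p]] by simp
  moreover have "peval f z \<noteq> 0"
    using ev[of f] fP[of 1] by auto
  ultimately show ?thesis using IP by (auto simp: vanishing_locus_def)
qed

text \<open>The form in which the Nullstellensatz is applied: evaluation at points of the variety
  sees only the vanishing ideal.\<close>

lemma radical_ideal_eq_vanishing_ideal:
  assumes "radical_homogeneous_ideal I"
  shows "vanishing_ideal (vanishing_locus I) = I"
proof
  show "I \<subseteq> vanishing_ideal (vanishing_locus I)"
    by (auto simp: vanishing_ideal_def vanishing_locus_def)
  show "vanishing_ideal (vanishing_locus I) \<subseteq> I"
    using Nullstellensatz[of I] assms
    unfolding radical_homogeneous_ideal_def vanishing_ideal_def by blast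
qed

section \<open>Polynomial functions on irreducible varieties\<close>

text \<open>Functions instead of elements of \<open>mpoly\<close>, in order to speak of polynomials
  in the coordinates from \<open>V\<close> alone and to take them as coefficients of polynomials in
  one further coordinate.\<close>

inductive_set polyfun :: "'n::finite set \<Rightarrow> (complex ^ 'n \<Rightarrow> complex) set" for V where
  const: "(\<lambda>_. c) \<in> polyfun V"
| coord: "i \<in> V \<Longrightarrow> (\<lambda>z. z $ i) \<in> polyfun V"
| add: "f \<in> polyfun V \<Longrightarrow> g \<in> polyfun V \<Longrightarrow> (\<lambda>z. f z + g z) \<in> polyfun V"
| mult: "f \<in> polyfun V \<Longrightarrow> g \<in> polyfun V \<Longrightarrow> (\<lambda>z. f z * g z) \<in> polyfun V"

lemma polyfun_mono: "f \<in> polyfun V \<Longrightarrow> V \<subseteq> V' \<Longrightarrow> f \<in> polyfun V'"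
  by (induction rule: polyfun.induct) (auto intro: polyfun.intros)

lemma polyfun_sum: "(\<And>x. x \<in> A \<Longrightarrow> f x \<in> polyfun V) \<Longrightarrow> (\<lambda>z. \<Sum>x\<in>A. f x z) \<in> polyfun V"
  by (induction A rule: infinite_finite_induct) (auto intro: polyfun.intros)

lemma polyfun_power: "f \<in> polyfun V \<Longrightarrow> (\<lambda>z. f z ^ k) \<in> polyfun V"
  by (induction k) (auto intro: polyfun.intros)

lemma polyfun_diff: "f \<in> polyfun V \<Longrightarrow> g \<in> polyfun V \<Longrightarrow> (\<lambda>z. f z - g z) \<in> polyfun V"
  using polyfun.add[OF _ polyfun.mult[OF polyfun.const[of "- 1"]], of f V g] by simp

lemma polyfun_dep: "f \<in> polyfun V \<Longrightarrow> (\<And>i. i \<in> V \<Longrightarrow> z $ i = w $ i) \<Longrightarrow> f z = f w"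
  by (induction rule: polyfun.induct) auto

lemma polyfun_imp_peval: "f \<in> polyfun V \<Longrightarrow> \<exists>p. \<forall>z. f z = peval p z"
proof (induction rule: polyfun.induct)
  case (const c)
  show ?case by (intro exI[of _ "const c"]) simp
next
  case (coord i)
  show ?case by (intro exI[of _ "coord i"]) simp
next
  case (add f g)
  then obtain p q where "\<forall>z. f z = peval p z" "\<forall>z. g z = peval q z" by blast
  then show ?case by (intro exI[of _ "p + q"]) simp
next
  case (mult f g)
  then obtain p q where "\<forall>z. f z = peval p z" "\<forall>z. g z = peval q z" by blast
  then show ?case by (intro exI[of _ "p * q"]) simp
qed

lemma peval_polyfun: "peval p \<in> polyfun UNIV"
proof (induction p rule: mpoly_induct)
  case (const c)
  have "peval (const c) = (\<lambda>_. c)" by (simp add: fun_eq_iff)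
  then show ?case by (rule ssubst) (rule polyfun.const)
next
  case (coord i)
  have "peval (coord i) = (\<lambda>z. z $ i)" by (simp add: fun_eq_iff)
  then show ?case by (rule ssubst) (rule polyfun.coord[OF UNIV_I])
next
  case (add p q)
  have "peval (p + q) = (\<lambda>z. peval p z + peval q z)" by (simp add: fun_eq_iff)
  then show ?case by (rule ssubst) (rule polyfun.add[OF add.IH])
next
  case (mult p q)
  have "peval (p * q) = (\<lambda>z. peval p z * peval q z)" by (simp add: fun_eq_iff)
  then show ?case by (rule ssubst) (rule polyfun.mult[OF mult.IH])
qed

text \<open>The coefficients form an infinite sequence that is 0 beyond \<open>m\<close>, because
  the Cauchy product \<open>polynomial_product\<close> is stated for such sequences.\<close>

lemma polyfun_expand:
  assumes "f \<in> polyfun (insert i V)"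
  obtains a m where "\<And>j. a j \<in> polyfun V" "\<And>j z. j > m \<Longrightarrow> a j z = 0"
    "\<And>z. f z = (\<Sum>j\<le>m. a j z * (z $ i) ^ j)"
proof -
  have "\<exists>a m. (\<forall>j. a j \<in> polyfun V) \<and> (\<forall>j>m. \<forall>z. a j z = 0) \<and> (\<forall>z. f z = (\<Sum>j\<le>m. a j z * (z $ i) ^ j))"
    using assms
  proof (induction rule: polyfun.induct)
    case (const c)
    show ?case
      by (intro exI[of _ "\<lambda>j z. if j = 0 then c else 0"] exI[of _ 0]) (auto intro: polyfun.const)
  next
    case (coord k)
    show ?case
    proof (cases "k \<in> V")
      case True
      have "(\<lambda>z. if j = 0 then z $ k else 0) \<in> polyfun V" for j :: nat
        using polyfun.coord[OF True] polyfun.const[of 0 V] by (cases "j = 0") auto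
      then show ?thesis
        by (intro exI[of _ "\<lambda>j z. if j = 0 then z $ k else 0"] exI[of _ 0]) auto
    next
      case False
      then have "k = i" using coord by simp
      have "(\<lambda>z. if j = 1 then 1 else 0) \<in> polyfun V" for j :: nat
        using polyfun.const[of 0 V] polyfun.const[of 1 V] by (cases "j = 1") auto
      then show ?thesis
        by (intro exI[of _ "\<lambda>j z. if j = 1 then 1 else 0"] exI[of _ 1]) (auto simp: \<open>k = i\<close>)
    qed
  next
    case (add f g)
    then obtain a m b n where ab: "\<forall>j. a j \<in> polyfun V" "\<forall>j>m. \<forall>z. a j z = 0" "\<forall>z. f z = (\<Sum>j\<le>m. a j z * (z $ i) ^ j)"
      "\<forall>j. b j \<in> polyfun V" "\<forall>j>n. \<forall>z. b j z = 0" "\<forall>z. g z = (\<Sum>j\<le>n. b j z * (z $ i) ^ j)" by blast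
    have f: "f z = (\<Sum>j\<le>m+n. a j z * (z $ i) ^ j)" for z
      unfolding ab(3)[rule_format] by (rule sum.mono_neutral_left) (use ab in auto)
    have g: "g z = (\<Sum>j\<le>m+n. b j z * (z $ i) ^ j)" for z
      unfolding ab(6)[rule_format] by (rule sum.mono_neutral_left) (use ab in auto)
    show ?case
      using ab(1,2,4,5)
      by (intro exI[of _ "\<lambda>j z. a j z + b j z"] exI[of _ "m + n"])
         (auto simp: f g sum.distrib[symmetric] algebra_simps intro: polyfun.add)
  next
    case (mult f g)
    then obtain a m b n where ab: "\<forall>j. a j \<in> polyfun V" "\<forall>j>m. \<forall>z. a j z = 0" "\<forall>z. f z = (\<Sum>j\<le>m. a j z * (z $ i) ^ j)"
      "\<forall>j. b j \<in> polyfun V" "\<forall>j>n. \<forall>z. b j z = 0" "\<forall>z. g z = (\<Sum>j\<le>n. b j z * (z $ i) ^ j)" by blast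
    have fg: "f z * g z = (\<Sum>r\<le>m + n. (\<Sum>k\<le>r. a k z * b (r - k) z) * (z $ i) ^ r)" for z
      unfolding ab(3)[rule_format] ab(6)[rule_format]
      by (rule polynomial_product) (use ab in auto)
    have zero: "(\<Sum>k\<le>r. a k z * b (r - k) z) = 0" if "r > m + n" for r z
    proof (rule sum.neutral, rule ballI)
      fix k
      show "a k z * b (r - k) z = 0"
        using ab(2,5) that by (cases "k > m") auto
    qed
    show ?case
      using ab(1,4) zero fg
      by (intro exI[of _ "\<lambda>r z. \<Sum>k\<le>r. a k z * b (r - k) z"] exI[of _ "m + n"])
         (auto intro!: polyfun_sum polyfun.mult)
  qed
  then show ?thesis using that by blast
qed

text \<open>The trace of irreducibility on which the parametrization rests: polynomial functions on
  \<open>W\<close> form an integral domain. Its zero test is \<open>vn\<close>; algebra over its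
  fraction field is done with representatives and without division.\<close>

locale prime_function_set =
  fixes W :: "(complex ^ 'n::finite) set"
  assumes W_ne: "W \<noteq> {}"
    and W_prime: "\<And>f g. f \<in> polyfun UNIV \<Longrightarrow> g \<in> polyfun UNIV \<Longrightarrow> \<forall>w\<in>W. f w * g w = 0 \<Longrightarrow>
      (\<forall>w\<in>W. f w = 0) \<or> (\<forall>w\<in>W. g w = 0)"
begin

definition vn :: "(complex ^ 'n \<Rightarrow> complex) \<Rightarrow> bool" where
  "vn f \<longleftrightarrow> (\<forall>w\<in>W. f w = 0)"

lemma vn_prime:
  "f \<in> polyfun V \<Longrightarrow> g \<in> polyfun V' \<Longrightarrow> vn (\<lambda>z. f z * g z) \<Longrightarrow> vn f \<or> vn g"
  using W_prime[of f g] polyfun_mono[of f V UNIV] polyfun_mono[of g V' UNIV] by (auto simp: vn_def)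

lemma vn_power: "f \<in> polyfun V \<Longrightarrow> vn (\<lambda>z. f z ^ k) \<Longrightarrow> vn f"
  using W_ne by (cases "k = 0") (auto simp: vn_def)

text \<open>The elimination of \<open>homogeneous_system_nontrivial\<close> over the domain of
  polynomial functions modulo \<open>vn\<close>. In the absence of division the pivot coefficient is
  cross-multiplied, and primality keeps the solution nonzero.\<close>

lemma homogeneous_system_mod:
  fixes q :: "'a \<Rightarrow> 'k \<Rightarrow> complex ^ 'n \<Rightarrow> complex"
  assumes "finite A" "finite T" "card A < card T" "\<And>a \<alpha>. q a \<alpha> \<in> polyfun V"
  shows "\<exists>c. (\<forall>a. c a \<in> polyfun V) \<and> (\<exists>a\<in>T. \<not> vn (c a)) \<and> (\<forall>\<alpha>\<in>A. vn (\<lambda>z. \<Sum>a\<in>T. c a z * q a \<alpha> z))"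
  using assms
proof (induction A arbitrary: T q rule: finite_induct)
  case empty
  then have "T \<noteq> {}" by auto
  then show ?case using W_ne
    by (intro exI[of _ "\<lambda>_ _. 1"]) (auto simp: vn_def intro: polyfun.const)
next
  case (insert \<beta> A)
  show ?case
  proof (cases "\<forall>a\<in>T. vn (q a \<beta>)")
    case True
    have "card A < card T" using insert by simp
    from insert.IH[OF insert.prems(1) this, of q] insert.prems(3) obtain c
      where "\<forall>a. c a \<in> polyfun V" "\<exists>a\<in>T. \<not> vn (c a)" "\<forall>\<alpha>\<in>A. vn (\<lambda>z. \<Sum>a\<in>T. c a z * q a \<alpha> z)" by blast
    then show ?thesis using True by (intro exI[of _ c]) (auto simp: vn_def)
  next
    case False
    then obtain a0 where a0: "a0 \<in> T" "\<not> vn (q a0 \<beta>)" by blast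
    define T' where "T' = T - {a0}"
    have T': "T = insert a0 T'" "a0 \<notin> T'" "finite T'" using a0 insert.prems by (auto simp: T'_def)
    have card: "card A < card T'" using insert T' by simp
    define q' where "q' a \<alpha> = (\<lambda>z. q a0 \<beta> z * q a \<alpha> z - q a \<beta> z * q a0 \<alpha> z)" for a \<alpha>
    have q'V: "q' a \<alpha> \<in> polyfun V" for a \<alpha>
      unfolding q'_def by (intro polyfun_diff polyfun.mult insert.prems)
    from insert.IH[OF T'(3) card, of q', OF q'V] obtain c where cV: "\<forall>a. c a \<in> polyfun V"
      and c: "\<exists>a\<in>T'. \<not> vn (c a)" "\<forall>\<alpha>\<in>A. vn (\<lambda>z. \<Sum>a\<in>T'. c a z * q' a \<alpha> z)" by blast
    define c' where "c' a = (if a = a0 then (\<lambda>z. (\<Sum>a\<in>T'. c a z * (- 1 * q a \<beta> z))) else (\<lambda>z. q a0 \<beta> z * c a z))" for a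
    have c'V: "c' a \<in> polyfun V" for a
    proof -
      have "(\<lambda>z. \<Sum>a\<in>T'. c a z * (- 1 * q a \<beta> z)) \<in> polyfun V"
        by (intro polyfun_sum polyfun.mult polyfun.const insert.prems cV[rule_format])
      moreover have "(\<lambda>z. q a0 \<beta> z * c a z) \<in> polyfun V"
        by (intro polyfun.mult insert.prems cV[rule_format])
      ultimately show ?thesis unfolding c'_def by (cases "a = a0") auto
    qed
    have sum: "(\<Sum>a\<in>T. c' a z * q a \<alpha> z) = (\<Sum>a\<in>T'. c a z * q' a \<alpha> z)" for \<alpha> z
    proof -
      have "(\<Sum>a\<in>T'. c' a z * q a \<alpha> z) = (\<Sum>a\<in>T'. q a0 \<beta> z * c a z * q a \<alpha> z)"
        using T'(2) by (intro sum.cong) (auto simp: c'_def)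
      then have "(\<Sum>a\<in>T. c' a z * q a \<alpha> z) = (\<Sum>a\<in>T'. c a z * (- 1 * q a \<beta> z)) * q a0 \<alpha> z + (\<Sum>a\<in>T'. q a0 \<beta> z * c a z * q a \<alpha> z)"
        using T' by (simp add: c'_def)
      also have "\<dots> = (\<Sum>a\<in>T'. c a z * (- 1 * q a \<beta> z) * q a0 \<alpha> z + q a0 \<beta> z * c a z * q a \<alpha> z)"
        by (simp only: sum_distrib_right sum.distrib)
      also have "\<dots> = (\<Sum>a\<in>T'. c a z * q' a \<alpha> z)"
        by (intro sum.cong refl) (simp add: q'_def algebra_simps)
      finally show ?thesis .
    qed
    have "vn (\<lambda>z. \<Sum>a\<in>T. c' a z * q a \<alpha> z)" if "\<alpha> \<in> insert \<beta> A" for \<alpha>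
    proof (cases "\<alpha> = \<beta>")
      case True
      then show ?thesis unfolding sum by (simp add: q'_def vn_def)
    next
      case False
      then show ?thesis unfolding sum using c(2) that by blast
    qed
    moreover have "\<exists>a\<in>T. \<not> vn (c' a)"
    proof -
      obtain a where a: "a \<in> T'" "\<not> vn (c a)" using c(1) by blast
      then have "\<not> vn (c' a)"
        using vn_prime[OF insert.prems(3)[of a0 \<beta>] cV[rule_format, of a]] a0(2) T'(2) by (auto simp: c'_def)
      then show ?thesis using a(1) T'(1) by blast
    qed
    ultimately show ?thesis using c'V by blast
  qed
qed

end

text \<open>\<open>x\<^sub>i\<close> is algebraic over \<open>polyfun V\<close>, with an equation of minimal degree
  \<open>m\<close> and coefficients \<open>a\<close>.\<close>

locale algebraic_step = prime_function_set W for W :: "(complex ^ 'n::finite) set" +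
  fixes V :: "'n set" and i :: 'n and a :: "nat \<Rightarrow> complex ^ 'n \<Rightarrow> complex" and m :: nat
  assumes iV: "i \<notin> V" and aV: "\<And>j. a j \<in> polyfun V"
    and F_vn: "vn (\<lambda>z. \<Sum>j\<le>m. a j z * (z $ i) ^ j)" and am: "\<not> vn (a m)"
    and Min: "\<And>b k j. k < m \<Longrightarrow> (\<And>j. b j \<in> polyfun V) \<Longrightarrow> vn (\<lambda>z. \<Sum>j\<le>k. b j z * (z $ i) ^ j) \<Longrightarrow> j \<le> k \<Longrightarrow> vn (b j)"
begin

definition F :: "complex ^ 'n \<Rightarrow> complex" where "F z = (\<Sum>j\<le>m. a j z * (z $ i) ^ j)"

lemma m_pos: "m > 0"
proof (rule ccontr)
  assume "\<not> m > 0"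
  then show False using F_vn am by (simp add: vn_def)
qed

lemma polyfun_insert: "f \<in> polyfun V \<Longrightarrow> f \<in> polyfun (insert i V)"
  by (rule polyfun_mono) auto

lemma vn_remainder:
  assumes "\<And>j. r j \<in> polyfun V" "vn (\<lambda>z. \<Sum>j<m. r j z * (z $ i) ^ j)" "j < m"
  shows "vn (r j)"
proof -
  have "{..<m} = {..m - 1}" using m_pos by auto
  then show ?thesis using Min[of "m - 1" r j] assms m_pos by simp
qed

text \<open>Pseudo-division by the minimal equation \<open>F\<close>: the leading coefficient
  \<open>a m\<close> is not invertible, hence its power on the left. On \<open>W\<close>, where
  \<open>F\<close> vanishes, the remainder of degree less than \<open>m\<close> in
  \<open>z $ i\<close> equals \<open>a m z ^ N * g z\<close>.\<close>

definition has_remainder :: "(complex ^ 'n \<Rightarrow> complex) \<Rightarrow> bool" where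
  "has_remainder g \<longleftrightarrow> (\<exists>N q r. q \<in> polyfun (insert i V) \<and> (\<forall>j. r j \<in> polyfun V) \<and>
     (\<forall>z. a m z ^ N * g z = q z * F z + (\<Sum>j<m. r j z * (z $ i) ^ j)))"

lemma has_remainder_add:
  assumes "has_remainder f" "has_remainder g" shows "has_remainder (\<lambda>z. f z + g z)"
proof -
  obtain N q r where 1: "q \<in> polyfun (insert i V)" "\<forall>j. r j \<in> polyfun V"
     "\<forall>z. a m z ^ N * f z = q z * F z + (\<Sum>j<m. r j z * (z $ i) ^ j)"
    using assms(1) unfolding has_remainder_def by blast
  obtain N' q' r' where 2: "q' \<in> polyfun (insert i V)" "\<forall>j. r' j \<in> polyfun V"
     "\<forall>z. a m z ^ N' * g z = q' z * F z + (\<Sum>j<m. r' j z * (z $ i) ^ j)"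
    using assms(2) unfolding has_remainder_def by blast
  have "a m z ^ (N + N') * (f z + g z) = (a m z ^ N' * q z + a m z ^ N * q' z) * F z
      + (\<Sum>j<m. (a m z ^ N' * r j z + a m z ^ N * r' j z) * (z $ i) ^ j)" for z
  proof -
    have "a m z ^ (N + N') * (f z + g z) = a m z ^ N' * (a m z ^ N * f z) + a m z ^ N * (a m z ^ N' * g z)"
      by (simp add: power_add algebra_simps)
    also have "\<dots> = a m z ^ N' * (q z * F z + (\<Sum>j<m. r j z * (z $ i) ^ j))
        + a m z ^ N * (q' z * F z + (\<Sum>j<m. r' j z * (z $ i) ^ j))"
      using 1(3) 2(3) by simp
    also have "\<dots> = (a m z ^ N' * q z + a m z ^ N * q' z) * F z
      + (\<Sum>j<m. (a m z ^ N' * r j z + a m z ^ N * r' j z) * (z $ i) ^ j)"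
      by (simp add: sum.distrib sum_distrib_left algebra_simps)
    finally show ?thesis .
  qed
  moreover have "(\<lambda>z. a m z ^ N' * q z + a m z ^ N * q' z) \<in> polyfun (insert i V)"
    by (intro polyfun.add polyfun.mult polyfun_power polyfun_insert aV 1 2)
  moreover have "(\<lambda>z. a m z ^ N' * r j z + a m z ^ N * r' j z) \<in> polyfun V" for j
    using 1(2) 2(2) by (intro polyfun.add polyfun.mult polyfun_power aV) auto
  ultimately show ?thesis
    unfolding has_remainder_def
    by (intro exI[of _ "N + N'"] exI[of _ "\<lambda>z. a m z ^ N' * q z + a m z ^ N * q' z"]
        exI[of _ "\<lambda>j z. a m z ^ N' * r j z + a m z ^ N * r' j z"]) auto
qed

lemma has_remainder_smult:
  assumes "c \<in> polyfun V" "has_remainder f" shows "has_remainder (\<lambda>z. c z * f z)"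
proof -
  obtain N q r where 1: "q \<in> polyfun (insert i V)" "\<forall>j. r j \<in> polyfun V"
     "\<forall>z. a m z ^ N * f z = q z * F z + (\<Sum>j<m. r j z * (z $ i) ^ j)"
    using assms(2) unfolding has_remainder_def by blast
  have "a m z ^ N * (c z * f z) = (c z * q z) * F z + (\<Sum>j<m. (c z * r j z) * (z $ i) ^ j)" for z
  proof -
    have "a m z ^ N * (c z * f z) = c z * (a m z ^ N * f z)" by simp
    also have "\<dots> = (c z * q z) * F z + (\<Sum>j<m. (c z * r j z) * (z $ i) ^ j)"
      unfolding 1(3)[rule_format] by (simp add: sum_distrib_left algebra_simps)
    finally show ?thesis .
  qed
  moreover have "(\<lambda>z. c z * q z) \<in> polyfun (insert i V)"
    by (intro polyfun.mult polyfun_insert[OF assms(1)] 1)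
  moreover have "(\<lambda>z. c z * r j z) \<in> polyfun V" for j
    using 1(2) by (intro polyfun.mult assms(1)) auto
  ultimately show ?thesis
    unfolding has_remainder_def
    by (intro exI[of _ N] exI[of _ "\<lambda>z. c z * q z"] exI[of _ "\<lambda>j z. c z * r j z"]) auto
qed

lemma has_remainder_power: "has_remainder (\<lambda>z. (z $ i) ^ k)"
proof (induction k)
  case 0
  have "(\<Sum>j<m. (if j = 0 then 1 else 0) * (z $ i) ^ j) = 1" for z :: "complex ^ 'n"
  proof -
    have "(\<Sum>j<m. (if j = 0 then 1 else 0) * (z $ i) ^ j) = (\<Sum>j<m. if j = 0 then 1 else 0)"
      by (intro sum.cong) auto
    then show ?thesis using m_pos by simp
  qed
  moreover have "(\<lambda>z. if j = 0 then 1 else 0) \<in> polyfun V" for j :: nat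
    using polyfun.const[of 0 V] polyfun.const[of 1 V] by (cases "j = 0") auto
  ultimately show ?case
    unfolding has_remainder_def
    by (intro exI[of _ 0] exI[of _ "\<lambda>_. 0"] exI[of _ "\<lambda>j z. if j = 0 then 1 else 0"]) (auto intro: polyfun.const)
next
  case (Suc k)
  then obtain N q r where 1: "q \<in> polyfun (insert i V)" "\<forall>j. r j \<in> polyfun V"
     "\<And>z. a m z ^ N * (z $ i) ^ k = q z * F z + (\<Sum>j<m. r j z * (z $ i) ^ j)"
    unfolding has_remainder_def by blast
  obtain l where l: "m = Suc l" using m_pos by (cases m) auto
  \<comment> \<open>The old remainder times \<open>a m\<close> and the coordinate, with the top
    term, of degree \<open>m = Suc l\<close>, reduced by means of \<open>F\<close>.\<close>
  define r' where "r' j = (\<lambda>z. a m z * (if j = 0 then 0 else r (j - 1) z) - r l z * a j z)" for j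
  have "a m z ^ Suc N * (z $ i) ^ Suc k = (a m z * (z $ i * q z) + r l z) * F z + (\<Sum>j<m. r' j z * (z $ i) ^ j)" for z
  proof -
    let ?x = "z $ i"
    have "a m z ^ Suc N * ?x ^ Suc k = a m z * ?x * (a m z ^ N * ?x ^ k)" by simp
    also have "\<dots> = (a m z * (?x * q z)) * F z + a m z * (\<Sum>j<m. r j z * ?x ^ Suc j)"
      unfolding 1(3) by (simp add: sum_distrib_left algebra_simps)
    also have "(\<Sum>j<m. r j z * ?x ^ Suc j) = (\<Sum>j<l. r j z * ?x ^ Suc j) + r l z * ?x ^ m"
      by (simp add: l)
    also have "a m z * ((\<Sum>j<l. r j z * ?x ^ Suc j) + r l z * ?x ^ m)
        = a m z * (\<Sum>j<l. r j z * ?x ^ Suc j) + r l z * (F z - (\<Sum>j<m. a j z * ?x ^ j))"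
    proof -
      have "F z = (\<Sum>j<m. a j z * ?x ^ j) + a m z * ?x ^ m"
        unfolding F_def by (simp flip: lessThan_Suc_atMost)
      then show ?thesis by (simp add: algebra_simps)
    qed
    also have "(\<Sum>j<l. r j z * ?x ^ Suc j) = (\<Sum>j<m. (if j = 0 then 0 else r (j - 1) z) * ?x ^ j)"
      unfolding l sum.lessThan_Suc_shift by simp
    finally show ?thesis
      by (simp add: r'_def sum_distrib_left sum_subtractf algebra_simps)
  qed
  moreover have "(\<lambda>z. a m z * (z $ i * q z) + r l z) \<in> polyfun (insert i V)"
    using 1(2)
    by (intro polyfun.add polyfun.mult[OF polyfun_insert[OF aV] polyfun.mult[OF polyfun.coord 1(1)]] polyfun_insert) auto
  moreover have "r' j \<in> polyfun V" for j
  proof -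
    have "(\<lambda>z. if j = 0 then 0 else r (j - 1) z) \<in> polyfun V"
      using 1(2) polyfun.const[of 0 V] by (cases "j = 0") auto
    then show ?thesis unfolding r'_def using 1(2) by (intro polyfun_diff polyfun.mult aV) auto
  qed
  ultimately show ?case
    unfolding has_remainder_def
    by (intro exI[of _ "Suc N"] exI[of _ "\<lambda>z. a m z * (z $ i * q z) + r l z"] exI[of _ r']) auto
qed

lemma has_remainder_polyfun:
  assumes "g \<in> polyfun (insert i V)" shows "has_remainder g"
proof -
  obtain b k where b: "\<And>j. b j \<in> polyfun V" "\<And>z. g z = (\<Sum>j\<le>k. b j z * (z $ i) ^ j)"
    using polyfun_expand[OF assms] by metis
  have zero: "has_remainder (\<lambda>_. 0)"
    using has_remainder_smult[OF polyfun.const[of 0] has_remainder_power[of 0]] by simp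
  have "has_remainder (\<lambda>z. \<Sum>j\<in>J. b j z * (z $ i) ^ j)" for J
    by (induction J rule: infinite_finite_induct)
       (simp_all add: zero has_remainder_add has_remainder_smult has_remainder_power b)
  then show ?thesis using b(2) by presburger
qed

text \<open>\<open>P z\<close> replaces the coordinates in \<open>V\<close> by a generic point of \<open>W\<close>;
  every root of the minimal equation over it behaves like the \<open>i\<close>-th coordinate.\<close>

lemma vn_at_root:
  assumes g: "g \<in> polyfun (insert i V)" "vn g"
    and p: "\<And>f. f \<in> polyfun V \<Longrightarrow> vn f \<Longrightarrow> f p = 0" "a m p \<noteq> 0" "F p = 0"
  shows "g p = 0"
proof -
  obtain N q r where 1: "q \<in> polyfun (insert i V)" "\<And>j. r j \<in> polyfun V"
     "\<And>z. a m z ^ N * g z = q z * F z + (\<Sum>j<m. r j z * (z $ i) ^ j)"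
    using has_remainder_polyfun[OF g(1)] unfolding has_remainder_def by blast
  have "vn (\<lambda>z. \<Sum>j<m. r j z * (z $ i) ^ j)"
    unfolding vn_def
  proof
    fix w assume "w \<in> W"
    then have "g w = 0" "F w = 0" using g(2) F_vn by (auto simp: vn_def F_def)
    then show "(\<Sum>j<m. r j w * (w $ i) ^ j) = 0" using 1(3)[of w] by simp
  qed
  \<comment> \<open>A remainder that vanishes on \<open>W\<close> has degree below \<open>m\<close>,
    so by minimality its coefficients vanish on \<open>W\<close>; and \<open>p\<close> satisfies
    every relation over \<open>polyfun V\<close> that holds on \<open>W\<close>.\<close>
  then have "r j p = 0" if "j < m" for j
    using vn_remainder[of r j] 1(2) that p(1) by blast
  then have "a m p ^ N * g p = 0" using 1(3)[of p] p(3) by simp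
  then show ?thesis using p(2) by simp
qed

text \<open>\<open>h\<close> is algebraic over \<open>polyfun V\<close> modulo \<open>W\<close>: the
  remainders of its powers up to the \<open>m\<close>-th have only \<open>m\<close> coefficients
  each and are therefore dependent. Once the constant coefficient of such an equation is nonzero on
  \<open>W\<close>, it is a multiple of \<open>h\<close> there. This transfers nonvanishing from
  functions of one more coordinate down to \<open>polyfun V\<close>.\<close>

lemma Bezout:
  assumes h: "h \<in> polyfun (insert i V)" "\<not> vn h"
  obtains c u where "c \<in> polyfun V" "u \<in> polyfun (insert i V)" "\<not> vn c" "vn (\<lambda>z. c z - u z * h z)"
proof -
  have rem: "\<forall>k. has_remainder (\<lambda>z. h z ^ k)"
    using has_remainder_polyfun[OF polyfun_power[OF h(1)]] by blast
  define R where "R k N q r \<longleftrightarrow> q \<in> polyfun (insert i V) \<and> (\<forall>j. r j \<in> polyfun V) \<and>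
     (\<forall>z. a m z ^ N * h z ^ k = q z * F z + (\<Sum>j<m. r j z * (z $ i) ^ j))" for k N q r
  have "\<forall>k. \<exists>N q r. R k N q r"
    using rem unfolding has_remainder_def R_def .
  then obtain N q r where R: "\<And>k. R k (N k) (q k) (r k)" by metis
  have 1: "\<And>k. q k \<in> polyfun (insert i V)" "\<And>k j. r k j \<in> polyfun V"
     "\<And>k z. a m z ^ N k * h z ^ k = q k z * F z + (\<Sum>j<m. r k j z * (z $ i) ^ j)"
    using R unfolding R_def by blast+
  obtain c where c: "\<forall>k. c k \<in> polyfun V" "\<exists>k\<in>{..m}. \<not> vn (c k)"
    "\<forall>j\<in>{..<m}. vn (\<lambda>z. \<Sum>k\<in>{..m}. c k z * r k j z)"
    using homogeneous_system_mod[of "{..<m}" "{..m}" r V] 1(2) by auto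
  define d where "d k = (\<lambda>z. c k z * a m z ^ N k)" for k
  have dV: "d k \<in> polyfun V" for k
    unfolding d_def using c(1) by (intro polyfun.mult polyfun_power aV) auto
  have d_vn: "vn (\<lambda>z. \<Sum>k\<le>m. d k z * h z ^ k)"
    unfolding vn_def
  proof
    fix w assume w: "w \<in> W"
    then have F0: "F w = 0" using F_vn by (auto simp: vn_def F_def)
    have "(\<Sum>k\<le>m. d k w * h w ^ k) = (\<Sum>k\<le>m. \<Sum>j<m. c k w * r k j w * (w $ i) ^ j)"
      using 1(3)[of w] F0 by (intro sum.cong refl) (simp add: d_def mult.assoc sum_distrib_left)
    also have "\<dots> = (\<Sum>j<m. (\<Sum>k\<le>m. c k w * r k j w) * (w $ i) ^ j)"
      by (subst sum.swap) (simp add: sum_distrib_right)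
    also have "\<dots> = 0" using c(3) w by (intro sum.neutral) (auto simp: vn_def)
    finally show "(\<Sum>k\<le>m. d k w * h w ^ k) = 0" .
  qed
  obtain k0 where k0: "k0 \<le> m" "\<not> vn (d k0)"
  proof -
    obtain k where k: "k \<le> m" "\<not> vn (c k)" using c(2) by auto
    have "\<not> vn (d k)"
      using vn_prime[OF c(1)[rule_format, of k] polyfun_power[OF aV], of m "N k"] k(2) vn_power[OF aV, of m "N k"] am
      by (auto simp: d_def)
    then show ?thesis using that k by blast
  qed
  text \<open>Cancelling powers of \<open>h\<close>, we may assume that the constant coefficient does not vanish.\<close>
  have "\<exists>d K. (\<forall>k. d k \<in> polyfun V) \<and> \<not> vn (d 0) \<and> vn (\<lambda>z. \<Sum>k\<le>K. d k z * h z ^ k)"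
    using dV d_vn k0
  proof (induction m arbitrary: d k0)
    case 0
    then show ?case by (intro exI[of _ d] exI[of _ 0]) auto
  next
    case (Suc K)
    show ?case
    proof (cases "vn (d 0)")
      case False
      then show ?thesis using Suc.prems by (intro exI[of _ d] exI[of _ "Suc K"]) auto
    next
      case True
      have e: "(\<Sum>k\<le>Suc K. d k z * h z ^ k) = d 0 z + h z * (\<Sum>k\<le>K. d (Suc k) z * h z ^ k)" for z
        unfolding sum.atMost_Suc_shift by (simp add: sum_distrib_left algebra_simps)
      have sV: "(\<lambda>z. \<Sum>k\<le>K. d (Suc k) z * h z ^ k) \<in> polyfun (insert i V)"
        using Suc.prems by (intro polyfun_sum polyfun.mult polyfun_power h polyfun_insert) auto
      have "vn (\<lambda>z. h z * (\<Sum>k\<le>K. d (Suc k) z * h z ^ k))"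
        using True Suc.prems(2) unfolding vn_def e by simp
      then have "vn (\<lambda>z. \<Sum>k\<le>K. d (Suc k) z * h z ^ k)"
        using vn_prime[OF h(1) sV] h(2) by blast
      moreover have "k0 \<noteq> 0" using True Suc.prems(4) by metis
      then have "k0 - 1 \<le> K" "\<not> vn (d (Suc (k0 - 1)))" using Suc.prems(3,4) by auto
      ultimately show ?thesis using Suc.IH[of "\<lambda>k. d (Suc k)" "k0 - 1"] Suc.prems(1) by blast
    qed
  qed
  then obtain d K where d: "\<And>k. d k \<in> polyfun V" "\<not> vn (d 0)" "vn (\<lambda>z. \<Sum>k\<le>K. d k z * h z ^ k)" by blast
  define u where "u z = (- 1) * (\<Sum>k<K. d (Suc k) z * h z ^ k)" for z
  have "(\<Sum>k\<le>K. d k z * h z ^ k) = d 0 z - u z * h z" for z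
    unfolding u_def lessThan_Suc_atMost[symmetric] sum.lessThan_Suc_shift
    by (simp add: sum_distrib_left sum_distrib_right sum_negf mult_ac)
  then have "vn (\<lambda>z. d 0 z - u z * h z)" using d(3) by simp
  moreover have "u \<in> polyfun (insert i V)"
    unfolding u_def[abs_def] using d(1)
    by (intro polyfun_sum polyfun.mult polyfun.const polyfun_power h polyfun_insert) auto
  ultimately show ?thesis using that d by blast
qed

end

section \<open>Norms, complex lines, and polynomial functions along curves\<close>

lemma norm_vector_scalar_mult: "norm (s *s (b :: complex ^ 'n::finite)) = cmod s * norm b"
  by (simp add: norm_vec_def L2_set_def power_mult_distrib norm_mult sum_distrib_left[symmetric] real_sqrt_mult)

lemma norm_axis_complex: "norm (axis i s :: complex ^ 'n::finite) = cmod s"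
proof -
  have "(\<Sum>j\<in>UNIV. (cmod ((axis i s :: complex ^ 'n) $ j))\<^sup>2) = (\<Sum>j\<in>UNIV. if j = i then (cmod s)\<^sup>2 else 0)"
    by (intro sum.cong) (auto simp: axis_def)
  then show ?thesis by (simp add: norm_vec_def L2_set_def)
qed

lemma open_line: "open {s. a + s *s (b :: complex ^ 'n::finite) \<in> ball z r}"
proof -
  have "continuous_on UNIV (\<lambda>s. a + s *s b)"
    unfolding plus_vec_def vector_scalar_mult_def by (auto intro!: continuous_intros)
  then have "open ((\<lambda>s. a + s *s b) -` ball z r)"
    by (simp add: open_vimage)
  then show ?thesis by (simp add: vimage_def)
qed

lemma convex_line: "convex {s. a + s *s (b :: complex ^ 'n::finite) \<in> ball z r}"
  unfolding convex_def
proof (intro ballI allI impI, unfold mem_Collect_eq)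
  fix s t and u v :: real
  assume s: "a + s *s b \<in> ball z r" and t: "a + t *s b \<in> ball z r" and uv: "0 \<le> u" "0 \<le> v" "u + v = 1"
  have v: "v = 1 - u" using uv by simp
  have "a + (u *\<^sub>R s + v *\<^sub>R t) *s b = u *\<^sub>R (a + s *s b) + v *\<^sub>R (a + t *s b)"
    by (simp add: vec_eq_iff v scaleR_conv_of_real[where 'a = complex] algebra_simps)
  also have "\<dots> \<in> ball z r" using s t uv convex_ball by (meson convexD)
  finally show "a + (u *\<^sub>R s + v *\<^sub>R t) *s b \<in> ball z r" .
qed

lemma polyfun_holomorphic:
  "f \<in> polyfun V \<Longrightarrow> (\<And>j. j \<in> V \<Longrightarrow> (\<lambda>s. \<gamma> s $ j) holomorphic_on S) \<Longrightarrow> (\<lambda>s. f (\<gamma> s)) holomorphic_on S"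
  by (induction rule: polyfun.induct) (auto intro: holomorphic_intros)

lemma polyfun_continuous:
  "f \<in> polyfun V \<Longrightarrow> (\<And>j. j \<in> V \<Longrightarrow> continuous_on S (\<lambda>s. \<gamma> s $ j)) \<Longrightarrow> continuous_on S (\<lambda>s. f (\<gamma> s))"
  by (induction rule: polyfun.induct) (auto intro: continuous_intros)

text \<open>\<open>\<phi>\<close> is a local analytic parametrization of the projection of \<open>W\<close> to
  the coordinates in \<open>V\<close>, by the coordinates in \<open>V\<close> of the parameter.\<close>

definition (in prime_function_set) parametrizes where
  "parametrizes V \<phi> U \<longleftrightarrow>
     (\<forall>j\<in>V. continuous_on U (\<lambda>z :: complex ^ 'n. \<phi> z $ j))
   \<and> (\<forall>j\<in>V. \<forall>a b. (\<lambda>s. \<phi> (a + s *s b) $ j) holomorphic_on {s. a + s *s b \<in> U})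
   \<and> (\<forall>j\<in>V. \<forall>k. k \<notin> V \<longrightarrow> (\<forall>z\<in>U. \<forall>s. z + axis k s \<in> U \<longrightarrow> \<phi> (z + axis k s) $ j = \<phi> z $ j))
   \<and> (\<forall>f\<in>polyfun V. vn f \<longleftrightarrow> (\<forall>z\<in>U. f (\<phi> z) = 0))"

context prime_function_set
begin

lemma parametrizesD:
  assumes "parametrizes V \<phi> U"
  shows "\<And>j. j \<in> V \<Longrightarrow> continuous_on U (\<lambda>z. \<phi> z $ j)"
    "\<And>j a b. j \<in> V \<Longrightarrow> (\<lambda>s. \<phi> (a + s *s b) $ j) holomorphic_on {s. a + s *s b \<in> U}"
    "\<And>j k z s. j \<in> V \<Longrightarrow> k \<notin> V \<Longrightarrow> z \<in> U \<Longrightarrow> z + axis k s \<in> U \<Longrightarrow> \<phi> (z + axis k s) $ j = \<phi> z $ j"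
    "\<And>f. f \<in> polyfun V \<Longrightarrow> vn f \<longleftrightarrow> (\<forall>z\<in>U. f (\<phi> z) = 0)"
  using assms unfolding parametrizes_def by blast+

text \<open>A polynomial function that vanishes over the small ball vanishes along each complex line
  through its centre \<open>z1\<close>, by the identity theorem in one variable; these lines reach
  every point of the large ball.\<close>

lemma parametrizes_shrink:
  assumes p: "parametrizes V \<phi> (ball z0 r)" and sub: "ball z1 r1 \<subseteq> ball z0 r" and r1: "r1 > 0"
  shows "parametrizes V \<phi> (ball z1 r1)"
  unfolding parametrizes_def
proof (intro conjI ballI allI impI)
  note D = parametrizesD[OF p]
  show "continuous_on (ball z1 r1) (\<lambda>z. \<phi> z $ j)" if "j \<in> V" for j
    using D(1)[OF that] sub by (rule continuous_on_subset)
  show "(\<lambda>s. \<phi> (a + s *s b) $ j) holomorphic_on {s. a + s *s b \<in> ball z1 r1}" if "j \<in> V" for j a b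
    using D(2)[OF that] by (rule holomorphic_on_subset) (use sub in auto)
  show "\<phi> (z + axis k s) $ j = \<phi> z $ j" if "j \<in> V" "k \<notin> V" "z \<in> ball z1 r1" "z + axis k s \<in> ball z1 r1" for j k z s
    using that sub by (intro D(3)) auto
  fix f assume f: "f \<in> polyfun V"
  show "vn f \<longleftrightarrow> (\<forall>z\<in>ball z1 r1. f (\<phi> z) = 0)"
  proof
    assume "vn f"
    then show "\<forall>z\<in>ball z1 r1. f (\<phi> z) = 0" using D(4)[OF f] sub by blast
  next
    assume zero: "\<forall>z\<in>ball z1 r1. f (\<phi> z) = 0"
    have "f (\<phi> z) = 0" if z: "z \<in> ball z0 r" for z
    proof -
      let ?S = "{s. z1 + s *s (z - z1) \<in> ball z0 r}" and ?S' = "{s. z1 + s *s (z - z1) \<in> ball z1 r1}"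
      have "f (\<phi> (z1 + 1 *s (z - z1))) = 0"
      proof (rule analytic_continuation_open[of ?S' ?S "\<lambda>s. f (\<phi> (z1 + s *s (z - z1)))" "\<lambda>_. 0" 1])
        show "open ?S'" "open ?S" by (rule open_line)+
        have "0 \<in> ?S'" using r1 by simp
        then show "?S' \<noteq> {}" by blast
        show "connected ?S" by (rule convex_connected[OF convex_line])
        show "?S' \<subseteq> ?S" using sub by auto
        show "(\<lambda>s. f (\<phi> (z1 + s *s (z - z1)))) holomorphic_on ?S"
          by (rule polyfun_holomorphic[OF f D(2)])
        show "(\<lambda>_. 0) holomorphic_on ?S" by (rule holomorphic_on_const)
        show "f (\<phi> (z1 + s *s (z - z1))) = 0" if "s \<in> ?S'" for s using that zero by simp
        show "1 \<in> ?S" using z by simp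
      qed
      then show ?thesis by simp
    qed
    then show "vn f" using D(4)[OF f] by blast
  qed
qed

text \<open>If \<open>z $ i\<close> satisfies no equation over \<open>polyfun V\<close>, the
  parameter itself serves as the new coordinate. Moving it leaves the coordinates in
  \<open>V\<close> of \<open>\<phi> z\<close> fixed, so a polynomial vanishing on the image has
  infinitely many roots in it, and all its coefficients vanish.\<close>

lemma parametrization_transcendental_step:
  assumes p: "parametrizes V \<phi> (ball z0 r)" and r: "r > 0" and iV: "i \<notin> V"
    and trans: "\<And>b k j. (\<And>j. b j \<in> polyfun V) \<Longrightarrow> vn (\<lambda>z. \<Sum>j\<le>k. b j z * (z $ i) ^ j) \<Longrightarrow> j \<le> k \<Longrightarrow> vn (b j)"
  shows "parametrizes (insert i V) (\<lambda>z. \<chi> j. if j = i then z $ i else \<phi> z $ j) (ball z0 r)"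
    (is "parametrizes _ ?\<psi> _")
  unfolding parametrizes_def
proof (intro conjI ballI allI impI)
  note D = parametrizesD[OF p]
  show "continuous_on (ball z0 r) (\<lambda>z. ?\<psi> z $ j)" if "j \<in> insert i V" for j
    using that D(1)[of j] by (cases "j = i") (auto intro: continuous_intros)
  show "(\<lambda>s. ?\<psi> (a + s *s b) $ j) holomorphic_on {s. a + s *s b \<in> ball z0 r}" if "j \<in> insert i V" for j a b
    using that D(2)[of j a b] by (cases "j = i") (auto intro!: holomorphic_intros)
  show "?\<psi> (z + axis k s) $ j = ?\<psi> z $ j"
    if "j \<in> insert i V" "k \<notin> insert i V" "z \<in> ball z0 r" "z + axis k s \<in> ball z0 r" for j k z s
    using that D(3)[of j k z s] by (cases "j = i") (auto simp: axis_def)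
  fix f assume f: "f \<in> polyfun (insert i V)"
  obtain b k where b: "\<And>j. b j \<in> polyfun V" "\<And>z. f z = (\<Sum>j\<le>k. b j z * (z $ i) ^ j)"
    using polyfun_expand[OF f] by metis
  have b\<psi>: "b j (?\<psi> z) = b j (\<phi> z)" for j z
    by (rule polyfun_dep[OF b(1)]) (use iV in auto)
  have f\<psi>: "f (?\<psi> z) = (\<Sum>j\<le>k. b j (\<phi> z) * (z $ i) ^ j)" for z
    unfolding b(2) b\<psi> by simp
  show "vn f \<longleftrightarrow> (\<forall>z\<in>ball z0 r. f (?\<psi> z) = 0)"
  proof
    assume "vn f"
    then have "vn (\<lambda>z. \<Sum>j\<le>k. b j z * (z $ i) ^ j)" by (simp add: vn_def b(2))
    then have "vn (b j)" if "j \<le> k" for j using trans[of b k j] b(1) that by blast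
    then have "b j (\<phi> z) = 0" if "j \<le> k" "z \<in> ball z0 r" for j z using D(4)[OF b(1)] that by blast
    then show "\<forall>z\<in>ball z0 r. f (?\<psi> z) = 0" unfolding f\<psi> by (auto intro!: sum.neutral)
  next
    assume zero: "\<forall>z\<in>ball z0 r. f (?\<psi> z) = 0"
    have "b j (\<phi> z) = 0" if j: "j \<le> k" and z: "z \<in> ball z0 r" for j z
    proof -
      define \<epsilon> where "\<epsilon> = r - dist z0 z"
      have \<epsilon>: "\<epsilon> > 0" using z by (simp add: \<epsilon>_def)
      have "(\<Sum>j\<le>k. b j (\<phi> z) * x ^ j) = 0" if x: "x \<in> ball (z $ i) \<epsilon>" for x
      proof -
        define s where "s = x - z $ i"
        have ns: "norm (axis i s :: complex ^ 'n) < \<epsilon>" using x by (simp add: s_def norm_axis_complex dist_norm norm_minus_commute)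
        have mem: "z + axis i s \<in> ball z0 r"
          using dist_triangle[of z0 "z + axis i s" z] ns by (simp add: \<epsilon>_def dist_norm)
        have "b l (\<phi> (z + axis i s)) = b l (\<phi> z)" for l
          using D(3)[OF _ iV z mem] by (rule polyfun_dep[OF b(1)])
        moreover have "(z + axis i s) $ i = x" by (simp add: s_def axis_def)
        ultimately show ?thesis using zero mem f\<psi>[of "z + axis i s"] by simp
      qed
      then have "ball (z $ i) \<epsilon> \<subseteq> {x. (\<Sum>j\<le>k. b j (\<phi> z) * x ^ j) = 0}" by blast
      moreover have "infinite (ball (z $ i) \<epsilon>)"
        using uncountable_ball[OF \<epsilon>] countable_finite by blast
      ultimately have "infinite {x. (\<Sum>j\<le>k. b j (\<phi> z) * x ^ j) = 0}"
        using finite_subset by blast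
      then show ?thesis using polyfun_finite_roots[where n = k and c = "\<lambda>j. b j (\<phi> z)"] j by blast
    qed
    then have "vn (b j)" if "j \<le> k" for j using D(4)[OF b(1)] that by blast
    then show "vn f" by (auto simp: vn_def b(2) intro!: sum.neutral)
  qed
qed

end

text \<open>The difference quotient of \<open>j\<close>-th powers as a polynomial, meaningful also
  for \<open>y = y'\<close>, where it is the derivative.\<close>

definition divided_power :: "nat \<Rightarrow> complex \<Rightarrow> complex \<Rightarrow> complex" where
  "divided_power j y y' = (\<Sum>p<j. y ^ p * y' ^ (j - Suc p))"

lemma divided_power: "y ^ j - y' ^ j = (y - y') * divided_power j y y'"
  by (cases j) (simp_all add: divided_power_def diff_power_eq_sum del: power_Suc)

lemma divided_power_same: "divided_power j y y = of_nat j * y ^ (j - 1)"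
proof -
  have "y ^ p * y ^ (j - Suc p) = y ^ (j - 1)" if "p < j" for p
    using that by (simp flip: power_add)
  then show ?thesis by (simp add: divided_power_def)
qed

context algebraic_step
begin

text \<open>An implicit function theorem along complex lines. The base point \<open>z1\<close> is
  chosen such that the equation has a simple root \<open>y1\<close> there. The difference quotient
  \<open>Q\<close> of the equation then stays away from 0 nearby and yields in turn existence,
  uniqueness, continuity and differentiability of the root \<open>Y z\<close>.\<close>

lemma parametrization_algebraic_step:
  assumes p: "parametrizes V \<phi> (ball z0 r)" and r: "r > 0"
  shows "\<exists>\<psi> z1 r1. r1 > 0 \<and> parametrizes (insert i V) \<psi> (ball z1 r1)"
proof -
  let ?U = "ball z0 r"
  note D = parametrizesD[OF p]
  define pt where "pt z y = (\<chi> j. if j = i then y else \<phi> z $ j)" for z y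
  have pt: "f (pt z y) = f (\<phi> z)" if "f \<in> polyfun V" for f z y
    by (rule polyfun_dep[OF that]) (use iV in \<open>auto simp: pt_def\<close>)
  have pt_i: "pt z y $ i = y" for z y by (simp add: pt_def)
  \<comment> \<open>Any root over a point where \<open>a m\<close> is nonzero satisfies all
    equations of \<open>W\<close> in the coordinates \<open>insert i V\<close>, so it does not
    matter which root is continued.\<close>
  have root: "g (pt z y) = 0"
    if "g \<in> polyfun (insert i V)" "vn g" "z \<in> ?U" "a m (\<phi> z) \<noteq> 0" "F (pt z y) = 0" for g z y
  proof (rule vn_at_root[OF that(1,2) _ _ that(5)])
    show "f (pt z y) = 0" if f: "f \<in> polyfun V" "vn f" for f
      using D(4)[OF f(1)] f(2) \<open>z \<in> ?U\<close> by (simp add: pt[OF f(1)])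
    show "a m (pt z y) \<noteq> 0" using that(4) by (simp add: pt[OF aV])
  qed
  define P where "P z y = (\<Sum>j\<le>m. a j (\<phi> z) * y ^ j)" for z y
  have FP: "F (pt z y) = P z y" for z y by (simp add: F_def P_def pt[OF aV] pt_i)
  define Q where "Q z y y' = (\<Sum>j\<le>m. a j (\<phi> z) * divided_power j y y')" for z y y'
  have PQ: "P z y - P z y' = (y - y') * Q z y y'" for z y y'
  proof -
    have "P z y - P z y' = (\<Sum>j\<le>m. a j (\<phi> z) * (y ^ j - y' ^ j))"
      by (simp add: P_def sum_subtractf right_diff_distrib)
    also have "\<dots> = (\<Sum>j\<le>m. a j (\<phi> z) * ((y - y') * divided_power j y y'))"
      by (simp only: divided_power)
    also have "\<dots> = (y - y') * Q z y y'"
      by (simp add: Q_def sum_distrib_left mult_ac)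
    finally show ?thesis .
  qed
  define F' where "F' z = (\<Sum>j\<le>m - 1. (of_nat (Suc j) * a (Suc j) z) * (z $ i) ^ j)" for z
  have F'V: "(\<lambda>z. of_nat (Suc j) * a (Suc j) z) \<in> polyfun V" for j
    by (intro polyfun.mult polyfun.const aV)
  have F'_poly: "F' \<in> polyfun (insert i V)"
    unfolding F'_def[abs_def]
    by (intro polyfun_sum polyfun.mult polyfun_power polyfun.coord polyfun_insert[OF F'V]) auto
  have F'Q: "F' (pt z y) = Q z y y" for z y
  proof -
    have "Q z y y = (\<Sum>j\<in>{..m}. a j (\<phi> z) * (of_nat j * y ^ (j - 1)))"
      by (simp add: Q_def divided_power_same)
    also have "\<dots> = (\<Sum>j\<in>{..<m}. a (Suc j) (\<phi> z) * (of_nat (Suc j) * y ^ j))"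
      unfolding lessThan_Suc_atMost[symmetric] sum.lessThan_Suc_shift by simp
    also have "{..<m} = {..m - 1}" using m_pos by auto
    finally show ?thesis by (simp add: F'_def pt[OF aV] pt_i mult_ac del: of_nat_Suc)
  qed
  \<comment> \<open>\<open>F'\<close> has degree \<open>m - 1\<close> in \<open>z $ i\<close> and
    leading coefficient \<open>m\<close> times \<open>a m\<close>, so vanishing on \<open>W\<close>
    would contradict the minimality of \<open>m\<close>.\<close>
  have F'_vn: "\<not> vn F'"
  proof
    assume "vn F'"
    then have "vn (\<lambda>z. of_nat (Suc (m - 1)) * a (Suc (m - 1)) z)"
      using Min[of "m - 1" "\<lambda>j z. of_nat (Suc j) * a (Suc j) z" "m - 1"] m_pos F'V
      unfolding F'_def[abs_def] by simp
    then show False using am m_pos by (simp add: vn_def)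
  qed
  \<comment> \<open>Together with \<open>root\<close>, this makes \<open>F'\<close> nonzero at every
    root over a point where \<open>c\<close> and \<open>a m\<close> are nonzero: such a root is
    simple.\<close>
  obtain c u where c: "c \<in> polyfun V" "u \<in> polyfun (insert i V)" "\<not> vn c" "vn (\<lambda>z. c z - u z * F' z)"
    using Bezout[OF F'_poly F'_vn] by blast
  have "\<not> vn (\<lambda>z. c z * a m z)" using vn_prime[OF c(1) aV] c(3) am by blast
  moreover have "(\<lambda>z. c z * a m z) \<in> polyfun V" by (intro polyfun.mult c aV)
  ultimately obtain z1 where z1: "z1 \<in> ?U" "c (\<phi> z1) \<noteq> 0" "a m (\<phi> z1) \<noteq> 0"
    using D(4) by force
  obtain y1 where y1: "P z1 y1 = 0"
    using alg_closed[of m "\<lambda>j. a j (\<phi> z1)"] m_pos z1(3) unfolding P_def by blast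
  have "Q z1 y1 y1 \<noteq> 0"
  proof -
    have "(\<lambda>z. c z - u z * F' z) (pt z1 y1) = 0"
      by (rule root[OF polyfun_diff[OF polyfun_insert[OF c(1)] polyfun.mult[OF c(2) F'_poly]] c(4) z1(1,3)])
         (simp add: FP y1)
    then show ?thesis using z1(2) by (auto simp: pt[OF c(1)] F'Q)
  qed
  \<comment> \<open>Half of the value at the base point, so that by continuity \<open>Q\<close>
    keeps modulus at least \<open>\<kappa>\<close> nearby.\<close>
  define \<kappa> where "\<kappa> = cmod (Q z1 y1 y1) / 2"
  have \<kappa>: "\<kappa> > 0" using \<open>Q z1 y1 y1 \<noteq> 0\<close> by (simp add: \<kappa>_def)
  have a_cont: "continuous_on ?U (\<lambda>z. a j (\<phi> z))" for j
    by (rule polyfun_continuous[OF aV D(1)])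
  have Q_cont: "continuous_on (?U \<times> UNIV) (\<lambda>(z, y, y'). Q z y y')"
    unfolding Q_def divided_power_def split_beta
    by (intro continuous_intros continuous_on_compose2[OF a_cont]) auto
  have P_cont: "continuous_on ?U (\<lambda>z. P z y)" for y
    unfolding P_def by (intro continuous_intros a_cont)
  have oU: "open (?U \<times> (UNIV :: (complex \<times> complex) set))" by (intro open_Times) auto
  obtain \<delta> where \<delta>: "\<delta> > 0" "\<And>z y y'. dist (z, y, y') (z1, y1, y1) < \<delta> \<Longrightarrow> z \<in> ?U \<Longrightarrow> cmod (Q z y y' - Q z1 y1 y1) < \<kappa>"
  proof -
    obtain \<delta> where "\<delta> > 0" "\<forall>x\<in>?U \<times> UNIV. dist x (z1, y1, y1) < \<delta> \<longrightarrow>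
        dist ((\<lambda>(z, y, y'). Q z y y') x) ((\<lambda>(z, y, y'). Q z y y') (z1, y1, y1)) < \<kappa>"
      using Q_cont[unfolded continuous_on_iff] z1(1) \<kappa> by (metis SigmaI UNIV_I)
    then show ?thesis using that[of \<delta>] by (auto simp: dist_norm)
  qed
  \<comment> \<open>A quarter, because the three coordinate distances in \<open>Q_bound\<close> add
    up to at most \<open>3 * \<rho>\<close>.\<close>
  define \<rho> where "\<rho> = \<delta> / 4"
  have \<rho>: "\<rho> > 0" using \<delta>(1) by (simp add: \<rho>_def)
  have Q_bound: "cmod (Q z y y') \<ge> \<kappa>" if "z \<in> ?U" "dist z z1 < \<rho>" "dist y y1 \<le> \<rho>" "dist y' y1 \<le> \<rho>" for z y y'
  proof -
    have "dist (z, y, y') (z1, y1, y1) \<le> dist z z1 + dist (y, y') (y1, y1)"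
      unfolding dist_Pair_Pair by (rule sqrt_sum_squares_le_sum) auto
    also have "dist (y, y') (y1, y1) \<le> dist y y1 + dist y' y1"
      unfolding dist_Pair_Pair by (rule sqrt_sum_squares_le_sum) auto
    finally have "dist (z, y, y') (z1, y1, y1) < \<delta>" using that \<rho> by (simp add: \<rho>_def)
    then have "cmod (Q z y y' - Q z1 y1 y1) < \<kappa>" using \<delta>(2) that(1) by blast
    moreover have "cmod (Q z1 y1 y1) = 2 * \<kappa>" by (simp add: \<kappa>_def)
    ultimately show ?thesis
      using norm_triangle_ineq2[of "Q z1 y1 y1" "Q z1 y1 y1 - Q z y y'"] by (simp add: norm_minus_commute)
  qed
  obtain r1 where r1: "r1 > 0" "r1 \<le> \<rho>" "ball z1 r1 \<subseteq> ?U"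
    "\<And>z. z \<in> ball z1 r1 \<Longrightarrow> cmod (P z y1) < \<kappa> * \<rho> / 2" "\<And>z. z \<in> ball z1 r1 \<Longrightarrow> a m (\<phi> z) \<noteq> 0"
  proof -
    have "\<kappa> * \<rho> / 2 > 0" using \<kappa> \<rho> by simp
    then obtain d1 where d1: "d1 > 0" "\<forall>z\<in>?U. dist z z1 < d1 \<longrightarrow> dist (P z y1) (P z1 y1) < \<kappa> * \<rho> / 2"
      using P_cont[unfolded continuous_on_iff] z1(1) by blast
    have "cmod (a m (\<phi> z1)) > 0" using z1(3) by simp
    then obtain d2 where d2: "d2 > 0" "\<forall>z\<in>?U. dist z z1 < d2 \<longrightarrow> dist (a m (\<phi> z)) (a m (\<phi> z1)) < cmod (a m (\<phi> z1))"
      using a_cont[unfolded continuous_on_iff] z1(1) by blast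
    obtain d3 where d3: "d3 > 0" "ball z1 d3 \<subseteq> ?U" using z1(1) openE[of ?U z1] by auto
    define r1 where "r1 = Min {d1, d2, d3, \<rho>}"
    have "r1 > 0" "r1 \<le> \<rho>" "r1 \<le> d1" "r1 \<le> d2" "r1 \<le> d3" using d1 d2 d3 \<rho> by (auto simp: r1_def)
    moreover have "ball z1 r1 \<subseteq> ?U" using \<open>r1 \<le> d3\<close> d3(2) subset_ball by blast
    moreover have "cmod (P z y1) < \<kappa> * \<rho> / 2" if "z \<in> ball z1 r1" for z
      using d1(2)[rule_format, of z] that \<open>r1 \<le> d1\<close> \<open>ball z1 r1 \<subseteq> ?U\<close> y1 by (auto simp: dist_norm norm_minus_commute)
    moreover have "a m (\<phi> z) \<noteq> 0" if "z \<in> ball z1 r1" for z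
      using d2(2)[rule_format, of z] that \<open>r1 \<le> d2\<close> \<open>ball z1 r1 \<subseteq> ?U\<close> by (auto simp: dist_norm norm_minus_commute)
    ultimately show ?thesis using that by blast
  qed
  let ?B = "ball z1 r1"
  have near: "z \<in> ?U" "dist z z1 < \<rho>" if "z \<in> ?B" for z
    using that r1 by (auto simp: dist_commute)
  \<comment> \<open>On the circle of radius \<open>\<rho>\<close> around \<open>y1\<close>,
    \<open>P z y\<close> differs from \<open>P z y1\<close> by at least
    \<open>\<rho> * \<kappa>\<close>, while \<open>P z y1\<close> is smaller than half of that. So
    \<open>P z\<close> is larger in modulus on the circle than at the centre, which forces a zero
    inside.\<close>
  have ex: "\<exists>y. y \<in> ball y1 \<rho> \<and> P z y = 0" if z: "z \<in> ?B" for z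
  proof -
    have "cmod (P z y1) < cmod (P z y)" if "norm (y1 - y) = \<rho>" for y
    proof -
      have y: "dist y y1 = \<rho>" using that by (simp add: dist_norm norm_minus_commute)
      have "\<rho> * \<kappa> \<le> cmod (y - y1) * cmod (Q z y y1)"
        using Q_bound[OF near[OF z], of y y1] y \<rho> by (simp add: dist_norm)
      also have "\<dots> = cmod (P z y - P z y1)" by (simp add: PQ norm_mult)
      also have "\<dots> \<le> cmod (P z y) + cmod (P z y1)" by (rule norm_triangle_ineq4)
      finally show ?thesis using r1(4)[OF z] by (simp add: mult.commute)
    qed
    moreover have "continuous_on (cball y1 \<rho>) (P z)" "(P z) holomorphic_on ball y1 \<rho>"
      unfolding P_def[abs_def] by (auto intro!: continuous_intros holomorphic_intros)
    ultimately show ?thesis using holomorphic_contract_to_zero[of y1 \<rho> "P z"] \<rho> by metis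
  qed
  have unique: "y = y'" if "z \<in> ?B" "y \<in> ball y1 \<rho>" "y' \<in> ball y1 \<rho>" "P z y = 0" "P z y' = 0" for z y y'
  proof (rule ccontr)
    assume "y \<noteq> y'"
    then have "Q z y y' = 0" using PQ[of z y y'] that by simp
    then show False using Q_bound[OF near[OF that(1)], of y y'] that \<kappa> by (simp add: dist_commute)
  qed
  define Y where "Y z = (THE y. y \<in> ball y1 \<rho> \<and> P z y = 0)" for z
  have Y: "Y z \<in> ball y1 \<rho>" "P z (Y z) = 0" if "z \<in> ?B" for z
  proof -
    have "\<exists>!y. y \<in> ball y1 \<rho> \<and> P z y = 0" using ex[OF that] unique[OF that] by metis
    from theI'[OF this] show "Y z \<in> ball y1 \<rho>" "P z (Y z) = 0" unfolding Y_def by auto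
  qed
  \<comment> \<open>\<open>PQ\<close> solved for the difference of two roots. Both the continuity
    and the derivative of \<open>Y\<close> are read off from this quotient.\<close>
  have Yeq: "Y z - Y w = - P z (Y w) / Q z (Y z) (Y w)" "Q z (Y z) (Y w) \<noteq> 0" "cmod (Q z (Y z) (Y w)) \<ge> \<kappa>"
    if z: "z \<in> ?B" and w: "w \<in> ?B" for z w
  proof -
    show b: "cmod (Q z (Y z) (Y w)) \<ge> \<kappa>"
      using Q_bound[OF near[OF z], of "Y z" "Y w"] Y(1)[OF z] Y(1)[OF w] by (simp add: dist_commute)
    then show "Q z (Y z) (Y w) \<noteq> 0" using \<kappa> by auto
    then show "Y z - Y w = - P z (Y w) / Q z (Y z) (Y w)"
      using PQ[of z "Y z" "Y w"] Y(2)[OF z] by (simp add: field_simps)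
  qed
  have Y_cont: "continuous_on ?B Y"
    unfolding continuous_on_def
  proof
    fix w assume w: "w \<in> ?B"
    have "((\<lambda>z. P z (Y w)) \<longlongrightarrow> P w (Y w)) (at w within ?B)"
      using continuous_on_subset[OF P_cont r1(3)] w unfolding continuous_on_def by blast
    then have "((\<lambda>z. cmod (P z (Y w)) / \<kappa>) \<longlongrightarrow> 0) (at w within ?B)"
      using Y(2)[OF w] \<kappa> by (auto intro!: tendsto_eq_intros)
    moreover have "\<forall>\<^sub>F z in at w within ?B. norm (Y z - Y w) \<le> cmod (P z (Y w)) / \<kappa>"
      unfolding eventually_at_filter
    proof (rule always_eventually, intro allI impI)
      fix z assume z: "z \<in> ?B"
      have "cmod (P z (Y w)) / cmod (Q z (Y z) (Y w)) \<le> cmod (P z (Y w)) / \<kappa>"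
        using Yeq(3)[OF z w] \<kappa> by (intro frac_le) auto
      then show "norm (Y z - Y w) \<le> cmod (P z (Y w)) / \<kappa>"
        unfolding Yeq(1)[OF z w] by (simp add: norm_divide)
    qed
    ultimately have "((\<lambda>z. Y z - Y w) \<longlongrightarrow> 0) (at w within ?B)"
      by (rule Lim_null_comparison[rotated])
    then show "(Y \<longlongrightarrow> Y w) (at w within ?B)" by (simp add: LIM_zero_iff)
  qed
  have Y_hol: "(\<lambda>s. Y (b + s *s d)) holomorphic_on {s. b + s *s d \<in> ?B}" (is "_ holomorphic_on ?L") for b d
  proof -
    let ?l = "\<lambda>s. b + s *s d"
    have oL: "open ?L" by (rule open_line)
    have l_cont: "continuous_on ?L ?l"
      unfolding plus_vec_def vector_scalar_mult_def by (auto intro!: continuous_intros)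
    have Yl_cont: "continuous_on ?L (\<lambda>s. Y (?l s))"
      by (rule continuous_on_compose2[OF Y_cont l_cont]) auto
    have a_hol: "(\<lambda>s. a j (\<phi> (?l s))) holomorphic_on ?L" for j
      by (rule holomorphic_on_subset[OF polyfun_holomorphic[OF aV D(2)]]) (use r1(3) in auto)
    have "\<exists>D. ((\<lambda>s. Y (?l s)) has_field_derivative D) (at t)" if t: "t \<in> ?L" for t
    proof -
      define w where "w = ?l t"
      have w: "w \<in> ?B" using t by (simp add: w_def)
      have "(\<lambda>s. P (?l s) (Y w)) holomorphic_on ?L"
        unfolding P_def by (intro holomorphic_intros a_hol)
      then obtain D where "((\<lambda>s. P (?l s) (Y w)) has_field_derivative D) (at t)"
        using oL t by (metis analytic_at analytic_on_open field_differentiable_def holomorphic_on_imp_differentiable_at)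
      then have "((\<lambda>s. (P (?l s) (Y w) - P w (Y w)) / (s - t)) \<longlongrightarrow> D) (at t)"
        by (simp add: has_field_derivative_iff w_def)
      then have d1: "((\<lambda>s. P (?l s) (Y w) / (s - t)) \<longlongrightarrow> D) (at t)"
        using Y(2)[OF w] by simp
      have "continuous_on ?L (\<lambda>s. (\<lambda>(z, y, y'). Q z y y') (?l s, Y (?l s), Y w))"
        by (rule continuous_on_compose2[OF Q_cont continuous_on_Pair[OF l_cont continuous_on_Pair[OF Yl_cont continuous_on_const]]])
           (use r1(3) in auto)
      then have "continuous_on ?L (\<lambda>s. Q (?l s) (Y (?l s)) (Y w))" by simp
      then have "((\<lambda>s. Q (?l s) (Y (?l s)) (Y w)) \<longlongrightarrow> Q w (Y w) (Y w)) (at t)"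
        using oL t by (simp add: continuous_on_eq_continuous_at isCont_def w_def)
      then have "((\<lambda>s. - (P (?l s) (Y w) / (s - t)) / Q (?l s) (Y (?l s)) (Y w)) \<longlongrightarrow> - D / Q w (Y w) (Y w)) (at t)"
        using Yeq(2)[OF w w] by (intro tendsto_intros d1)
      moreover have "\<forall>\<^sub>F s in at t. - (P (?l s) (Y w) / (s - t)) / Q (?l s) (Y (?l s)) (Y w) = (Y (?l s) - Y (?l t)) / (s - t)"
      proof -
        have "\<forall>\<^sub>F s in at t. s \<in> ?L" using oL t by (rule eventually_at_in_open')
        then show ?thesis
        proof eventually_elim
          case (elim s)
          then have "?l s \<in> ?B" by simp
          from Yeq(1)[OF this w] show ?case by (simp add: w_def)
        qed
      qed
      ultimately have "((\<lambda>s. (Y (?l s) - Y (?l t)) / (s - t)) \<longlongrightarrow> - D / Q w (Y w) (Y w)) (at t)"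
        by (rule Lim_transform_eventually)
      then show ?thesis by (auto simp: has_field_derivative_iff)
    qed
    then show ?thesis
      by (auto simp: holomorphic_on_def field_differentiable_def intro: has_field_derivative_at_within)
  qed
  define \<psi> where "\<psi> z = pt z (Y z)" for z
  have pB: "parametrizes V \<phi> ?B" by (rule parametrizes_shrink[OF p r1(3,1)])
  note DB = parametrizesD[OF pB]
  have \<psi>_V: "\<psi> z $ j = \<phi> z $ j" if "j \<in> V" for j z using that iV by (auto simp: \<psi>_def pt_def)
  have \<psi>_i: "\<psi> z $ i = Y z" for z by (simp add: \<psi>_def pt_def)
  have root\<psi>: "g (\<psi> z) = 0" if "g \<in> polyfun (insert i V)" "vn g" "z \<in> ?B" for g z
    unfolding \<psi>_def by (rule root[OF that(1,2) near(1)[OF that(3)] r1(5)[OF that(3)]])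
      (simp add: FP Y(2)[OF that(3)])
  have "parametrizes (insert i V) \<psi> ?B"
    unfolding parametrizes_def
  proof (intro conjI ballI allI impI)
    show "continuous_on ?B (\<lambda>z. \<psi> z $ j)" if "j \<in> insert i V" for j
      using that DB(1)[of j] Y_cont by (cases "j = i") (auto simp: \<psi>_V \<psi>_i)
    show "(\<lambda>s. \<psi> (b + s *s d) $ j) holomorphic_on {s. b + s *s d \<in> ?B}" if "j \<in> insert i V" for j b d
      using that DB(2)[of j b d] Y_hol[of b d] by (cases "j = i") (auto simp: \<psi>_V \<psi>_i)
    show "\<psi> (z + axis k s) $ j = \<psi> z $ j"
      if j: "j \<in> insert i V" and k: "k \<notin> insert i V" and z: "z \<in> ?B" "z + axis k s \<in> ?B" for j k z s
    proof (cases "j = i")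
      case True
      \<comment> \<open>\<open>Y z\<close> depends on \<open>z\<close> only through the polynomial
        \<open>P z\<close>, whose coefficients a coordinate outside \<open>insert i V\<close> does
        not affect.\<close>
      have "a l (\<phi> (z + axis k s)) = a l (\<phi> z)" for l
        by (rule polyfun_dep[OF aV]) (use DB(3) k z in blast)
      then have "P (z + axis k s) = P z" by (simp add: P_def fun_eq_iff)
      then show ?thesis using True by (simp add: \<psi>_i Y_def)
    next
      case False
      then show ?thesis using j k z DB(3)[of j k z s] by (simp add: \<psi>_V)
    qed
    fix g assume g: "g \<in> polyfun (insert i V)"
    show "vn g \<longleftrightarrow> (\<forall>z\<in>?B. g (\<psi> z) = 0)"
    proof
      assume "vn g"
      then show "\<forall>z\<in>?B. g (\<psi> z) = 0" using root\<psi>[OF g] by blast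
    next
      assume zero: "\<forall>z\<in>?B. g (\<psi> z) = 0"
      show "vn g"
      proof (rule ccontr)
        assume "\<not> vn g"
        then obtain c u where c: "c \<in> polyfun V" "u \<in> polyfun (insert i V)" "\<not> vn c" "vn (\<lambda>z. c z - u z * g z)"
          using Bezout[OF g] by blast
        \<comment> \<open>On the image \<open>c\<close> equals \<open>u * g\<close>, where
          \<open>g\<close> vanishes. So \<open>c\<close> vanishes over the smaller ball and hence on
          \<open>W\<close>, a contradiction.\<close>
        have "c (\<phi> z) = 0" if z: "z \<in> ?B" for z
        proof -
          have "(\<lambda>z. c z - u z * g z) (\<psi> z) = 0"
            by (rule root\<psi>[OF _ c(4) z]) (intro polyfun_diff polyfun.mult polyfun_insert[OF c(1)] c(2) g)
          then have "c (\<psi> z) = 0" using zero z by simp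
          then show ?thesis by (simp add: \<psi>_def pt[OF c(1)])
        qed
        then show False using DB(4)[OF c(1)] c(3) by blast
      qed
    qed
  qed
  then show ?thesis using r1(1) by blast
qed

end

text \<open>Coordinates are added one at a time, each being either transcendental or algebraic over
  the earlier ones; in the algebraic case the ball shrinks.\<close>

theorem (in prime_function_set) local_parametrization:
  assumes "finite V"
  shows "\<exists>\<phi> z0 r. r > 0 \<and> parametrizes V \<phi> (ball z0 r)"
  using assms
proof (induction V rule: finite_induct)
  case empty
  have "f \<in> polyfun {} \<Longrightarrow> \<exists>c. f = (\<lambda>_. c)" for f :: "complex ^ 'n \<Rightarrow> complex"
    by (induction rule: polyfun.induct) auto
  then have "parametrizes {} (\<lambda>z. z) (ball 0 1)"
    unfolding parametrizes_def vn_def using W_ne by (fastforce intro!: exI[of _ 0])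
  then show ?case by (intro exI[of _ "\<lambda>z. z"] exI[of _ 0] exI[of _ 1]) simp
next
  case (insert i V)
  then obtain \<phi> z0 r where p: "r > 0" "parametrizes V \<phi> (ball z0 r)" by blast
  \<comment> \<open>The coefficient that is nonzero on \<open>W\<close> may be any one. For the
    least such \<open>k\<close> the leading coefficient is nonzero, as otherwise the relation could
    be shortened.\<close>
  define alg where "alg k \<longleftrightarrow> (\<exists>b j. (\<forall>j. b j \<in> polyfun V) \<and> vn (\<lambda>z. \<Sum>j\<le>k. b j z * (z $ i) ^ j) \<and> j \<le> k \<and> \<not> vn (b j))" for k :: nat
  show ?case
  proof (cases "\<exists>k. alg k")
    case False
    have "parametrizes (insert i V) (\<lambda>z. \<chi> j. if j = i then z $ i else \<phi> z $ j) (ball z0 r)"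
    proof (rule parametrization_transcendental_step[OF p(2,1) insert.hyps(2)])
      show "vn (b j)" if "\<And>j. b j \<in> polyfun V" "vn (\<lambda>z. \<Sum>j\<le>k. b j z * (z $ i) ^ j)" "j \<le> k" for b k j
        using False that unfolding alg_def by blast
    qed
    then show ?thesis using p(1) by blast
  next
    case True
    define m where "m = (LEAST k. alg k)"
    have "alg m" unfolding m_def using True by (metis LeastI)
    have least: "\<not> alg k" if "k < m" for k using that not_less_Least unfolding m_def by blast
    obtain a j0 where a: "\<forall>j. a j \<in> polyfun V" "vn (\<lambda>z. \<Sum>j\<le>m. a j z * (z $ i) ^ j)" "j0 \<le> m" "\<not> vn (a j0)"
      using \<open>alg m\<close> unfolding alg_def by blast
    have am: "\<not> vn (a m)"
    proof
      assume am: "vn (a m)"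
      then have "j0 < m" using a(3,4) by (cases "j0 = m") auto
      then have "{..m} = insert m {..m - 1}" by auto
      then have "vn (\<lambda>z. \<Sum>j\<le>m - 1. a j z * (z $ i) ^ j)"
        using a(2) am \<open>j0 < m\<close> by (auto simp: vn_def)
      moreover have "j0 \<le> m - 1" using \<open>j0 < m\<close> by simp
      ultimately have "alg (m - 1)" unfolding alg_def using a(1,4) by blast
      then show False using least[of "m - 1"] \<open>j0 < m\<close> by simp
    qed
    interpret algebraic_step W V i a m
    proof unfold_locales
      show "vn (b j)" if "k < m" "\<And>j. b j \<in> polyfun V" "vn (\<lambda>z. \<Sum>j\<le>k. b j z * (z $ i) ^ j)" "j \<le> k" for b k j
        using least[OF that(1)] that(2-4) unfolding alg_def by blast
    qed (use a insert.hyps am in auto)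
    show ?thesis by (rule parametrization_algebraic_step[OF p(2,1)])
  qed
qed

subsection \<open>Polarization\<close>

lemma holomorphic_zero_on_reals:
  assumes "f holomorphic_on ball 0 R" "R > 0" "\<And>x :: real. \<bar>x\<bar> < R \<Longrightarrow> f (of_real x) = 0" "z \<in> ball 0 R"
  shows "f z = 0"
proof (rule analytic_continuation[of f "ball 0 R" "of_real ` {-R<..<R}" 0 z])
  show "(0 :: complex) islimpt of_real ` {- R<..<R}"
    unfolding islimpt_approachable
  proof (intro allI impI)
    fix e :: real assume "e > 0"
    define x where "x = min R e / 2"
    have "x \<in> {- R<..<R}" "x \<noteq> 0" "\<bar>x\<bar> < e"
      using assms(2) \<open>e > 0\<close> by (auto simp: x_def min_def)
    then show "\<exists>x'\<in>of_real ` {- R<..<R}. x' \<noteq> (0 :: complex) \<and> dist x' 0 < e"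
      by (intro bexI[of _ "of_real x"]) auto
  qed
qed (use assms in auto)

text \<open>Makes the conjugated factor holomorphic in the conjugate of its argument, as needed
  after the change of coordinates below.\<close>

lemma holomorphic_cnj_cnj:
  assumes "h holomorphic_on ball 0 R"
  shows "(\<lambda>z. cnj (h (cnj z))) holomorphic_on ball 0 R"
  unfolding holomorphic_on_open[OF open_ball]
proof (intro ballI)
  fix z :: complex assume "z \<in> ball 0 R"
  then have "cnj z \<in> ball 0 R" by simp
  then obtain D where "(h has_field_derivative D) (at (cnj z))"
    using assms holomorphic_on_open[OF open_ball] by blast
  then have D: "(h has_derivative (\<lambda>x. D * x)) (at (cnj z))" by (simp add: has_field_derivative_def)
  have "(cnj has_derivative cnj) (at z)"
    using bounded_linear.has_derivative[OF bounded_linear_cnj has_derivative_ident] by simp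
  from has_derivative_compose[OF this D] have "((\<lambda>z. h (cnj z)) has_derivative (\<lambda>x. D * cnj x)) (at z)" .
  from bounded_linear.has_derivative[OF bounded_linear_cnj this]
  have "((\<lambda>z. cnj (h (cnj z))) has_derivative (\<lambda>x. cnj D * x)) (at z)" by simp
  then show "\<exists>D. ((\<lambda>z. cnj (h (cnj z))) has_field_derivative D) (at z)"
    unfolding has_field_derivative_def by blast
qed

text \<open>In the coordinates \<open>u = (s + cnj t) / 2\<close> and \<open>v = (s - cnj t) / (2 * \<i>)\<close> the
  expression is holomorphic, and the diagonal consists of the real points.\<close>

lemma sesquiholomorphic_zero_on_diagonal:
  assumes g: "\<And>i. i \<in> I \<Longrightarrow> g i holomorphic_on ball 0 R" and h: "\<And>i. i \<in> I \<Longrightarrow> h i holomorphic_on ball 0 R"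
    and R: "R > 0" and diag: "\<And>s. s \<in> ball 0 R \<Longrightarrow> (\<Sum>i\<in>I. g i s * cnj (h i s)) = 0"
    and s: "s \<in> ball 0 (R/2)" and t: "t \<in> ball 0 (R/2)"
  shows "(\<Sum>i\<in>I. g i s * cnj (h i t)) = 0"
proof -
  define G where "G u v = (\<Sum>i\<in>I. g i (u + \<i> * v) * cnj (h i (cnj (u - \<i> * v))))" for u v
  have mem: "u + \<i> * v \<in> ball 0 R" "u - \<i> * v \<in> ball 0 R" if "u \<in> ball 0 (R/2)" "v \<in> ball 0 (R/2)" for u v
    using that norm_triangle_ineq[of u "\<i> * v"] norm_triangle_ineq4[of u "\<i> * v"] by (auto simp: norm_mult)
  have hol_g: "(\<lambda>x. g i (e x)) holomorphic_on ball 0 (R/2)"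
    if "i \<in> I" "e holomorphic_on ball 0 (R/2)" "e ` ball 0 (R/2) \<subseteq> ball 0 R" for i e
    using holomorphic_on_compose_gen[OF that(2) g[OF that(1)] that(3)] by (simp add: comp_def)
  have hol_h: "(\<lambda>x. cnj (h i (cnj (e x)))) holomorphic_on ball 0 (R/2)"
    if "i \<in> I" "e holomorphic_on ball 0 (R/2)" "e ` ball 0 (R/2) \<subseteq> ball 0 R" for i e
    using holomorphic_on_compose_gen[OF that(2) holomorphic_cnj_cnj[OF h[OF that(1)]] that(3)] by (simp add: comp_def)
  have hu: "(\<lambda>u. G u v) holomorphic_on ball 0 (R/2)" if v: "v \<in> ball 0 (R/2)" for v
    unfolding G_def using mem v
    by (intro holomorphic_intros hol_g hol_h) (auto simp del: mem_ball)
  have hv: "(\<lambda>v. G u v) holomorphic_on ball 0 (R/2)" if u: "u \<in> ball 0 (R/2)" for u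
    unfolding G_def using mem u
    by (intro holomorphic_intros hol_g hol_h) (auto simp del: mem_ball)
  have R2: "R / 2 > 0" using R by simp
  have real: "G (of_real x) (of_real y) = 0" if "\<bar>x\<bar> < R / 2" "\<bar>y\<bar> < R / 2" for x y :: real
  proof -
    have "of_real x \<in> ball (0::complex) (R/2)" "of_real y \<in> ball (0::complex) (R/2)" using that by auto
    from diag[OF mem(1)[OF this]] show ?thesis by (simp add: G_def)
  qed
  \<comment> \<open>First \<open>u\<close> and then \<open>v\<close> is moved from real to complex
    values, each time by the identity theorem in one variable.\<close>
  have "G u (of_real y) = 0" if "u \<in> ball 0 (R/2)" "\<bar>y\<bar> < R / 2" for u and y :: real
    by (rule holomorphic_zero_on_reals[OF hu R2 real that(1)]) (use that in auto)
  then have "G u v = 0" if "u \<in> ball 0 (R/2)" "v \<in> ball 0 (R/2)" for u v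
    using holomorphic_zero_on_reals[OF hv[OF that(1)] R2 _ that(2)] that(1) by blast
  moreover define u where "u = (s + cnj t) / 2"
  moreover define v where "v = (s - cnj t) / (2 * \<i>)"
  moreover have "u \<in> ball 0 (R/2)" "v \<in> ball 0 (R/2)"
    using s t norm_triangle_ineq[of s "cnj t"] norm_triangle_ineq4[of s "cnj t"]
    by (auto simp: u_def v_def norm_divide norm_mult)
  ultimately have "G u v = 0" by blast
  moreover have "u + \<i> * v = s" "u - \<i> * v = cnj t" by (simp_all add: u_def v_def field_simps)
  ultimately show ?thesis by (simp add: G_def)
qed

text \<open>The zeros of \<open>f\<close> on \<open>W\<close> and the zeros of \<open>g\<close> on
  \<open>W\<close> are algebraic sets that cover \<open>W\<close>, so one of them is
  \<open>W\<close>.\<close>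

lemma irreducible_variety_prime:
  assumes "irreducible_variety W" shows "prime_function_set W"
proof
  show "W \<noteq> {}" using assms by (simp add: irreducible_variety_def)
  obtain S where S: "W = vanishing_locus S" using assms by (auto simp: irreducible_variety_def algebraic_set_def)
  fix f g assume fg: "f \<in> polyfun UNIV" "g \<in> polyfun UNIV" "\<forall>w\<in>W. f w * g w = 0"
  obtain p q where p: "\<forall>z. f z = peval p z" and q: "\<forall>z. g z = peval q z"
    using fg polyfun_imp_peval by metis
  let ?W1 = "vanishing_locus (insert p S)" and ?W2 = "vanishing_locus (insert q S)"
  have "W = ?W1 \<union> ?W2" using fg(3) p q unfolding S by (auto simp: vanishing_locus_def)
  moreover have "algebraic_set ?W1" "algebraic_set ?W2" by (auto simp: algebraic_set_def)
  ultimately have "W = ?W1 \<or> W = ?W2" using assms unfolding irreducible_variety_def by blast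
  then show "(\<forall>w\<in>W. f w = 0) \<or> (\<forall>w\<in>W. g w = 0)" using p q by (auto simp: vanishing_locus_def)
qed

lemma linear_component:
  assumes "Vector_Spaces.linear (*s) (*s) (A :: complex ^ 'm::finite \<Rightarrow> complex ^ 'n::finite)"
  shows "A z $ i = (\<Sum>j\<in>UNIV. z $ j * A (axis j 1) $ i)"
proof -
  interpret A: Vector_Spaces.linear "(*s)" "(*s)" A by fact
  have "A z = (\<Sum>j\<in>UNIV. (z $ j) *s A (axis j 1))"
    using A.sum[of "\<lambda>j. (z $ j) *s axis j 1" UNIV] basis_expansion[of z] by (simp add: A.scale)
  then show ?thesis by simp
qed

lemma cinner_self: "cinner z z = complex_of_real ((norm z)\<^sup>2)"
  by (simp add: cinner_def norm_vec_def L2_set_def sum_nonneg complex_norm_square del: of_real_power)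

lemma cinner_cnj: "cinner w z = cnj (cinner z w)"
  by (simp add: cinner_def mult.commute)

lemma cinner_add_left: "cinner (x + y) z = cinner x z + cinner y z"
  and cinner_scale_left: "cinner (c *s x) z = c * cinner x z"
  by (simp_all add: cinner_def algebra_simps sum.distrib sum_distrib_left)

text \<open>The identity theorem gives the claim for \<open>\<phi> x\<close> and
  \<open>\<phi> y\<close> with nearby parameters. As \<open>E\<close> is polynomial in its first
  argument, and the parametrization detects polynomials vanishing on \<open>W\<close>, it extends to
  all of \<open>W\<close>, in one argument after the other by conjugate symmetry.\<close>

theorem isometry_polarization:
  fixes A :: "complex ^ 'm::finite \<Rightarrow> complex ^ 'n::finite"
  assumes W: "irreducible_variety W" and A: "Vector_Spaces.linear (*s) (*s) A"
    and iso: "\<And>w. w \<in> W \<Longrightarrow> norm (A w) = norm w"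
    and z: "z \<in> W" and w: "w \<in> W"
  shows "cinner (A z) (A w) = cinner z w"
proof -
  interpret prime_function_set W by (rule irreducible_variety_prime[OF W])
  obtain S where S: "W = vanishing_locus S" using W by (auto simp: irreducible_variety_def algebraic_set_def)
  obtain \<phi> z0 r where r: "r > 0" and p: "parametrizes UNIV \<phi> (ball z0 r)"
    using local_parametrization[of UNIV] by auto
  have r4: "r / 4 > 0" using r by simp
  have p': "parametrizes UNIV \<phi> (ball z0 (r / 4))"
    by (rule parametrizes_shrink[OF p _ r4]) (use r in auto)
  note D = parametrizesD[OF p] and D' = parametrizesD[OF p']
  have \<phi>W: "\<phi> x \<in> W" if "x \<in> ball z0 r" for x
  proof -
    have "peval f (\<phi> x) = 0" if "f \<in> S" for f
    proof -
      have "vn (peval f)" unfolding vn_def using that by (auto simp: S vanishing_locus_def)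
      then show ?thesis using D(4)[OF peval_polyfun] \<open>x \<in> ball z0 r\<close> by blast
    qed
    then show ?thesis by (simp add: S vanishing_locus_def)
  qed
  define E where "E z w = cinner (A z) (A w) - cinner z w" for z w
  have E_diag: "E z z = 0" if "z \<in> W" for z using iso[OF that] by (simp add: E_def cinner_self)
  have E_cnj: "E w z = cnj (E z w)" for z w by (simp add: E_def cinner_cnj[of _ z] cinner_cnj[of _ "A z"])
  have A_poly: "(\<lambda>z. A z $ i) \<in> polyfun UNIV" for i
  proof -
    have "(\<lambda>z. A z $ i) = (\<lambda>z. \<Sum>j\<in>UNIV. z $ j * A (axis j 1) $ i)"
      by (rule ext) (rule linear_component[OF A])
    moreover have "(\<lambda>z. \<Sum>j\<in>UNIV. z $ j * A (axis j 1) $ i) \<in> polyfun UNIV"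
      by (intro polyfun_sum polyfun.mult polyfun.coord polyfun.const UNIV_I)
    ultimately show ?thesis by (rule ssubst[where P = "\<lambda>f. f \<in> polyfun UNIV"])
  qed
  have E_poly: "(\<lambda>z. E z w) \<in> polyfun UNIV" for w
    unfolding E_def cinner_def
    by (intro polyfun_diff polyfun_sum polyfun.mult polyfun.const A_poly polyfun.coord) auto
  have local: "E (\<phi> x) (\<phi> y) = 0" if x: "x \<in> ball z0 (r/4)" and y: "y \<in> ball z0 (r/4)" for x y
  proof -
    \<comment> \<open>On the line through \<open>c\<close> in direction \<open>d\<close>,
      \<open>s = 1\<close> and \<open>s = - 1\<close> give \<open>x\<close> and \<open>y\<close>. As
      both are within \<open>r / 4\<close> of \<open>z0\<close>, the line stays in the large ball
      for \<open>cmod s < 3\<close>, and 1 and \<open>- 1\<close> lie in the disc of half that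
      radius to which the polarization applies.\<close>
    define c where "c = (1/2) *s (x + y)"
    define d where "d = (1/2) *s (x - y)"
    define \<gamma> where "\<gamma> s = \<phi> (c + s *s d)" for s
    have "c - z0 = (1/2) *s ((x - z0) + (y - z0))" "d = (1/2) *s ((x - z0) - (y - z0))"
      by (auto simp: c_def d_def vec_eq_iff field_simps)
    then have "norm (c - z0) = 1/2 * norm ((x - z0) + (y - z0))" "norm d = 1/2 * norm ((x - z0) - (y - z0))"
      by (simp_all only: norm_vector_scalar_mult) (simp_all add: norm_divide)
    then have cd: "norm (c - z0) < r/4" "norm d < r/4"
      using norm_triangle_ineq[of "x - z0" "y - z0"] norm_triangle_ineq4[of "x - z0" "y - z0"] x y
      by (auto simp: dist_norm norm_minus_commute)
    have in_ball: "c + s *s d \<in> ball z0 r" if s: "s \<in> ball 0 3" for s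
    proof -
      have "cmod s * norm d \<le> 3 * norm d" using s by (intro mult_right_mono) auto
      then have "norm (s *s d) \<le> 3 * (r/4)" using cd(2) by (simp add: norm_vector_scalar_mult)
      moreover have "norm ((c - z0) + s *s d) \<le> norm (c - z0) + norm (s *s d)" by (rule norm_triangle_ineq)
      moreover have "(c - z0) + s *s d = (c + s *s d) - z0" by simp
      ultimately have "norm ((c + s *s d) - z0) < r" using cd(1) by simp
      then show ?thesis by (simp add: dist_norm norm_minus_commute)
    qed
    have \<gamma>_hol: "(\<lambda>s. \<gamma> s $ j) holomorphic_on ball 0 3" for j
      unfolding \<gamma>_def by (rule holomorphic_on_subset[OF D(2)]) (use in_ball in auto)
    have A\<gamma>_hol: "(\<lambda>s. A (\<gamma> s) $ j) holomorphic_on ball 0 3" for j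
      by (rule polyfun_holomorphic[OF A_poly \<gamma>_hol])
    \<comment> \<open>The sum type indexes the components of \<open>A\<close> and of the identity
      together; the minus sign turns the difference of two inner products into a single sum.\<close>
    define g where "g k s = (case k of Inl i \<Rightarrow> A (\<gamma> s) $ i | Inr j \<Rightarrow> - (\<gamma> s $ j))" for k :: "'n + 'm" and s
    define h where "h k s = (case k of Inl i \<Rightarrow> A (\<gamma> s) $ i | Inr j \<Rightarrow> \<gamma> s $ j)" for k :: "'n + 'm" and s
    have E_sum: "E (\<gamma> s) (\<gamma> t) = (\<Sum>k\<in>UNIV. g k s * cnj (h k t))" for s t
    proof -
      have "(\<Sum>k\<in>UNIV. g k s * cnj (h k t)) = (\<Sum>i\<in>UNIV. g (Inl i) s * cnj (h (Inl i) t)) + (\<Sum>j\<in>UNIV. g (Inr j) s * cnj (h (Inr j) t))"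
        unfolding UNIV_Plus_UNIV[symmetric] by (subst sum.Plus) auto
      then show ?thesis by (simp add: g_def h_def E_def cinner_def sum_negf)
    qed
    have "(\<Sum>k\<in>UNIV. g k 1 * cnj (h k (- 1))) = 0"
    proof (rule sesquiholomorphic_zero_on_diagonal[where R = 3])
      show "g k holomorphic_on ball 0 3" for k
        unfolding g_def by (cases k) (auto intro!: holomorphic_intros A\<gamma>_hol \<gamma>_hol)
      show "h k holomorphic_on ball 0 3" for k
        unfolding h_def by (cases k) (auto intro!: A\<gamma>_hol \<gamma>_hol)
      show "(\<Sum>k\<in>UNIV. g k s * cnj (h k s)) = 0" if "s \<in> ball 0 3" for s
        unfolding E_sum[symmetric] using E_diag[OF \<phi>W[OF in_ball[OF that]]] by (simp add: \<gamma>_def)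
    qed auto
    then have "E (\<gamma> 1) (\<gamma> (- 1)) = 0" by (simp add: E_sum)
    moreover have "c + 1 *s d = x" "c + (- 1) *s d = y" by (auto simp: c_def d_def vec_eq_iff field_simps)
    ultimately show ?thesis by (simp add: \<gamma>_def)
  qed
  have half: "E z (\<phi> y) = 0" if "z \<in> W" "y \<in> ball z0 (r/4)" for z y
  proof -
    have "vn (\<lambda>z. E z (\<phi> y))" using D'(4)[OF E_poly] local that(2) by blast
    then show ?thesis using that(1) by (auto simp: vn_def)
  qed
  have "vn (\<lambda>w. E w z)" using D'(4)[OF E_poly] half[OF z] E_cnj by (metis complex_cnj_zero)
  then have "E w z = 0" using w by (auto simp: vn_def)
  then show ?thesis using E_cnj[of z w] by (simp add: E_def)
qed

text \<open>For fixed \<open>w\<close>, the equation holds on a subspace of vectors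
  \<open>z\<close>; conjugate symmetry then handles the second argument.\<close>

corollary isometry_polarization_span:
  fixes A :: "complex ^ 'm::finite \<Rightarrow> complex ^ 'n::finite"
  assumes W: "irreducible_variety W" and A: "Vector_Spaces.linear (*s) (*s) A"
    and iso: "\<And>w. w \<in> W \<Longrightarrow> norm (A w) = norm w"
    and z: "z \<in> vec.span W" and w: "w \<in> vec.span W"
  shows "cinner (A z) (A w) = cinner z w"
proof -
  interpret A: Vector_Spaces.linear "(*s)" "(*s)" A by (rule A)
  have sub: "vec.subspace {z. cinner (A z) (A w) = cinner z w}" for w
    by (rule vec.subspaceI) (auto simp: A.add A.scale A.zero cinner_add_left cinner_scale_left, simp_all add: cinner_def)
  have 1: "cinner (A z) (A w) = cinner z w" if "z \<in> vec.span W" "w \<in> W" for z w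
    using vec.span_minimal[OF _ sub, of W w] isometry_polarization[OF W A iso _ that(2)] that(1) by blast
  have "cinner (A u) (A z) = cinner u z" if "u \<in> W" for u
    using 1[OF z that] cinner_cnj[of "A u" "A z"] cinner_cnj[of u z] by simp
  then have "cinner (A w) (A z) = cinner w z"
    using vec.span_minimal[OF _ sub, of W z] w by blast
  then show ?thesis using cinner_cnj[of "A z" "A w"] cinner_cnj[of z w] by simp
qed

section \<open>Reproducing kernel Hilbert spaces\<close>

context hilbert_fs_pair
begin

lemma linear_graph_isometric:
  assumes k: "\<And>i. i \<in> L \<Longrightarrow> k i \<in> hcar H" and k': "\<And>i. i \<in> L \<Longrightarrow> k' i \<in> hcar K"
    and iso: "\<And>i j. i \<in> L \<Longrightarrow> j \<in> L \<Longrightarrow> hip K (k' i) (k' j) = hip H (k i) (k j)"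
    and uv: "(u, v) \<in> linear_graph L k k'" and uv': "(u', v') \<in> linear_graph L k k'"
  shows "hip K v v' = hip H u u'"
proof -
  note mem = linear_graph_mem[OF k k']
  have 1: "hip K v (k' j) = hip H u (k j)" if "(u, v) \<in> linear_graph L k k'" "j \<in> L" for u v j
    using that
  proof (induction)
    case zero
    then show ?case using H.hip_zero_left[OF k[of j]] K.hip_zero_left[OF k'[of j]] by (simp only:)
  next
    case (step u v i c)
    note uvm = mem[OF _ _ step.hyps(1)]
    have "hip K (v + fscale c (k' i)) (k' j) = hip K v (k' j) + c * hip K (k' i) (k' j)"
      using K.hip_add_left[OF uvm(2) K.scale_mem[OF k'[OF step.hyps(2)], of c] k'[OF step.prems]]
        K.hip_scale_left[OF k'[OF step.hyps(2)] k'[OF step.prems], of c] by (simp only:)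
    moreover have "hip H (u + fscale c (k i)) (k j) = hip H u (k j) + c * hip H (k i) (k j)"
      using H.hip_add_left[OF uvm(1) H.scale_mem[OF k[OF step.hyps(2)], of c] k[OF step.prems]]
        H.hip_scale_left[OF k[OF step.hyps(2)] k[OF step.prems], of c] by (simp only:)
    ultimately show ?case using step.IH[OF step.prems] iso[OF step.hyps(2) step.prems] by metis
  qed
  note vm = mem[OF _ _ uv]
  show ?thesis
    using uv'
  proof (induction)
    case zero
    show ?case using H.hip_zero_right[OF vm(1)] K.hip_zero_right[OF vm(2)] by (simp only:)
  next
    case (step u' v' i c)
    note uvm = mem[OF _ _ step.hyps(1)]
    have "hip K v (v' + fscale c (k' i)) = hip K v v' + cnj c * hip K v (k' i)"
      using K.hip_add_right[OF uvm(2) K.scale_mem[OF k'[OF step.hyps(2)], of c] vm(2)]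
        K.hip_scale_right[OF k'[OF step.hyps(2)] vm(2), of c] by (simp only:)
    moreover have "hip H u (u' + fscale c (k i)) = hip H u u' + cnj c * hip H u (k i)"
      using H.hip_add_right[OF uvm(1) H.scale_mem[OF k[OF step.hyps(2)], of c] vm(1)]
        H.hip_scale_right[OF k[OF step.hyps(2)] vm(1), of c] by (simp only:)
    ultimately show ?case using step.IH 1[OF uv step.hyps(2)] by metis
  qed
qed

text \<open>The extension by density comes with a norm bound only. Inner products are handled by the
  adjoint \<open>S\<close>: \<open>S (T (k i)) = k i\<close>, since both sides have the same inner
  products with all \<open>k j\<close>, and then \<open>S (T g) = g\<close> in the same
  manner.\<close>

theorem isometric_extension:
  assumes k: "\<And>i. i \<in> L \<Longrightarrow> k i \<in> hcar H" and k': "\<And>i. i \<in> L \<Longrightarrow> k' i \<in> hcar K"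
    and total: "\<And>f. f \<in> hcar H \<Longrightarrow> (\<And>i. i \<in> L \<Longrightarrow> hip H f (k i) = 0) \<Longrightarrow> f = 0"
    and iso: "\<And>i j. i \<in> L \<Longrightarrow> j \<in> L \<Longrightarrow> hip K (k' i) (k' j) = hip H (k i) (k j)"
  obtains T where "T \<in> bounded_ops H K" "\<And>i. i \<in> L \<Longrightarrow> T (k i) = k' i"
    "\<And>f g. f \<in> hcar H \<Longrightarrow> g \<in> hcar H \<Longrightarrow> hip K (T f) (T g) = hip H f g"
proof -
  have bound: "hnorm K v \<le> 1 * hnorm H u" if "(u, v) \<in> linear_graph L k k'" for u v
    using linear_graph_isometric[OF k k' iso that that] by (simp add: hnorm_def)
  obtain T where T: "T \<in> bounded_ops H K" and Tk: "\<And>i. i \<in> L \<Longrightarrow> T (k i) = k' i"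
  proof (rule extension_by_density[of L k k' 1])
    show "f = 0" if "f \<in> hcar H" "\<And>i. i \<in> L \<Longrightarrow> hip H f (k i) = 0" for f by (rule total[OF that])
    show "k i \<in> hcar H" "k' i \<in> hcar K" if "i \<in> L" for i by (rule k[OF that], rule k'[OF that])
    show "hnorm K v \<le> 1 * hnorm H u" if "(u, v) \<in> linear_graph L k k'" for u v by (rule bound[OF that])
    fix T assume "T \<in> bounded_ops H K" "\<And>i. i \<in> L \<Longrightarrow> T (k i) = k' i"
    then show thesis by (rule that)
  qed
  interpret KH: hilbert_fs_pair Y K X H by unfold_locales
  define S where "S = hadjoint H K T"
  note Tm = bops_mem[OF T]
  have S: "S \<in> bounded_ops K H" unfolding S_def by (rule hadjoint_bops[OF T])
  note Sm = KH.bops_mem[OF S]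
  have adj: "hip K (T f) g = hip H f (S g)" if "f \<in> hcar H" "g \<in> hcar K" for f g
    unfolding S_def by (rule hadjoint_hip[OF T that])
  have adj': "hip H (S g) f = hip K g (T f)" if "f \<in> hcar H" "g \<in> hcar K" for f g
    using adj[OF that] H.hip_cnj[OF that(1) Sm[OF that(2)]] K.hip_cnj[OF Tm[OF that(1)] that(2)] by simp
  have STm: "S (T f) \<in> hcar H" if "f \<in> hcar H" for f using that Sm Tm by blast
  have STk: "S (T (k i)) = k i" if i: "i \<in> L" for i
  proof -
    have "hip H (S (T (k i)) - k i) (k j) = 0" if j: "j \<in> L" for j
      using adj'[OF k[OF j] Tm[OF k[OF i]]] H.hip_diff_left[OF STm[OF k[OF i]] k[OF i] k[OF j]] Tk i j iso by simp
    then have "S (T (k i)) - k i = 0"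
      using total[OF H.diff_mem[OF STm[OF k[OF i]] k[OF i]]] by blast
    then show ?thesis by simp
  qed
  have ST: "S (T g) = g" if g: "g \<in> hcar H" for g
  proof -
    have "hip H (S (T g) - g) (k i) = 0" if i: "i \<in> L" for i
      using adj'[OF k[OF i] Tm[OF g]] adj[OF g Tm[OF k[OF i]]] STk[OF i] H.hip_diff_left[OF STm[OF g] g k[OF i]]
      by simp
    then have "S (T g) - g = 0"
      using total[OF H.diff_mem[OF STm[OF g] g]] by blast
    then show ?thesis by simp
  qed
  show ?thesis
    by (rule that[OF T Tk]) (simp_all add: adj Tm ST)
qed

end

definition kernel_at :: "'x set \<Rightarrow> ('x \<Rightarrow> 'x \<Rightarrow> complex) \<Rightarrow> 'x \<Rightarrow> 'x \<Rightarrow> complex" where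
  "kernel_at X K w = (\<lambda>z. if z \<in> X then K z w else 0)"

lemma is_rkhsD:
  assumes "is_rkhs X K H"
  shows "hilbert_fs X H" "\<And>w. w \<in> X \<Longrightarrow> kernel_at X K w \<in> hcar H"
    "\<And>f w. w \<in> X \<Longrightarrow> f \<in> hcar H \<Longrightarrow> hip H f (kernel_at X K w) = f w"
  using assms unfolding is_rkhs_def kernel_at_def hilbert_fs_def by blast+

lemma is_rkhs_total:
  assumes "is_rkhs X K H" "f \<in> hcar H" "\<And>w. w \<in> X \<Longrightarrow> hip H f (kernel_at X K w) = 0"
  shows "f = 0"
proof
  interpret hilbert_fs X H by (rule is_rkhsD(1)[OF assms(1)])
  fix x show "f x = 0 x"
    using assms(2,3) is_rkhsD(3)[OF assms(1)] off_X[OF assms(2)] by (cases "x \<in> X") auto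
qed

text \<open>The uniqueness half of the Moore-Aronszajn theorem: the isometry that fixes all kernel
  functions fixes every function, as values are inner products with kernel functions.\<close>

lemma is_rkhs_unique_aux:
  assumes H: "is_rkhs X K H" and H': "is_rkhs X K H'"
  shows "hcar H \<subseteq> hcar H'" "\<And>f g. f \<in> hcar H \<Longrightarrow> g \<in> hcar H \<Longrightarrow> hip H' f g = hip H f g"
proof -
  interpret A: hilbert_fs X H by (rule is_rkhsD(1)[OF H])
  interpret B: hilbert_fs X H' by (rule is_rkhsD(1)[OF H'])
  interpret hilbert_fs_pair X H X H' by unfold_locales
  let ?k = "kernel_at X K"
  obtain T where T: "T \<in> bounded_ops H H'" "\<And>i. i \<in> X \<Longrightarrow> T (?k i) = ?k i"
    "\<And>f g. f \<in> hcar H \<Longrightarrow> g \<in> hcar H \<Longrightarrow> hip H' (T f) (T g) = hip H f g"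
  proof (rule isometric_extension[of X ?k ?k])
    show "?k i \<in> hcar H" "?k i \<in> hcar H'" if "i \<in> X" for i
      by (rule is_rkhsD(2)[OF H that], rule is_rkhsD(2)[OF H' that])
    show "f = 0" if "f \<in> hcar H" "\<And>i. i \<in> X \<Longrightarrow> hip H f (?k i) = 0" for f
      by (rule is_rkhs_total[OF H that])
    show "hip H' (?k i) (?k j) = hip H (?k i) (?k j)" if "i \<in> X" "j \<in> X" for i j
      using that is_rkhsD(2,3)[OF H] is_rkhsD(2,3)[OF H'] by simp
    fix T assume "T \<in> bounded_ops H H'" "\<And>i. i \<in> X \<Longrightarrow> T (?k i) = ?k i"
      "\<And>f g. f \<in> hcar H \<Longrightarrow> g \<in> hcar H \<Longrightarrow> hip H' (T f) (T g) = hip H f g"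
    then show thesis by (rule that)
  qed
  have id: "T f = f" if f: "f \<in> hcar H" for f
  proof
    fix z
    show "T f z = f z"
    proof (cases "z \<in> X")
      case True
      have "T f z = hip H' (T f) (T (?k z))"
        using is_rkhsD(3)[OF H' True bops_mem[OF T(1) f]] T(2)[OF True] by simp
      also have "\<dots> = f z" using T(3)[OF f is_rkhsD(2)[OF H True]] is_rkhsD(3)[OF H True f] by simp
      finally show ?thesis .
    qed (use A.off_X[OF f] B.off_X[OF bops_mem[OF T(1) f]] in simp)
  qed
  show "hcar H \<subseteq> hcar H'" using bops_mem[OF T(1)] id by force
  show "hip H' f g = hip H f g" if "f \<in> hcar H" "g \<in> hcar H" for f g
    using T(3)[OF that] id that by simp
qed

lemma is_rkhs_unique:
  assumes "is_rkhs X K H" "is_rkhs X K H'"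
  shows "hcar H = hcar H'" "\<And>f g. f \<in> hcar H \<Longrightarrow> g \<in> hcar H \<Longrightarrow> hip H f g = hip H' f g"
  using is_rkhs_unique_aux[OF assms] is_rkhs_unique_aux[OF assms(2,1)] by auto

subsection \<open>Square summable families\<close>

definition sq_summable :: "('k \<Rightarrow> complex) \<Rightarrow> bool" where
  "sq_summable a \<longleftrightarrow> (\<lambda>i. (cmod (a i))\<^sup>2) summable_on UNIV"

lemma sq_summable_prod:
  assumes "sq_summable a" "sq_summable b"
  shows "(\<lambda>i. norm (a i * b i)) summable_on UNIV"
proof (rule summable_on_comparison_test)
  show "(\<lambda>i. (cmod (a i))\<^sup>2 + (cmod (b i))\<^sup>2) summable_on UNIV"
    using assms unfolding sq_summable_def by (rule summable_on_add)
  show "norm (a i * b i) \<le> (cmod (a i))\<^sup>2 + (cmod (b i))\<^sup>2" for i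
  proof -
    have "2 * (cmod (a i) * cmod (b i)) \<le> (cmod (a i))\<^sup>2 + (cmod (b i))\<^sup>2"
      using sum_squares_bound[of "cmod (a i)" "cmod (b i)"] by (simp only: mult.assoc)
    moreover have "0 \<le> cmod (a i) * cmod (b i)" by simp
    ultimately show ?thesis unfolding norm_mult by linarith
  qed
qed auto

lemma sq_summable_cnj: "sq_summable a \<Longrightarrow> sq_summable (\<lambda>i. cnj (a i))"
  by (simp add: sq_summable_def)

lemma sq_summable_inner:
  assumes "sq_summable a" "sq_summable b"
  shows "(\<lambda>i. a i * cnj (b i)) summable_on UNIV" "(\<lambda>i. a i * b i) summable_on UNIV"
  using abs_summable_summable[OF sq_summable_prod] assms sq_summable_cnj by blast+

lemma sq_summable_add:
  assumes "sq_summable a" "sq_summable b" shows "sq_summable (\<lambda>i. a i + b i)"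
  unfolding sq_summable_def
proof (rule summable_on_comparison_test)
  show "(\<lambda>i. 2 * (cmod (a i))\<^sup>2 + 2 * (cmod (b i))\<^sup>2) summable_on UNIV"
    using assms unfolding sq_summable_def by (intro summable_on_add summable_on_cmult_right)
  show "(cmod (a i + b i))\<^sup>2 \<le> 2 * (cmod (a i))\<^sup>2 + 2 * (cmod (b i))\<^sup>2" for i
  proof -
    have "(cmod (a i + b i))\<^sup>2 \<le> (cmod (a i) + cmod (b i))\<^sup>2"
      by (intro power_mono norm_triangle_ineq) auto
    also have "\<dots> \<le> 2 * (cmod (a i))\<^sup>2 + 2 * (cmod (b i))\<^sup>2"
      using sum_squares_bound[of "cmod (a i)" "cmod (b i)"] by (simp add: power2_sum)
    finally show ?thesis .
  qed
qed auto

lemma sq_summable_scale: "sq_summable a \<Longrightarrow> sq_summable (\<lambda>i. c * a i)"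
  by (simp add: sq_summable_def norm_mult power_mult_distrib summable_on_cmult_right)

lemma sq_summable_diff: "sq_summable a \<Longrightarrow> sq_summable b \<Longrightarrow> sq_summable (\<lambda>i. a i - b i)"
  using sq_summable_add[OF _ sq_summable_scale[of b "- 1"], of a] by simp

lemma sq_summable_finite: "finite {i. a i \<noteq> 0} \<Longrightarrow> sq_summable a"
  unfolding sq_summable_def
  by (rule finite_nonzero_values_imp_summable_on) (auto elim!: rev_finite_subset)

lemma infsum_self_inner:
  assumes "sq_summable a"
  shows "(\<Sum>\<^sub>\<infinity>i. a i * cnj (a i)) = complex_of_real (\<Sum>\<^sub>\<infinity>i. (cmod (a i))\<^sup>2)"
proof -
  have "((\<lambda>i. complex_of_real ((cmod (a i))\<^sup>2)) has_sum complex_of_real (\<Sum>\<^sub>\<infinity>i. (cmod (a i))\<^sup>2)) UNIV"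
    using assms unfolding sq_summable_def by (intro has_sum_of_real has_sum_infsum)
  then show ?thesis by (intro infsumI) (simp only: complex_norm_square)
qed

text \<open>The limit is taken coordinatewise, and the bounds pass to it through finite partial
  sums.\<close>

lemma sq_summable_complete:
  fixes a :: "nat \<Rightarrow> 'k \<Rightarrow> complex"
  assumes a: "\<And>n. sq_summable (a n)"
    and Cauchy: "\<And>e. e > 0 \<Longrightarrow> \<exists>N. \<forall>m\<ge>N. \<forall>n\<ge>N. (\<Sum>\<^sub>\<infinity>i. (cmod (a m i - a n i))\<^sup>2) < e\<^sup>2"
  shows "\<exists>b. sq_summable b \<and> (\<forall>e>0. \<exists>N. \<forall>n\<ge>N. (\<Sum>\<^sub>\<infinity>i. (cmod (a n i - b i))\<^sup>2) \<le> e\<^sup>2)"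
proof -
  have d: "(\<lambda>i. (cmod (a m i - a n i))\<^sup>2) summable_on UNIV" for m n
    using sq_summable_diff[OF a a, of m n] by (simp add: sq_summable_def)
  have fin: "(\<Sum>i\<in>F. (cmod (a m i - a n i))\<^sup>2) \<le> (\<Sum>\<^sub>\<infinity>i. (cmod (a m i - a n i))\<^sup>2)" if "finite F" for F m n
    by (rule finite_sum_le_infsum[OF d that]) auto
  have "convergent (\<lambda>n. a n i)" for i
    unfolding Cauchy_convergent_iff[symmetric]
  proof (rule metric_CauchyI)
    fix e :: real assume e: "e > 0"
    then obtain N where N: "\<And>m n. m \<ge> N \<Longrightarrow> n \<ge> N \<Longrightarrow> (\<Sum>\<^sub>\<infinity>i. (cmod (a m i - a n i))\<^sup>2) < e\<^sup>2"
      using Cauchy by blast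
    have "dist (a m i) (a n i) < e" if "m \<ge> N" "n \<ge> N" for m n
    proof -
      have "(cmod (a m i - a n i))\<^sup>2 < e\<^sup>2" using fin[of "{i}" m n] N[OF that] by simp
      then show ?thesis using e by (simp add: dist_norm power2_less_imp_less)
    qed
    then show "\<exists>M. \<forall>m\<ge>M. \<forall>n\<ge>M. dist (a m i) (a n i) < e" by blast
  qed
  then obtain b where b: "\<And>i. (\<lambda>n. a n i) \<longlonglongrightarrow> b i" unfolding convergent_def by metis
  have key: "\<exists>N. \<forall>n\<ge>N. \<forall>F. finite F \<longrightarrow> (\<Sum>i\<in>F. (cmod (a n i - b i))\<^sup>2) \<le> e\<^sup>2" if e: "e > 0" for e
  proof -
    obtain N where N: "\<And>m n. m \<ge> N \<Longrightarrow> n \<ge> N \<Longrightarrow> (\<Sum>\<^sub>\<infinity>i. (cmod (a m i - a n i))\<^sup>2) < e\<^sup>2"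
      using Cauchy[OF e] by blast
    have "(\<Sum>i\<in>F. (cmod (a n i - b i))\<^sup>2) \<le> e\<^sup>2" if n: "n \<ge> N" and F: "finite F" for n F
    proof (rule LIMSEQ_le_const2)
      show "(\<lambda>m. \<Sum>i\<in>F. (cmod (a n i - a m i))\<^sup>2) \<longlonglongrightarrow> (\<Sum>i\<in>F. (cmod (a n i - b i))\<^sup>2)"
        by (intro tendsto_intros b)
      show "\<exists>M. \<forall>m\<ge>M. (\<Sum>i\<in>F. (cmod (a n i - a m i))\<^sup>2) \<le> e\<^sup>2"
        using fin[OF F, of n] N[OF n] by (intro exI[of _ N]) (meson less_imp_le order_trans)
    qed
    then show ?thesis by blast
  qed
  have sq: "(\<lambda>i. (cmod (a n i - b i))\<^sup>2) summable_on UNIV \<and> (\<Sum>\<^sub>\<infinity>i. (cmod (a n i - b i))\<^sup>2) \<le> e\<^sup>2"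
    if n: "\<And>F. finite F \<Longrightarrow> (\<Sum>i\<in>F. (cmod (a n i - b i))\<^sup>2) \<le> e\<^sup>2" for n e
  proof -
    have "(\<lambda>i. (cmod (a n i - b i))\<^sup>2) summable_on UNIV"
      by (rule nonneg_bdd_above_summable_on) (auto intro!: bdd_aboveI2[of _ _ "e\<^sup>2"] n)
    then show ?thesis using infsum_le_finite_sums[of _ UNIV "e\<^sup>2"] n by blast
  qed
  obtain N where "\<And>F. finite F \<Longrightarrow> (\<Sum>i\<in>F. (cmod (a N i - b i))\<^sup>2) \<le> 1\<^sup>2" using key[of 1] by auto
  then have "sq_summable (\<lambda>i. a N i - b i)" using sq unfolding sq_summable_def by blast
  from sq_summable_diff[OF a[of N] this] have "sq_summable b" by simp
  moreover have "\<exists>N. \<forall>n\<ge>N. (\<Sum>\<^sub>\<infinity>i. (cmod (a n i - b i))\<^sup>2) \<le> e\<^sup>2" if "e > 0" for e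
    using key[OF that] sq by blast
  ultimately show ?thesis by blast
qed

subsection \<open>Spaces spanned by a family of functions\<close>

text \<open>\<open>e\<close> is going to be an orthonormal basis: the space consists of series with
  square summable coefficients, and \<open>e_indep\<close> makes these unique, so that the inner
  product can be read off them.\<close>

locale feature_space =
  fixes X :: "'x set" and e :: "'k \<Rightarrow> 'x \<Rightarrow> complex"
  assumes e_sq: "\<And>z. z \<in> X \<Longrightarrow> sq_summable (\<lambda>i. e i z)"
    and e_indep: "\<And>a i. sq_summable a \<Longrightarrow> (\<And>z. z \<in> X \<Longrightarrow> (\<Sum>\<^sub>\<infinity>i. a i * e i z) = 0) \<Longrightarrow> a i = 0"
begin

definition synth :: "('k \<Rightarrow> complex) \<Rightarrow> 'x \<Rightarrow> complex" where
  "synth a = (\<lambda>z. if z \<in> X then \<Sum>\<^sub>\<infinity>i. a i * e i z else 0)"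

definition coef :: "('x \<Rightarrow> complex) \<Rightarrow> 'k \<Rightarrow> complex" where
  "coef f = (SOME a. sq_summable a \<and> synth a = f)"

definition fsp :: "'x hfs" where
  "fsp = \<lparr>hcar = synth ` Collect sq_summable, hip = (\<lambda>f g. \<Sum>\<^sub>\<infinity>i. coef f i * cnj (coef g i))\<rparr>"

lemma synth_add:
  assumes "sq_summable a" "sq_summable b" shows "synth (\<lambda>i. a i + b i) = synth a + synth b"
proof
  fix z
  have "(\<Sum>\<^sub>\<infinity>i. (a i + b i) * e i z) = (\<Sum>\<^sub>\<infinity>i. a i * e i z) + (\<Sum>\<^sub>\<infinity>i. b i * e i z)" if "z \<in> X"
    unfolding distrib_right
    by (intro infsum_add sq_summable_inner(2) assms e_sq that)
  then show "synth (\<lambda>i. a i + b i) z = (synth a + synth b) z" by (simp add: synth_def)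
qed

lemma synth_scale: "synth (\<lambda>i. c * a i) = fscale c (synth a)"
  by (simp add: synth_def fscale_def fun_eq_iff mult.assoc infsum_cmult_right')

lemma synth_diff:
  assumes "sq_summable a" "sq_summable b" shows "synth (\<lambda>i. a i - b i) = synth a - synth b"
  using synth_add[OF assms(1) sq_summable_scale[OF assms(2), of "- 1"]] synth_scale[of "- 1" b]
  by (simp add: fscale_def fun_eq_iff)

lemma synth_inj:
  assumes "sq_summable a" "sq_summable b" "synth a = synth b" shows "a = b"
proof
  fix i
  have "synth (\<lambda>i. a i - b i) = (\<lambda>_. 0)" using assms by (simp add: synth_diff fun_eq_iff)
  then have "(\<Sum>\<^sub>\<infinity>i. (a i - b i) * e i z) = 0" if "z \<in> X" for z
    using that by (metis synth_def)
  from e_indep[OF sq_summable_diff[OF assms(1,2)] this] show "a i = b i" by simp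
qed

lemma coef_synth: "sq_summable a \<Longrightarrow> coef (synth a) = a"
  unfolding coef_def using synth_inj by (metis (mono_tags, lifting) someI)

lemma hip_synth: "sq_summable a \<Longrightarrow> sq_summable b \<Longrightarrow> hip fsp (synth a) (synth b) = (\<Sum>\<^sub>\<infinity>i. a i * cnj (b i))"
  by (simp add: fsp_def coef_synth)

lemma hcar_fsp: "hcar fsp = synth ` Collect sq_summable"
  by (simp add: fsp_def)

lemma hnorm_synth: "sq_summable a \<Longrightarrow> hnorm fsp (synth a) = sqrt (\<Sum>\<^sub>\<infinity>i. (cmod (a i))\<^sup>2)"
  by (simp add: hnorm_def hip_synth infsum_self_inner)

lemma fsp_hilbert: "hilbert_function_space X fsp"
  unfolding hilbert_function_space_def
proof (intro conjI ballI allI impI)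
  let ?C = "hcar fsp"
  have zero: "synth (\<lambda>_. 0) = 0" by (simp add: synth_def fun_eq_iff)
  have sq0: "sq_summable (\<lambda>_. 0)" by (simp add: sq_summable_def)
  show "f x = 0" if "f \<in> ?C" "x \<notin> X" for f x using that by (auto simp: hcar_fsp synth_def)
  show "0 \<in> ?C" unfolding hcar_fsp using sq0 by (intro image_eqI[of 0 synth "\<lambda>_. 0"]) (auto simp: zero)
  show "f + g \<in> ?C" if fg: "f \<in> ?C" "g \<in> ?C" for f g
  proof -
    obtain a b where ab: "sq_summable a" "sq_summable b" "f = synth a" "g = synth b"
      using fg unfolding hcar_fsp by blast
    show ?thesis
      unfolding hcar_fsp ab(3,4) synth_add[OF ab(1,2), symmetric]
      using sq_summable_add[OF ab(1,2)] by (intro imageI) simp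
  qed
  show "fscale c f \<in> ?C" if f: "f \<in> ?C" for c f
  proof -
    obtain a where a: "sq_summable a" "f = synth a" using f unfolding hcar_fsp by blast
    show ?thesis
      unfolding hcar_fsp a(2) synth_scale[symmetric]
      using sq_summable_scale[OF a(1)] by (intro imageI) simp
  qed
  show "hip fsp (f + g) h = hip fsp f h + hip fsp g h" if fgh: "f \<in> ?C" "g \<in> ?C" "h \<in> ?C" for f g h
  proof -
    obtain a b c where abc: "sq_summable a" "sq_summable b" "sq_summable c" "f = synth a" "g = synth b" "h = synth c"
      using fgh unfolding hcar_fsp by blast
    show ?thesis
      unfolding abc(4-6) synth_add[OF abc(1,2), symmetric] hip_synth[OF sq_summable_add[OF abc(1,2)] abc(3)]
        hip_synth[OF abc(1,3)] hip_synth[OF abc(2,3)] distrib_right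
      by (intro infsum_add sq_summable_inner abc)
  qed
  show "hip fsp (fscale c f) g = c * hip fsp f g" if fg: "f \<in> ?C" "g \<in> ?C" for c f g
  proof -
    obtain a b where abc: "sq_summable a" "sq_summable b" "f = synth a" "g = synth b"
      using fg unfolding hcar_fsp by blast
    show ?thesis
      unfolding abc(3,4) synth_scale[symmetric] hip_synth[OF sq_summable_scale[OF abc(1)] abc(2)]
        hip_synth[OF abc(1,2)] mult.assoc by (rule infsum_cmult_right')
  qed
  show "hip fsp g f = cnj (hip fsp f g)" if "f \<in> ?C" "g \<in> ?C" for f g
    by (simp add: fsp_def infsum_cnj[symmetric] mult.commute)
  show "0 < Re (hip fsp f f)" if f: "f \<in> ?C" "f \<noteq> 0" for f
  proof -
    obtain a where a: "sq_summable a" "f = synth a" using f unfolding hcar_fsp by blast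
    have "Re (hip fsp f f) = (\<Sum>\<^sub>\<infinity>i. (cmod (a i))\<^sup>2)" using a by (simp add: hip_synth infsum_self_inner)
    moreover have "\<dots> \<noteq> 0"
    proof
      assume "(\<Sum>\<^sub>\<infinity>i. (cmod (a i))\<^sup>2) = 0"
      then have "(cmod (a i))\<^sup>2 = 0" for i
        using nonneg_infsum_le_0D[of "\<lambda>i. (cmod (a i))\<^sup>2" UNIV i] a(1) by (simp add: sq_summable_def)
      then have "a = (\<lambda>_. 0)" by auto
      then show False using f(2) a(2) zero by simp
    qed
    moreover have "(\<Sum>\<^sub>\<infinity>i. (cmod (a i))\<^sup>2) \<ge> 0" by (rule infsum_nonneg) auto
    ultimately show ?thesis by linarith
  qed
  fix s :: "nat \<Rightarrow> 'x \<Rightarrow> complex"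
  assume s: "(\<forall>n. s n \<in> ?C) \<and> (\<forall>e>0. \<exists>N. \<forall>m\<ge>N. \<forall>n\<ge>N. hnorm fsp (s m - s n) < e)"
  then have "\<forall>n. \<exists>a. sq_summable a \<and> s n = synth a" unfolding hcar_fsp by blast
  then obtain a where a: "\<And>n. sq_summable (a n)" "\<And>n. s n = synth (a n)" by metis
  have norm: "hnorm fsp (synth b - synth c) = sqrt (\<Sum>\<^sub>\<infinity>i. (cmod (b i - c i))\<^sup>2)"
    if "sq_summable b" "sq_summable c" for b c
    using hnorm_synth[OF sq_summable_diff[OF that]] synth_diff[OF that] by simp
  have "\<exists>N. \<forall>m\<ge>N. \<forall>n\<ge>N. (\<Sum>\<^sub>\<infinity>i. (cmod (a m i - a n i))\<^sup>2) < \<epsilon>\<^sup>2" if \<epsilon>: "\<epsilon> > 0" for \<epsilon>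
  proof -
    obtain N where N: "\<And>m n. m \<ge> N \<Longrightarrow> n \<ge> N \<Longrightarrow> hnorm fsp (s m - s n) < \<epsilon>" using s \<epsilon> by blast
    have "(\<Sum>\<^sub>\<infinity>i. (cmod (a m i - a n i))\<^sup>2) < \<epsilon>\<^sup>2" if "m \<ge> N" "n \<ge> N" for m n
    proof -
      have "sqrt (\<Sum>\<^sub>\<infinity>i. (cmod (a m i - a n i))\<^sup>2) < sqrt (\<epsilon>\<^sup>2)"
        using N[OF that] \<epsilon> unfolding a(2) norm[OF a(1) a(1)] by simp
      then show ?thesis by (simp only: real_sqrt_less_iff)
    qed
    then show ?thesis by blast
  qed
  from sq_summable_complete[OF a(1) this] obtain b
    where b: "sq_summable b" "\<And>\<epsilon>. \<epsilon> > 0 \<Longrightarrow> \<exists>N. \<forall>n\<ge>N. (\<Sum>\<^sub>\<infinity>i. (cmod (a n i - b i))\<^sup>2) \<le> \<epsilon>\<^sup>2" by blast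
  have "(\<lambda>n. hnorm fsp (s n - synth b)) \<longlonglongrightarrow> 0"
  proof (rule LIMSEQ_I)
    fix r :: real assume r: "r > 0"
    then obtain N where N: "\<And>n. n \<ge> N \<Longrightarrow> (\<Sum>\<^sub>\<infinity>i. (cmod (a n i - b i))\<^sup>2) \<le> (r/2)\<^sup>2" using b(2)[of "r/2"] by auto
    have "norm (hnorm fsp (s n - synth b) - 0) < r" if "n \<ge> N" for n
    proof -
      have "sqrt (\<Sum>\<^sub>\<infinity>i. (cmod (a n i - b i))\<^sup>2) \<le> r/2"
        using N[OF that] r by (intro real_le_lsqrt) auto
      moreover have "sqrt (\<Sum>\<^sub>\<infinity>i. (cmod (a n i - b i))\<^sup>2) \<ge> 0" by (simp add: infsum_nonneg)
      ultimately show ?thesis unfolding a(2) norm[OF a(1) b(1)] using r by simp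
    qed
    then show "\<exists>no. \<forall>n\<ge>no. norm (hnorm fsp (s n - synth b) - 0) < r" by blast
  qed
  then show "\<exists>f\<in>?C. (\<lambda>n. hnorm fsp (s n - f)) \<longlonglongrightarrow> 0" using b(1) unfolding hcar_fsp by blast
qed

lemma fsp_rkhs:
  assumes K: "\<And>z w. z \<in> X \<Longrightarrow> w \<in> X \<Longrightarrow> K z w = (\<Sum>\<^sub>\<infinity>i. e i z * cnj (e i w))"
  shows "is_rkhs X K fsp"
  unfolding is_rkhs_def
proof (intro conjI ballI)
  show "hilbert_function_space X fsp" by (rule fsp_hilbert)
  fix w assume w: "w \<in> X"
  have sq: "sq_summable (\<lambda>i. cnj (e i w))" by (rule sq_summable_cnj[OF e_sq[OF w]])
  have k: "(\<lambda>z. if z \<in> X then K z w else 0) = synth (\<lambda>i. cnj (e i w))"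
    using K[OF _ w] by (auto simp: synth_def fun_eq_iff mult.commute)
  show "(\<lambda>z. if z \<in> X then K z w else 0) \<in> hcar fsp" unfolding k hcar_fsp using sq by blast
  fix f assume "f \<in> hcar fsp"
  then obtain a where a: "sq_summable a" "f = synth a" unfolding hcar_fsp by blast
  show "hip fsp f (\<lambda>z. if z \<in> X then K z w else 0) = f w"
    unfolding k a(2) hip_synth[OF a(1) sq] using w by (simp add: synth_def)
qed

end

section \<open>The Drury-Arveson space\<close>

definition word_content :: "'n list \<Rightarrow> 'n \<Rightarrow>\<^sub>0 nat" where
  "word_content u = sum_list (map (\<lambda>i. Poly_Mapping.single i 1) u)"

text \<open>The multinomial coefficient; as a count of words it expands \<open>cinner z w ^ n\<close> directly.\<close>

definition multinom :: "('n::finite \<Rightarrow>\<^sub>0 nat) \<Rightarrow> nat" where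
  "multinom \<alpha> = card {u. word_content u = \<alpha>}"

lemma word_content_Nil [simp]: "word_content [] = 0"
  and word_content_Cons [simp]: "word_content (i # u) = Poly_Mapping.single i 1 + word_content u"
  by (simp_all add: word_content_def)

lemma tdeg_word_content: "tdeg (word_content u) = length (u :: 'n::finite list)"
  by (induction u) (simp_all del: One_nat_def add: tdeg_add)

lemma finite_words_of_length: "finite {u :: 'n::finite list. length u = n}"
  using finite_lists_length_eq[of "UNIV :: 'n set" n] by simp

lemma finite_words_of_content: "finite {u. word_content u = (\<alpha> :: 'n::finite \<Rightarrow>\<^sub>0 nat)}"
  by (rule finite_subset[OF _ finite_words_of_length[of "tdeg \<alpha>"]]) (auto simp: tdeg_word_content)

lemma word_with_content: "\<exists>u. word_content u = (\<alpha> :: 'n::finite \<Rightarrow>\<^sub>0 nat)"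
proof (induction "tdeg \<alpha>" arbitrary: \<alpha>)
  case 0
  then show ?case using tdeg_eq_0[of \<alpha>] by (intro exI[of _ "[]"]) simp
next
  case (Suc n)
  then have "\<alpha> \<noteq> 0" by auto
  then obtain i \<beta> where e: "\<alpha> = Poly_Mapping.single i 1 + \<beta>" by (rule exponent_cases)
  then have "n = tdeg \<beta>" using Suc(2) by (simp add: tdeg_add)
  then obtain u where "word_content u = \<beta>" using Suc(1) by blast
  then show ?case using e by (intro exI[of _ "i # u"]) simp
qed

lemma multinom_pos: "multinom \<alpha> > 0"
  using word_with_content[of \<alpha>] finite_words_of_content[of \<alpha>] by (auto simp: multinom_def card_gt_0_iff)

lemma multinom_ne_0: "multinom \<alpha> \<noteq> 0"
  using multinom_pos[of \<alpha>] by simp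

text \<open>Prefixing the letter \<open>i\<close> to a word is injective. The inequality is what
  makes multiplication by a coordinate contractive.\<close>

lemma multinom_mono: "multinom \<alpha> \<le> multinom (Poly_Mapping.single i 1 + \<alpha>)"
proof -
  have "multinom \<alpha> = card ((#) i ` {u. word_content u = \<alpha>})"
    unfolding multinom_def by (subst card_image) auto
  also have "\<dots> \<le> multinom (Poly_Mapping.single i 1 + \<alpha>)"
    unfolding multinom_def by (rule card_mono[OF finite_words_of_content]) auto
  finally show ?thesis .
qed

definition level :: "nat \<Rightarrow> ('n::finite \<Rightarrow>\<^sub>0 nat) set" where
  "level n = {\<alpha>. tdeg \<alpha> = n}"

lemma finite_level: "finite (level n)"
  by (rule finite_subset[OF _ finite_exponents_bounded[of n]]) (auto simp: level_def)

lemma words_of_length_sum: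
  "(\<Sum>u\<in>{u. length u = n}. monom_fun (word_content u) x) = (\<Sum>i\<in>UNIV. x $ i) ^ n"
proof (induction n)
  case (Suc n)
  have inj: "inj_on (\<lambda>(i :: 'a, u). i # u) (UNIV \<times> {u. length u = n})" by (auto simp: inj_on_def)
  have eq: "{u :: 'a list. length u = Suc n} = (\<lambda>(i, u). i # u) ` (UNIV \<times> {u. length u = n})"
    by (auto simp: length_Suc_conv)
  have "(\<Sum>u\<in>{u. length u = Suc n}. monom_fun (word_content u) x)
      = (\<Sum>iu\<in>UNIV \<times> {u. length u = n}. monom_fun (word_content ((\<lambda>(i, u). i # u) iu)) x)"
    unfolding eq by (simp only: sum.reindex[OF inj] o_def)
  also have "\<dots> = (\<Sum>(i, u)\<in>UNIV \<times> {u. length u = n}. x $ i * monom_fun (word_content u) x)"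
    by (intro sum.cong refl) (auto simp: monom_fun_add simp del: One_nat_def)
  also have "\<dots> = (\<Sum>i\<in>UNIV. x $ i) * (\<Sum>u\<in>{u. length u = n}. monom_fun (word_content u) x)"
    by (simp add: sum.cartesian_product[symmetric] sum_product)
  finally show ?case using Suc by simp
qed simp

text \<open>Words of length \<open>n\<close> index the terms of the expanded power; grouping them by
  content collects equal monomials.\<close>

lemma multinomial_theorem:
  "(\<Sum>\<alpha>\<in>level n. of_nat (multinom \<alpha>) * monom_fun \<alpha> x) = (\<Sum>i\<in>UNIV. x $ i) ^ n"
proof -
  have "of_nat (multinom \<alpha>) * monom_fun \<alpha> x
      = (\<Sum>u | u \<in> {u. length u = n} \<and> word_content u = \<alpha>. monom_fun (word_content u) x)" if "\<alpha> \<in> level n" for \<alpha>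
  proof -
    have "(\<Sum>u | u \<in> {u. length u = n} \<and> word_content u = \<alpha>. monom_fun (word_content u) x)
        = (\<Sum>u\<in>{u. word_content u = \<alpha>}. monom_fun \<alpha> x)"
      using that by (intro sum.cong) (auto simp: level_def tdeg_word_content[symmetric])
    then show ?thesis by (auto simp: multinom_def)
  qed
  then have "(\<Sum>\<alpha>\<in>level n. of_nat (multinom \<alpha>) * monom_fun \<alpha> x)
      = (\<Sum>\<alpha>\<in>level n. \<Sum>u | u \<in> {u. length u = n} \<and> word_content u = \<alpha>. monom_fun (word_content u) x)"
    by (rule sum.cong[OF refl])
  also have "\<dots> = (\<Sum>u\<in>{u. length u = n}. monom_fun (word_content u) x)"
    by (rule sum.group[OF finite_words_of_length finite_level]) (auto simp: level_def tdeg_word_content)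
  finally show ?thesis by (simp only: words_of_length_sum)
qed

text \<open>Grouping by total degree turns an unordered sum into an ordinary series, to which the
  geometric series and the identity theorem for power series apply.\<close>

lemma sums_levels:
  fixes f :: "('n::finite \<Rightarrow>\<^sub>0 nat) \<Rightarrow> 'a :: banach"
  assumes "f summable_on UNIV"
  shows "(\<lambda>n. \<Sum>\<alpha>\<in>level n. f \<alpha>) sums (infsum f UNIV)"
proof -
  define B where "B N = {\<alpha> :: 'n \<Rightarrow>\<^sub>0 nat. tdeg \<alpha> < N}" for N
  have finB: "finite (B N)" for N
    by (rule finite_subset[OF _ finite_exponents_bounded[of N]]) (auto simp: B_def)
  have "(sum f \<longlongrightarrow> infsum f UNIV) (finite_subsets_at_top UNIV)"
    using has_sum_infsum[OF assms] by (simp add: has_sum_def)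
  moreover have "filterlim B (finite_subsets_at_top UNIV) sequentially"
    unfolding filterlim_finite_subsets_at_top
  proof (intro allI impI)
    fix A :: "('n \<Rightarrow>\<^sub>0 nat) set" assume A: "finite A \<and> A \<subseteq> UNIV"
    then obtain M where "\<forall>\<alpha>\<in>A. tdeg \<alpha> \<le> M"
      by (metis finite_imageI finite_nat_set_iff_bounded_le image_eqI)
    then have "A \<subseteq> B N" if "N \<ge> Suc M" for N using that by (force simp: B_def)
    then show "\<forall>\<^sub>F N in sequentially. finite (B N) \<and> A \<subseteq> B N \<and> B N \<subseteq> UNIV"
      unfolding eventually_sequentially using finB by blast
  qed
  ultimately have "(\<lambda>N. sum f (B N)) \<longlonglongrightarrow> infsum f UNIV" by (rule filterlim_compose)
  moreover have "sum f (B N) = (\<Sum>n<N. \<Sum>\<alpha>\<in>level n. f \<alpha>)" for N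
  proof -
    have "B N = (\<Union>n\<in>{..<N}. level n)" by (auto simp: B_def level_def)
    then show ?thesis by (simp only:) (rule sum.UNION_disjoint, auto simp: finite_level, auto simp: level_def)
  qed
  ultimately show ?thesis by (simp add: sums_def)
qed

lemma norm_monom_fun: "complex_of_real (cmod (monom_fun \<alpha> x)) = monom_fun \<alpha> (\<chi> i. complex_of_real (cmod (x $ i)))"
  by (simp add: monom_fun_def prod_norm[symmetric] norm_power)

text \<open>By the multinomial theorem for the moduli, each degree contributes one term of a
  geometric series, which bounds all finite sums.\<close>

lemma multinomial_summable:
  assumes "(\<Sum>i\<in>UNIV. cmod (x $ i)) < 1"
  shows "(\<lambda>\<alpha>. norm (of_nat (multinom \<alpha>) * monom_fun \<alpha> x)) summable_on UNIV"
proof (rule nonneg_bdd_above_summable_on)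
  let ?t = "\<Sum>i\<in>UNIV. cmod (x $ i)" and ?f = "\<lambda>\<alpha>. norm (of_nat (multinom \<alpha>) * monom_fun \<alpha> x)"
  have t0: "?t \<ge> 0" by (intro sum_nonneg) auto
  have lev: "sum ?f (level n) = ?t ^ n" for n
  proof -
    have "complex_of_real (sum ?f (level n)) = complex_of_real (?t ^ n)"
      using multinomial_theorem[where n = n and x = "\<chi> i. complex_of_real (cmod (x $ i))"]
      by (simp add: norm_mult norm_monom_fun)
    then show ?thesis by (simp only: of_real_eq_iff)
  qed
  have "sum ?f A \<le> 1 / (1 - ?t)" if A: "finite A" for A
  proof -
    obtain M where "\<forall>\<alpha>\<in>A. tdeg \<alpha> \<le> M"
      using A by (metis finite_imageI finite_nat_set_iff_bounded_le image_eqI)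
    then have "A \<subseteq> (\<Union>n\<in>{..M}. level n)" by (auto simp: level_def)
    then have "sum ?f A \<le> sum ?f (\<Union>n\<in>{..M}. level n)"
      by (intro sum_mono2) (auto simp: finite_level)
    also have "\<dots> = (\<Sum>n\<le>M. sum ?f (level n))"
      by (rule sum.UNION_disjoint) (auto simp: finite_level, auto simp: level_def)
    also have "\<dots> = (\<Sum>n\<le>M. ?t ^ n)" by (simp only: lev)
    also have "\<dots> \<le> suminf (\<lambda>n. ?t ^ n)"
      using assms t0 by (intro sum_le_suminf summable_geometric) auto
    also have "\<dots> = 1 / (1 - ?t)" using assms t0 by (intro suminf_geometric) auto
    finally show ?thesis .
  qed
  then show "bdd_above (sum ?f ` {F. F \<subseteq> UNIV \<and> finite F})" by (intro bdd_aboveI2) auto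
qed auto

lemma multinomial_series:
  assumes "(\<Sum>i\<in>UNIV. cmod (x $ i)) < 1"
  shows "(\<Sum>\<^sub>\<infinity>\<alpha>. of_nat (multinom \<alpha>) * monom_fun \<alpha> x) = 1 / (1 - (\<Sum>i\<in>UNIV. x $ i))"
proof -
  have "(\<lambda>\<alpha>. of_nat (multinom \<alpha>) * monom_fun \<alpha> x) summable_on UNIV"
    by (rule abs_summable_summable[OF multinomial_summable[OF assms]])
  from sums_levels[OF this] have "(\<lambda>n. (\<Sum>i\<in>UNIV. x $ i) ^ n) sums (\<Sum>\<^sub>\<infinity>\<alpha>. of_nat (multinom \<alpha>) * monom_fun \<alpha> x)"
    by (simp add: multinomial_theorem)
  moreover have "cmod (\<Sum>i\<in>UNIV. x $ i) < 1"
    using assms norm_sum[of "\<lambda>i. x $ i" UNIV] by linarith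
  ultimately show ?thesis using geometric_sums sums_unique2 by blast
qed

text \<open>The monomials scaled to unit norm: the squared norm of a monomial in the Drury-Arveson
  space is the inverse of its multinomial coefficient. Expanding the kernel as a geometric series in
  \<open>cinner z w\<close> produces this basis.\<close>

definition da_feature :: "('n::finite \<Rightarrow>\<^sub>0 nat) \<Rightarrow> complex ^ 'n \<Rightarrow> complex" where
  "da_feature \<alpha> z = complex_of_real (sqrt (real (multinom \<alpha>))) * monom_fun \<alpha> z"

lemma da_feature_prod:
  "da_feature \<alpha> z * cnj (da_feature \<alpha> w) = of_nat (multinom \<alpha>) * monom_fun \<alpha> (\<chi> i. z $ i * cnj (w $ i))"
proof -
  have "cnj (monom_fun \<alpha> w) = monom_fun \<alpha> (\<chi> i. cnj (w $ i))" by (simp add: monom_fun_def)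
  then have "monom_fun \<alpha> (\<chi> i. z $ i * cnj (w $ i)) = monom_fun \<alpha> z * cnj (monom_fun \<alpha> w)"
    using monom_fun_times[of \<alpha> z "\<chi> i. cnj (w $ i)"] by simp
  moreover have "complex_of_real (sqrt (real (multinom \<alpha>))) * complex_of_real (sqrt (real (multinom \<alpha>))) = of_nat (multinom \<alpha>)"
    unfolding of_real_mult[symmetric] by simp
  ultimately show ?thesis by (simp add: da_feature_def algebra_simps)
qed

lemma product_sum_less_1:
  assumes "z \<in> ball 0 1" "w \<in> ball (0 :: complex ^ 'n::finite) 1"
  shows "(\<Sum>i\<in>UNIV. cmod ((\<chi> i. z $ i * cnj (w $ i)) $ i)) < 1"
proof -
  have "(\<Sum>i\<in>UNIV. \<bar>cmod (z $ i)\<bar> * \<bar>cmod (w $ i)\<bar>) \<le> norm z * norm w"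
    unfolding norm_vec_def by (rule L2_set_mult_ineq)
  also have "\<dots> < 1" using assms mult_strict_mono[of "norm z" 1 "norm w" 1] by simp
  finally show ?thesis by (simp add: norm_mult)
qed

lemma da_feature_sq_summable: "z \<in> ball 0 1 \<Longrightarrow> sq_summable (\<lambda>\<alpha>. da_feature \<alpha> z)"
  unfolding sq_summable_def
proof -
  assume z: "z \<in> ball 0 1"
  have "(cmod (da_feature \<alpha> z))\<^sup>2 = norm (of_nat (multinom \<alpha>) * monom_fun \<alpha> (\<chi> i. z $ i * cnj (z $ i)))" for \<alpha>
    unfolding da_feature_prod[symmetric] by (simp add: norm_mult power2_eq_square)
  then show "(\<lambda>\<alpha>. (cmod (da_feature \<alpha> z))\<^sup>2) summable_on UNIV"
    using multinomial_summable[OF product_sum_less_1[OF z z]] by simp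
qed

lemma da_feature_kernel:
  assumes "z \<in> ball 0 1" "w \<in> ball 0 1"
  shows "1 / (1 - cinner z w) = (\<Sum>\<^sub>\<infinity>\<alpha>. da_feature \<alpha> z * cnj (da_feature \<alpha> w))"
  unfolding da_feature_prod multinomial_series[OF product_sum_less_1[OF assms]] by (simp add: cinner_def)

lemma da_feature_scale: "da_feature \<alpha> (c *s z) = c ^ tdeg \<alpha> * da_feature \<alpha> z"
  by (simp add: da_feature_def monom_fun_scale)

section \<open>Homogeneous expansions and the identity theorem at the origin\<close>

lemma power_series_zero:
  assumes "\<And>t :: complex. cmod t < 1 \<Longrightarrow> (\<lambda>n. c n * t ^ n) sums 0"
  shows "c n = 0"
proof (rule ccontr)
  assume c: "c n \<noteq> 0"
  show False
  proof (cases "n = 0")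
    case True
    then show False using assms[of 0] c by simp
  next
    case False
    obtain s where s: "s > 0" "\<And>z :: complex. z \<in> cball 0 s - {0} \<Longrightarrow> (\<lambda>_. 0 :: complex) z \<noteq> 0"
      by (rule powser_0_nonzero[of 1 0 c "\<lambda>_. 0" n]) (use assms c False in auto)
    have "complex_of_real s \<in> cball 0 s - {0}" using s(1) by simp
    then show False using s(2) by blast
  qed
qed

text \<open>Along \<open>t *s z\<close> the series becomes a power series in \<open>t\<close>, whose
  coefficients are the homogeneous parts at \<open>z\<close>.\<close>

lemma da_series_level_zero:
  assumes a: "sq_summable a" and z: "z \<in> ball 0 1"
    and zero: "\<And>t. cmod t < 1 \<Longrightarrow> (\<Sum>\<^sub>\<infinity>\<alpha>. a \<alpha> * da_feature \<alpha> (t *s z)) = 0"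
  shows "(\<Sum>\<alpha>\<in>level n. a \<alpha> * da_feature \<alpha> z) = 0"
proof (rule power_series_zero)
  fix t :: complex assume t: "cmod t < 1"
  have "cmod t * norm z \<le> 1 * norm z" using t by (intro mult_right_mono) auto
  then have tz: "t *s z \<in> ball 0 1" using z by (simp add: norm_vector_scalar_mult)
  have "(\<lambda>\<alpha>. a \<alpha> * da_feature \<alpha> (t *s z)) summable_on UNIV"
    by (rule sq_summable_inner(2)[OF a da_feature_sq_summable[OF tz]])
  from sums_levels[OF this] have "(\<lambda>n. \<Sum>\<alpha>\<in>level n. a \<alpha> * da_feature \<alpha> (t *s z)) sums 0"
    by (simp add: zero[OF t])
  moreover have "(\<Sum>\<alpha>\<in>level n. a \<alpha> * da_feature \<alpha> (t *s z)) = (\<Sum>\<alpha>\<in>level n. a \<alpha> * da_feature \<alpha> z) * t ^ n" for n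
    unfolding sum_distrib_right by (intro sum.cong) (auto simp: da_feature_scale level_def)
  ultimately show "(\<lambda>n. (\<Sum>\<alpha>\<in>level n. a \<alpha> * da_feature \<alpha> z) * t ^ n) sums 0" by simp
qed

text \<open>The assumption is local because later identities are available only where
  \<open>cadjoint A\<close> maps into the ball. Each homogeneous part vanishes near 0, hence
  everywhere by scaling, and the monomials are independent.\<close>

lemma da_series_identity:
  assumes a: "sq_summable a" and \<epsilon>: "\<epsilon> > 0"
    and zero: "\<And>z. norm z < \<epsilon> \<Longrightarrow> norm z < 1 \<Longrightarrow> (\<Sum>\<^sub>\<infinity>\<alpha>. a \<alpha> * da_feature \<alpha> z) = 0"
  shows "a \<alpha> = 0"
proof -
  let ?n = "tdeg \<alpha>"
  define \<rho> where "\<rho> = min \<epsilon> 1 / 2"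
  have \<rho>: "\<rho> > 0" "\<rho> < \<epsilon>" "\<rho> < 1" using \<epsilon> by (auto simp: \<rho>_def min_def)
  have small: "(\<Sum>\<alpha>\<in>level ?n. a \<alpha> * da_feature \<alpha> z) = 0" if z: "norm z \<le> \<rho>" for z
  proof (rule da_series_level_zero[OF a])
    show "z \<in> ball 0 1" using z \<rho> by simp
    fix t :: complex assume t: "cmod t < 1"
    have "cmod t * norm z \<le> 1 * norm z" using t by (intro mult_right_mono) auto
    then have "norm (t *s z) \<le> \<rho>" using z by (simp add: norm_vector_scalar_mult)
    then show "(\<Sum>\<^sub>\<infinity>\<alpha>. a \<alpha> * da_feature \<alpha> (t *s z)) = 0" using \<rho> by (intro zero) auto
  qed
  have "(\<Sum>\<alpha>\<in>level ?n. (a \<alpha> * complex_of_real (sqrt (real (multinom \<alpha>)))) * monom_fun \<alpha> z) = 0" for z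
  proof -
    \<comment> \<open>Scales \<open>z\<close> into the ball of radius \<open>\<rho>\<close>; the
      added 1 covers \<open>z = 0\<close>.\<close>
    define c where "c = complex_of_real (\<rho> / (norm z + 1))"
    have "\<rho> / (norm z + 1) > 0" using \<rho> by (intro divide_pos_pos add_nonneg_pos) auto
    then have c: "c \<noteq> 0" unfolding c_def of_real_eq_0_iff by linarith
    have "norm (c *s z) = \<rho> * (norm z / (norm z + 1))"
      using \<rho> by (simp add: c_def norm_vector_scalar_mult norm_divide)
    also have "\<dots> \<le> \<rho> * 1" using \<rho> by (intro mult_left_mono) (auto simp: divide_le_eq_1 add_nonneg_pos)
    finally have "(\<Sum>\<alpha>\<in>level ?n. a \<alpha> * da_feature \<alpha> (c *s z)) = 0" by (intro small) simp
    moreover have "(\<Sum>\<alpha>\<in>level ?n. a \<alpha> * da_feature \<alpha> (c *s z)) = c ^ ?n * (\<Sum>\<alpha>\<in>level ?n. a \<alpha> * da_feature \<alpha> z)"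
      unfolding sum_distrib_left by (intro sum.cong) (auto simp: da_feature_scale level_def)
    ultimately show ?thesis using c by (simp add: da_feature_def mult_ac)
  qed
  from monom_fun_independent[OF finite_level this, of \<alpha>]
  have "a \<alpha> * complex_of_real (sqrt (real (multinom \<alpha>))) = 0" by (simp add: level_def)
  then show ?thesis using multinom_pos[of \<alpha>] by simp
qed

interpretation da: feature_space "ball (0 :: complex ^ 'n::finite) 1" da_feature
proof
  show "a \<alpha> = 0" if "sq_summable a" "\<And>z. z \<in> ball 0 1 \<Longrightarrow> (\<Sum>\<^sub>\<infinity>\<alpha>. a \<alpha> * da_feature \<alpha> z) = 0"
    for a :: "('n \<Rightarrow>\<^sub>0 nat) \<Rightarrow> complex" and \<alpha>
    by (rule da_series_identity[OF that(1), of 1]) (use that(2) in auto)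
qed (rule da_feature_sq_summable)

lemma da_fsp_rkhs: "is_rkhs (ball 0 1) (\<lambda>z w. 1 / (1 - cinner z w)) (da.fsp :: (complex ^ 'n::finite) hfs)"
  by (rule da.fsp_rkhs) (rule da_feature_kernel)

abbreviation da_kernel :: "complex ^ 'n::finite \<Rightarrow> complex ^ 'n \<Rightarrow> complex" where
  "da_kernel w \<equiv> on_ball (\<lambda>z. 1 / (1 - cinner z w))"

text \<open>The witness \<open>da.fsp\<close> makes the choice in \<open>drury_arveson\<close>
  meaningful. By uniqueness the chosen space has the same carrier and the same inner product on it,
  so computations with coefficients carry over.\<close>

lemma da_rkhs: "is_rkhs (ball 0 1) (\<lambda>z w. 1 / (1 - cinner z w)) (drury_arveson :: (complex ^ 'n::finite) hfs)"
  unfolding drury_arveson_def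
  by (rule someI[of "is_rkhs (ball 0 1) (\<lambda>z w. 1 / (1 - cinner z w))"]) (rule da_fsp_rkhs)

interpretation DA: hilbert_fs "ball (0 :: complex ^ 'n::finite) 1" drury_arveson
  by (rule is_rkhsD(1)[OF da_rkhs])

lemma kernel_at_da: "kernel_at (ball 0 1) (\<lambda>z w. 1 / (1 - cinner z w)) w = da_kernel w"
  by (simp add: kernel_at_def on_ball_def)

lemma da_kernel_mem: "w \<in> ball 0 1 \<Longrightarrow> da_kernel w \<in> hcar drury_arveson"
  using is_rkhsD(2)[OF da_rkhs] unfolding kernel_at_da .

lemma da_kernel_hip: "w \<in> ball 0 1 \<Longrightarrow> f \<in> hcar drury_arveson \<Longrightarrow> hip drury_arveson f (da_kernel w) = f w"
  using is_rkhsD(3)[OF da_rkhs] unfolding kernel_at_da .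

lemma hcar_da: "hcar drury_arveson = da.synth ` Collect sq_summable"
  using is_rkhs_unique(1)[OF da_rkhs da_fsp_rkhs] by (simp add: da.hcar_fsp)

lemma hip_da: "sq_summable a \<Longrightarrow> sq_summable b \<Longrightarrow>
    hip drury_arveson (da.synth a) (da.synth b) = (\<Sum>\<^sub>\<infinity>i. a i * cnj (b i))"
proof -
  assume ab: "sq_summable a" "sq_summable b"
  then have "da.synth a \<in> hcar drury_arveson" "da.synth b \<in> hcar drury_arveson"
    unfolding hcar_da by blast+
  from is_rkhs_unique(2)[OF da_rkhs da_fsp_rkhs this] show ?thesis
    unfolding da.hip_synth[OF ab] .
qed

lemma hnorm_da_sq: "sq_summable a \<Longrightarrow> (hnorm drury_arveson (da.synth a))\<^sup>2 = (\<Sum>\<^sub>\<infinity>i. (cmod (a i))\<^sup>2)"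
proof -
  assume a: "sq_summable a"
  then have "da.synth a \<in> hcar drury_arveson" using hcar_da by blast
  then show ?thesis using a by (simp add: DA.hnorm_sq hip_da infsum_self_inner)
qed

lemma da_identity:
  assumes f: "f \<in> hcar drury_arveson" and "\<epsilon> > 0" and "\<And>z. norm z < \<epsilon> \<Longrightarrow> norm z < 1 \<Longrightarrow> f z = 0"
  shows "f = 0"
proof -
  obtain a where a: "sq_summable a" "f = da.synth a" using f unfolding hcar_da by blast
  have "a \<alpha> = 0" for \<alpha>
    by (rule da_series_identity[OF a(1) assms(2)]) (use assms(3) a(2) in \<open>simp add: da.synth_def\<close>)
  then show ?thesis by (simp add: a(2) da.synth_def fun_eq_iff)
qed

lemma on_ball_poly_synth:
  "on_ball (peval p) = da.synth (\<lambda>\<alpha>. Poly_Mapping.lookup p \<alpha> / complex_of_real (sqrt (real (multinom \<alpha>))))"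
    (is "_ = da.synth ?a")
  and on_ball_poly_sq_summable:
  "sq_summable (\<lambda>\<alpha>. Poly_Mapping.lookup p \<alpha> / complex_of_real (sqrt (real (multinom \<alpha>))))"
proof -
  show "sq_summable ?a"
    by (rule sq_summable_finite) (rule finite_subset[OF _ finite_keys[of p]], auto simp: in_keys_iff)
  have "(\<Sum>\<^sub>\<infinity>\<alpha>. ?a \<alpha> * da_feature \<alpha> z) = peval p z" for z
  proof -
    have "?a \<alpha> * da_feature \<alpha> z = Poly_Mapping.lookup p \<alpha> * monom_fun \<alpha> z" for \<alpha>
      using multinom_pos[of \<alpha>] by (simp add: da_feature_def)
    then have "(\<Sum>\<^sub>\<infinity>\<alpha>. ?a \<alpha> * da_feature \<alpha> z) = (\<Sum>\<^sub>\<infinity>\<alpha>. Poly_Mapping.lookup p \<alpha> * monom_fun \<alpha> z)" by simp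
    also have "\<dots> = (\<Sum>\<^sub>\<infinity>\<alpha>\<in>Poly_Mapping.keys p. Poly_Mapping.lookup p \<alpha> * monom_fun \<alpha> z)"
      by (rule infsum_cong_neutral) (auto simp: in_keys_iff)
    also have "\<dots> = peval p z" by (simp add: peval_superset[OF finite_keys subset_refl])
    finally show ?thesis .
  qed
  then show "on_ball (peval p) = da.synth ?a" by (simp add: on_ball_def da.synth_def fun_eq_iff)
qed

lemma on_ball_poly_mem [simp, intro]: "on_ball (peval p) \<in> hcar drury_arveson"
  unfolding hcar_da on_ball_poly_synth using on_ball_poly_sq_summable by blast

subsection \<open>Homogeneous parts\<close>

text \<open>Filtering the coefficients by total degree covers single homogeneous parts as well as
  truncations; each filter is an orthogonal projection.\<close>

definition da_part :: "(nat \<Rightarrow> bool) \<Rightarrow> (complex ^ 'n::finite \<Rightarrow> complex) \<Rightarrow> complex ^ 'n \<Rightarrow> complex" where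
  "da_part P f = da.synth (\<lambda>\<alpha>. if P (tdeg \<alpha>) then da.coef f \<alpha> else 0)"

lemma sq_summable_part: "sq_summable a \<Longrightarrow> sq_summable (\<lambda>\<alpha>. if P \<alpha> then a \<alpha> else 0)"
  unfolding sq_summable_def by (rule summable_on_comparison_test) auto

lemma da_part_synth: "sq_summable a \<Longrightarrow> da_part P (da.synth a) = da.synth (\<lambda>\<alpha>. if P (tdeg \<alpha>) then a \<alpha> else 0)"
  by (simp only: da_part_def da.coef_synth)

lemma da_part_mem: "f \<in> hcar drury_arveson \<Longrightarrow> da_part P f \<in> hcar drury_arveson"
proof -
  assume "f \<in> hcar drury_arveson"
  then obtain a where a: "sq_summable a" "f = da.synth a" unfolding hcar_da by blast
  show ?thesis
    unfolding hcar_da a(2) da_part_synth[OF a(1)]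
    using sq_summable_part[OF a(1), of "\<lambda>\<alpha>. P (tdeg \<alpha>)"] by blast
qed

lemma da_part_hip:
  assumes "f \<in> hcar drury_arveson" "g \<in> hcar drury_arveson"
  shows "hip drury_arveson (da_part P f) g = hip drury_arveson f (da_part P g)"
    and "hip drury_arveson (da_part P f) g = hip drury_arveson (da_part P f) (da_part P g)"
proof -
  obtain a b where ab: "sq_summable a" "sq_summable b" "f = da.synth a" "g = da.synth b"
    using assms unfolding hcar_da by blast
  note parts = sq_summable_part[OF ab(1), of "\<lambda>\<alpha>. P (tdeg \<alpha>)"] sq_summable_part[OF ab(2), of "\<lambda>\<alpha>. P (tdeg \<alpha>)"]
  show "hip drury_arveson (da_part P f) g = hip drury_arveson f (da_part P g)"
    unfolding ab(3,4) da_part_synth[OF ab(1)] da_part_synth[OF ab(2)] hip_da[OF parts(1) ab(2)] hip_da[OF ab(1) parts(2)]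
    by (intro infsum_cong) auto
  show "hip drury_arveson (da_part P f) g = hip drury_arveson (da_part P f) (da_part P g)"
    unfolding ab(3,4) da_part_synth[OF ab(1)] da_part_synth[OF ab(2)] hip_da[OF parts(1) ab(2)] hip_da[OF parts]
    by (intro infsum_cong) auto
qed

lemma da_part_poly: "da_part ((=) n) (on_ball (peval p)) = on_ball (peval (hom_comp n p))"
  unfolding on_ball_poly_synth da_part_synth[OF on_ball_poly_sq_summable]
  by (intro arg_cong[where f = da.synth]) (auto simp: fun_eq_iff lookup_hom_comp)

lemma da_part_trunc_poly: "da_part (\<lambda>k. k < N) (on_ball (peval p)) = on_ball (peval (\<Sum>n<N. hom_comp n p))"
  unfolding on_ball_poly_synth da_part_synth[OF on_ball_poly_sq_summable]
  by (intro arg_cong[where f = da.synth]) (auto simp: fun_eq_iff lookup_sum lookup_hom_comp)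

lemma da_part_is_poly:
  assumes f: "f \<in> hcar drury_arveson" and fin: "finite (Collect P)"
  obtains q where "da_part P f = on_ball (peval q)"
proof -
  obtain a where a: "sq_summable a" "f = da.synth a" using f unfolding hcar_da by blast
  let ?g = "\<lambda>\<alpha>. (if P (tdeg \<alpha>) then a \<alpha> else 0) * complex_of_real (sqrt (real (multinom \<alpha>)))"
  have "finite {\<alpha>. ?g \<alpha> \<noteq> 0}"
    by (rule finite_subset[of _ "\<Union>n\<in>Collect P. level n"]) (auto simp: finite_level fin, auto simp: level_def)
  then have "Poly_Mapping.lookup (Abs_poly_mapping ?g) = ?g" by (rule lookup_Abs_poly_mapping)
  then have "on_ball (peval (Abs_poly_mapping ?g)) = da_part P f"
    unfolding on_ball_poly_synth a(2) da_part_synth[OF a(1)]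
    by (intro arg_cong[where f = da.synth]) (auto simp: fun_eq_iff multinom_ne_0)
  then show ?thesis using that by metis
qed

text \<open>The squared distance is the tail of a convergent series over the degrees. This is the
  source of the density of polynomials.\<close>

lemma da_part_trunc_lim:
  assumes f: "f \<in> hcar drury_arveson"
  shows "(\<lambda>N. hnorm drury_arveson (da_part (\<lambda>k. k < N) f - f)) \<longlonglongrightarrow> 0"
proof -
  obtain a where a: "sq_summable a" "f = da.synth a" using f unfolding hcar_da by blast
  let ?h = "\<lambda>\<alpha>. (cmod (a \<alpha>))\<^sup>2"
  have h: "?h summable_on UNIV" using a(1) by (simp add: sq_summable_def)
  have "(hnorm drury_arveson (da_part (\<lambda>k. k < N) f - f))\<^sup>2 = infsum ?h UNIV - (\<Sum>n<N. \<Sum>\<alpha>\<in>level n. ?h \<alpha>)" for N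
  proof -
    let ?b = "\<lambda>\<alpha>. if tdeg \<alpha> < N then a \<alpha> else 0"
    have b: "sq_summable ?b" by (rule sq_summable_part[OF a(1)])
    have "(hnorm drury_arveson (da_part (\<lambda>k. k < N) f - f))\<^sup>2 = (\<Sum>\<^sub>\<infinity>\<alpha>. (cmod (?b \<alpha> - a \<alpha>))\<^sup>2)"
      unfolding a(2) da_part_synth[OF a(1)] da.synth_diff[OF b a(1), symmetric]
      by (rule hnorm_da_sq[OF sq_summable_diff[OF b a(1)]])
    also have "\<dots> = (\<Sum>\<^sub>\<infinity>\<alpha>. ?h \<alpha> + (- 1) * (if tdeg \<alpha> < N then ?h \<alpha> else 0))"
      by (intro infsum_cong) auto
    also have "\<dots> = infsum ?h UNIV + (\<Sum>\<^sub>\<infinity>\<alpha>. (- 1) * (if tdeg \<alpha> < N then ?h \<alpha> else 0))"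
    proof (rule infsum_add[OF h])
      have "(\<lambda>\<alpha>. if tdeg \<alpha> < N then ?h \<alpha> else 0) summable_on UNIV"
        by (rule summable_on_comparison_test[OF h]) auto
      then show "(\<lambda>\<alpha>. (- 1) * (if tdeg \<alpha> < N then ?h \<alpha> else 0)) summable_on UNIV"
        by (rule summable_on_cmult_right)
    qed
    also have "(\<Sum>\<^sub>\<infinity>\<alpha>. (- 1) * (if tdeg \<alpha> < N then ?h \<alpha> else 0)) = - (\<Sum>\<^sub>\<infinity>\<alpha>. if tdeg \<alpha> < N then ?h \<alpha> else 0)"
      by (subst infsum_cmult_right') simp
    also have "(\<Sum>\<^sub>\<infinity>\<alpha>. if tdeg \<alpha> < N then ?h \<alpha> else 0) = (\<Sum>\<^sub>\<infinity>\<alpha>\<in>(\<Union>n\<in>{..<N}. level n). ?h \<alpha>)"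
      by (rule infsum_cong_neutral) (auto simp: level_def)
    also have "\<dots> = (\<Sum>\<alpha>\<in>(\<Union>n\<in>{..<N}. level n). ?h \<alpha>)" by (rule infsum_finite) (auto simp: finite_level)
    also have "\<dots> = (\<Sum>n<N. \<Sum>\<alpha>\<in>level n. ?h \<alpha>)"
      by (rule sum.UNION_disjoint) (auto simp: finite_level, auto simp: level_def)
    finally show ?thesis by linarith
  qed
  moreover have "(\<lambda>N. infsum ?h UNIV - (\<Sum>n<N. \<Sum>\<alpha>\<in>level n. ?h \<alpha>)) \<longlonglongrightarrow> infsum ?h UNIV - infsum ?h UNIV"
    using sums_levels[OF h] unfolding sums_def by (intro tendsto_intros)
  ultimately have "(\<lambda>N. (hnorm drury_arveson (da_part (\<lambda>k. k < N) f - f))\<^sup>2) \<longlonglongrightarrow> 0" by simp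
  then have "(\<lambda>N. sqrt ((hnorm drury_arveson (da_part (\<lambda>k. k < N) f - f))\<^sup>2)) \<longlonglongrightarrow> sqrt 0"
    by (rule tendsto_real_sqrt)
  then show ?thesis using da_part_mem[OF f] f by (simp add: DA.diff_mem)
qed

text \<open>For \<open>z\<close> in the cone the points \<open>t *s z\<close> stay in the cone, so
  the homogeneous parts of \<open>f\<close> vanish at \<open>z\<close>. The conclusion is about
  \<open>hom_comp n q\<close>, whose homogeneity carries the vanishing from the ball to the whole
  cone.\<close>

lemma da_part_vanishing:
  assumes f: "f \<in> hcar drury_arveson" and Z: "cone Z" and zero: "\<And>z. z \<in> Z \<Longrightarrow> z \<in> ball 0 1 \<Longrightarrow> f z = 0"
    and q: "da_part ((=) n) f = on_ball (peval q)" and z: "z \<in> Z"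
  shows "peval (hom_comp n q) z = 0"
proof -
  obtain a where a: "sq_summable a" "f = da.synth a" using f unfolding hcar_da by blast
  have small: "peval (hom_comp n q) z = 0" if z: "z \<in> Z" "z \<in> ball 0 1" for z
  proof -
    have lev: "(\<Sum>\<alpha>\<in>level n. a \<alpha> * da_feature \<alpha> z) = 0"
    proof (rule da_series_level_zero[OF a(1) z(2)])
      fix t :: complex assume t: "cmod t < 1"
      have "cmod t * norm z \<le> 1 * norm z" using t by (intro mult_right_mono) auto
      then have tz: "t *s z \<in> ball 0 1" using z by (simp add: norm_vector_scalar_mult)
      moreover have "t *s z \<in> Z" using Z z(1) by (simp add: cone_def)
      ultimately have "f (t *s z) = 0" by (intro zero)
      then show "(\<Sum>\<^sub>\<infinity>\<alpha>. a \<alpha> * da_feature \<alpha> (t *s z)) = 0" using tz by (simp add: a(2) da.synth_def)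
    qed
    \<comment> \<open>Filtering twice by the same degree changes nothing, so
      \<open>hom_comp n q\<close> and \<open>q\<close> give the same function on the ball.\<close>
    have "da_part ((=) n) (da_part ((=) n) f) = da_part ((=) n) f"
      unfolding a(2) da_part_synth[OF a(1)] da_part_synth[OF sq_summable_part[OF a(1)]]
      by (intro arg_cong[where f = da.synth]) auto
    then have "on_ball (peval (hom_comp n q)) z = da_part ((=) n) f z"
      unfolding q da_part_poly by (rule fun_cong)
    also have "\<dots> = (\<Sum>\<^sub>\<infinity>\<alpha>. (if n = tdeg \<alpha> then a \<alpha> else 0) * da_feature \<alpha> z)"
      unfolding a(2) da_part_synth[OF a(1)] using z(2) by (simp add: da.synth_def)
    also have "\<dots> = (\<Sum>\<^sub>\<infinity>\<alpha>\<in>level n. a \<alpha> * da_feature \<alpha> z)"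
      by (rule infsum_cong_neutral) (auto simp: level_def)
    also have "\<dots> = 0" using lev by (simp add: finite_level)
    finally show ?thesis using z(2) by (simp add: on_ball_def)
  qed
  define c where "c = complex_of_real (1 / (norm z + 1))"
  have "1 / (norm z + 1) > 0" by (intro divide_pos_pos add_nonneg_pos) auto
  then have c: "c \<noteq> 0" unfolding c_def of_real_eq_0_iff by linarith
  have "norm (c *s z) = norm z / (norm z + 1)"
    by (simp add: c_def norm_vector_scalar_mult norm_divide)
  also have "\<dots> < 1" by (simp add: divide_less_eq_1 add_nonneg_pos)
  finally have "peval (hom_comp n q) (c *s z) = 0"
    using Z z by (intro small) (auto simp: cone_def)
  then show ?thesis using c by (simp add: peval_hom_comp_scale)
qed

subsection \<open>Multiplication by coordinates\<close>

text \<open>In the orthonormal basis, multiplication by a coordinate is a weighted shift with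
  weights \<open>r \<alpha>\<close> at most 1.\<close>

lemma da_coordinate_mult:
  assumes f: "f \<in> hcar drury_arveson"
  shows "on_ball (\<lambda>z. z $ i) * f \<in> hcar drury_arveson"
    and "hnorm drury_arveson (on_ball (\<lambda>z. z $ i) * f) \<le> hnorm drury_arveson f"
proof -
  obtain a where a: "sq_summable a" "f = da.synth a" using f unfolding hcar_da by blast
  define \<sigma> where "\<sigma> \<alpha> = Poly_Mapping.single i 1 + \<alpha>" for \<alpha> :: "'a \<Rightarrow>\<^sub>0 nat"
  have \<sigma>: "inj \<sigma>" by (auto simp: inj_on_def \<sigma>_def)
  define r where "r \<alpha> = sqrt (real (multinom \<alpha>)) / sqrt (real (multinom (\<sigma> \<alpha>)))" for \<alpha>
  have r: "0 \<le> r \<alpha>" "r \<alpha> \<le> 1" for \<alpha>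
    using multinom_mono[of \<alpha> i] multinom_pos[of "\<sigma> \<alpha>"] by (auto simp: r_def \<sigma>_def divide_le_eq_1)
  define b where "b \<beta> = (if \<beta> \<in> range \<sigma> then a (inv \<sigma> \<beta>) * complex_of_real (r (inv \<sigma> \<beta>)) else 0)" for \<beta>
  have b\<sigma>: "b (\<sigma> \<alpha>) = a \<alpha> * complex_of_real (r \<alpha>)" for \<alpha>
    by (simp add: b_def inv_f_f[OF \<sigma>])
  have le: "(cmod (a \<alpha> * complex_of_real (r \<alpha>)))\<^sup>2 \<le> (cmod (a \<alpha>))\<^sup>2" for \<alpha>
    using r[of \<alpha>] by (intro power_mono) (auto simp: norm_mult mult_left_le)
  have a': "(\<lambda>\<alpha>. (cmod (a \<alpha>))\<^sup>2) summable_on UNIV" using a(1) by (simp add: sq_summable_def)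
  have ar: "(\<lambda>\<alpha>. (cmod (a \<alpha> * complex_of_real (r \<alpha>)))\<^sup>2) summable_on UNIV"
    by (rule summable_on_comparison_test[OF a' le]) auto
  have comp: "(\<lambda>\<beta>. (cmod (b \<beta>))\<^sup>2) \<circ> \<sigma> = (\<lambda>\<alpha>. (cmod (a \<alpha> * complex_of_real (r \<alpha>)))\<^sup>2)"
    by (simp add: fun_eq_iff b\<sigma>)
  have "(\<lambda>\<beta>. (cmod (b \<beta>))\<^sup>2) summable_on range \<sigma>"
    unfolding summable_on_reindex[OF \<sigma>] comp by (rule ar)
  moreover have "(\<lambda>\<beta>. (cmod (b \<beta>))\<^sup>2) summable_on UNIV \<longleftrightarrow> (\<lambda>\<beta>. (cmod (b \<beta>))\<^sup>2) summable_on range \<sigma>"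
    by (rule summable_on_cong_neutral) (auto simp: b_def)
  ultimately have b: "sq_summable b" by (simp add: sq_summable_def)
  have e: "on_ball (\<lambda>z. z $ i) * f = da.synth b"
  proof
    fix z
    show "(on_ball (\<lambda>z. z $ i) * f) z = da.synth b z"
    proof (cases "z \<in> ball 0 1")
      case True
      have summand: "a \<alpha> * complex_of_real (r \<alpha>) * da_feature (\<sigma> \<alpha>) z = z $ i * (a \<alpha> * da_feature \<alpha> z)" for \<alpha>
      proof -
        have "monom_fun (\<sigma> \<alpha>) z = z $ i * monom_fun \<alpha> z"
          unfolding \<sigma>_def monom_fun_add monom_fun_single ..
        moreover have "complex_of_real (r \<alpha>) * complex_of_real (sqrt (real (multinom (\<sigma> \<alpha>)))) = complex_of_real (sqrt (real (multinom \<alpha>)))"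
          using multinom_pos[of "\<sigma> \<alpha>"] unfolding of_real_mult[symmetric] by (simp add: r_def)
        ultimately show ?thesis by (simp add: da_feature_def mult_ac)
      qed
      have "(\<Sum>\<^sub>\<infinity>\<beta>. b \<beta> * da_feature \<beta> z) = (\<Sum>\<^sub>\<infinity>\<beta>\<in>range \<sigma>. b \<beta> * da_feature \<beta> z)"
        by (rule infsum_cong_neutral) (auto simp: b_def)
      also have "\<dots> = (\<Sum>\<^sub>\<infinity>\<alpha>. z $ i * (a \<alpha> * da_feature \<alpha> z))"
        unfolding infsum_reindex[OF \<sigma>] by (simp add: comp_def b\<sigma> summand)
      also have "\<dots> = z $ i * (\<Sum>\<^sub>\<infinity>\<alpha>. a \<alpha> * da_feature \<alpha> z)" by (rule infsum_cmult_right')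
      finally show ?thesis using True by (simp add: on_ball_def a(2) da.synth_def)
    qed (simp add: on_ball_def da.synth_def)
  qed
  have le': "(hnorm drury_arveson (da.synth b))\<^sup>2 \<le> (hnorm drury_arveson f)\<^sup>2"
  proof -
    have "(\<Sum>\<^sub>\<infinity>\<beta>. (cmod (b \<beta>))\<^sup>2) = (\<Sum>\<^sub>\<infinity>\<beta>\<in>range \<sigma>. (cmod (b \<beta>))\<^sup>2)"
      by (rule infsum_cong_neutral) (auto simp: b_def)
    also have "\<dots> = (\<Sum>\<^sub>\<infinity>\<alpha>. (cmod (a \<alpha> * complex_of_real (r \<alpha>)))\<^sup>2)"
      unfolding infsum_reindex[OF \<sigma>] comp ..
    also have "\<dots> \<le> (\<Sum>\<^sub>\<infinity>\<alpha>. (cmod (a \<alpha>))\<^sup>2)" by (rule infsum_mono[OF ar a' le])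
    finally show ?thesis by (simp add: hnorm_da_sq b a)
  qed
  show "on_ball (\<lambda>z. z $ i) * f \<in> hcar drury_arveson"
    unfolding e hcar_da using b by blast
  show "hnorm drury_arveson (on_ball (\<lambda>z. z $ i) * f) \<le> hnorm drury_arveson f"
    unfolding e by (rule power2_le_imp_le[OF le' DA.hnorm_nonneg[OF f]])
qed

section \<open>The spaces \<open>Fsp I\<close>\<close>

lemma da_parts_zero:
  assumes f: "f \<in> hcar drury_arveson" and "\<And>n. da_part ((=) n) f = 0"
  shows "f = 0"
proof -
  obtain a where a: "sq_summable a" "f = da.synth a" using f unfolding hcar_da by blast
  have sq0: "sq_summable (\<lambda>_. 0)" and zero: "da.synth (\<lambda>_. 0) = 0"
    by (simp_all add: sq_summable_def da.synth_def fun_eq_iff)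
  have "a \<alpha> = 0" for \<alpha>
  proof -
    have "da.synth (\<lambda>\<beta>. if tdeg \<alpha> = tdeg \<beta> then a \<beta> else 0) = da.synth (\<lambda>_. 0)"
      using assms(2)[of "tdeg \<alpha>"] unfolding a(2) da_part_synth[OF a(1)] zero .
    from da.synth_inj[OF sq_summable_part[OF a(1)] sq0 this] show ?thesis by (metis (full_types))
  qed
  then have "a = (\<lambda>_. 0)" by auto
  then show ?thesis using a(2) zero by metis
qed

lemma Fsp_simps [simp]: "hip (Fsp I) = hip drury_arveson" "hnorm (Fsp I) = hnorm drury_arveson"
  by (simp_all add: Fsp_def hnorm_def fun_eq_iff)

lemma mem_Fsp: "f \<in> hcar (Fsp I) \<longleftrightarrow> f \<in> hcar drury_arveson \<and> (\<forall>p\<in>I. hip drury_arveson f (on_ball (peval p)) = 0)"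
  by (simp add: Fsp_def)

lemma hsub_Fsp: "DA.hsub (hcar (Fsp I))"
  unfolding DA.hsub_def using on_ball_poly_mem
  by (auto simp: mem_Fsp DA.hip_add_left DA.hip_scale_left)

lemma hclosed_Fsp: "hclosed drury_arveson (hcar (Fsp I))"
  unfolding hclosed_def
proof (intro allI impI, elim conjE)
  fix s f assume s: "\<forall>n. s n \<in> hcar (Fsp I)" and f: "f \<in> hcar drury_arveson"
    and l: "(\<lambda>n::nat. hnorm drury_arveson (s n - f)) \<longlonglongrightarrow> 0"
  have "hip drury_arveson f (on_ball (peval p)) = 0" if p: "p \<in> I" for p
  proof -
    have "(\<lambda>n. hip drury_arveson (s n) (on_ball (peval p))) \<longlonglongrightarrow> hip drury_arveson f (on_ball (peval p))"
      by (rule DA.lim_hip[OF _ f l on_ball_poly_mem]) (use s mem_Fsp in blast)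
    moreover have "hip drury_arveson (s n) (on_ball (peval p)) = 0" for n using s p mem_Fsp by blast
    ultimately show ?thesis using LIMSEQ_unique[OF _ tendsto_const] by simp
  qed
  then show "f \<in> hcar (Fsp I)" using f mem_Fsp by blast
qed

interpretation F: hilbert_fs "ball (0 :: complex ^ 'n::finite) 1" "Fsp I" for I
proof
  have "Fsp I = drury_arveson\<lparr>hcar := hcar (Fsp I)\<rparr>" by (simp add: Fsp_def)
  then show "hilbert_function_space (ball 0 1) (Fsp I)"
    using DA.restrict_hilbert[OF hsub_Fsp hclosed_Fsp, of I] by metis
qed

interpretation FF: hilbert_fs_pair "ball (0 :: complex ^ 'm::finite) 1" "Fsp J" "ball (0 :: complex ^ 'n::finite) 1" "Fsp I" for I J
  by unfold_locales

text \<open>Lets the results on pairs of spaces \<open>Fsp\<close> be applied with the whole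
  Drury-Arveson space as target.\<close>

lemma Fsp_empty: "hcar (Fsp {}) = hcar drury_arveson"
  by (auto simp: mem_Fsp)

lemma kernel_mem_Fsp:
  assumes "w \<in> vanishing_locus I" "w \<in> ball 0 1"
  shows "da_kernel w \<in> hcar (Fsp I)"
  unfolding mem_Fsp
proof (intro conjI ballI)
  show k: "da_kernel w \<in> hcar drury_arveson" by (rule da_kernel_mem[OF assms(2)])
  fix p assume "p \<in> I"
  then have "hip drury_arveson (on_ball (peval p)) (da_kernel w) = 0"
    using da_kernel_hip[OF assms(2) on_ball_poly_mem, of p] assms by (auto simp: on_ball_def vanishing_locus_def)
  then show "hip drury_arveson (da_kernel w) (on_ball (peval p)) = 0"
    using DA.hip_cnj[OF on_ball_poly_mem k] by simp
qed

lemma Fsp_DA: "f \<in> hcar (Fsp I) \<Longrightarrow> f \<in> hcar drury_arveson"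
  by (simp add: mem_Fsp)

lemma Fsp_eval: "w \<in> ball 0 1 \<Longrightarrow> f \<in> hcar (Fsp I) \<Longrightarrow> hip drury_arveson f (da_kernel w) = f w"
  by (rule da_kernel_hip) (auto simp: Fsp_DA)

text \<open>Each homogeneous part of \<open>f\<close> is a polynomial vanishing on \<open>Z\<close>,
  so it belongs to the ideal and is orthogonal to \<open>f\<close>; being the projection of
  \<open>f\<close> to one degree, it is 0. Thus the kernel functions at the points of
  \<open>Z\<close> in the ball are total.\<close>

lemma Fsp_total:
  assumes Z: "cone Z" and f: "f \<in> hcar (Fsp (vanishing_ideal Z))"
    and zero: "\<And>z. z \<in> Z \<Longrightarrow> z \<in> ball 0 1 \<Longrightarrow> f z = 0"
  shows "f = 0"
proof (rule da_parts_zero)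
  show fH: "f \<in> hcar drury_arveson" by (rule Fsp_DA[OF f])
  fix n
  let ?g = "da_part ((=) n) f"
  have g: "?g \<in> hcar drury_arveson" by (rule da_part_mem[OF fH])
  obtain q where q: "?g = on_ball (peval q)"
    using da_part_is_poly[OF fH, of "(=) n"] by (metis Collect_mono_iff finite.emptyI finite.insertI rev_finite_subset singleton_conv2 subset_refl)
  have "hom_comp n q \<in> vanishing_ideal Z"
    using da_part_vanishing[OF fH Z zero q] by (simp add: vanishing_ideal_def)
  then have "hip drury_arveson f (on_ball (peval (hom_comp n q))) = 0" using f mem_Fsp by blast
  then have "hip drury_arveson f (da_part ((=) n) ?g) = 0" unfolding q da_part_poly .
  then have "hip drury_arveson ?g ?g = 0" using da_part_hip(1)[OF fH g] by simp
  then show "?g = 0" using DA.hip_pos[OF g] by force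
qed

text \<open>Truncation is self-adjoint and maps the homogeneous ideal into itself.\<close>

lemma da_part_trunc_Fsp:
  assumes I: "radical_homogeneous_ideal I" and f: "f \<in> hcar (Fsp I)"
  shows "da_part (\<lambda>k. k < N) f \<in> hcar (Fsp I)"
  unfolding mem_Fsp
proof (intro conjI ballI)
  note fH = Fsp_DA[OF f]
  show "da_part (\<lambda>k. k < N) f \<in> hcar drury_arveson" by (rule da_part_mem[OF fH])
  fix p assume p: "p \<in> I"
  have "(\<Sum>n<N. hom_comp n p) \<in> I"
    using I p unfolding radical_homogeneous_ideal_def poly_ideal_def by (induction N) auto
  then have "hip drury_arveson f (on_ball (peval (\<Sum>n<N. hom_comp n p))) = 0" using f mem_Fsp by blast
  then show "hip drury_arveson (da_part (\<lambda>k. k < N) f) (on_ball (peval p)) = 0"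
    unfolding da_part_hip(1)[OF fH on_ball_poly_mem] da_part_trunc_poly .
qed

subsection \<open>Adjoints of linear maps\<close>

text \<open>\<open>M\<close> is the conjugate transpose. Only continuity at 0 locates images in the
  ball, since \<open>A\<close> may expand vectors off the variety.\<close>

lemma cadjoint:
  fixes A :: "complex ^ 'm::finite \<Rightarrow> complex ^ 'n::finite"
  assumes A: "Vector_Spaces.linear (*s) (*s) A"
  shows cadjoint_cinner: "cinner (A z) w = cinner z (cadjoint A w)"
    and cadjoint_linear: "Vector_Spaces.linear (*s) (*s) (cadjoint A)"
    and cadjoint_small: "\<exists>\<delta>>0. \<forall>w. norm w < \<delta> \<longrightarrow> cadjoint A w \<in> ball 0 1"
proof -
  define M :: "complex ^ 'n ^ 'm" where "M = (\<chi> j i. cnj (A (axis j 1) $ i))"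
  have M: "cinner (A z) w = cinner z (M *v w)" for z w
  proof -
    have "cinner (A z) w = (\<Sum>i\<in>UNIV. \<Sum>j\<in>UNIV. z $ j * A (axis j 1) $ i * cnj (w $ i))"
      unfolding cinner_def sum_distrib_right[symmetric]
      by (intro sum.cong refl arg_cong2[where f = "(*)"] linear_component[OF A])
    also have "\<dots> = cinner z (M *v w)"
      by (subst sum.swap) (simp add: cinner_def M_def matrix_vector_mult_def sum_distrib_left mult.assoc)
    finally show ?thesis .
  qed
  have eq: "cadjoint A = (*v) M"
    unfolding cadjoint_def
  proof (rule the_equality)
    show "\<forall>z w. cinner (A z) w = cinner z (M *v w)" using M by blast
    fix B assume B: "\<forall>z w. cinner (A z) w = cinner z (B w)"
    show "B = (*v) M"
    proof
      fix w
      have "cinner z (B w - M *v w) = 0" for z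
      proof -
        have "cinner z (B w) = cinner z (M *v w)" using B M[of z w] by simp
        then show ?thesis by (simp add: cinner_def right_diff_distrib sum_subtractf)
      qed
      then have "cinner (B w - M *v w) (B w - M *v w) = 0" by blast
      then show "B w = M *v w" by (simp add: cinner_self)
    qed
  qed
  show "cinner (A z) w = cinner z (cadjoint A w)" unfolding eq by (rule M)
  show "Vector_Spaces.linear (*s) (*s) (cadjoint A)" unfolding eq by (rule matrix_vector_mul_linear_gen)
  have "continuous_on UNIV (\<lambda>w. M *v w)"
    unfolding matrix_vector_mult_def by (intro continuous_intros continuous_on_vec_lambda)
  then obtain \<delta> where "\<delta> > 0" "\<forall>w. dist w 0 < \<delta> \<longrightarrow> dist (M *v w) (M *v 0) < 1"
    unfolding continuous_on_iff by (metis UNIV_I zero_less_one)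
  then show "\<exists>\<delta>>0. \<forall>w. norm w < \<delta> \<longrightarrow> cadjoint A w \<in> ball 0 1"
    unfolding eq by (intro exI[of _ \<delta>]) (auto simp: matrix_vector_mult_0_right)
qed

text \<open>Moving \<open>A\<close> across the inner product shows why composition with
  \<open>cadjoint A\<close> acts on kernel functions by \<open>A\<close>. Both points have to lie in
  the ball, outside of which kernel functions are set to 0.\<close>

lemma kernel_compose:
  assumes A: "Vector_Spaces.linear (*s) (*s) A" and "z \<in> ball 0 1" "cadjoint A z \<in> ball 0 1"
  shows "da_kernel (A w) z = da_kernel w (cadjoint A z)"
  using assms cadjoint_cinner[OF A, of w z] cinner_cnj[of z "A w"] cinner_cnj[of "cadjoint A z" w]
  by (simp add: on_ball_def)

section \<open>Composition operators\<close>

text \<open>For fixed \<open>z\<close>, the difference of the two sides is a bounded functional of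
  \<open>f\<close>, hence pairing with some \<open>h\<close>. It vanishes on the kernel functions at
  \<open>Z\<close>, so \<open>h\<close> vanishes on \<open>Z\<close> and is 0.\<close>

lemma composition_eval:
  fixes A :: "complex ^ 'm::finite \<Rightarrow> complex ^ 'n::finite"
  assumes Z: "cone Z" and A: "Vector_Spaces.linear (*s) (*s) A"
    and ZV: "Z \<subseteq> vanishing_locus (vanishing_ideal Z)"
    and T: "T \<in> bounded_ops (Fsp (vanishing_ideal Z)) (Fsp I)"
    and Tk: "\<And>w. w \<in> Z \<Longrightarrow> w \<in> ball 0 1 \<Longrightarrow> T (da_kernel w) = da_kernel (A w)"
    and z: "z \<in> ball 0 1" "cadjoint A z \<in> ball 0 1" and f: "f \<in> hcar (Fsp (vanishing_ideal Z))"
  shows "T f z = f (cadjoint A z)"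
proof -
  let ?J = "vanishing_ideal Z"
  note Tm = FF.bops_mem[OF T]
  obtain b where b: "b \<ge> 0" "\<And>f. f \<in> hcar (Fsp ?J) \<Longrightarrow> hnorm drury_arveson (T f) \<le> b * hnorm drury_arveson f"
    using FF.bops_bound[OF T] by auto
  let ?kz = "hnorm drury_arveson (da_kernel z)" and ?ka = "hnorm drury_arveson (da_kernel (cadjoint A z))"
  have eval_bound: "cmod (f w) \<le> hnorm drury_arveson f * hnorm drury_arveson (da_kernel w)"
    if "f \<in> hcar (Fsp K)" "w \<in> ball 0 1" for f K and w :: "complex ^ 'k::finite"
    using DA.Cauchy_Schwarz[OF Fsp_DA[OF that(1)] da_kernel_mem[OF that(2)]] Fsp_eval[OF that(2,1)] by simp
  obtain h where h: "h \<in> hcar (Fsp ?J)" "\<And>f. f \<in> hcar (Fsp ?J) \<Longrightarrow> T f z - f (cadjoint A z) = hip (Fsp ?J) f h"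
  proof (rule F.Riesz[of ?J "\<lambda>f. T f z - f (cadjoint A z)" "b * ?kz + ?ka"])
    show "T (f + g) z - (f + g) (cadjoint A z) = T f z - f (cadjoint A z) + (T g z - g (cadjoint A z))"
      if "f \<in> hcar (Fsp ?J)" "g \<in> hcar (Fsp ?J)" for f g
      unfolding FF.bops_add[OF T that] by simp
    show "T (fscale c f) z - fscale c f (cadjoint A z) = c * (T f z - f (cadjoint A z))"
      if "f \<in> hcar (Fsp ?J)" for c f
      unfolding FF.bops_scale[OF T that] by (simp add: fscale_def algebra_simps)
    show "cmod (T f z - f (cadjoint A z)) \<le> (b * ?kz + ?ka) * hnorm (Fsp ?J) f"
      if f: "f \<in> hcar (Fsp ?J)" for f
    proof -
      have "cmod (T f z - f (cadjoint A z)) \<le> cmod (T f z) + cmod (f (cadjoint A z))" by (rule norm_triangle_ineq4)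
      also have "cmod (T f z) \<le> hnorm drury_arveson (T f) * ?kz" by (rule eval_bound[OF Tm[OF f] z(1)])
      also have "\<dots> \<le> b * hnorm drury_arveson f * ?kz"
        using b(2)[OF f] DA.hnorm_nonneg[OF da_kernel_mem[OF z(1)]] by (rule mult_right_mono)
      also have "cmod (f (cadjoint A z)) \<le> hnorm drury_arveson f * ?ka" by (rule eval_bound[OF f z(2)])
      finally show ?thesis by (simp add: algebra_simps)
    qed
    fix g assume "g \<in> hcar (Fsp ?J)" "\<And>f. f \<in> hcar (Fsp ?J) \<Longrightarrow> T f z - f (cadjoint A z) = hip (Fsp ?J) f g"
    then show thesis by (rule that)
  qed
  have "h = 0"
  proof (rule Fsp_total[OF Z h(1)])
    fix w assume w: "w \<in> Z" "w \<in> ball 0 1"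
    have k: "da_kernel w \<in> hcar (Fsp ?J)" using ZV w by (intro kernel_mem_Fsp) auto
    have "hip drury_arveson (da_kernel w) h = 0"
      using h(2)[OF k] Tk[OF w] kernel_compose[OF A z, of w] by simp
    then have "hip drury_arveson h (da_kernel w) = 0"
      using DA.hip_cnj[OF Fsp_DA[OF k] Fsp_DA[OF h(1)]] by simp
    then show "h w = 0" using Fsp_eval[OF w(2) h(1)] by simp
  qed
  then show ?thesis using h(2)[OF f] F.hip_zero_right[OF f] by simp
qed

lemma subset_vanishing_locus: "Z \<subseteq> vanishing_locus (vanishing_ideal Z)"
  by (auto simp: vanishing_locus_def vanishing_ideal_def)

lemma cone_span: "cone (vec.span (W :: (complex ^ 'n) set))"
  by (simp add: cone_def vec.span_scale)

text \<open>An element \<open>u\<close> of the span of kernel functions is split by admissibility,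
  and isometries \<open>T W\<close> are applied to the components. The images add up to
  \<open>v\<close>, because near the origin both are \<open>u\<close> composed with
  \<open>cadjoint A\<close>. The splitting need not be the one from which \<open>u\<close> was
  built, so \<open>v\<close> has to be described independently of it.\<close>

theorem composition_bound:
  fixes A :: "complex ^ 'm::finite \<Rightarrow> complex ^ 'n::finite"
  assumes J: "radical_homogeneous_ideal J" and adm: "admissible J"
    and A: "Vector_Spaces.linear (*s) (*s) A"
    and iso: "\<And>z. z \<in> vanishing_locus J \<Longrightarrow> norm (A z) = norm z"
  shows "\<exists>C. \<forall>u v. (u, v) \<in> linear_graph (vanishing_locus J \<inter> ball 0 1) da_kernel (\<lambda>w. da_kernel (A w)) \<longrightarrow>
     hnorm drury_arveson v \<le> C * hnorm drury_arveson u"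
proof -
  let ?L = "vanishing_locus J \<inter> ball 0 1"
  let ?G = "linear_graph ?L da_kernel (\<lambda>w. da_kernel (A w))"
  obtain \<W> where dec: "irreducible_decomposition (vanishing_locus J) \<W>"
    and cl: "hclosed drury_arveson {\<Sum>W\<in>\<W>. g W | g. \<forall>W\<in>\<W>. g W \<in> hcar (Fsp (vanishing_ideal (vec.span W)))}"
    using adm unfolding admissible_def by blast
  have fin: "finite \<W>" and V: "vanishing_locus J = \<Union>\<W>" and irr: "\<And>W. W \<in> \<W> \<Longrightarrow> irreducible_variety W"
    using dec by (auto simp: irreducible_decomposition_def)
  define FW where "FW W = hcar (Fsp (vanishing_ideal (vec.span W)))" for W :: "(complex ^ 'm) set"
  obtain C where C: "C \<ge> 0" "\<And>f. f \<in> {\<Sum>W\<in>\<W>. g W | g. \<forall>W\<in>\<W>. g W \<in> FW W} \<Longrightarrow>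
      \<exists>g. (\<forall>W\<in>\<W>. g W \<in> FW W \<and> hnorm drury_arveson (g W) \<le> C * hnorm drury_arveson f) \<and> f = (\<Sum>W\<in>\<W>. g W)"
  proof (rule DA.bounded_decomposition[OF fin, where F = FW and S = "{\<Sum>W\<in>\<W>. g W | g. \<forall>W\<in>\<W>. g W \<in> FW W}"])
    show "DA.hsub (FW W)" "hclosed drury_arveson (FW W)" for W
      unfolding FW_def by (rule hsub_Fsp, rule hclosed_Fsp)
    show "hclosed drury_arveson {\<Sum>W\<in>\<W>. g W | g. \<forall>W\<in>\<W>. g W \<in> FW W}"
      using cl unfolding FW_def .
    fix C assume "C \<ge> 0" "\<And>f. f \<in> {\<Sum>W\<in>\<W>. g W | g. \<forall>W\<in>\<W>. g W \<in> FW W} \<Longrightarrow>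
      \<exists>g. (\<forall>W\<in>\<W>. g W \<in> FW W \<and> hnorm drury_arveson (g W) \<le> C * hnorm drury_arveson f) \<and> f = (\<Sum>W\<in>\<W>. g W)"
    then show thesis by (rule that)
  qed (rule refl)
  have Aiso: "cinner (A z) (A w) = cinner z w" if "W \<in> \<W>" "z \<in> vec.span W" "w \<in> vec.span W" for W z w
    by (rule isometry_polarization_span[OF irr[OF that(1)] A iso that(2,3)]) (use V that(1) in blast)
  have Aball: "A z \<in> ball 0 1" if "W \<in> \<W>" "z \<in> vec.span W" "z \<in> ball 0 1" for W z
  proof -
    have "complex_of_real ((norm (A z))\<^sup>2) = complex_of_real ((norm z)\<^sup>2)"
      using Aiso[OF that(1,2,2)] unfolding cinner_self .
    then have "norm (A z) = norm z" by (simp only: of_real_eq_iff power2_eq_iff_nonneg norm_ge_zero)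
    then show ?thesis using that(3) by simp
  qed
  \<comment> \<open>Kernel functions at points of the whole span of \<open>W\<close>, not only of
    \<open>W\<close>, are total in this space, and polarization on the span preserves all their
    inner products.\<close>
  have "\<exists>T. T \<in> bounded_ops (Fsp (vanishing_ideal (vec.span W))) (Fsp {})
      \<and> (\<forall>w\<in>vec.span W \<inter> ball 0 1. T (da_kernel w) = da_kernel (A w))
      \<and> (\<forall>f\<in>FW W. hnorm drury_arveson (T f) = hnorm drury_arveson f)" if W: "W \<in> \<W>" for W
  proof -
    let ?E = "vec.span W \<inter> ball 0 1"
    have k: "da_kernel w \<in> hcar (Fsp (vanishing_ideal (vec.span W)))" if "w \<in> ?E" for w
      using that subset_vanishing_locus[of "vec.span W"] by (intro kernel_mem_Fsp) auto
    have k': "da_kernel (A w) \<in> hcar (Fsp {})" if "w \<in> ?E" for w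
      using that Aball[OF W] by (intro kernel_mem_Fsp) (auto simp: vanishing_locus_def)
    obtain T where T: "T \<in> bounded_ops (Fsp (vanishing_ideal (vec.span W))) (Fsp {})"
      "\<And>w. w \<in> ?E \<Longrightarrow> T (da_kernel w) = da_kernel (A w)"
      "\<And>f g. f \<in> FW W \<Longrightarrow> g \<in> FW W \<Longrightarrow> hip drury_arveson (T f) (T g) = hip drury_arveson f g"
    proof (rule FF.isometric_extension[of ?E da_kernel "vanishing_ideal (vec.span W)" "\<lambda>w. da_kernel (A w)" "{}"])
      show "da_kernel w \<in> hcar (Fsp (vanishing_ideal (vec.span W)))" "da_kernel (A w) \<in> hcar (Fsp {})" if "w \<in> ?E" for w
        using k[OF that] k'[OF that] by blast+
      show "f = 0" if f: "f \<in> hcar (Fsp (vanishing_ideal (vec.span W)))"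
        "\<And>w. w \<in> ?E \<Longrightarrow> hip (Fsp (vanishing_ideal (vec.span W))) f (da_kernel w) = 0" for f
      proof (rule Fsp_total[OF cone_span f(1)])
        fix w assume "w \<in> vec.span W" "w \<in> ball 0 1"
        then show "f w = 0" using f(2)[of w] Fsp_eval[OF _ f(1), of w] by simp
      qed
      show "hip (Fsp {}) (da_kernel (A z)) (da_kernel (A w)) = hip (Fsp (vanishing_ideal (vec.span W))) (da_kernel z) (da_kernel w)"
        if z: "z \<in> ?E" and w: "w \<in> ?E" for z w
      proof -
        have "hip drury_arveson (da_kernel (A z)) (da_kernel (A w)) = da_kernel (A z) (A w)"
          using Aball[OF W] z w by (intro da_kernel_hip da_kernel_mem) auto
        moreover have "hip drury_arveson (da_kernel z) (da_kernel w) = da_kernel z w"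
          using z w by (intro da_kernel_hip da_kernel_mem) auto
        moreover have "da_kernel (A z) (A w) = da_kernel z w"
          using Aiso[OF W, of w z] Aball[OF W, of w] z w by (simp add: on_ball_def)
        ultimately show ?thesis by simp
      qed
      fix T assume "T \<in> bounded_ops (Fsp (vanishing_ideal (vec.span W))) (Fsp {})"
        "\<And>w. w \<in> ?E \<Longrightarrow> T (da_kernel w) = da_kernel (A w)"
        "\<And>f g. f \<in> hcar (Fsp (vanishing_ideal (vec.span W))) \<Longrightarrow> g \<in> hcar (Fsp (vanishing_ideal (vec.span W))) \<Longrightarrow>
           hip (Fsp {}) (T f) (T g) = hip (Fsp (vanishing_ideal (vec.span W))) f g"
      then show thesis by (intro that[of T]) (auto simp: FW_def)
    qed
    have "hnorm drury_arveson (T f) = hnorm drury_arveson f" if "f \<in> FW W" for f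
      using T(3)[OF that that] by (simp add: hnorm_def)
    then show ?thesis using T(1,2) by blast
  qed
  then obtain T where T: "\<And>W. W \<in> \<W> \<Longrightarrow> T W \<in> bounded_ops (Fsp (vanishing_ideal (vec.span W))) (Fsp {})"
    "\<And>W w. W \<in> \<W> \<Longrightarrow> w \<in> vec.span W \<Longrightarrow> w \<in> ball 0 1 \<Longrightarrow> T W (da_kernel w) = da_kernel (A w)"
    "\<And>W f. W \<in> \<W> \<Longrightarrow> f \<in> FW W \<Longrightarrow> hnorm drury_arveson (T W f) = hnorm drury_arveson f"
    by (metis IntI)
  have Tm: "T W f \<in> hcar drury_arveson" if "W \<in> \<W>" "f \<in> FW W" for W f
    using FF.bops_mem[OF T(1)[OF that(1)]] that(2) unfolding FW_def Fsp_empty by blast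
  obtain \<delta> where "\<delta> > 0 \<and> (\<forall>z. norm z < \<delta> \<longrightarrow> cadjoint A z \<in> ball 0 1)"
    using cadjoint_small[OF A] by (elim exE)
  then have \<delta>: "\<delta> > 0" "\<And>z. norm z < \<delta> \<Longrightarrow> cadjoint A z \<in> ball 0 1"
    by simp_all
  have AL: "A w \<in> ball 0 1" if "w \<in> ?L" for w using iso[of w] that by simp
  have graph: "(\<exists>g. (\<forall>W\<in>\<W>. g W \<in> FW W) \<and> u = (\<Sum>W\<in>\<W>. g W)) \<and> v \<in> hcar drury_arveson
      \<and> (\<forall>z. norm z < \<delta> \<longrightarrow> norm z < 1 \<longrightarrow> v z = u (cadjoint A z))" if "(u, v) \<in> ?G" for u v
    using that
  proof induction
    case zero
    show ?case
    proof (intro conjI exI[of _ "\<lambda>_. 0"] ballI allI impI)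
      show "0 \<in> FW W" for W unfolding FW_def by (rule F.zero_mem)
      show "0 = (\<Sum>W\<in>\<W>. 0 :: complex ^ 'm \<Rightarrow> complex)" by (rule sum.neutral_const[symmetric])
      show "0 \<in> hcar drury_arveson" by (rule DA.zero_mem)
    qed simp
  next
    case (step u v w c)
    then obtain g where g: "\<And>W. W \<in> \<W> \<Longrightarrow> g W \<in> FW W" "u = (\<Sum>W\<in>\<W>. g W)" by blast
    obtain W where W: "W \<in> \<W>" "w \<in> W" using step.hyps(2) V by blast
    have kW: "da_kernel w \<in> FW W"
      unfolding FW_def using step.hyps(2) W(2) vec.span_base[of w W] subset_vanishing_locus[of "vec.span W"]
      by (intro kernel_mem_Fsp) auto
    define g' where "g' W' = g W' + (if W' = W then fscale c (da_kernel w) else 0)" for W'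
    have g'F: "g' W' \<in> FW W'" if "W' \<in> \<W>" for W'
      using g(1)[OF that] kW unfolding g'_def FW_def by (cases "W' = W") auto
    have g'sum: "(\<Sum>W'\<in>\<W>. g' W') = u + fscale c (da_kernel w)"
    proof -
      have "(\<Sum>W'\<in>\<W>. if W' = W then fscale c (da_kernel w) else 0) = fscale c (da_kernel w)"
        unfolding sum.delta[OF fin] using W(1) by (simp only: if_True)
      then show ?thesis unfolding g'_def sum.distrib g(2) by (simp only:)
    qed
    have vm: "v + fscale c (da_kernel (A w)) \<in> hcar drury_arveson"
      using step.IH da_kernel_mem[OF AL[OF step.hyps(2)]] by blast
    have ve: "(v + fscale c (da_kernel (A w))) z = (u + fscale c (da_kernel w)) (cadjoint A z)"
      if "norm z < \<delta>" "norm z < 1" for z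
      using step.IH that kernel_compose[OF A _ \<delta>(2)[OF that(1)], of w] by (simp add: fscale_def)
    show ?case
    proof (intro conjI exI[of _ g'] ballI allI impI)
      show "g' W' \<in> FW W'" if "W' \<in> \<W>" for W' by (rule g'F[OF that])
      show "u + fscale c (da_kernel w) = (\<Sum>W'\<in>\<W>. g' W')" by (rule g'sum[symmetric])
      show "v + fscale c (da_kernel (A w)) \<in> hcar drury_arveson" by (rule vm)
      show "(v + fscale c (da_kernel (A w))) z = (u + fscale c (da_kernel w)) (cadjoint A z)"
        if "norm z < \<delta>" "norm z < 1" for z by (rule ve[OF that])
    qed
  qed
  have "hnorm drury_arveson v \<le> (real (card \<W>) * C) * hnorm drury_arveson u" if uv: "(u, v) \<in> ?G" for u v
  proof -
    note gr = graph[OF uv]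
    have "u \<in> {\<Sum>W\<in>\<W>. g W | g. \<forall>W\<in>\<W>. g W \<in> FW W}" using gr by blast
    from C(2)[OF this] obtain s where s: "\<And>W. W \<in> \<W> \<Longrightarrow> s W \<in> FW W"
      "\<And>W. W \<in> \<W> \<Longrightarrow> hnorm drury_arveson (s W) \<le> C * hnorm drury_arveson u" "u = (\<Sum>W\<in>\<W>. s W)" by blast
    have Ts: "T W (s W) \<in> hcar drury_arveson" if "W \<in> \<W>" for W by (rule Tm[OF that s(1)[OF that]])
    have sumT: "(\<Sum>W\<in>\<W>. T W (s W)) \<in> hcar drury_arveson" by (rule DA.sum_mem[OF Ts])
    have sum_apply: "(\<Sum>W\<in>B. f W) z = (\<Sum>W\<in>B. f W z)" for B and f :: "(complex ^ 'm) set \<Rightarrow> 'x \<Rightarrow> complex" and z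
      by (induction B rule: infinite_finite_induct) auto
    have "v - (\<Sum>W\<in>\<W>. T W (s W)) = 0"
    proof (rule da_identity[OF DA.diff_mem[OF _ sumT] \<delta>(1)])
      show "v \<in> hcar drury_arveson" using gr by blast
      fix z :: "complex ^ 'n" assume z: "norm z < \<delta>" "norm z < 1"
      have "T W (s W) z = s W (cadjoint A z)" if W: "W \<in> \<W>" for W
        by (rule composition_eval[OF cone_span A subset_vanishing_locus T(1)[OF W] T(2)[OF W] _ \<delta>(2)[OF z(1)]])
           (use z s(1)[OF W] in \<open>auto simp: FW_def\<close>)
      moreover have "v z = u (cadjoint A z)" using gr z by blast
      ultimately show "(v - (\<Sum>W\<in>\<W>. T W (s W))) z = 0"
        unfolding s(3) by (simp add: sum_apply)
    qed
    then have "v = (\<Sum>W\<in>\<W>. T W (s W))" by simp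
    then have "hnorm drury_arveson v \<le> (\<Sum>W\<in>\<W>. hnorm drury_arveson (T W (s W)))"
      using DA.hnorm_sum_le[OF Ts] by simp
    also have "\<dots> \<le> (\<Sum>W\<in>\<W>. C * hnorm drury_arveson u)"
      using s(1,2) T(3) by (intro sum_mono) simp
    finally show ?thesis by (simp add: mult.assoc)
  qed
  then show ?thesis by blast
qed

text \<open>Truncations of \<open>f\<close> are polynomials, stay in \<open>Fsp J\<close> because
  \<open>J\<close> is homogeneous, and converge to \<open>f\<close>.\<close>

lemma comp_extension_unique:
  fixes J :: "'m::finite mpoly set" and I :: "'n::finite mpoly set"
  assumes J: "radical_homogeneous_ideal J"
    and C: "comp_extension J I L C" and C': "comp_extension J I L C'"
  shows "C = C'"
proof (rule FF.bops_eqI)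
  show Cb: "C \<in> bounded_ops (Fsp J) (Fsp I)" and Cb': "C' \<in> bounded_ops (Fsp J) (Fsp I)"
    using C C' by (auto simp: comp_extension_def)
  fix f assume f: "f \<in> hcar (Fsp J)"
  let ?s = "\<lambda>N. da_part (\<lambda>k. k < N) f"
  have s: "?s N \<in> hcar (Fsp J)" for N by (rule da_part_trunc_Fsp[OF J f])
  have l: "(\<lambda>N. hnorm (Fsp J) (?s N - f)) \<longlonglongrightarrow> 0" using da_part_trunc_lim[OF Fsp_DA[OF f]] by simp
  have eq: "C (?s N) = C' (?s N)" for N
  proof -
    obtain q where q: "?s N = on_ball (peval q)"
      by (rule da_part_is_poly[OF Fsp_DA[OF f], of "\<lambda>k. k < N"]) auto
    then show ?thesis using C C' s[of N] unfolding comp_extension_def by metis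
  qed
  show "C f = C' f"
  proof (rule F.lim_unique[of "\<lambda>N. C (?s N)"])
    show "C (?s N) \<in> hcar (Fsp I)" for N by (rule FF.bops_mem[OF Cb s])
    show "C f \<in> hcar (Fsp I)" "C' f \<in> hcar (Fsp I)" by (rule FF.bops_mem[OF Cb f], rule FF.bops_mem[OF Cb' f])
    show "(\<lambda>N. hnorm (Fsp I) (C (?s N) - C f)) \<longlonglongrightarrow> 0" by (rule FF.bops_lim[OF Cb s f l])
    show "(\<lambda>N. hnorm (Fsp I) (C (?s N) - C' f)) \<longlonglongrightarrow> 0"
      unfolding eq by (rule FF.bops_lim[OF Cb' s f l])
  qed
qed

text \<open>Density gives an operator with the right values on kernel functions. That it extends the
  composition of polynomials is checked near the origin, where \<open>composition_eval\<close>
  applies.\<close>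

theorem composition_operator:
  fixes A :: "complex ^ 'm::finite \<Rightarrow> complex ^ 'n::finite"
    and J :: "'m mpoly set" and I :: "'n mpoly set"
  assumes J: "radical_homogeneous_ideal J" and adm: "admissible J"
    and A: "Vector_Spaces.linear (*s) (*s) A"
    and iso: "\<And>z. z \<in> vanishing_locus J \<Longrightarrow> norm (A z) = norm z"
    and AV: "\<And>z. z \<in> vanishing_locus J \<Longrightarrow> A z \<in> vanishing_locus I"
  shows comp_op_extension: "comp_extension J I (cadjoint A) (comp_op J I (cadjoint A))"
    and comp_op_kernel: "\<And>w. w \<in> vanishing_locus J \<Longrightarrow> w \<in> ball 0 1 \<Longrightarrow>
       comp_op J I (cadjoint A) (da_kernel w) = da_kernel (A w)"
proof -
  let ?Z = "vanishing_locus J"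
  let ?L = "?Z \<inter> ball 0 1"
  have Z: "cone ?Z" by (rule cone_vanishing_locus[OF J])
  have JZ: "vanishing_ideal ?Z = J" by (rule radical_ideal_eq_vanishing_ideal[OF J])
  obtain C where C: "\<And>u v. (u, v) \<in> linear_graph ?L da_kernel (\<lambda>w. da_kernel (A w)) \<Longrightarrow>
     hnorm drury_arveson v \<le> C * hnorm drury_arveson u"
    using composition_bound[OF J adm A iso] by blast
  obtain T where T: "T \<in> bounded_ops (Fsp J) (Fsp I)" "\<And>w. w \<in> ?L \<Longrightarrow> T (da_kernel w) = da_kernel (A w)"
  proof (rule FF.extension_by_density[of ?L da_kernel J "\<lambda>w. da_kernel (A w)" I C])
    show "da_kernel w \<in> hcar (Fsp J)" "da_kernel (A w) \<in> hcar (Fsp I)" if "w \<in> ?L" for w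
      using that AV[of w] iso[of w] by (auto intro!: kernel_mem_Fsp)
    show "f = 0" if f: "f \<in> hcar (Fsp J)" "\<And>w. w \<in> ?L \<Longrightarrow> hip (Fsp J) f (da_kernel w) = 0" for f
    proof (rule Fsp_total[OF Z])
      show "f \<in> hcar (Fsp (vanishing_ideal ?Z))" unfolding JZ by (rule f(1))
      fix w assume "w \<in> ?Z" "w \<in> ball 0 1"
      then show "f w = 0" using f(2)[of w] Fsp_eval[OF _ f(1), of w] by simp
    qed
    show "hnorm (Fsp I) v \<le> C * hnorm (Fsp J) u" if "(u, v) \<in> linear_graph ?L da_kernel (\<lambda>w. da_kernel (A w))" for u v
      using C[OF that] by simp
    fix T assume "T \<in> bounded_ops (Fsp J) (Fsp I)" "\<And>w. w \<in> ?L \<Longrightarrow> T (da_kernel w) = da_kernel (A w)"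
    then show thesis by (rule that)
  qed
  have T1: "T \<in> bounded_ops (Fsp (vanishing_ideal ?Z)) (Fsp I)"
    unfolding JZ by (rule T(1))
  have ext: "comp_extension J I (cadjoint A) T"
    unfolding comp_extension_def
  proof (intro conjI allI impI)
    show "T \<in> bounded_ops (Fsp J) (Fsp I)" by (rule T(1))
    fix p assume p: "on_ball (peval p) \<in> hcar (Fsp J)"
    obtain q where q: "\<And>z. peval q z = peval p (cadjoint A z)"
      using mpoly_compose_linear[OF cadjoint_linear[OF A], of p] by blast
    obtain \<delta> where "\<delta> > 0 \<and> (\<forall>z. norm z < \<delta> \<longrightarrow> cadjoint A z \<in> ball 0 1)"
      using cadjoint_small[OF A] by (elim exE)
    then have \<delta>: "\<delta> > 0" "\<And>z. norm z < \<delta> \<Longrightarrow> cadjoint A z \<in> ball 0 1"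
      by simp_all
    have "T (on_ball (peval p)) - on_ball (peval q) = 0"
    proof (rule da_identity[OF DA.diff_mem[OF Fsp_DA[OF FF.bops_mem[OF T(1) p]] on_ball_poly_mem] \<delta>(1)])
      fix z :: "complex ^ 'n" assume z: "norm z < \<delta>" "norm z < 1"
      have "T (on_ball (peval p)) z = on_ball (peval p) (cadjoint A z)"
        by (rule composition_eval[OF Z A subset_vanishing_locus T1 _ _ \<delta>(2)[OF z(1)]])
           (use z in \<open>simp_all add: T(2) JZ p\<close>)
      then show "(T (on_ball (peval p)) - on_ball (peval q)) z = 0"
        using z \<delta>(2)[OF z(1)] by (simp add: on_ball_def q)
    qed
    then have "T (on_ball (peval p)) = on_ball (peval q)" by simp
    also have "\<dots> = on_ball (\<lambda>z. peval p (cadjoint A z))" by (simp add: on_ball_def q fun_eq_iff)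
    finally show "T (on_ball (peval p)) = on_ball (\<lambda>z. peval p (cadjoint A z))" .
  qed
  have "comp_op J I (cadjoint A) = T"
    unfolding comp_op_def using ext comp_extension_unique[OF J _ ext] by blast
  then show "comp_extension J I (cadjoint A) (comp_op J I (cadjoint A))"
    "\<And>w. w \<in> vanishing_locus J \<Longrightarrow> w \<in> ball 0 1 \<Longrightarrow> comp_op J I (cadjoint A) (da_kernel w) = da_kernel (A w)"
    using ext T(2) by auto
qed

section \<open>Operator norms\<close>

context hilbert_fs
begin

interpretation E: hilbert_fs_pair X H X H by unfold_locales

lemma op_norm_le:
  assumes "0 \<le> b" "\<And>f. f \<in> hcar H \<Longrightarrow> hnorm H (T f) \<le> b * hnorm H f"
  shows "op_norm H H T \<le> b"
  unfolding op_norm_def by (rule cInf_lower) (auto intro!: bdd_belowI[of _ 0] assms)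

lemma op_norm_greatest:
  assumes T: "T \<in> bounded_ops H H"
    and "\<And>b. 0 \<le> b \<Longrightarrow> (\<And>f. f \<in> hcar H \<Longrightarrow> hnorm H (T f) \<le> b * hnorm H f) \<Longrightarrow> c \<le> b"
  shows "c \<le> op_norm H H T"
proof -
  obtain b where "b \<ge> 0" "\<And>f. f \<in> hcar H \<Longrightarrow> hnorm H (T f) \<le> b * hnorm H f"
    using E.bops_bound[OF T] by blast
  then have ne: "{b. 0 \<le> b \<and> (\<forall>f\<in>hcar H. hnorm H (T f) \<le> b * hnorm H f)} \<noteq> {}" by blast
  show ?thesis unfolding op_norm_def by (rule cInf_greatest[OF ne]) (use assms(2) in blast)
qed

lemma op_norm_nonneg: "T \<in> bounded_ops H H \<Longrightarrow> 0 \<le> op_norm H H T"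
  by (rule op_norm_greatest)

lemma op_norm_bound:
  assumes T: "T \<in> bounded_ops H H" and f: "f \<in> hcar H"
  shows "hnorm H (T f) \<le> op_norm H H T * hnorm H f"
proof (cases "hnorm H f = 0")
  case True
  then show ?thesis using f hnorm_eq_0[OF f] E.bops_zero[OF T] by simp
next
  case False
  then have pos: "hnorm H f > 0" using hnorm_nonneg[OF f] by linarith
  have "hnorm H (T f) / hnorm H f \<le> op_norm H H T"
  proof (rule op_norm_greatest[OF T])
    fix b assume "0 \<le> b" "\<And>f. f \<in> hcar H \<Longrightarrow> hnorm H (T f) \<le> b * hnorm H f"
    then show "hnorm H (T f) / hnorm H f \<le> b" using pos f by (simp add: pos_divide_le_eq)
  qed
  then show ?thesis using pos by (simp add: pos_divide_le_eq)
qed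

lemma op_id_bops: "op_id H \<in> bounded_ops H H"
  by (rule E.bopsI[where b = 1]) (auto simp: op_id_def)

lemma op_diff_eq_add: "op_diff H S T = op_add H S (op_scale H (- 1) T)"
  unfolding op_diff_def op_add_def op_scale_def by (simp add: restrict_def diff_eq fun_eq_iff)

lemma op_scale_bops:
  assumes T: "T \<in> bounded_ops H H" shows "op_scale H c T \<in> bounded_ops H H"
proof (rule E.bopsI[where b = "cmod c * op_norm H H T"])
  fix f assume f: "f \<in> hcar H"
  note Tf = E.bops_mem[OF T f]
  show "op_scale H c T f \<in> hcar H" using f Tf by (simp add: op_scale_def)
  show "op_scale H c T (f + g) = op_scale H c T f + op_scale H c T g" if "g \<in> hcar H" for g
    using f that E.bops_add[OF T f that] by (simp add: op_scale_def fscale_def fun_eq_iff algebra_simps)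
  show "op_scale H c T (fscale d f) = fscale d (op_scale H c T f)" for d
    using f E.bops_scale[OF T f, of d] scale_mem[OF f, of d] by (simp add: op_scale_def) (simp add: fscale_def fun_eq_iff)
  show "hnorm H (op_scale H c T f) \<le> cmod c * op_norm H H T * hnorm H f"
    using f hnorm_scale[OF Tf] mult_left_mono[OF op_norm_bound[OF T f], of "cmod c"]
    by (simp add: op_scale_def mult.assoc)
qed (simp add: op_scale_def)

lemma op_add_bops:
  assumes S: "S \<in> bounded_ops H H" and T: "T \<in> bounded_ops H H" shows "op_add H S T \<in> bounded_ops H H"
proof (rule E.bopsI[where b = "op_norm H H S + op_norm H H T"])
  fix f assume f: "f \<in> hcar H"
  note m = E.bops_mem[OF S f] E.bops_mem[OF T f]
  show "op_add H S T f \<in> hcar H" using f m by (simp add: op_add_def)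
  show "op_add H S T (f + g) = op_add H S T f + op_add H S T g" if "g \<in> hcar H" for g
    using f that E.bops_add[OF T f that] E.bops_add[OF S f that] by (simp add: op_add_def fun_eq_iff)
  show "op_add H S T (fscale d f) = fscale d (op_add H S T f)" for d
    using f E.bops_scale[OF T f, of d] E.bops_scale[OF S f, of d] scale_mem[OF f, of d]
    by (simp add: op_add_def) (simp add: fscale_def fun_eq_iff distrib_left)
  show "hnorm H (op_add H S T f) \<le> (op_norm H H S + op_norm H H T) * hnorm H f"
    using f hnorm_triangle[OF m] op_norm_bound[OF S f] op_norm_bound[OF T f]
    by (simp add: op_add_def distrib_right)
qed (simp add: op_add_def)

lemma op_mult_bops:
  assumes S: "S \<in> bounded_ops H H" and T: "T \<in> bounded_ops H H" shows "op_mult H S T \<in> bounded_ops H H"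
proof (rule E.bopsI[where b = "op_norm H H S * op_norm H H T"])
  fix f assume f: "f \<in> hcar H"
  note Tf = E.bops_mem[OF T f]
  show "op_mult H S T f \<in> hcar H" using f E.bops_mem[OF S Tf] by (simp add: op_mult_def)
  show "op_mult H S T (f + g) = op_mult H S T f + op_mult H S T g" if "g \<in> hcar H" for g
    using f that E.bops_add[OF T f that] E.bops_add[OF S Tf E.bops_mem[OF T that]]
    by (simp only: op_mult_def restrict_apply' add_mem)
  show "op_mult H S T (fscale d f) = fscale d (op_mult H S T f)" for d
    using f E.bops_scale[OF T f] E.bops_scale[OF S Tf] by (simp only: op_mult_def restrict_apply' scale_mem)
  show "hnorm H (op_mult H S T f) \<le> op_norm H H S * op_norm H H T * hnorm H f"
    using f op_norm_bound[OF S Tf] mult_left_mono[OF op_norm_bound[OF T f] op_norm_nonneg[OF S]]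
    by (simp add: op_mult_def mult.assoc)
qed (simp add: op_mult_def)

lemma op_diff_bops: "S \<in> bounded_ops H H \<Longrightarrow> T \<in> bounded_ops H H \<Longrightarrow> op_diff H S T \<in> bounded_ops H H"
  unfolding op_diff_eq_add by (intro op_add_bops op_scale_bops)

lemma op_diff_bound:
  assumes "S \<in> bounded_ops H H" "T \<in> bounded_ops H H" "f \<in> hcar H"
  shows "hnorm H (S f - T f) \<le> op_norm H H (op_diff H S T) * hnorm H f"
  using op_norm_bound[OF op_diff_bops[OF assms(1,2)] assms(3)] assms(3) by (simp add: op_diff_def)

lemma op_diff_self [simp]:
  assumes "T \<in> bounded_ops H H" shows "op_norm H H (op_diff H T T) = 0"
proof (rule antisym)
  show "op_norm H H (op_diff H T T) \<le> 0" by (rule op_norm_le) (auto simp: op_diff_def)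
qed (rule op_norm_nonneg[OF op_diff_bops[OF assms assms]])

lemma op_norm_triangle_diff:
  assumes S: "S \<in> bounded_ops H H" and T: "T \<in> bounded_ops H H" and U: "U \<in> bounded_ops H H"
  shows "op_norm H H (op_diff H S U) \<le> op_norm H H (op_diff H S T) + op_norm H H (op_diff H T U)"
proof (rule op_norm_le)
  show "0 \<le> op_norm H H (op_diff H S T) + op_norm H H (op_diff H T U)"
    by (intro add_nonneg_nonneg op_norm_nonneg op_diff_bops S T U)
  fix f assume f: "f \<in> hcar H"
  have "hnorm H (S f - U f) \<le> hnorm H (S f - T f) + hnorm H (T f - U f)"
    by (intro hnorm_triangle_diff E.bops_mem[OF S f] E.bops_mem[OF T f] E.bops_mem[OF U f])
  also have "\<dots> \<le> (op_norm H H (op_diff H S T) + op_norm H H (op_diff H T U)) * hnorm H f"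
    using op_diff_bound[OF S T f] op_diff_bound[OF T U f] by (simp add: distrib_right)
  finally show "hnorm H (op_diff H S U f) \<le> \<dots>" using f by (simp add: op_diff_def)
qed

lemma op_diff_sym:
  assumes S: "S \<in> bounded_ops H H" and T: "T \<in> bounded_ops H H"
  shows "op_norm H H (op_diff H S T) = op_norm H H (op_diff H T S)"
proof -
  have "hnorm H (op_diff H S T f) = hnorm H (op_diff H T S f)" if "f \<in> hcar H" for f
    using hnorm_uminus_diff[OF E.bops_mem[OF S that] E.bops_mem[OF T that]] that by (simp add: op_diff_def)
  then show ?thesis unfolding op_norm_def by (metis (no_types, lifting))
qed

lemma op_norm_le_diff:
  assumes S: "S \<in> bounded_ops H H" and T: "T \<in> bounded_ops H H"
  shows "op_norm H H S \<le> op_norm H H (op_diff H S T) + op_norm H H T"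
proof (rule op_norm_le)
  show "0 \<le> op_norm H H (op_diff H S T) + op_norm H H T"
    by (intro add_nonneg_nonneg op_norm_nonneg op_diff_bops S T)
  fix f assume f: "f \<in> hcar H"
  note m = E.bops_mem[OF S f] E.bops_mem[OF T f]
  have "hnorm H (S f) \<le> hnorm H (S f - T f) + hnorm H (T f)"
    using hnorm_triangle[OF diff_mem[OF m] m(2)] by simp
  then show "hnorm H (S f) \<le> (op_norm H H (op_diff H S T) + op_norm H H T) * hnorm H f"
    using op_diff_bound[OF S T f] op_norm_bound[OF T f] by (simp add: distrib_right)
qed

lemma op_norm_diff_add:
  assumes "S \<in> bounded_ops H H" "T \<in> bounded_ops H H" "S' \<in> bounded_ops H H" "T' \<in> bounded_ops H H"
  shows "op_norm H H (op_diff H (op_add H S S') (op_add H T T'))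
    \<le> op_norm H H (op_diff H S T) + op_norm H H (op_diff H S' T')"
proof (rule op_norm_le)
  show "0 \<le> op_norm H H (op_diff H S T) + op_norm H H (op_diff H S' T')"
    by (intro add_nonneg_nonneg op_norm_nonneg op_diff_bops assms)
  fix f assume f: "f \<in> hcar H"
  have "op_diff H (op_add H S S') (op_add H T T') f = (S f - T f) + (S' f - T' f)"
    using f by (simp add: op_diff_def op_add_def)
  moreover have "hnorm H ((S f - T f) + (S' f - T' f)) \<le> hnorm H (S f - T f) + hnorm H (S' f - T' f)"
    by (intro hnorm_triangle diff_mem E.bops_mem[OF _ f] assms)
  ultimately show "hnorm H (op_diff H (op_add H S S') (op_add H T T') f)
      \<le> (op_norm H H (op_diff H S T) + op_norm H H (op_diff H S' T')) * hnorm H f"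
    using op_diff_bound[OF assms(1,2) f] op_diff_bound[OF assms(3,4) f] by (simp add: distrib_right)
qed

lemma op_norm_diff_scale:
  assumes "S \<in> bounded_ops H H" "T \<in> bounded_ops H H"
  shows "op_norm H H (op_diff H (op_scale H c S) (op_scale H c T)) \<le> cmod c * op_norm H H (op_diff H S T)"
proof (rule op_norm_le)
  show "0 \<le> cmod c * op_norm H H (op_diff H S T)"
    by (intro mult_nonneg_nonneg op_norm_nonneg op_diff_bops assms norm_ge_zero)
  fix f assume f: "f \<in> hcar H"
  have "op_diff H (op_scale H c S) (op_scale H c T) f = fscale c (S f - T f)"
    using f by (simp add: op_diff_def op_scale_def fscale_def fun_eq_iff algebra_simps)
  moreover have "hnorm H (fscale c (S f - T f)) = cmod c * hnorm H (S f - T f)"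
    by (intro hnorm_scale diff_mem E.bops_mem[OF _ f] assms)
  ultimately show "hnorm H (op_diff H (op_scale H c S) (op_scale H c T) f) \<le> cmod c * op_norm H H (op_diff H S T) * hnorm H f"
    using mult_left_mono[OF op_diff_bound[OF assms f], of "cmod c"] by (simp add: mult.assoc)
qed

text \<open>\<open>S (S' f) - T (T' f)\<close> is split into \<open>S (S' f) - T (S' f)\<close> and
  \<open>T (S' f - T' f)\<close>; \<open>S'\<close> is estimated through \<open>T'\<close>, so that
  besides the two distances only norms of the limits occur.\<close>

lemma op_norm_diff_mult:
  assumes S: "S \<in> bounded_ops H H" and T: "T \<in> bounded_ops H H"
    and S': "S' \<in> bounded_ops H H" and T': "T' \<in> bounded_ops H H"
  shows "op_norm H H (op_diff H (op_mult H S S') (op_mult H T T'))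
    \<le> op_norm H H (op_diff H S T) * (op_norm H H (op_diff H S' T') + op_norm H H T')
      + op_norm H H T * op_norm H H (op_diff H S' T')"
    (is "_ \<le> ?a * (?a' + ?t') + ?t * ?a'")
proof (rule op_norm_le)
  have nn: "0 \<le> ?a" "0 \<le> ?a'" "0 \<le> ?t" "0 \<le> ?t'"
    by (intro op_norm_nonneg op_diff_bops assms)+
  then show "0 \<le> ?a * (?a' + ?t') + ?t * ?a'" by simp
  fix f assume f: "f \<in> hcar H"
  note m = E.bops_mem[OF S' f] E.bops_mem[OF T' f]
  have eq: "op_diff H (op_mult H S S') (op_mult H T T') f = (S (S' f) - T (S' f)) + T (S' f - T' f)"
    using f E.bops_diff[OF T m] by (simp add: op_diff_def op_mult_def)
  have "hnorm H (S' f) \<le> op_norm H H S' * hnorm H f" by (rule op_norm_bound[OF S' f])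
  also have "\<dots> \<le> (?a' + ?t') * hnorm H f"
    by (rule mult_right_mono[OF op_norm_le_diff[OF S' T'] hnorm_nonneg[OF f]])
  finally have "hnorm H (S' f) \<le> (?a' + ?t') * hnorm H f" .
  then have 1: "hnorm H (S (S' f) - T (S' f)) \<le> ?a * ((?a' + ?t') * hnorm H f)"
    by (rule order_trans[OF op_diff_bound[OF S T m(1)] mult_left_mono[OF _ nn(1)]])
  have 2: "hnorm H (T (S' f - T' f)) \<le> ?t * (?a' * hnorm H f)"
    by (rule order_trans[OF op_norm_bound[OF T diff_mem[OF m]] mult_left_mono[OF op_diff_bound[OF S' T' f] nn(3)]])
  have "hnorm H ((S (S' f) - T (S' f)) + T (S' f - T' f)) \<le> hnorm H (S (S' f) - T (S' f)) + hnorm H (T (S' f - T' f))"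
    by (intro hnorm_triangle diff_mem E.bops_mem[OF S] E.bops_mem[OF T] m)
  then show "hnorm H (op_diff H (op_mult H S S') (op_mult H T T') f) \<le> (?a * (?a' + ?t') + ?t * ?a') * hnorm H f"
    unfolding eq distrib_right[of "?a * (?a' + ?t')"] mult.assoc by (rule order_trans[OF _ add_mono[OF 1 2]])
qed

section \<open>Norm limits and norm closures of sets of operators\<close>

definition op_lim :: "(nat \<Rightarrow> ('x, 'x) hop) \<Rightarrow> ('x, 'x) hop \<Rightarrow> bool" where
  "op_lim s T \<longleftrightarrow> (\<forall>n. s n \<in> bounded_ops H H) \<and> T \<in> bounded_ops H H
     \<and> (\<lambda>n. op_norm H H (op_diff H (s n) T)) \<longlonglongrightarrow> 0"

lemma op_limD:
  assumes "op_lim s T"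
  shows "s n \<in> bounded_ops H H" "T \<in> bounded_ops H H" "(\<lambda>n. op_norm H H (op_diff H (s n) T)) \<longlonglongrightarrow> 0"
  using assms by (auto simp: op_lim_def)

lemma op_limI:
  assumes "\<And>n. s n \<in> bounded_ops H H" "T \<in> bounded_ops H H"
    and "\<And>n. op_norm H H (op_diff H (s n) T) \<le> b n" "b \<longlonglongrightarrow> 0"
  shows "op_lim s T"
  unfolding op_lim_def
proof (intro conjI allI assms(1,2))
  show "(\<lambda>n. op_norm H H (op_diff H (s n) T)) \<longlonglongrightarrow> 0"
    by (rule tendsto_sandwich[OF _ _ tendsto_const assms(4)])
       (auto intro!: always_eventually assms(3) op_norm_nonneg op_diff_bops assms(1,2))
qed

lemma op_lim_const: "T \<in> bounded_ops H H \<Longrightarrow> op_lim (\<lambda>_. T) T"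
  by (simp add: op_lim_def)

lemma op_lim_add:
  assumes S: "op_lim s S" and T: "op_lim t T"
  shows "op_lim (\<lambda>n. op_add H (s n) (t n)) (op_add H S T)"
proof (rule op_limI)
  note m = op_limD(1)[OF S] op_limD(2)[OF S] op_limD(1)[OF T] op_limD(2)[OF T]
  show "op_add H (s n) (t n) \<in> bounded_ops H H" "op_add H S T \<in> bounded_ops H H" for n
    by (intro op_add_bops m)+
  show "op_norm H H (op_diff H (op_add H (s n) (t n)) (op_add H S T))
    \<le> op_norm H H (op_diff H (s n) S) + op_norm H H (op_diff H (t n) T)" for n
    by (rule op_norm_diff_add[OF m])
  show "(\<lambda>n. op_norm H H (op_diff H (s n) S) + op_norm H H (op_diff H (t n) T)) \<longlonglongrightarrow> 0"
    using tendsto_add[OF op_limD(3)[OF S] op_limD(3)[OF T]] by simp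
qed

lemma op_lim_scale:
  assumes T: "op_lim t T" shows "op_lim (\<lambda>n. op_scale H c (t n)) (op_scale H c T)"
proof (rule op_limI)
  note m = op_limD(1)[OF T] op_limD(2)[OF T]
  show "op_scale H c (t n) \<in> bounded_ops H H" "op_scale H c T \<in> bounded_ops H H" for n
    by (intro op_scale_bops m)+
  show "op_norm H H (op_diff H (op_scale H c (t n)) (op_scale H c T)) \<le> cmod c * op_norm H H (op_diff H (t n) T)" for n
    by (rule op_norm_diff_scale[OF m])
  show "(\<lambda>n. cmod c * op_norm H H (op_diff H (t n) T)) \<longlonglongrightarrow> 0"
    using tendsto_mult[OF tendsto_const op_limD(3)[OF T], of "cmod c"] by simp
qed

lemma op_lim_mult:
  assumes S: "op_lim s S" and T: "op_lim t T"
  shows "op_lim (\<lambda>n. op_mult H (s n) (t n)) (op_mult H S T)"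
proof (rule op_limI)
  note m = op_limD(1)[OF S] op_limD(2)[OF S] op_limD(1)[OF T] op_limD(2)[OF T]
  show "op_mult H (s n) (t n) \<in> bounded_ops H H" "op_mult H S T \<in> bounded_ops H H" for n
    by (intro op_mult_bops m)+
  show "op_norm H H (op_diff H (op_mult H (s n) (t n)) (op_mult H S T))
    \<le> op_norm H H (op_diff H (s n) S) * (op_norm H H (op_diff H (t n) T) + op_norm H H T)
      + op_norm H H S * op_norm H H (op_diff H (t n) T)" for n
    by (rule op_norm_diff_mult[OF m])
  have "(\<lambda>n. op_norm H H (op_diff H (s n) S) * (op_norm H H (op_diff H (t n) T) + op_norm H H T)
      + op_norm H H S * op_norm H H (op_diff H (t n) T)) \<longlonglongrightarrow> 0 * (0 + op_norm H H T) + op_norm H H S * 0"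
    by (intro tendsto_intros op_limD(3)[OF S] op_limD(3)[OF T])
  then show "(\<lambda>n. op_norm H H (op_diff H (s n) S) * (op_norm H H (op_diff H (t n) T) + op_norm H H T)
      + op_norm H H S * op_norm H H (op_diff H (t n) T)) \<longlonglongrightarrow> 0" by simp
qed

definition op_closure :: "('x, 'x) hop set \<Rightarrow> ('x, 'x) hop set" where
  "op_closure P = {T. \<exists>s. (\<forall>n. s n \<in> P) \<and> op_lim s T}"

lemma op_closure_limI: "(\<And>n. s n \<in> P) \<Longrightarrow> op_lim s T \<Longrightarrow> T \<in> op_closure P"
  unfolding op_closure_def by blast

lemma op_closureE:
  assumes "T \<in> op_closure P" obtains s where "\<forall>n. s n \<in> P" "op_lim s T"
  using assms unfolding op_closure_def mem_Collect_eq by (elim exE conjE) (rule that)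

lemma op_closureI:
  assumes P: "P \<subseteq> bounded_ops H H" and T: "T \<in> bounded_ops H H"
    and "\<And>e. e > 0 \<Longrightarrow> \<exists>S\<in>P. op_norm H H (op_diff H S T) < e"
  shows "T \<in> op_closure P"
proof -
  have "\<forall>n. \<exists>S. S \<in> P \<and> op_norm H H (op_diff H S T) < inverse (real (Suc n))"
    using assms(3) by (metis inverse_positive_iff_positive of_nat_0_less_iff zero_less_Suc)
  from choice[OF this] obtain s where s: "\<And>n. s n \<in> P" "\<And>n. op_norm H H (op_diff H (s n) T) < inverse (real (Suc n))"
    by blast
  have "op_lim s T"
    by (rule op_limI[OF _ T less_imp_le[OF s(2)] LIMSEQ_inverse_real_of_nat]) (use s(1) P in blast)
  then show ?thesis using s(1) unfolding op_closure_def by blast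
qed

lemma op_closure_approx:
  assumes "T \<in> op_closure P" "e > 0"
  shows "\<exists>S\<in>P. op_norm H H (op_diff H S T) < e"
proof -
  obtain s where s: "\<forall>n. s n \<in> P" "op_lim s T" by (rule op_closureE[OF assms(1)])
  have "eventually (\<lambda>n. op_norm H H (op_diff H (s n) T) < e) sequentially"
    by (rule order_tendstoD(2)[OF op_limD(3)[OF s(2)] assms(2)])
  then obtain n where "op_norm H H (op_diff H (s n) T) < e" by (auto simp: eventually_sequentially)
  then show ?thesis using s(1) by blast
qed

lemma op_closure_subset: "P \<subseteq> bounded_ops H H \<Longrightarrow> P \<subseteq> op_closure P"
  by (rule subsetI, rule op_closure_limI[OF _ op_lim_const]) (assumption, erule (1) subsetD)

lemma op_closure_bops: "op_closure P \<subseteq> bounded_ops H H"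
proof
  fix T assume "T \<in> op_closure P"
  then obtain s where "op_lim s T" by (elim op_closureE)
  then show "T \<in> bounded_ops H H" by (rule op_limD(2))
qed

lemma closed_unital_subalgebra_op_closure:
  assumes P: "P \<subseteq> bounded_ops H H" and id: "op_id H \<in> P"
    and add: "\<And>S T. S \<in> P \<Longrightarrow> T \<in> P \<Longrightarrow> op_add H S T \<in> P"
    and scale: "\<And>c T. T \<in> P \<Longrightarrow> op_scale H c T \<in> P"
    and mult: "\<And>S T. S \<in> P \<Longrightarrow> T \<in> P \<Longrightarrow> op_mult H S T \<in> P"
  shows "closed_unital_subalgebra H (op_closure P)"
  unfolding closed_unital_subalgebra_def
proof (intro conjI ballI allI impI; (elim conjE)?)
  show "op_closure P \<subseteq> bounded_ops H H" by (rule op_closure_bops)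
  show "op_id H \<in> op_closure P" by (rule subsetD[OF op_closure_subset[OF P] id])
next
  fix S T assume "S \<in> op_closure P" "T \<in> op_closure P"
  then obtain s t where s: "\<forall>n. s n \<in> P" "op_lim s S" and t: "\<forall>n. t n \<in> P" "op_lim t T"
    by (elim op_closureE)
  note st = s(1)[rule_format] s(2) t(1)[rule_format] t(2)
  show "op_add H S T \<in> op_closure P"
    by (rule op_closure_limI[OF add[OF st(1,3)] op_lim_add[OF st(2,4)]])
  show "op_mult H S T \<in> op_closure P"
    by (rule op_closure_limI[OF mult[OF st(1,3)] op_lim_mult[OF st(2,4)]])
next
  fix c T assume "T \<in> op_closure P"
  then obtain t where t: "\<forall>n. t n \<in> P" "op_lim t T" by (elim op_closureE)
  show "op_scale H c T \<in> op_closure P"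
    by (rule op_closure_limI[OF scale[OF t(1)[rule_format]] op_lim_scale[OF t(2)]])
next
  fix s T assume s: "\<forall>n. s n \<in> op_closure P" and T: "T \<in> bounded_ops H H"
    and l: "(\<lambda>n::nat. op_norm H H (op_diff H (s n) T)) \<longlonglongrightarrow> 0"
  show "T \<in> op_closure P"
  proof (rule op_closureI[OF P T])
    fix e :: real assume "e > 0"
    then have e: "e / 2 > 0" by simp
    have "eventually (\<lambda>n. op_norm H H (op_diff H (s n) T) < e / 2) sequentially"
      by (rule order_tendstoD(2)[OF l e])
    then obtain n where n: "op_norm H H (op_diff H (s n) T) < e / 2" by (auto simp: eventually_sequentially)
    obtain S where S: "S \<in> P" "op_norm H H (op_diff H S (s n)) < e / 2"
      using op_closure_approx[OF s[rule_format] e] by blast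
    have "op_norm H H (op_diff H S T) \<le> op_norm H H (op_diff H S (s n)) + op_norm H H (op_diff H (s n) T)"
      by (rule op_norm_triangle_diff[OF _ _ T]) (rule subsetD[OF P S(1)], rule subsetD[OF op_closure_bops s[rule_format]])
    then show "\<exists>S\<in>P. op_norm H H (op_diff H S T) < e" using S n by force
  qed
qed

lemma op_closure_least:
  assumes "closed_unital_subalgebra H \<A>" "P \<subseteq> \<A>"
  shows "op_closure P \<subseteq> \<A>"
proof
  fix T assume "T \<in> op_closure P"
  then obtain s where s: "\<forall>n. s n \<in> P" "op_lim s T" by (elim op_closureE)
  have "\<forall>n. s n \<in> \<A>" using s(1) assms(2) by blast
  moreover note op_limD(2,3)[OF s(2)]
  ultimately show "T \<in> \<A>" using assms(1) unfolding closed_unital_subalgebra_def by blast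
qed

end

section \<open>Compressions of polynomial multipliers\<close>

lemma poly_mult_DA:
  "\<exists>b\<ge>0. \<forall>f\<in>hcar drury_arveson. on_ball (peval p) * f \<in> hcar drury_arveson
     \<and> hnorm drury_arveson (on_ball (peval p) * f) \<le> b * hnorm drury_arveson f"
proof (induction p rule: mpoly_induct)
  case (const c)
  have "on_ball (peval (const c)) * f = fscale c f" if "f \<in> hcar drury_arveson" for f :: "complex ^ 'a \<Rightarrow> complex"
    using DA.off_X[OF that] by (auto simp: on_ball_def fscale_def fun_eq_iff)
  then show ?case
    by (intro exI[of _ "cmod c"] conjI ballI) (simp_all only: DA.hnorm_scale DA.scale_mem norm_ge_zero order_refl)
next
  case (coord i)
  have "on_ball (peval (coord i)) = on_ball (\<lambda>z. z $ i)" by (simp add: on_ball_def fun_eq_iff)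
  then show ?case using da_coordinate_mult by (intro exI[of _ 1] conjI ballI) (simp_all only: mult_1 zero_le_one)
next
  case (add p q)
  then obtain b c where b: "b \<ge> 0" "\<And>f. f \<in> hcar drury_arveson \<Longrightarrow> on_ball (peval p) * f \<in> hcar drury_arveson"
      "\<And>f. f \<in> hcar drury_arveson \<Longrightarrow> hnorm drury_arveson (on_ball (peval p) * f) \<le> b * hnorm drury_arveson f"
    and c: "c \<ge> 0" "\<And>f. f \<in> hcar drury_arveson \<Longrightarrow> on_ball (peval q) * f \<in> hcar drury_arveson"
      "\<And>f. f \<in> hcar drury_arveson \<Longrightarrow> hnorm drury_arveson (on_ball (peval q) * f) \<le> c * hnorm drury_arveson f"
    by metis
  have eq: "on_ball (peval (p + q)) * f = on_ball (peval p) * f + on_ball (peval q) * f" for f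
    by (simp add: on_ball_def fun_eq_iff distrib_right)
  show ?case
  proof (intro exI[of _ "b + c"] conjI ballI)
    fix f :: "complex ^ 'a \<Rightarrow> complex" assume f: "f \<in> hcar drury_arveson"
    show "on_ball (peval (p + q)) * f \<in> hcar drury_arveson"
      unfolding eq by (rule DA.add_mem[OF b(2)[OF f] c(2)[OF f]])
    show "hnorm drury_arveson (on_ball (peval (p + q)) * f) \<le> (b + c) * hnorm drury_arveson f"
      unfolding eq distrib_right using DA.hnorm_triangle[OF b(2)[OF f] c(2)[OF f]] b(3)[OF f] c(3)[OF f] by linarith
  qed (use b(1) c(1) in simp)
next
  case (mult p q)
  then obtain b c where b: "b \<ge> 0" "\<And>f. f \<in> hcar drury_arveson \<Longrightarrow> on_ball (peval p) * f \<in> hcar drury_arveson"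
      "\<And>f. f \<in> hcar drury_arveson \<Longrightarrow> hnorm drury_arveson (on_ball (peval p) * f) \<le> b * hnorm drury_arveson f"
    and c: "c \<ge> 0" "\<And>f. f \<in> hcar drury_arveson \<Longrightarrow> on_ball (peval q) * f \<in> hcar drury_arveson"
      "\<And>f. f \<in> hcar drury_arveson \<Longrightarrow> hnorm drury_arveson (on_ball (peval q) * f) \<le> c * hnorm drury_arveson f"
    by metis
  have eq: "on_ball (peval (p * q)) * f = on_ball (peval p) * (on_ball (peval q) * f)" for f
    by (simp add: on_ball_def fun_eq_iff)
  show ?case
  proof (intro exI[of _ "b * c"] conjI ballI)
    fix f :: "complex ^ 'a \<Rightarrow> complex" assume f: "f \<in> hcar drury_arveson"
    show "on_ball (peval (p * q)) * f \<in> hcar drury_arveson"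
      unfolding eq by (rule b(2)[OF c(2)[OF f]])
    show "hnorm drury_arveson (on_ball (peval (p * q)) * f) \<le> b * c * hnorm drury_arveson f"
      unfolding eq mult.assoc by (rule order_trans[OF b(3)[OF c(2)[OF f]] mult_left_mono[OF c(3)[OF f] b(1)]])
  qed (use b(1) c(1) in simp)
qed

lemma hproj_Fsp:
  assumes g: "g \<in> hcar drury_arveson"
  shows hproj_mem: "hproj drury_arveson (Fsp I) g \<in> hcar (Fsp I)"
    and hproj_orthogonal: "h \<in> hcar (Fsp I) \<Longrightarrow> hip drury_arveson (hproj drury_arveson (Fsp I) g) h = hip drury_arveson g h"
    and hproj_contractive: "hnorm drury_arveson (hproj drury_arveson (Fsp I) g) \<le> hnorm drury_arveson g"
proof -
  let ?P = "\<lambda>u. u \<in> hcar (Fsp I) \<and> (\<forall>h\<in>hcar (Fsp I). hip drury_arveson (g - u) h = 0)"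
  obtain u where u: "u \<in> hcar (Fsp I)" "\<And>h. h \<in> hcar (Fsp I) \<Longrightarrow> hip drury_arveson (g - u) h = 0"
    using DA.projection[OF hsub_Fsp hclosed_Fsp g] by blast
  have "hproj drury_arveson (Fsp I) g = u"
    unfolding hproj_def
  proof (rule the_equality)
    show "?P u" using u by blast
    fix v assume v: "?P v"
    have "hip drury_arveson (u - v) (u - v) = hip drury_arveson (g - v) (u - v) - hip drury_arveson (g - u) (u - v)"
      using Fsp_DA[OF u(1)] Fsp_DA[OF conjunct1[OF v]] g by (simp add: DA.hip_diff_left)
    also have "\<dots> = 0" using v u F.diff_mem[OF u(1), of v] by simp
    finally have "u - v = 0" using DA.hip_pos[of "u - v"] u(1) v Fsp_DA by force
    then show "v = u" by simp
  qed
  then show mem: "hproj drury_arveson (Fsp I) g \<in> hcar (Fsp I)"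
    and orth: "h \<in> hcar (Fsp I) \<Longrightarrow> hip drury_arveson (hproj drury_arveson (Fsp I) g) h = hip drury_arveson g h" for h
    using u DA.hip_diff_left[OF g Fsp_DA[OF u(1)] Fsp_DA, of h] by simp_all
  let ?u = "hproj drury_arveson (Fsp I) g"
  have uD: "?u \<in> hcar drury_arveson" by (rule Fsp_DA[OF mem])
  have "complex_of_real ((hnorm drury_arveson ?u)\<^sup>2) = hip drury_arveson g ?u"
    using orth[OF mem] DA.hip_self[OF uD] by simp
  then have "(hnorm drury_arveson ?u)\<^sup>2 = cmod (hip drury_arveson g ?u)"
    by (metis abs_of_nonneg norm_of_real zero_le_power2)
  then have "hnorm drury_arveson ?u * hnorm drury_arveson ?u \<le> hnorm drury_arveson g * hnorm drury_arveson ?u"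
    using DA.Cauchy_Schwarz[OF g uD] by (simp add: power2_eq_square)
  then show "hnorm drury_arveson ?u \<le> hnorm drury_arveson g"
    using DA.hnorm_nonneg[OF uD] DA.hnorm_nonneg[OF g]
    by (cases "hnorm drury_arveson ?u = 0") (auto dest: mult_right_le_imp_le)
qed

text \<open>Kernel functions at points of the variety lie in \<open>Fsp I\<close>, so projecting
  does not change values there. This is why a compression acts as multiplication on the
  variety.\<close>

lemma hproj_eval:
  assumes "g \<in> hcar drury_arveson" "w \<in> vanishing_locus I" "w \<in> ball 0 1"
  shows "hproj drury_arveson (Fsp I) g w = g w"
  using hproj_orthogonal[OF assms(1) kernel_mem_Fsp[OF assms(2,3)]]
  unfolding da_kernel_hip[OF assms(3,1)] da_kernel_hip[OF assms(3) Fsp_DA[OF hproj_mem[OF assms(1)]]] .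

lemma hproj_add:
  assumes f: "f \<in> hcar drury_arveson" and g: "g \<in> hcar drury_arveson"
  shows "hproj drury_arveson (Fsp I) (f + g) = hproj drury_arveson (Fsp I) f + hproj drury_arveson (Fsp I) g"
    (is "?l = ?r")
proof -
  note m = hproj_mem[OF DA.add_mem[OF f g]] F.add_mem[OF hproj_mem[OF f] hproj_mem[OF g]]
  have "hip drury_arveson (?l - ?r) h = 0" if h: "h \<in> hcar (Fsp I)" for h
    using f g h Fsp_DA[OF h] Fsp_DA[OF hproj_mem[OF f]] Fsp_DA[OF hproj_mem[OF g]] Fsp_DA[OF m(1)] Fsp_DA[OF m(2)]
    by (simp add: DA.hip_diff_left DA.hip_add_left hproj_orthogonal)
  then have "?l - ?r = 0" by (intro F.hip_eq_zero_imp[OF F.diff_mem[OF m]]) simp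
  then show ?thesis by simp
qed

lemma hproj_scale:
  assumes f: "f \<in> hcar drury_arveson"
  shows "hproj drury_arveson (Fsp I) (fscale c f) = fscale c (hproj drury_arveson (Fsp I) f)"
    (is "?l = ?r")
proof -
  note m = hproj_mem[OF DA.scale_mem[OF f]] F.scale_mem[OF hproj_mem[OF f]]
  have "hip drury_arveson (?l - ?r) h = 0" if h: "h \<in> hcar (Fsp I)" for h
    using f h Fsp_DA[OF h] Fsp_DA[OF hproj_mem[OF f]] Fsp_DA[OF m(1)] Fsp_DA[OF m(2)]
    by (simp add: DA.hip_diff_left DA.hip_scale_left hproj_orthogonal)
  then have "?l - ?r = 0" by (intro F.hip_eq_zero_imp[OF F.diff_mem[OF m]]) simp
  then show ?thesis by simp
qed

lemma compression_bops: "compression I p \<in> bounded_ops (Fsp I) (Fsp I)"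
proof -
  obtain b where b: "b \<ge> 0" "\<And>f. f \<in> hcar drury_arveson \<Longrightarrow> on_ball (peval p) * f \<in> hcar drury_arveson"
      "\<And>f. f \<in> hcar drury_arveson \<Longrightarrow> hnorm drury_arveson (on_ball (peval p) * f) \<le> b * hnorm drury_arveson f"
    using poly_mult_DA by metis
  let ?P = "hproj drury_arveson (Fsp I)"
  show ?thesis
  proof (rule FF.bopsI[where b = b])
    fix f assume f: "f \<in> hcar (Fsp I)"
    note pf = b(2)[OF Fsp_DA[OF f]]
    show "compression I p f \<in> hcar (Fsp I)" using f hproj_mem[OF pf] by (simp add: compression_def)
    show "compression I p (f + g) = compression I p f + compression I p g" if g: "g \<in> hcar (Fsp I)" for g
    proof -
      have "on_ball (peval p) * (f + g) = on_ball (peval p) * f + on_ball (peval p) * g" by (rule distrib_left)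
      then have "?P (on_ball (peval p) * (f + g)) = ?P (on_ball (peval p) * f) + ?P (on_ball (peval p) * g)"
        using hproj_add[OF pf b(2)[OF Fsp_DA[OF g]]] by (simp only:)
      then show ?thesis using f g F.add_mem[OF f g] by (simp only: compression_def restrict_apply')
    qed
    show "compression I p (fscale c f) = fscale c (compression I p f)" for c
    proof -
      have "on_ball (peval p) * fscale c f = fscale c (on_ball (peval p) * f)"
        by (simp add: fscale_def fun_eq_iff)
      then have "?P (on_ball (peval p) * fscale c f) = fscale c (?P (on_ball (peval p) * f))"
        using hproj_scale[OF pf] by (simp only:)
      then show ?thesis using f F.scale_mem[OF f] by (simp only: compression_def restrict_apply')
    qed
    show "hnorm (Fsp I) (compression I p f) \<le> b * hnorm (Fsp I) f"
      using f hproj_contractive[OF pf] b(3)[OF Fsp_DA[OF f]] by (auto simp: compression_def intro: order_trans)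
  qed (simp add: compression_def)
qed

lemma compression_eval:
  assumes f: "f \<in> hcar (Fsp I)" and w: "w \<in> vanishing_locus I" "w \<in> ball 0 1"
  shows "compression I p f w = peval p w * f w"
proof -
  have "on_ball (peval p) * f \<in> hcar drury_arveson" using poly_mult_DA[of p] Fsp_DA[OF f] by blast
  from hproj_eval[OF this w] show ?thesis using f w by (simp add: compression_def on_ball_def)
qed

text \<open>Totality of the kernel functions combined with the Nullstellensatz. From here on,
  identities between operators are checked at points of the variety.\<close>

lemma Fsp_eqI:
  assumes I: "radical_homogeneous_ideal I" and f: "f \<in> hcar (Fsp I)" and g: "g \<in> hcar (Fsp I)"
    and eq: "\<And>w. w \<in> vanishing_locus I \<Longrightarrow> w \<in> ball 0 1 \<Longrightarrow> f w = g w"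
  shows "f = g"
proof -
  have "f - g = 0"
  proof (rule Fsp_total[OF cone_vanishing_locus[OF I]])
    show "f - g \<in> hcar (Fsp (vanishing_ideal (vanishing_locus I)))"
      unfolding radical_ideal_eq_vanishing_ideal[OF I] by (rule F.diff_mem[OF f g])
  qed (simp add: eq)
  then show ?thesis by simp
qed

lemma bops_Fsp_eqI:
  assumes I: "radical_homogeneous_ideal I"
    and S: "S \<in> bounded_ops (Fsp J) (Fsp I)" and T: "T \<in> bounded_ops (Fsp J) (Fsp I)"
    and "\<And>f w. f \<in> hcar (Fsp J) \<Longrightarrow> w \<in> vanishing_locus I \<Longrightarrow> w \<in> ball 0 1 \<Longrightarrow> S f w = T f w"
  shows "S = T"
  by (rule FF.bops_eqI[OF S T], rule Fsp_eqI[OF I FF.bops_mem[OF S] FF.bops_mem[OF T]]) (simp_all add: assms(4))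

context
  fixes I :: "'n::finite mpoly set"
  assumes I: "radical_homogeneous_ideal I"
begin

lemma compression_const: "compression I (const c) = op_scale (Fsp I) c (op_id (Fsp I))"
  by (rule bops_Fsp_eqI[OF I compression_bops F.op_scale_bops[OF F.op_id_bops]])
     (simp add: compression_eval op_scale_def op_id_def fscale_def)

lemma compression_1: "compression I 1 = op_id (Fsp I)"
  by (rule bops_Fsp_eqI[OF I compression_bops F.op_id_bops]) (simp add: compression_eval op_id_def)

lemma compression_add: "compression I (p + q) = op_add (Fsp I) (compression I p) (compression I q)"
  by (rule bops_Fsp_eqI[OF I compression_bops F.op_add_bops[OF compression_bops compression_bops]])
     (simp add: compression_eval op_add_def distrib_right)

lemma compression_mult: "compression I (p * q) = op_mult (Fsp I) (compression I p) (compression I q)"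
  by (rule bops_Fsp_eqI[OF I compression_bops F.op_mult_bops[OF compression_bops compression_bops]])
     (simp add: compression_eval op_mult_def FF.bops_mem[OF compression_bops])

lemma compression_scale: "compression I (const c * p) = op_scale (Fsp I) c (compression I p)"
  by (rule bops_Fsp_eqI[OF I compression_bops F.op_scale_bops[OF compression_bops]])
     (simp add: compression_eval op_scale_def fscale_def)

text \<open>As compression respects sums and products of polynomials, its range is already an
  algebra, and only the norm closure remains to be taken.\<close>

theorem Aalg_eq_closure: "Aalg I = F.op_closure I (range (compression I))"
proof (rule antisym)
  have P: "range (compression I) \<subseteq> bounded_ops (Fsp I) (Fsp I)" using compression_bops by blast
  have "closed_unital_subalgebra (Fsp I) (F.op_closure I (range (compression I)))"
  proof (rule F.closed_unital_subalgebra_op_closure[OF P])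
    show "op_id (Fsp I) \<in> range (compression I)" unfolding compression_1[symmetric] by (rule rangeI)
  next
    fix S T assume "S \<in> range (compression I)" "T \<in> range (compression I)"
    then obtain p q where ST: "S = compression I p" "T = compression I q" by blast
    show "op_add (Fsp I) S T \<in> range (compression I)"
      unfolding ST compression_add[symmetric] by (rule rangeI)
    show "op_mult (Fsp I) S T \<in> range (compression I)"
      unfolding ST compression_mult[symmetric] by (rule rangeI)
  next
    fix c T assume "T \<in> range (compression I)"
    then obtain p where T: "T = compression I p" by blast
    show "op_scale (Fsp I) c T \<in> range (compression I)"
      unfolding T compression_scale[symmetric] by (rule rangeI)
  qed
  then show "Aalg I \<subseteq> F.op_closure I (range (compression I))"
    unfolding Aalg_def using F.op_closure_subset[OF P] by blast
  show "F.op_closure I (range (compression I)) \<subseteq> Aalg I"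
    unfolding Aalg_def
  proof (rule Inter_greatest, elim CollectE conjE)
    fix \<A> assume \<A>: "closed_unital_subalgebra (Fsp I) \<A>" and c: "\<forall>i. compression I (coord i) \<in> \<A>"
    note \<A>' = \<A>[unfolded closed_unital_subalgebra_def]
    have "compression I p \<in> \<A>" for p
    proof (induction p rule: mpoly_induct)
      case (const c)
      show ?case unfolding compression_const using \<A>' by blast
    next
      case (coord i)
      show ?case using c by blast
    next
      case (add p q)
      then show ?case unfolding compression_add using \<A>' by blast
    next
      case (mult p q)
      then show ?case unfolding compression_mult using \<A>' by blast
    qed
    then show "F.op_closure I (range (compression I)) \<subseteq> \<A>"
      by (intro F.op_closure_least[OF \<A>]) blast
  qed
qed

end

section \<open>Functions on the variety\<close>

lemma continuous_on_peval: "continuous_on S (peval p)"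
  unfolding peval_def by (intro continuous_intros)

context
  fixes I :: "'n::finite mpoly set"
  assumes I: "radical_homogeneous_ideal I"
begin

abbreviation (input) "opnorm \<equiv> op_norm (Fsp I) (Fsp I)"

text \<open>Applying the compression of \<open>p\<close> to the kernel function at \<open>z\<close>
  and pairing with the same kernel function gives \<open>peval p z\<close> times its squared
  norm.\<close>

lemma peval_le_compression_ball:
  assumes z: "z \<in> vanishing_locus I" "z \<in> ball 0 1"
  shows "cmod (peval p z) \<le> opnorm (compression I p)"
proof -
  let ?k = "da_kernel z"
  have k: "?k \<in> hcar (Fsp I)" by (rule kernel_mem_Fsp[OF z])
  note m = FF.bops_mem[OF compression_bops k]
  have kk: "?k z = complex_of_real ((hnorm drury_arveson ?k)\<^sup>2)"
    using Fsp_eval[OF z(2) k] DA.hip_self[OF Fsp_DA[OF k]] by simp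
  have "(norm z)\<^sup>2 < 1" using z(2) by (simp add: power_less_one_iff)
  then have "1 - cinner z z \<noteq> 0" unfolding cinner_self
    by (metis eq_iff_diff_eq_0 less_irrefl of_real_1 of_real_eq_iff)
  then have "?k z \<noteq> 0" using z(2) by (simp add: on_ball_def)
  then have pos: "(hnorm drury_arveson ?k)\<^sup>2 > 0" unfolding kk by (metis of_real_0 zero_less_power2 zero_power2)
  have "cmod (peval p z) * (hnorm drury_arveson ?k)\<^sup>2 = cmod (compression I p ?k z)"
    unfolding compression_eval[OF k z] kk norm_mult by (simp del: of_real_power)
  also have "\<dots> = cmod (hip drury_arveson (compression I p ?k) ?k)"
    unfolding Fsp_eval[OF z(2) m] ..
  also have "\<dots> \<le> hnorm drury_arveson (compression I p ?k) * hnorm drury_arveson ?k"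
    by (rule DA.Cauchy_Schwarz[OF Fsp_DA[OF m] Fsp_DA[OF k]])
  also have "\<dots> \<le> opnorm (compression I p) * hnorm drury_arveson ?k * hnorm drury_arveson ?k"
    using F.op_norm_bound[OF compression_bops k, of p] DA.hnorm_nonneg[OF Fsp_DA[OF k]]
    by (intro mult_right_mono) simp_all
  finally have "cmod (peval p z) * (hnorm drury_arveson ?k)\<^sup>2 \<le> opnorm (compression I p) * (hnorm drury_arveson ?k)\<^sup>2"
    by (simp only: power2_eq_square mult.assoc)
  then show ?thesis by (rule mult_right_le_imp_le[OF _ pos])
qed

lemma peval_le_compression:
  assumes z: "z \<in> ball_locus I"
  shows "cmod (peval p z) \<le> opnorm (compression I p)"
proof -
  \<comment> \<open>Points on the boundary of the ball are approached along the radius; the cone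
    property keeps \<open>s n\<close> on the variety.\<close>
  define r where "r n = 1 - inverse (real (Suc n))" for n
  define s where "s n = complex_of_real (r n) *s z" for n
  have r: "0 \<le> r n" "r n < 1" for n by (simp_all add: r_def divide_simps)
  have "r \<longlonglongrightarrow> 1 - 0"
    unfolding r_def by (intro tendsto_intros LIMSEQ_inverse_real_of_nat)
  then have "s \<longlonglongrightarrow> z"
    unfolding s_def by (intro vec_tendstoI) (auto intro!: tendsto_eq_intros)
  then have l: "(\<lambda>n. cmod (peval p (s n))) \<longlonglongrightarrow> cmod (peval p z)"
    by (intro tendsto_norm continuous_on_tendsto_compose[OF continuous_on_peval[of UNIV]]) auto
  have "cmod (peval p (s n)) \<le> opnorm (compression I p)" for n
  proof (rule peval_le_compression_ball)
    show "s n \<in> vanishing_locus I"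
      using z cone_vanishing_locus[OF I] unfolding s_def cone_def ball_locus_def by blast
    have "r n * norm z \<le> r n * 1" using z r(1)[of n] by (intro mult_left_mono) (auto simp: ball_locus_def)
    then show "s n \<in> ball 0 1"
      using r[of n] by (simp add: s_def norm_vector_scalar_mult)
  qed
  then show ?thesis by (intro LIMSEQ_le_const2[OF l]) blast
qed

lemma compression_diff: "op_diff (Fsp I) (compression I p) (compression I q) = compression I (p - q)"
  by (rule bops_Fsp_eqI[OF I F.op_diff_bops[OF compression_bops compression_bops] compression_bops])
     (simp add: compression_eval op_diff_def left_diff_distrib)

lemma AalgE:
  assumes "T \<in> Aalg I"
  obtains p where "F.op_lim I (\<lambda>n. compression I (p n)) T"
proof -
  obtain s where s: "\<forall>n. s n \<in> range (compression I)" "F.op_lim I s T"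
    using assms unfolding Aalg_eq_closure[OF I] by (elim F.op_closureE)
  from s(1) have "\<forall>n. \<exists>p. s n = compression I p" by blast
  from choice[OF this] obtain p where "\<forall>n. s n = compression I (p n)" ..
  then have "s = (\<lambda>n. compression I (p n))" by blast
  with s(2) show thesis by (intro that) simp
qed

lemma AalgI: "F.op_lim I (\<lambda>n. compression I (p n)) T \<Longrightarrow> T \<in> Aalg I"
  unfolding Aalg_eq_closure[OF I] by (rule F.op_closure_limI[OF rangeI])

lemma Aalg_bops: "T \<in> Aalg I \<Longrightarrow> T \<in> bounded_ops (Fsp I) (Fsp I)"
  unfolding Aalg_eq_closure[OF I] by (rule subsetD[OF F.op_closure_bops])

lemma compression_Aalg: "compression I p \<in> Aalg I"
  by (rule AalgI[OF F.op_lim_const[OF compression_bops]])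

text \<open>The value is pinned down by its distance to the values of all polynomials at once, which
  makes it independent of any approximating sequence and turns convergence statements into
  estimates.\<close>

definition gelfand :: "(complex ^ 'n, complex ^ 'n) hop \<Rightarrow> complex ^ 'n \<Rightarrow> complex" where
  "gelfand T z = (SOME l. \<forall>p. cmod (peval p z - l) \<le> opnorm (op_diff (Fsp I) (compression I p) T))"

text \<open>The estimate for compressions of differences makes the values of approximating
  polynomials Cauchy, and the inequality survives in the limit.\<close>

lemma gelfand_bound:
  assumes T: "T \<in> Aalg I" and z: "z \<in> ball_locus I"
  shows "cmod (peval p z - gelfand T z) \<le> opnorm (op_diff (Fsp I) (compression I p) T)"
proof -
  obtain s where s: "F.op_lim I (\<lambda>n. compression I (s n)) T" by (rule AalgE[OF T])
  note Tb = Aalg_bops[OF T]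
  let ?d = "\<lambda>p. opnorm (op_diff (Fsp I) (compression I p) T)"
  have d0: "?d p \<ge> 0" for p by (intro F.op_norm_nonneg F.op_diff_bops compression_bops Tb)
  have lip: "cmod (peval p z - peval q z) \<le> ?d p + ?d q" for p q
  proof -
    have "cmod (peval p z - peval q z) \<le> opnorm (op_diff (Fsp I) (compression I p) (compression I q))"
      using peval_le_compression[OF z, of "p - q"] unfolding compression_diff by simp
    also have "\<dots> \<le> ?d p + opnorm (op_diff (Fsp I) T (compression I q))"
      by (intro F.op_norm_triangle_diff compression_bops Tb)
    also have "opnorm (op_diff (Fsp I) T (compression I q)) = ?d q"
      by (rule F.op_diff_sym[OF Tb compression_bops])
    finally show ?thesis .
  qed
  have ds: "(\<lambda>n. ?d (s n)) \<longlonglongrightarrow> 0" by (rule F.op_limD(3)[OF s])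
  have "Cauchy (\<lambda>n. peval (s n) z)"
  proof (rule CauchyI)
    fix e :: real assume "e > 0"
    then have "eventually (\<lambda>n. ?d (s n) < e / 2) sequentially" by (intro order_tendstoD(2)[OF ds]) simp
    then obtain M where M: "\<And>n. n \<ge> M \<Longrightarrow> ?d (s n) < e / 2" unfolding eventually_sequentially by blast
    show "\<exists>M. \<forall>m\<ge>M. \<forall>n\<ge>M. cmod (peval (s m) z - peval (s n) z) < e"
    proof (intro exI[of _ M] allI impI)
      fix m n assume "M \<le> m" "M \<le> n"
      then show "cmod (peval (s m) z - peval (s n) z) < e"
        using lip[of "s m" "s n"] M[of m] M[of n] by linarith
    qed
  qed
  then obtain l where l: "(\<lambda>n. peval (s n) z) \<longlonglongrightarrow> l" using Cauchy_convergent convergentD by blast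
  have "cmod (peval p z - l) \<le> ?d p" for p
  proof (rule tendsto_le[OF sequentially_bot])
    show "(\<lambda>n. cmod (peval p z - peval (s n) z)) \<longlonglongrightarrow> cmod (peval p z - l)" by (intro tendsto_intros l)
    show "(\<lambda>n. ?d p + ?d (s n)) \<longlonglongrightarrow> ?d p" using tendsto_add[OF tendsto_const ds, of "?d p"] by simp
  qed (simp add: lip)
  then have "\<exists>l. \<forall>p. cmod (peval p z - l) \<le> ?d p" by blast
  from someI_ex[OF this] show ?thesis unfolding gelfand_def by blast
qed

lemma gelfand_lim:
  assumes s: "F.op_lim I (\<lambda>n. compression I (s n)) T" and z: "z \<in> ball_locus I"
  shows "(\<lambda>n. peval (s n) z) \<longlonglongrightarrow> gelfand T z"
proof (rule LIM_zero_cancel, rule Lim_null_comparison[OF _ F.op_limD(3)[OF s]])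
  show "\<forall>\<^sub>F n in sequentially. norm (peval (s n) z - gelfand T z) \<le> opnorm (op_diff (Fsp I) (compression I (s n)) T)"
    using gelfand_bound[OF AalgI[OF s] z] by (intro always_eventually allI)
qed

lemma gelfand_compression: "z \<in> ball_locus I \<Longrightarrow> gelfand (compression I p) z = peval p z"
  using gelfand_lim[OF F.op_lim_const[OF compression_bops], of z p] LIMSEQ_unique[OF _ tendsto_const] by metis

text \<open>Passes from compressions to their norm limits. It shows that the function determines the
  operator, that is, injectivity of the realisation.\<close>

lemma gelfand_apply:
  assumes T: "T \<in> Aalg I" and f: "f \<in> hcar (Fsp I)" and z: "z \<in> vanishing_locus I" "z \<in> ball 0 1"
  shows "T f z = gelfand T z * f z"
proof -
  obtain s where s: "F.op_lim I (\<lambda>n. compression I (s n)) T" by (rule AalgE[OF T])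
  have zb: "z \<in> ball_locus I" using z by (auto simp: ball_locus_def)
  note Tb = Aalg_bops[OF T] and Tf = FF.bops_mem[OF Aalg_bops[OF T] f]
  note cf = FF.bops_mem[OF compression_bops f]
  let ?c = "hnorm drury_arveson f * hnorm drury_arveson (da_kernel z)"
  have "(\<lambda>n. compression I (s n) f z) \<longlonglongrightarrow> T f z"
  proof (rule LIM_zero_cancel, rule Lim_null_comparison)
    show "\<forall>\<^sub>F n in sequentially. norm (compression I (s n) f z - T f z) \<le> opnorm (op_diff (Fsp I) (compression I (s n)) T) * ?c"
    proof (intro always_eventually allI)
      fix n
      have m: "compression I (s n) f - T f \<in> hcar (Fsp I)" by (rule F.diff_mem[OF cf Tf])
      have "cmod (compression I (s n) f z - T f z) = cmod (hip drury_arveson (compression I (s n) f - T f) (da_kernel z))"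
        unfolding Fsp_eval[OF z(2) m] by simp
      also have "\<dots> \<le> hnorm drury_arveson (compression I (s n) f - T f) * hnorm drury_arveson (da_kernel z)"
        by (rule DA.Cauchy_Schwarz[OF Fsp_DA[OF m] da_kernel_mem[OF z(2)]])
      also have "\<dots> \<le> opnorm (op_diff (Fsp I) (compression I (s n)) T) * hnorm drury_arveson f * hnorm drury_arveson (da_kernel z)"
        using F.op_diff_bound[OF compression_bops Tb f, of "s n"] DA.hnorm_nonneg[OF da_kernel_mem[OF z(2)]]
        by (intro mult_right_mono) simp_all
      finally show "norm (compression I (s n) f z - T f z) \<le> opnorm (op_diff (Fsp I) (compression I (s n)) T) * ?c"
        by (simp only: mult.assoc)
    qed
    show "(\<lambda>n. opnorm (op_diff (Fsp I) (compression I (s n)) T) * ?c) \<longlonglongrightarrow> 0"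
      using tendsto_mult_right[OF F.op_limD(3)[OF s], of ?c] by simp
  qed
  moreover have "(\<lambda>n. compression I (s n) f z) \<longlonglongrightarrow> gelfand T z * f z"
    unfolding compression_eval[OF f z] by (intro tendsto_mult_right gelfand_lim[OF s zb])
  ultimately show ?thesis by (rule LIMSEQ_unique)
qed

text \<open>Supplies the witness for the choice in \<open>alg_fun\<close>. Continuity comes from
  uniform convergence of polynomials on \<open>ball_locus I\<close>.\<close>

lemma function_realisation_gelfand: "function_realisation I gelfand"
  unfolding function_realisation_def
proof (intro conjI ballI allI impI)
  fix T assume T: "T \<in> Aalg I"
  obtain s where s: "F.op_lim I (\<lambda>n. compression I (s n)) T" by (rule AalgE[OF T])
  have "uniform_limit (ball_locus I) (\<lambda>n. peval (s n)) (gelfand T) sequentially"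
  proof (rule uniform_limitI)
    fix e :: real assume "e > 0"
    then have "\<forall>\<^sub>F n in sequentially. opnorm (op_diff (Fsp I) (compression I (s n)) T) < e"
      by (rule order_tendstoD(2)[OF F.op_limD(3)[OF s]])
    then show "\<forall>\<^sub>F n in sequentially. \<forall>x\<in>ball_locus I. dist (peval (s n) x) (gelfand T x) < e"
    proof eventually_elim
      case (elim n)
      then show ?case using gelfand_bound[OF T, of _ "s n"] by (auto simp: dist_norm intro: le_less_trans)
    qed
  qed
  then show "continuous_on (ball_locus I) (gelfand T)"
    by (rule uniform_limit_theorem[OF always_eventually[OF allI[OF continuous_on_peval]]]) simp
  fix z assume z: "z \<in> ball_locus I"
  show "gelfand (op_scale (Fsp I) c T) z = c * gelfand T z" for c
  proof (rule LIMSEQ_unique)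
    have "F.op_lim I (\<lambda>n. compression I (const c * s n)) (op_scale (Fsp I) c T)"
      unfolding compression_scale[OF I] by (rule F.op_lim_scale[OF s])
    from gelfand_lim[OF this z] show "(\<lambda>n. peval (const c * s n) z) \<longlonglongrightarrow> gelfand (op_scale (Fsp I) c T) z" .
    show "(\<lambda>n. peval (const c * s n) z) \<longlonglongrightarrow> c * gelfand T z"
      using tendsto_mult_left[OF gelfand_lim[OF s z], of c] by simp
  qed
  show "cmod (gelfand T z) \<le> opnorm T"
  proof (rule tendsto_le[OF sequentially_bot])
    show "(\<lambda>n. cmod (peval (s n) z)) \<longlonglongrightarrow> cmod (gelfand T z)" by (intro tendsto_norm gelfand_lim[OF s z])
    show "(\<lambda>n. opnorm (op_diff (Fsp I) (compression I (s n)) T) + opnorm T) \<longlonglongrightarrow> opnorm T"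
      using tendsto_add[OF F.op_limD(3)[OF s] tendsto_const, of "opnorm T"] by simp
    show "\<forall>\<^sub>F n in sequentially. cmod (peval (s n) z) \<le> opnorm (op_diff (Fsp I) (compression I (s n)) T) + opnorm T"
      by (intro always_eventually allI order_trans[OF peval_le_compression[OF z]]
            F.op_norm_le_diff[OF compression_bops Aalg_bops[OF T]])
  qed
next
  fix S T assume S: "S \<in> Aalg I" and T: "T \<in> Aalg I"
  obtain s where s: "F.op_lim I (\<lambda>n. compression I (s n)) S" by (rule AalgE[OF S])
  obtain t where t: "F.op_lim I (\<lambda>n. compression I (t n)) T" by (rule AalgE[OF T])
  show "gelfand (op_add (Fsp I) S T) z = gelfand S z + gelfand T z" if z: "z \<in> ball_locus I" for z
  proof (rule LIMSEQ_unique)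
    have "F.op_lim I (\<lambda>n. compression I (s n + t n)) (op_add (Fsp I) S T)"
      unfolding compression_add[OF I] by (rule F.op_lim_add[OF s t])
    from gelfand_lim[OF this z] show "(\<lambda>n. peval (s n + t n) z) \<longlonglongrightarrow> gelfand (op_add (Fsp I) S T) z" .
    show "(\<lambda>n. peval (s n + t n) z) \<longlonglongrightarrow> gelfand S z + gelfand T z"
      unfolding peval_add by (intro tendsto_add gelfand_lim[OF s z] gelfand_lim[OF t z])
  qed
  show "gelfand (op_mult (Fsp I) S T) z = gelfand S z * gelfand T z" if z: "z \<in> ball_locus I" for z
  proof (rule LIMSEQ_unique)
    have "F.op_lim I (\<lambda>n. compression I (s n * t n)) (op_mult (Fsp I) S T)"
      unfolding compression_mult[OF I] by (rule F.op_lim_mult[OF s t])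
    from gelfand_lim[OF this z] show "(\<lambda>n. peval (s n * t n) z) \<longlonglongrightarrow> gelfand (op_mult (Fsp I) S T) z" .
    show "(\<lambda>n. peval (s n * t n) z) \<longlonglongrightarrow> gelfand S z * gelfand T z"
      unfolding peval_mult by (intro tendsto_mult gelfand_lim[OF s z] gelfand_lim[OF t z])
  qed
  assume eq: "\<forall>z\<in>ball_locus I. gelfand S z = gelfand T z"
  show "S = T"
  proof (rule bops_Fsp_eqI[OF I Aalg_bops[OF S] Aalg_bops[OF T]])
    fix f w assume f: "f \<in> hcar (Fsp I)" and w: "w \<in> vanishing_locus I" "w \<in> ball 0 1"
    have "w \<in> ball_locus I" using w by (auto simp: ball_locus_def)
    then show "S f w = T f w" using eq gelfand_apply[OF S f w] gelfand_apply[OF T f w] by simp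
  qed
next
  fix p z assume "z \<in> ball_locus I"
  then show "gelfand (compression I p) z = peval p z" by (rule gelfand_compression)
qed

text \<open>Contractivity of the chosen realisation, applied to the difference of \<open>T\<close>
  and its approximants, forces this limit. So the values of \<open>alg_fun\<close> are the same for
  every possible choice.\<close>

theorem alg_fun_lim:
  assumes s: "F.op_lim I (\<lambda>n. compression I (s n)) T" and z: "z \<in> ball_locus I"
  shows "(\<lambda>n. peval (s n) z) \<longlonglongrightarrow> alg_fun I T z"
proof -
  let ?G = "alg_fun I"
  have R: "function_realisation I ?G"
    unfolding alg_fun_def by (rule someI[of "function_realisation I", OF function_realisation_gelfand])
  note R' = R[unfolded function_realisation_def]
  have add: "?G (op_add (Fsp I) S T) z = ?G S z + ?G T z" if "S \<in> Aalg I" "T \<in> Aalg I" for S T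
    using R' that z by blast
  have scale: "?G (op_scale (Fsp I) c T) z = c * ?G T z" if "T \<in> Aalg I" for c T
    using R' that z by blast
  have le: "cmod (?G T z) \<le> opnorm T" if "T \<in> Aalg I" for T
    using R' that z by blast
  have pol: "?G (compression I p) z = peval p z" for p
    using R' z by blast
  note T = AalgI[OF s]
  have sT: "op_scale (Fsp I) c T \<in> Aalg I" for c
  proof (rule AalgI)
    show "F.op_lim I (\<lambda>n. compression I (const c * s n)) (op_scale (Fsp I) c T)"
      unfolding compression_scale[OF I] by (rule F.op_lim_scale[OF s])
  qed
  have dT: "op_diff (Fsp I) (compression I p) T \<in> Aalg I" for p
  proof (rule AalgI)
    show "F.op_lim I (\<lambda>n. compression I (p + const (- 1) * s n)) (op_diff (Fsp I) (compression I p) T)"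
      unfolding compression_scale[OF I] compression_add[OF I] F.op_diff_eq_add
      by (rule F.op_lim_add[OF F.op_lim_const[OF compression_bops] F.op_lim_scale[OF s]])
  qed
  have diff: "?G (op_diff (Fsp I) (compression I p) T) z = peval p z - ?G T z" for p
    unfolding F.op_diff_eq_add add[OF compression_Aalg sT] scale[OF T] pol by simp
  show ?thesis
  proof (rule LIM_zero_cancel, rule Lim_null_comparison[OF _ F.op_limD(3)[OF s]])
    show "\<forall>\<^sub>F n in sequentially. norm (peval (s n) z - ?G T z) \<le> opnorm (op_diff (Fsp I) (compression I (s n)) T)"
    proof (intro always_eventually allI)
      fix n
      show "norm (peval (s n) z - ?G T z) \<le> opnorm (op_diff (Fsp I) (compression I (s n)) T)"
        using le[OF dT[of "s n"]] unfolding diff .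
    qed
  qed
qed

end

section \<open>Similarities of operator algebras\<close>

definition similar :: "'y hfs \<Rightarrow> ('x, 'y) hop \<Rightarrow> ('y, 'x) hop \<Rightarrow> ('x, 'x) hop \<Rightarrow> ('y, 'y) hop" where
  "similar K R S T = (\<lambda>f\<in>hcar K. R (T (S f)))"

context hilbert_fs_pair
begin

text \<open>The infimum in \<open>matrix_op_norm\<close> has to be over a nonempty set before it can
  be bounded below. The bound exhibited is a crude one from the row sums of operator norms.\<close>

lemma matrix_op_norm_nonempty:
  fixes n :: nat
  assumes "\<And>i j. i < n \<Longrightarrow> j < n \<Longrightarrow> T i j \<in> bounded_ops H H"
  shows "\<exists>b. 0 \<le> b \<and> (\<forall>h. (\<forall>j<n. h j \<in> hcar H) \<longrightarrow>
     sqrt (\<Sum>i<n. (hnorm H (\<Sum>j<n. T i j (h j)))\<^sup>2) \<le> b * sqrt (\<Sum>j<n. (hnorm H (h j))\<^sup>2))"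
proof -
  define \<beta> where "\<beta> i = (\<Sum>j<n. op_norm H H (T i j))" for i
  have \<beta>: "\<beta> i \<ge> 0" if "i < n" for i
    unfolding \<beta>_def using that by (intro sum_nonneg H.op_norm_nonneg assms) auto
  show ?thesis
  proof (intro exI[of _ "sqrt (\<Sum>i<n. (\<beta> i)\<^sup>2)"] conjI allI impI)
    show "0 \<le> sqrt (\<Sum>i<n. (\<beta> i)\<^sup>2)" by (simp add: sum_nonneg)
    fix h assume h: "\<forall>j<n. h j \<in> hcar H"
    let ?N = "sqrt (\<Sum>j<n. (hnorm H (h j))\<^sup>2)"
    interpret E: hilbert_fs_pair X H X H by unfold_locales
    have "hnorm H (\<Sum>j<n. T i j (h j)) \<le> \<beta> i * ?N" if i: "i < n" for i
    proof -
      have m: "T i j (h j) \<in> hcar H" if "j \<in> {..<n}" for j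
        using E.bops_mem[OF assms[OF i]] h that by simp
      have "hnorm H (\<Sum>j<n. T i j (h j)) \<le> (\<Sum>j<n. hnorm H (T i j (h j)))" by (rule H.hnorm_sum_le[OF m])
      also have "\<dots> \<le> (\<Sum>j<n. op_norm H H (T i j) * ?N)"
      proof (rule sum_mono)
        fix j assume j: "j \<in> {..<n}"
        have "(hnorm H (h j))\<^sup>2 \<le> (\<Sum>j<n. (hnorm H (h j))\<^sup>2)" by (rule member_le_sum[OF j]) simp_all
        then have "hnorm H (h j) \<le> ?N" by (rule real_le_rsqrt)
        moreover have "hnorm H (T i j (h j)) \<le> op_norm H H (T i j) * hnorm H (h j)"
          using j h by (intro H.op_norm_bound assms i) auto
        moreover have "op_norm H H (T i j) \<ge> 0" using j by (intro H.op_norm_nonneg assms i) auto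
        ultimately show "hnorm H (T i j (h j)) \<le> op_norm H H (T i j) * ?N"
          by (meson mult_left_mono order_trans)
      qed
      finally show ?thesis by (simp add: \<beta>_def sum_distrib_right)
    qed
    moreover have "0 \<le> hnorm H (\<Sum>j<n. T i j (h j))" if i: "i < n" for i
      using E.bops_mem[OF assms[OF i]] h by (intro H.hnorm_nonneg H.sum_mem) simp
    ultimately have "(\<Sum>i<n. (hnorm H (\<Sum>j<n. T i j (h j)))\<^sup>2) \<le> (\<Sum>i<n. (\<beta> i * ?N)\<^sup>2)"
      by (intro sum_mono power_mono) auto
    also have "\<dots> = (\<Sum>i<n. (\<beta> i)\<^sup>2) * (\<Sum>j<n. (hnorm H (h j))\<^sup>2)"
      by (simp add: power_mult_distrib sum_distrib_right sum_nonneg)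
    finally show "sqrt (\<Sum>i<n. (hnorm H (\<Sum>j<n. T i j (h j)))\<^sup>2) \<le> sqrt (\<Sum>i<n. (\<beta> i)\<^sup>2) * ?N"
      unfolding real_sqrt_mult[symmetric] by (rule real_sqrt_le_mono)
  qed
qed

context
  fixes R S
  assumes R: "R \<in> bounded_ops H K" and S: "S \<in> bounded_ops K H"
begin

interpretation E: hilbert_fs_pair X H X H by unfold_locales
interpretation E': hilbert_fs_pair Y K Y K by unfold_locales
interpretation W: hilbert_fs_pair Y K X H by unfold_locales

text \<open>In the matrix estimate \<open>S\<close> acts on each entry of the argument and
  \<open>R\<close> on each entry of the result, so one constant serves all sizes
  \<open>n\<close>.\<close>

lemma similar_bound:
  obtains c where "c > 0" "\<And>T. T \<in> bounded_ops H H \<Longrightarrow> similar K R S T \<in> bounded_ops K K"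
    "\<And>T. T \<in> bounded_ops H H \<Longrightarrow> op_norm K K (similar K R S T) \<le> c * op_norm H H T"
    "\<And>n T. (\<And>i j. i < n \<Longrightarrow> j < n \<Longrightarrow> T i j \<in> bounded_ops H H) \<Longrightarrow>
       matrix_op_norm n K (\<lambda>i j. similar K R S (T i j)) \<le> c * matrix_op_norm n H T"
proof -
  obtain r where r: "r \<ge> 0" "\<And>f. f \<in> hcar H \<Longrightarrow> hnorm K (R f) \<le> r * hnorm H f"
    using bops_bound[OF R] by blast
  obtain s where s: "s \<ge> 0" "\<And>f. f \<in> hcar K \<Longrightarrow> hnorm H (S f) \<le> s * hnorm K f"
    using W.bops_bound[OF S] by blast
  \<comment> \<open>The added 1 keeps \<open>c\<close> positive, which allows dividing by it
    below.\<close>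
  define c where "c = r * s + 1"
  have c: "c > 0" "r * s \<le> c" using mult_nonneg_nonneg[OF r(1) s(1)] by (auto simp: c_def)
  have norm: "hnorm K (similar K R S T f) \<le> c * op_norm H H T * hnorm K f"
    if T: "T \<in> bounded_ops H H" and f: "f \<in> hcar K" for T f
  proof -
    note Sf = W.bops_mem[OF S f]
    have "hnorm K (R (T (S f))) \<le> r * hnorm H (T (S f))" by (rule r(2)[OF E.bops_mem[OF T Sf]])
    also have "\<dots> \<le> r * (op_norm H H T * (s * hnorm K f))"
      by (intro mult_left_mono r(1) order_trans[OF H.op_norm_bound[OF T Sf]] s(2)[OF f] H.op_norm_nonneg[OF T])
    also have "\<dots> = r * s * (op_norm H H T * hnorm K f)" by simp
    also have "\<dots> \<le> c * (op_norm H H T * hnorm K f)"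
      by (intro mult_right_mono c(2) mult_nonneg_nonneg H.op_norm_nonneg[OF T] K.hnorm_nonneg[OF f])
    finally show ?thesis using f by (simp add: similar_def mult.assoc)
  qed
  have bops: "similar K R S T \<in> bounded_ops K K" if T: "T \<in> bounded_ops H H" for T
  proof (rule E'.bopsI[OF _ _ _ _ norm[OF T]])
    fix f assume f: "f \<in> hcar K"
    note Sf = W.bops_mem[OF S f]
    note TSf = E.bops_mem[OF T Sf]
    show "similar K R S T f \<in> hcar K" using bops_mem[OF R TSf] f by (simp add: similar_def)
    show "similar K R S T (f + g) = similar K R S T f + similar K R S T g" if g: "g \<in> hcar K" for g
      using f g K.add_mem[OF f g] W.bops_add[OF S f g] E.bops_add[OF T Sf W.bops_mem[OF S g]]
        bops_add[OF R TSf E.bops_mem[OF T W.bops_mem[OF S g]]]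
      by (simp only: similar_def restrict_apply')
    show "similar K R S T (fscale d f) = fscale d (similar K R S T f)" for d
      using f K.scale_mem[OF f] W.bops_scale[OF S f] E.bops_scale[OF T Sf] bops_scale[OF R TSf]
      by (simp only: similar_def restrict_apply')
  qed (simp add: similar_def)
  have op: "op_norm K K (similar K R S T) \<le> c * op_norm H H T" if T: "T \<in> bounded_ops H H" for T
    using c(1) H.op_norm_nonneg[OF T] norm[OF T] by (intro K.op_norm_le) auto
  have mat: "matrix_op_norm n K (\<lambda>i j. similar K R S (T i j)) \<le> c * matrix_op_norm n H T"
    if T: "\<And>i j. i < n \<Longrightarrow> j < n \<Longrightarrow> T i j \<in> bounded_ops H H" for n and T :: "nat \<Rightarrow> nat \<Rightarrow> ('x, 'x) hop"
  proof -
    define B where "B = {b. 0 \<le> b \<and> (\<forall>h. (\<forall>j<n. h j \<in> hcar H) \<longrightarrow>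
       sqrt (\<Sum>i<n. (hnorm H (\<Sum>j<n. T i j (h j)))\<^sup>2) \<le> b * sqrt (\<Sum>j<n. (hnorm H (h j))\<^sup>2))}"
    have ne: "B \<noteq> {}" using matrix_op_norm_nonempty[of n T] T unfolding B_def by blast
    have *: "matrix_op_norm n K (\<lambda>i j. similar K R S (T i j)) \<le> c * b" if b: "b \<in> B" for b
      unfolding matrix_op_norm_def
    proof (rule cInf_lower)
      have b0: "b \<ge> 0" using b by (simp add: B_def)
      have bB: "sqrt (\<Sum>i<n. (hnorm H (\<Sum>j<n. T i j (h j)))\<^sup>2) \<le> b * sqrt (\<Sum>j<n. (hnorm H (h j))\<^sup>2)"
        if "\<forall>j<n. h j \<in> hcar H" for h
        using b that unfolding B_def by blast
      have scale: "sqrt (\<Sum>i<n. (x i)\<^sup>2) \<le> a * sqrt (\<Sum>i<n. (y i)\<^sup>2)"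
        if "\<And>i. i < n \<Longrightarrow> 0 \<le> x i \<and> x i \<le> a * y i" "a \<ge> 0" for x y :: "nat \<Rightarrow> real" and a
      proof -
        have "(\<Sum>i<n. (x i)\<^sup>2) \<le> (\<Sum>i<n. (a * y i)\<^sup>2)" using that(1) by (intro sum_mono power_mono) auto
        also have "\<dots> = a\<^sup>2 * (\<Sum>i<n. (y i)\<^sup>2)" by (simp add: power_mult_distrib sum_distrib_left)
        finally have "sqrt (\<Sum>i<n. (x i)\<^sup>2) \<le> sqrt (a\<^sup>2 * (\<Sum>i<n. (y i)\<^sup>2))" by (rule real_sqrt_le_mono)
        then show ?thesis using that(2) by (simp add: real_sqrt_mult)
      qed
      have "sqrt (\<Sum>i<n. (hnorm K (\<Sum>j<n. similar K R S (T i j) (h j)))\<^sup>2) \<le> c * b * sqrt (\<Sum>j<n. (hnorm K (h j))\<^sup>2)"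
        if h: "\<forall>j<n. h j \<in> hcar K" for h
      proof -
        have Sh: "\<forall>j<n. S (h j) \<in> hcar H" using h W.bops_mem[OF S] by blast
        have TSh: "T i j (S (h j)) \<in> hcar H" if "i < n" "j \<in> {..<n}" for i j
          using E.bops_mem[OF T[OF that(1)]] Sh that(2) by simp
        have eq: "(\<Sum>j<n. similar K R S (T i j) (h j)) = R (\<Sum>j<n. T i j (S (h j)))" if i: "i < n" for i
        proof -
          have "(\<Sum>j<n. similar K R S (T i j) (h j)) = (\<Sum>j<n. R (T i j (S (h j))))"
            by (rule sum.cong[OF refl]) (use h in \<open>simp add: similar_def\<close>)
          also have "\<dots> = R (\<Sum>j<n. T i j (S (h j)))" by (rule bops_sum[OF R TSh[OF i], symmetric])
          finally show ?thesis .
        qed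
        have sumT: "(\<Sum>j<n. T i j (S (h j))) \<in> hcar H" if "i < n" for i by (rule H.sum_mem[OF TSh[OF that]])
        have "sqrt (\<Sum>i<n. (hnorm K (\<Sum>j<n. similar K R S (T i j) (h j)))\<^sup>2)
            \<le> r * sqrt (\<Sum>i<n. (hnorm H (\<Sum>j<n. T i j (S (h j))))\<^sup>2)"
          using r sumT bops_mem[OF R] by (intro scale) (simp_all add: eq)
        also have "\<dots> \<le> r * (b * (s * sqrt (\<Sum>j<n. (hnorm K (h j))\<^sup>2)))"
        proof (intro mult_left_mono[OF _ r(1)] order_trans[OF bB[OF Sh]] mult_left_mono[OF _ b0] scale s(1) conjI)
          fix j assume "j < n"
          then show "0 \<le> hnorm H (S (h j))" "hnorm H (S (h j)) \<le> s * hnorm K (h j)"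
            using s(2) h Sh by simp_all
        qed
        also have "\<dots> = r * s * (b * sqrt (\<Sum>j<n. (hnorm K (h j))\<^sup>2))" by simp
        also have "\<dots> \<le> c * (b * sqrt (\<Sum>j<n. (hnorm K (h j))\<^sup>2))"
          by (intro mult_right_mono c(2) mult_nonneg_nonneg b0) (simp add: sum_nonneg)
        finally show ?thesis by (simp only: mult.assoc)
      qed
      moreover have "0 \<le> c * b" using c(1) b0 by simp
      ultimately show "c * b \<in> {b. 0 \<le> b \<and> (\<forall>h. (\<forall>j<n. h j \<in> hcar K) \<longrightarrow>
         sqrt (\<Sum>i<n. (hnorm K (\<Sum>j<n. similar K R S (T i j) (h j)))\<^sup>2) \<le> b * sqrt (\<Sum>j<n. (hnorm K (h j))\<^sup>2))}"
        by blast
    qed (auto intro!: bdd_belowI[of _ 0])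
    have "matrix_op_norm n K (\<lambda>i j. similar K R S (T i j)) / c \<le> Inf B"
      by (rule cInf_greatest[OF ne]) (use * c(1) in \<open>simp add: pos_divide_le_eq mult.commute\<close>)
    then show ?thesis using c(1) unfolding B_def matrix_op_norm_def[symmetric] by (simp add: pos_divide_le_eq mult.commute)
  qed
  show thesis by (rule that[OF c(1) bops op mat])
qed

lemma similar_bops: "T \<in> bounded_ops H H \<Longrightarrow> similar K R S T \<in> bounded_ops K K"
  using similar_bound by blast

text \<open>Agreement of \<open>\<Phi>\<close> with the similarity is asked for on
  \<open>\<A>\<close> only, so that \<open>inv_into\<close> is covered as well.\<close>

lemma completely_bounded_similar:
  assumes "\<A> \<subseteq> bounded_ops H H" "\<And>T. T \<in> \<A> \<Longrightarrow> \<Phi> T = similar K R S T"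
  shows "completely_bounded H \<A> K \<Phi>"
proof (rule similar_bound)
  fix c
  assume mat: "\<And>n T. (\<And>i j. i < n \<Longrightarrow> j < n \<Longrightarrow> T i j \<in> bounded_ops H H) \<Longrightarrow>
       matrix_op_norm n K (\<lambda>i j. similar K R S (T i j)) \<le> c * matrix_op_norm n H T"
  show ?thesis
    unfolding completely_bounded_def
  proof (intro exI[of _ c] allI impI)
    fix n and T :: "nat \<Rightarrow> nat \<Rightarrow> ('x, 'x) hop" assume T: "\<forall>i<n. \<forall>j<n. T i j \<in> \<A>"
    then have "\<Phi> (T i j) = similar K R S (T i j)" if "i < n" "j < n" for i j using assms(2) that by blast
    then have "(\<Sum>i<n. (hnorm K (\<Sum>j<n. \<Phi> (T i j) (h j)))\<^sup>2) = (\<Sum>i<n. (hnorm K (\<Sum>j<n. similar K R S (T i j) (h j)))\<^sup>2)" for h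
      by (intro sum.cong refl arg_cong[where f = "\<lambda>x. (hnorm K x)\<^sup>2"]) simp
    then have "matrix_op_norm n K (\<lambda>i j. \<Phi> (T i j)) = matrix_op_norm n K (\<lambda>i j. similar K R S (T i j))"
      unfolding matrix_op_norm_def by (simp only:)
    also have "\<dots> \<le> c * matrix_op_norm n H T" by (rule mat) (use T assms(1) in blast)
    finally show "matrix_op_norm n K (\<lambda>i j. \<Phi> (T i j)) \<le> c * matrix_op_norm n H T" .
  qed
qed

lemma similar_add:
  assumes T: "T \<in> bounded_ops H H" and U: "U \<in> bounded_ops H H"
  shows "similar K R S (op_add H T U) = op_add K (similar K R S T) (similar K R S U)"
proof
  fix f
  show "similar K R S (op_add H T U) f = op_add K (similar K R S T) (similar K R S U) f"
  proof (cases "f \<in> hcar K")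
    case True
    note Sf = W.bops_mem[OF S True]
    show ?thesis
      using True Sf bops_add[OF R E.bops_mem[OF T Sf] E.bops_mem[OF U Sf]]
      by (simp only: similar_def op_add_def restrict_apply')
  qed (simp add: similar_def op_add_def)
qed

lemma similar_scale:
  assumes T: "T \<in> bounded_ops H H"
  shows "similar K R S (op_scale H c T) = op_scale K c (similar K R S T)"
proof
  fix f
  show "similar K R S (op_scale H c T) f = op_scale K c (similar K R S T) f"
  proof (cases "f \<in> hcar K")
    case True
    note Sf = W.bops_mem[OF S True]
    show ?thesis
      using True Sf bops_scale[OF R E.bops_mem[OF T Sf]]
      by (simp only: similar_def op_scale_def restrict_apply')
  qed (simp add: similar_def op_scale_def)
qed

lemma similar_lim:
  assumes t: "H.op_lim t T" shows "K.op_lim (\<lambda>n. similar K R S (t n)) (similar K R S T)"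
proof (rule similar_bound)
  note m = H.op_limD(1)[OF t] H.op_limD(2)[OF t]
  fix c assume c: "\<And>T. T \<in> bounded_ops H H \<Longrightarrow> op_norm K K (similar K R S T) \<le> c * op_norm H H T"
  have diff: "op_diff K (similar K R S (t n)) (similar K R S T) = similar K R S (op_diff H (t n) T)" for n
    unfolding H.op_diff_eq_add K.op_diff_eq_add similar_add[OF m(1) H.op_scale_bops[OF m(2)]] similar_scale[OF m(2)] ..
  show ?thesis
  proof (rule K.op_limI[OF similar_bops[OF m(1)] similar_bops[OF m(2)]])
    show "op_norm K K (op_diff K (similar K R S (t n)) (similar K R S T)) \<le> c * op_norm H H (op_diff H (t n) T)" for n
      unfolding diff by (rule c[OF H.op_diff_bops[OF m]])
    show "(\<lambda>n. c * op_norm H H (op_diff H (t n) T)) \<longlonglongrightarrow> 0"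
      using tendsto_mult_left[OF H.op_limD(3)[OF t], of c] by simp
  qed
qed

end

end

section \<open>Linear equivalences of varieties\<close>

text \<open>By homogeneity, facts about the unit parts extend to the cones. Only an inequality of
  norms results; equality comes from using the lemma for \<open>A\<close> and for
  \<open>B\<close>.\<close>

lemma linear_ball_locus:
  assumes A: "Vector_Spaces.linear (*s) (*s) A" and B: "Vector_Spaces.linear (*s) (*s) B"
    and J: "cone (vanishing_locus J)" and I: "cone (vanishing_locus I)"
    and AJ: "A ` ball_locus J \<subseteq> ball_locus I" and BA: "\<forall>z\<in>ball_locus J. B (A z) = z"
    and z: "z \<in> vanishing_locus J"
  shows "A z \<in> vanishing_locus I" "norm (A z) \<le> norm z" "B (A z) = z"
proof -
  note sA = vec.linear_scale[OF A] and sB = vec.linear_scale[OF B]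
  define r where "r = complex_of_real (norm z)"
  \<comment> \<open>For \<open>z = 0\<close> the convention \<open>inverse 0 = 0\<close> makes
    \<open>u = 0\<close>.\<close>
  define u where "u = inverse r *s z"
  have u: "u \<in> ball_locus J"
  proof -
    have "inverse (norm z) * norm z \<le> 1" by (cases "z = 0") simp_all
    then show ?thesis
      using J z by (auto simp: u_def r_def ball_locus_def cone_def norm_vector_scalar_mult norm_inverse)
  qed
  have zu: "z = r *s u"
    by (cases "z = 0") (simp_all add: u_def r_def)
  have "A u \<in> ball_locus I" using AJ u by blast
  then have Au: "A u \<in> vanishing_locus I" "norm (A u) \<le> 1" by (simp_all add: ball_locus_def)
  have Az: "A z = r *s A u" unfolding zu by (rule sA)
  show "A z \<in> vanishing_locus I" unfolding Az using Au(1) I by (simp add: cone_def)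
  show "norm (A z) \<le> norm z"
    unfolding Az norm_vector_scalar_mult using mult_left_mono[OF Au(2), of "norm z"] by (simp add: r_def)
  show "B (A z) = z" unfolding Az sB bspec[OF BA u] by (rule zu[symmetric])
qed

text \<open>\<open>R\<close> and \<open>S\<close> stand for the adjoints of the two composition
  operators, known through their values on the varieties. Exchanging the roles gives the opposite
  direction, so each fact is proved once and interpreted twice.\<close>

locale variety_equivalence =
  fixes I :: "'n::finite mpoly set" and J :: "'m::finite mpoly set"
    and A :: "complex ^ 'm \<Rightarrow> complex ^ 'n" and B :: "complex ^ 'n \<Rightarrow> complex ^ 'm"
    and R :: "(complex ^ 'n, complex ^ 'm) hop" and S :: "(complex ^ 'm, complex ^ 'n) hop"
  assumes I: "radical_homogeneous_ideal I" and J: "radical_homogeneous_ideal J"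
    and A: "Vector_Spaces.linear (*s) (*s) A"
    and A_mem: "\<And>z. z \<in> vanishing_locus J \<Longrightarrow> A z \<in> vanishing_locus I"
    and A_norm: "\<And>z. z \<in> vanishing_locus J \<Longrightarrow> norm (A z) = norm z"
    and BA: "\<And>z. z \<in> vanishing_locus J \<Longrightarrow> B (A z) = z"
    and B_mem: "\<And>w. w \<in> vanishing_locus I \<Longrightarrow> B w \<in> vanishing_locus J"
    and B_norm: "\<And>w. w \<in> vanishing_locus I \<Longrightarrow> norm (B w) = norm w"
    and AB: "\<And>w. w \<in> vanishing_locus I \<Longrightarrow> A (B w) = w"
    and R: "R \<in> bounded_ops (Fsp I) (Fsp J)" and S: "S \<in> bounded_ops (Fsp J) (Fsp I)"
    and R_eval: "\<And>f w. f \<in> hcar (Fsp I) \<Longrightarrow> w \<in> vanishing_locus J \<Longrightarrow> w \<in> ball 0 1 \<Longrightarrow> R f w = f (A w)"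
    and S_eval: "\<And>f w. f \<in> hcar (Fsp J) \<Longrightarrow> w \<in> vanishing_locus I \<Longrightarrow> w \<in> ball 0 1 \<Longrightarrow> S f w = f (B w)"
begin

lemma R_mem: "f \<in> hcar (Fsp I) \<Longrightarrow> R f \<in> hcar (Fsp J)" by (rule FF.bops_mem[OF R])

lemma S_mem: "f \<in> hcar (Fsp J) \<Longrightarrow> S f \<in> hcar (Fsp I)" by (rule FF.bops_mem[OF S])

lemma R_S: "f \<in> hcar (Fsp J) \<Longrightarrow> R (S f) = f"
  by (rule Fsp_eqI[OF J R_mem[OF S_mem]]) (simp_all add: R_eval S_eval S_mem A_mem A_norm BA)

lemma S_R: "f \<in> hcar (Fsp I) \<Longrightarrow> S (R f) = f"
  by (rule Fsp_eqI[OF I S_mem[OF R_mem]]) (simp_all add: R_eval S_eval R_mem B_mem B_norm AB)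

text \<open>At a point \<open>w\<close> of the variety of \<open>J\<close>, \<open>R\<close> moves
  to \<open>A w\<close>, the compression multiplies by \<open>peval p (A w)\<close>, and
  \<open>S\<close> moves back to \<open>B (A w) = w\<close>.\<close>

lemma similar_compression:
  assumes "\<And>z. peval q z = peval p (A z)"
  shows "similar (Fsp J) R S (compression I p) = compression J q"
proof (rule bops_Fsp_eqI[OF J FF.similar_bops[OF R S compression_bops] compression_bops])
  fix f w assume f: "f \<in> hcar (Fsp J)" and w: "w \<in> vanishing_locus J" "w \<in> ball 0 1"
  have Aw: "A w \<in> ball 0 1" using w A_norm by simp
  have "similar (Fsp J) R S (compression I p) f w = R (compression I p (S f)) w"
    using f by (simp add: similar_def)
  also have "\<dots> = compression I p (S f) (A w)"
    by (rule R_eval[OF FF.bops_mem[OF compression_bops S_mem[OF f]] w])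
  also have "\<dots> = peval p (A w) * S f (A w)"
    by (rule compression_eval[OF S_mem[OF f] A_mem[OF w(1)] Aw])
  also have "\<dots> = compression J q f w"
    unfolding S_eval[OF f A_mem[OF w(1)] Aw] BA[OF w(1)] compression_eval[OF f w] assms ..
  finally show "similar (Fsp J) R S (compression I p) f w = compression J q f w" .
qed

text \<open>Polynomials whose compressions approximate \<open>T\<close> are composed with
  \<open>A\<close>; their compressions approximate the similar operator, and their values have the
  same limits.\<close>

lemma similar_Aalg:
  assumes T: "T \<in> Aalg I"
  shows "similar (Fsp J) R S T \<in> Aalg J"
    and "z \<in> ball_locus J \<Longrightarrow> alg_fun J (similar (Fsp J) R S T) z = alg_fun I T (A z)"
proof -
  obtain s where s: "F.op_lim I (\<lambda>n. compression I (s n)) T" by (rule AalgE[OF I T])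
  have "\<forall>n. \<exists>q. \<forall>z. peval q z = peval (s n) (A z)" using mpoly_compose_linear[OF A] by blast
  from choice[OF this] obtain q where q: "\<forall>n. \<forall>z. peval (q n) z = peval (s n) (A z)" ..
  have "F.op_lim J (\<lambda>n. similar (Fsp J) R S (compression I (s n))) (similar (Fsp J) R S T)"
    by (rule FF.similar_lim[OF R S s])
  then have l: "F.op_lim J (\<lambda>n. compression J (q n)) (similar (Fsp J) R S T)"
    unfolding similar_compression[OF q[rule_format]] .
  show "similar (Fsp J) R S T \<in> Aalg J" by (rule AalgI[OF J l])
  assume z: "z \<in> ball_locus J"
  then have "A z \<in> ball_locus I" using A_mem A_norm by (simp add: ball_locus_def)
  from alg_fun_lim[OF I s this] have "(\<lambda>n. peval (q n) z) \<longlonglongrightarrow> alg_fun I T (A z)" using q by simp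
  with alg_fun_lim[OF J l z] show "alg_fun J (similar (Fsp J) R S T) z = alg_fun I T (A z)"
    by (rule LIMSEQ_unique)
qed

lemma similar_op_id: "similar (Fsp J) R S (op_id (Fsp I)) = op_id (Fsp J)"
proof
  fix f show "similar (Fsp J) R S (op_id (Fsp I)) f = op_id (Fsp J) f"
    by (cases "f \<in> hcar (Fsp J)") (simp_all add: similar_def op_id_def S_mem R_S)
qed

lemma similar_op_mult:
  assumes T: "T \<in> bounded_ops (Fsp I) (Fsp I)" and U: "U \<in> bounded_ops (Fsp I) (Fsp I)"
  shows "similar (Fsp J) R S (op_mult (Fsp I) T U) = op_mult (Fsp J) (similar (Fsp J) R S T) (similar (Fsp J) R S U)"
proof
  fix f show "similar (Fsp J) R S (op_mult (Fsp I) T U) f = op_mult (Fsp J) (similar (Fsp J) R S T) (similar (Fsp J) R S U) f"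
  proof (cases "f \<in> hcar (Fsp J)")
    case True
    note USf = FF.bops_mem[OF U S_mem[OF True]]
    show ?thesis
      using True S_mem[OF True] R_mem[OF USf] S_R[OF USf]
      by (simp only: similar_def op_mult_def restrict_apply')
  qed (simp add: similar_def op_mult_def)
qed

lemma similar_similar:
  assumes T: "T \<in> bounded_ops (Fsp I) (Fsp I)"
  shows "similar (Fsp I) S R (similar (Fsp J) R S T) = T"
proof
  fix f show "similar (Fsp I) S R (similar (Fsp J) R S T) f = T f"
  proof (cases "f \<in> hcar (Fsp I)")
    case True
    show ?thesis
      using True R_mem[OF True] S_R[OF True] S_R[OF FF.bops_mem[OF T True]]
      by (simp only: similar_def restrict_apply')
  next
    case False
    then show ?thesis using FF.bops_undef[OF T False] by (simp add: similar_def)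
  qed
qed

end

text \<open>The inverse is the similarity with \<open>R\<close> and \<open>S\<close> exchanged,
  hence completely bounded for the same reason.\<close>

theorem variety_equivalence_cb_isomorphism:
  assumes "variety_equivalence I J A B R S" "variety_equivalence J I B A S R"
  shows "cb_isomorphism (Fsp I) (Aalg I) (Fsp J) (Aalg J) (similar (Fsp J) R S)"
proof -
  interpret P: variety_equivalence I J A B R S by fact
  interpret Q: variety_equivalence J I B A S R by fact
  note AI = Aalg_bops[OF P.I] and AJ = Aalg_bops[OF P.J]
  let ?\<Phi> = "similar (Fsp J) R S" and ?\<Psi> = "similar (Fsp I) S R"
  have bij: "bij_betw ?\<Phi> (Aalg I) (Aalg J)"
    by (rule bij_betw_byWitness[of _ ?\<Psi>])
       (auto simp: P.similar_similar[OF AI] Q.similar_similar[OF AJ] P.similar_Aalg(1) Q.similar_Aalg(1))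
  have inv: "inv_into (Aalg I) ?\<Phi> T = ?\<Psi> T" if T: "T \<in> Aalg J" for T
    using inv_into_f_f[OF bij_betw_imp_inj_on[OF bij] Q.similar_Aalg(1)[OF T]]
    unfolding Q.similar_similar[OF AJ[OF T]] .
  show ?thesis
    unfolding cb_isomorphism_def
  proof (intro conjI ballI allI bij P.similar_op_id)
    show "completely_bounded (Fsp I) (Aalg I) (Fsp J) ?\<Phi>"
      by (rule FF.completely_bounded_similar[OF P.R P.S]) (auto simp: AI)
    show "completely_bounded (Fsp J) (Aalg J) (Fsp I) (inv_into (Aalg I) ?\<Phi>)"
      by (rule FF.completely_bounded_similar[OF P.S P.R]) (auto simp: AJ inv)
    fix T assume T: "T \<in> Aalg I"
    show "?\<Phi> (op_scale (Fsp I) c T) = op_scale (Fsp J) c (?\<Phi> T)" for c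
      by (rule FF.similar_scale[OF P.R P.S AI[OF T]])
    fix U assume U: "U \<in> Aalg I"
    show "?\<Phi> (op_add (Fsp I) T U) = op_add (Fsp J) (?\<Phi> T) (?\<Phi> U)"
      by (rule FF.similar_add[OF P.R P.S AI[OF T] AI[OF U]])
    show "?\<Phi> (op_mult (Fsp I) T U) = op_mult (Fsp J) (?\<Phi> T) (?\<Phi> U)"
      by (rule P.similar_op_mult[OF AI[OF T] AI[OF U]])
  qed
qed

text \<open>Evaluation at \<open>w\<close> is pairing with the kernel function at \<open>w\<close>,
  which \<open>C\<close> carries to the one at \<open>A w\<close>.\<close>

lemma hadjoint_composition_eval:
  assumes C: "C \<in> bounded_ops (Fsp J) (Fsp I)" and k: "C (da_kernel w) = da_kernel (A w)"
    and w: "w \<in> vanishing_locus J" "w \<in> ball 0 1" and Aw: "A w \<in> ball 0 1"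
    and f: "f \<in> hcar (Fsp I)"
  shows "hadjoint (Fsp J) (Fsp I) C f w = f (A w)"
proof -
  let ?R = "hadjoint (Fsp J) (Fsp I) C"
  have Rf: "?R f \<in> hcar (Fsp J)" by (rule FF.bops_mem[OF FF.hadjoint_bops[OF C] f])
  note kw = kernel_mem_Fsp[OF w]
  have "?R f w = hip drury_arveson (?R f) (da_kernel w)" by (rule Fsp_eval[OF w(2) Rf, symmetric])
  also have "\<dots> = cnj (hip drury_arveson (da_kernel w) (?R f))"
    by (rule DA.hip_cnj[OF Fsp_DA[OF kw] Fsp_DA[OF Rf]])
  also have "hip drury_arveson (da_kernel w) (?R f) = hip drury_arveson (da_kernel (A w)) f"
    using FF.hadjoint_hip[OF C kw f] k by simp
  also have "cnj \<dots> = hip drury_arveson f (da_kernel (A w))"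
    by (rule DA.hip_cnj[OF da_kernel_mem[OF Aw] Fsp_DA[OF f], symmetric])
  also have "\<dots> = f (A w)" by (rule Fsp_eval[OF Aw f])
  finally show ?thesis .
qed

text \<open>The composition operators are not compositions on all of the ball, as
  \<open>cadjoint A\<close> may leave it. Their adjoints act by substitution on the varieties, where
  the inverse relation is evident; it is transferred by taking adjoints.\<close>

lemma hadjoint_left_inverse:
  assumes C: "C \<in> bounded_ops (Fsp J) (Fsp I)" and D: "D \<in> bounded_ops (Fsp I) (Fsp J)"
    and RS: "\<And>g. g \<in> hcar (Fsp J) \<Longrightarrow> hadjoint (Fsp J) (Fsp I) C (hadjoint (Fsp I) (Fsp J) D g) = g"
    and f: "f \<in> hcar (Fsp J)"
  shows "D (C f) = f"
proof -
  note Cf = FF.bops_mem[OF C f]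
  note DCf = FF.bops_mem[OF D Cf]
  have "hip (Fsp J) (D (C f) - f) g = 0" if g: "g \<in> hcar (Fsp J)" for g
  proof -
    note Sg = FF.bops_mem[OF FF.hadjoint_bops[OF D] g]
    have "hip (Fsp J) (D (C f)) g = hip (Fsp J) f g"
      using FF.hadjoint_hip[OF D Cf g] FF.hadjoint_hip[OF C f Sg] RS[OF g] by simp
    then show ?thesis using F.hip_diff_left[OF DCf f g] by simp
  qed
  then have "D (C f) - f = 0" by (rule F.hip_eq_zero_imp[OF F.diff_mem[OF DCf f]])
  then show ?thesis by simp
qed

theorem corollary2p6:
  fixes I :: "'n::finite mpoly set" and J :: "'m::finite mpoly set"
    and A :: "complex ^ 'm \<Rightarrow> complex ^ 'n" and B :: "complex ^ 'n \<Rightarrow> complex ^ 'm"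
  assumes "radical_homogeneous_ideal I" and "radical_homogeneous_ideal J"
    and "Vector_Spaces.linear (*s) (*s) A" and "Vector_Spaces.linear (*s) (*s) B"
    and "bij_betw A (ball_locus J) (ball_locus I)"
    and "bij_betw B (ball_locus I) (ball_locus J)"
    and "\<forall>z\<in>ball_locus J. B (A z) = z"
    and "\<forall>w\<in>ball_locus I. A (B w) = w"
    and "admissible I" and "admissible J"
  shows "let CA = comp_op J I (cadjoint A);
             CB = comp_op I J (cadjoint B);
             \<Phi> = (\<lambda>T. \<lambda>f\<in>hcar (Fsp J).
                     hadjoint (Fsp J) (Fsp I) CA (T (hadjoint (Fsp I) (Fsp J) CB f)))
         in comp_extension J I (cadjoint A) CA
          \<and> comp_extension I J (cadjoint B) CB
          \<and> (\<forall>f\<in>hcar (Fsp J). CB (CA f) = f)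
          \<and> (\<forall>g\<in>hcar (Fsp I). CA (CB g) = g)
          \<and> cb_isomorphism (Fsp I) (Aalg I) (Fsp J) (Aalg J) \<Phi>
          \<and> (\<forall>T\<in>Aalg I. \<forall>z\<in>ball_locus J. alg_fun J (\<Phi> T) z = alg_fun I T (A z))"
proof -
  note I = assms(1) and J = assms(2) and A = assms(3) and B = assms(4)
  have AJ: "A ` ball_locus J \<subseteq> ball_locus I" and BI: "B ` ball_locus I \<subseteq> ball_locus J"
    using assms(5,6) by (simp_all add: bij_betw_imp_surj_on)
  note cI = cone_vanishing_locus[OF I] and cJ = cone_vanishing_locus[OF J]
  note LA = linear_ball_locus[OF A B cJ cI AJ assms(7)]
  note LB = linear_ball_locus[OF B A cI cJ BI assms(8)]
  \<comment> \<open>Two contractions that are inverse to each other preserve norms.\<close>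
  have nA: "norm (A z) = norm z" if "z \<in> vanishing_locus J" for z
    using LA(2,3)[OF that] LB(2)[OF LA(1)[OF that]] by simp
  have nB: "norm (B w) = norm w" if "w \<in> vanishing_locus I" for w
    using LB(2,3)[OF that] LA(2)[OF LB(1)[OF that]] by simp
  define CA where "CA = comp_op J I (cadjoint A)"
  define CB where "CB = comp_op I J (cadjoint B)"
  note extA = comp_op_extension[OF J assms(10) A nA LA(1), folded CA_def]
  note extB = comp_op_extension[OF I assms(9) B nB LB(1), folded CB_def]
  note kA = comp_op_kernel[OF J assms(10) A nA LA(1), folded CA_def]
  note kB = comp_op_kernel[OF I assms(9) B nB LB(1), folded CB_def]
  have CA: "CA \<in> bounded_ops (Fsp J) (Fsp I)" using extA by (simp add: comp_extension_def)
  have CB: "CB \<in> bounded_ops (Fsp I) (Fsp J)" using extB by (simp add: comp_extension_def)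
  define R where "R = hadjoint (Fsp J) (Fsp I) CA"
  define S where "S = hadjoint (Fsp I) (Fsp J) CB"
  have R: "R \<in> bounded_ops (Fsp I) (Fsp J)" unfolding R_def by (rule FF.hadjoint_bops[OF CA])
  have S: "S \<in> bounded_ops (Fsp J) (Fsp I)" unfolding S_def by (rule FF.hadjoint_bops[OF CB])
  have Re: "R f w = f (A w)" if "f \<in> hcar (Fsp I)" "w \<in> vanishing_locus J" "w \<in> ball 0 1" for f w
    unfolding R_def by (rule hadjoint_composition_eval[OF CA kA]) (use that nA in simp_all)
  have Se: "S f w = f (B w)" if "f \<in> hcar (Fsp J)" "w \<in> vanishing_locus I" "w \<in> ball 0 1" for f w
    unfolding S_def by (rule hadjoint_composition_eval[OF CB kB]) (use that nB in simp_all)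
  have VP: "variety_equivalence I J A B R S"
    by (rule variety_equivalence.intro) (fact I J A LA(1) nA LA(3) LB(1) nB LB(3) R S Re Se)+
  have VQ: "variety_equivalence J I B A S R"
    by (rule variety_equivalence.intro) (fact I J B LA(1) nA LA(3) LB(1) nB LB(3) R S Re Se)+
  have "CB (CA f) = f" if "f \<in> hcar (Fsp J)" for f
    by (rule hadjoint_left_inverse[OF CA CB variety_equivalence.R_S[OF VP, unfolded R_def S_def] that])
  moreover have "CA (CB g) = g" if "g \<in> hcar (Fsp I)" for g
    by (rule hadjoint_left_inverse[OF CB CA variety_equivalence.R_S[OF VQ, unfolded R_def S_def] that])
  moreover have "cb_isomorphism (Fsp I) (Aalg I) (Fsp J) (Aalg J) (\<lambda>T. \<lambda>f\<in>hcar (Fsp J). R (T (S f)))"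
    using variety_equivalence_cb_isomorphism[OF VP VQ] unfolding similar_def[abs_def] .
  moreover have "alg_fun J (\<lambda>f\<in>hcar (Fsp J). R (T (S f))) z = alg_fun I T (A z)"
    if "T \<in> Aalg I" "z \<in> ball_locus J" for T z
    using variety_equivalence.similar_Aalg(2)[OF VP that] unfolding similar_def .
  ultimately show ?thesis
    unfolding Let_def CA_def[symmetric] CB_def[symmetric] R_def[symmetric] S_def[symmetric]
    using extA extB by (intro conjI ballI)
qed

end
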